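(* Let $n\ge2$, let $a=(a_1,\dots,a_n)$ be an anisotropy and let $0<q\le\infty$. When $0<p<1$, then $\gamma_0$ maps $F^{\frac{|a|}{p}-|a'|,a}_{p,q}(\mathbb{R}^n)$ continuously onto the space $A^{|a'|(\frac1p-1),a'}_{p,p}(\mathbb{R}^{n-1})$ with extensions $Ef\in F^{\frac{|a|}{p}-|a'|,a}_{p,q}(\mathbb{R}^n)$ depending boundedly on $f$; the latter means that there is a constant $c$ such that every $f\in A^{|a'|(\frac1p-1),a'}_{p,p}(\mathbb{R}^{n-1})$ has an extension $Ef$ with $$\|Ef\,|\,F^{\frac{|a|}{p}-|a'|,a}_{p,q}(\mathbb{R}^n)\|\le c\,\|f\,|\,A^{|a'|(\frac1p-1),a'}_{p,p}(\mathbb{R}^{n-1})\|.$$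
   Context: An anisotropy is a vector $a=(a_1,\dots,a_n)$ of real numbers with $\min(a_1,\dots,a_n)=1$. Put $a'=(a_1,\dots,a_{n-1})$, $|a|=a_1+\dots+a_n$, $|a'|=a_1+\dots+a_{n-1}$, $x=(x',x_n)\in\mathbb{R}^{n-1}\times\mathbb{R}$. For a vector $b=(b_1,\dots,b_d)$ of positive weights on $\mathbb{R}^d$ (used with $(d,b)=(n,a)$ and $(n-1,a')$) let $t^bx=(t^{b_1}x_1,\dots,t^{b_d}x_d)$ for $t>0$, and $2^{kb}x=(2^k)^bx$. For $x\ne0$, $|x|_b$ is the unique $t>0$ with $\sum_{i=1}^d x_i^2/t^{2b_i}=1$, and $|0|_b=0$. $\mathcal{F}$ is the Fourier transform on $\mathcal{S}'(\mathbb{R}^d)$. Fix $\psi\in C_0^\infty(\mathbb{R}^n)$ with $\psi(x)=1$ for $|x|_a\le1$ and $\psi(x)=0$ for $|x|_a\ge2$; set $\varphi_0=\psi$ and $\varphi_j(x)=\varphi_0(2^{-ja}x)-\varphi_0(2^{(-j+1)a}x)$ for $j\ge1$. For $p<\infty$, $F^{s,a}_{p,q}(\mathbb{R}^n)$ is the set of $f\in\mathcal{S}'(\mathbb{R}^n)$ with finite quasi-norm $\bigl\|\bigl(\sum_{j\ge0}2^{jsq}|\mathcal{F}^{-1}(\varphi_j\mathcal{F}f)(\cdot)|^q\bigr)^{1/q}\bigr\|_{L_p}$ (usual modification for $q=\infty$). For $0<p<1$ and $s=|a'|(\frac1p-1)$, $A^{s,a'}_{p,p}(\mathbb{R}^{n-1})$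 is the set of $f\in\mathcal{S}'(\mathbb{R}^{n-1})$ for which there are $h_j\in L_p\cap\mathcal{S}'$ on $\mathbb{R}^{n-1}$, $j\ge0$, with $\operatorname{supp}\mathcal{F}h_j\subset\{\xi':|\xi'|_{a'}\le2^j\}$, $f=\sum_{j\ge0}h_j$ in $\mathcal{S}'$ and $\bigl(\sum_j2^{jsp}\|h_j\|_{L_p}^p\bigr)^{1/p}<\infty$; its quasi-norm is the infimum of the latter expression over all such representations. Trace: $\gamma_0f=\lim_{N\to\infty}\sum_{j=0}^N\bigl(\mathcal{F}^{-1}[\varphi_j\mathcal{F}f]\bigr)(\cdot,0)$ whenever this limit exists in $\mathcal{S}'(\mathbb{R}^{n-1})$. That $\gamma_0$ maps $X$ continuously onto $Y$ includes that $\gamma_0f$ exists for every $f\in X$. Extensions: fix $\eta_0,\eta\in\mathcal{S}(\mathbb{R})$ with $\operatorname{supp}\eta_0\subset\,]-1,1[$, $\operatorname{supp}\eta\subset\,]1,2[$, $(\mathcal{F}_1^{-1}\eta_0)(0)=(\mathcal{F}_1^{-1}\eta)(0)=1$ ($\mathcal{F}_1$ the Fourier transform on $\mathbb{R}$) and $\eta_j(t)=\eta(2^{-ja_n}t)$ for $j\ge1$. An extension $Ef$ of $f$ means a distribution $Ef(x',x_n)=\sum_{j\ge0}2^{-ja_n}(\mathcal{F}_1^{-1}\eta_j)(x_n)\,h_j(x')$ (convergence in $\mathcal{S}'(\mathbb{R}^n)$) formed from some representation $f=\sum_{j\ge0}h_j$ in $\mathcal{S}'(\mathbb{R}^{n-1})$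 with $\operatorname{supp}\mathcal{F}h_j\subset\{\xi':|\xi'|_{a'}\le2^j\}$; then $\gamma_0Ef=f$. *)

theory Defs
  imports "HOL-Analysis.Analysis"
begin

text \<open>\<open>iter_pderiv [v\<^sub>1, \<dots>, v\<^sub>k] f\<close> is the iterated partial derivative
  \<open>\<partial>\<^bsub>v1\<^esub> \<dots> \<partial>\<^bsub>vk\<^esub> f\<close>; it is meaningful for smooth \<open>f\<close>.\<close>

fun iter_pderiv :: "'a::euclidean_space list \<Rightarrow> ('a \<Rightarrow> complex) \<Rightarrow> 'a \<Rightarrow> complex" where
  "iter_pderiv [] f = f"
| "iter_pderiv (v # vs) f = (\<lambda>x. frechet_derivative (iter_pderiv vs f) (at x) v)"

definition smooth :: "('a::euclidean_space \<Rightarrow> complex) \<Rightarrow> bool" where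
  "smooth f \<longleftrightarrow> (\<forall>vs. set vs \<subseteq> Basis \<longrightarrow> iter_pderiv vs f differentiable_on UNIV)"

definition fun_support :: "('a::topological_space \<Rightarrow> complex) \<Rightarrow> 'a set" where
  "fun_support f = closure {x. f x \<noteq> 0}"

definition test_functions :: "('a::euclidean_space \<Rightarrow> complex) set" where
  "test_functions = {f. smooth f \<and> compact (fun_support f)}"

definition schwartz :: "('a::euclidean_space \<Rightarrow> complex) set" where
  "schwartz = {f. smooth f \<and>
     (\<forall>vs k. set vs \<subseteq> Basis \<longrightarrow> bounded (range (\<lambda>x. norm x ^ k *\<^sub>R iter_pderiv vs f x)))}"

definition schwartz_seminorm :: "nat \<Rightarrow> ('a::euclidean_space \<Rightarrow> complex) \<Rightarrow> real" where
  "schwartz_seminorm N f =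
     (SUP (vs, x) \<in> {vs. set vs \<subseteq> Basis \<and> length vs \<le> N} \<times> UNIV.
        (1 + norm x) ^ N * norm (iter_pderiv vs f x))"

text \<open>A distribution is a functional on Schwartz functions. It is represented by a functional
  on all functions that is \<open>0\<close> outside the Schwartz space, so that HOL equality is
  equality of distributions.\<close>

type_synonym 'a dist = "('a \<Rightarrow> complex) \<Rightarrow> complex"

definition tempered :: "'a::euclidean_space dist set" where
  "tempered = {T.
     (\<forall>f. f \<notin> schwartz \<longrightarrow> T f = 0) \<and>
     (\<forall>f\<in>schwartz. \<forall>g\<in>schwartz. \<forall>c. T (\<lambda>x. c * f x + g x) = c * T f + T g) \<and>
     (\<exists>N C. \<forall>f\<in>schwartz. norm (T f) \<le> C * schwartz_seminorm N f)}"

definition dist_diff :: "'a::euclidean_space dist \<Rightarrow> 'a dist \<Rightarrow> 'a dist" where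
  "dist_diff S T = (\<lambda>f. S f - T f)"

text \<open>Convergence of sequences and of series in the space of tempered distributions
  (weak-* convergence; for sequences this agrees with strong convergence).\<close>

definition dist_tendsto :: "(nat \<Rightarrow> 'a::euclidean_space dist) \<Rightarrow> 'a dist \<Rightarrow> bool" where
  "dist_tendsto T S \<longleftrightarrow> S \<in> tempered \<and> (\<forall>f\<in>schwartz. (\<lambda>N. T N f) \<longlonglongrightarrow> S f)"

definition dist_sums :: "(nat \<Rightarrow> 'a::euclidean_space dist) \<Rightarrow> 'a dist \<Rightarrow> bool" where
  "dist_sums T S \<longleftrightarrow> dist_tendsto (\<lambda>N f. \<Sum>j\<le>N. T j f) S"

definition dist_support :: "'a::euclidean_space dist \<Rightarrow> 'a set" where
  "dist_support T =
     - \<Union>{U. open U \<and> (\<forall>f\<in>test_functions. fun_support f \<subseteq> U \<longrightarrow> T f = 0)}"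

definition dist_of_fun :: "('a::euclidean_space \<Rightarrow> complex) \<Rightarrow> 'a dist" where
  "dist_of_fun g = (\<lambda>f. if f \<in> schwartz then LINT x|lborel. g x * f x else 0)"

text \<open>Functions that are tempered distributions. Functions with compactly supported Fourier
  transform grow at most polynomially, so for them integrability against all Schwartz functions
  (and not merely test functions) is no restriction.\<close>

definition tempered_fun :: "('a::euclidean_space \<Rightarrow> complex) \<Rightarrow> bool" where
  "tempered_fun g \<longleftrightarrow> g \<in> borel_measurable lborel \<and>
     (\<forall>f\<in>schwartz. integrable lborel (\<lambda>x. g x * f x)) \<and> dist_of_fun g \<in> tempered"

text \<open>The continuous function with which a regular distribution is identified. It exists, in
  particular, if the Fourier transform of the distribution has compact support
  (Paley--Wiener--Schwartz).\<close>

definition fun_of_dist :: "'a::euclidean_space dist \<Rightarrow> 'a \<Rightarrow> complex" where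
  "fun_of_dist T = (THE g. continuous_on UNIV g \<and> tempered_fun g \<and> dist_of_fun g = T)"

definition dist_mult :: "('a::euclidean_space \<Rightarrow> complex) \<Rightarrow> 'a dist \<Rightarrow> 'a dist" where
  "dist_mult g T = (\<lambda>f. if f \<in> schwartz then T (\<lambda>x. g x * f x) else 0)"

text \<open>Tensor product \<open>T(x') g(x\<^sub>n)\<close> of a distribution and a Schwartz function.\<close>

definition dist_tensor ::
    "'a::euclidean_space dist \<Rightarrow> ('b::euclidean_space \<Rightarrow> complex) \<Rightarrow> ('a \<times> 'b) dist" where
  "dist_tensor T g =
     (\<lambda>f. if f \<in> schwartz then T (\<lambda>x. LINT y|lborel. g y * f (x, y)) else 0)"

definition fourier :: "('a::euclidean_space \<Rightarrow> complex) \<Rightarrow> 'a \<Rightarrow> complex" where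
  "fourier f = (\<lambda>\<xi>. LINT x|lborel. exp (- (\<i> * of_real (x \<bullet> \<xi>))) * f x)"

definition inv_fourier :: "('a::euclidean_space \<Rightarrow> complex) \<Rightarrow> 'a \<Rightarrow> complex" where
  "inv_fourier f =
     (\<lambda>x. (LINT \<xi>|lborel. exp (\<i> * of_real (x \<bullet> \<xi>)) * f \<xi>) / of_real ((2 * pi) ^ DIM('a)))"

definition dist_fourier :: "'a::euclidean_space dist \<Rightarrow> 'a dist" where
  "dist_fourier T = (\<lambda>f. if f \<in> schwartz then T (fourier f) else 0)"

definition dist_inv_fourier :: "'a::euclidean_space dist \<Rightarrow> 'a dist" where
  "dist_inv_fourier T = (\<lambda>f. if f \<in> schwartz then T (inv_fourier f) else 0)"

text \<open>Powers of \<open>[0, \<infinity>]\<close>-valued quantities, only used with exponents \<open>r > 0\<close>.\<close>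

definition ennpowr :: "ennreal \<Rightarrow> real \<Rightarrow> ennreal" where
  "ennpowr x r = (if x = \<infinity> then \<infinity> else ennreal (enn2real x powr r))"

definition lq_norm :: "ennreal \<Rightarrow> (nat \<Rightarrow> real) \<Rightarrow> ennreal" where
  "lq_norm q u =
     (if q = \<infinity> then (SUP j. ennreal \<bar>u j\<bar>)
      else ennpowr (\<Sum>j. ennreal (\<bar>u j\<bar> powr enn2real q)) (1 / enn2real q))"

definition Lp_norm :: "real \<Rightarrow> ('a::euclidean_space \<Rightarrow> ennreal) \<Rightarrow> ennreal" where
  "Lp_norm p F = ennpowr (\<integral>\<^sup>+x. ennpowr (F x) p \<partial>lborel) (1 / p)"

text \<open>Weights are vectors whose coordinates with respect to the standard basis are the individual
  weights. For \<open>n = CARD('m) + 1\<close>, the space \<open>\<real>\<^sup>n = \<real>\<^sup>n\<^sup>-\<^sup>1 \<times> \<real>\<close> is the type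
  \<open>(real ^ 'm) \<times> real\<close>, and an anisotropy \<open>a = (a', a\<^sub>n)\<close> has \<open>a' = fst a\<close> and
  \<open>a\<^sub>n = snd a\<close>.\<close>

definition anisotropy :: "'a::euclidean_space \<Rightarrow> bool" where
  "anisotropy a \<longleftrightarrow> Min ((\<lambda>i. a \<bullet> i) ` Basis) = 1"

definition weight_sum :: "'a::euclidean_space \<Rightarrow> real" where
  "weight_sum b = (\<Sum>i\<in>Basis. b \<bullet> i)"

definition aniso_dilation :: "'a::euclidean_space \<Rightarrow> real \<Rightarrow> 'a \<Rightarrow> 'a" where
  "aniso_dilation b t x = (\<Sum>i\<in>Basis. (t powr (b \<bullet> i) * (x \<bullet> i)) *\<^sub>R i)"

definition aniso_norm :: "'a::euclidean_space \<Rightarrow> 'a \<Rightarrow> real" where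
  "aniso_norm b x =
     (if x = 0 then 0
      else THE t. t > 0 \<and> (\<Sum>i\<in>Basis. (x \<bullet> i)\<^sup>2 / t powr (2 * (b \<bullet> i))) = 1)"

definition LP_generator :: "'a::euclidean_space \<Rightarrow> ('a \<Rightarrow> complex) \<Rightarrow> bool" where
  "LP_generator a \<psi> \<longleftrightarrow> \<psi> \<in> test_functions \<and>
     (\<forall>x. aniso_norm a x \<le> 1 \<longrightarrow> \<psi> x = 1) \<and> (\<forall>x. aniso_norm a x \<ge> 2 \<longrightarrow> \<psi> x = 0)"

definition LP_fun :: "'a::euclidean_space \<Rightarrow> ('a \<Rightarrow> complex) \<Rightarrow> nat \<Rightarrow> 'a \<Rightarrow> complex" where
  "LP_fun a \<psi> j x =
     (if j = 0 then \<psi> x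
      else \<psi> (aniso_dilation a (2 powr (- real j)) x) -
           \<psi> (aniso_dilation a (2 powr (- real j + 1)) x))"

text \<open>The function \<open>\<F>\<^sup>-\<^sup>1(\<phi>\<^sub>j \<F> f)\<close>.\<close>

definition LP_piece ::
    "'a::euclidean_space \<Rightarrow> ('a \<Rightarrow> complex) \<Rightarrow> nat \<Rightarrow> 'a dist \<Rightarrow> 'a \<Rightarrow> complex" where
  "LP_piece a \<psi> j f = fun_of_dist (dist_inv_fourier (dist_mult (LP_fun a \<psi> j) (dist_fourier f)))"

definition F_norm ::
    "('a::euclidean_space \<Rightarrow> complex) \<Rightarrow> 'a \<Rightarrow> real \<Rightarrow> real \<Rightarrow> ennreal \<Rightarrow> 'a dist \<Rightarrow> ennreal" where
  "F_norm \<psi> a s p q f =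
     Lp_norm p (\<lambda>x. lq_norm q (\<lambda>j. 2 powr (real j * s) * norm (LP_piece a \<psi> j f x)))"

definition F_space ::
    "('a::euclidean_space \<Rightarrow> complex) \<Rightarrow> 'a \<Rightarrow> real \<Rightarrow> real \<Rightarrow> ennreal \<Rightarrow> 'a dist set" where
  "F_space \<psi> a s p q = {f \<in> tempered. F_norm \<psi> a s p q f < \<infinity>}"

definition band_representation ::
    "'a::euclidean_space \<Rightarrow> (nat \<Rightarrow> 'a dist) \<Rightarrow> 'a dist \<Rightarrow> bool" where
  "band_representation b h f \<longleftrightarrow>
     (\<forall>j. h j \<in> tempered \<and> dist_support (dist_fourier (h j)) \<subseteq> {\<xi>. aniso_norm b \<xi> \<le> 2 ^ j}) \<and>
     dist_sums h f"

definition Lp_representation ::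
    "'a::euclidean_space \<Rightarrow> real \<Rightarrow> (nat \<Rightarrow> 'a \<Rightarrow> complex) \<Rightarrow> 'a dist \<Rightarrow> bool" where
  "Lp_representation b p h f \<longleftrightarrow>
     (\<forall>j. tempered_fun (h j) \<and> Lp_norm p (\<lambda>x. ennreal (norm (h j x))) < \<infinity>) \<and>
     band_representation b (\<lambda>j. dist_of_fun (h j)) f"

text \<open>\<open>A_cost\<close> and \<open>A_norm\<close> take the value \<open>\<infinity>\<close> where the quasi-norm is not finite; in
  particular \<open>A_norm\<close> is \<open>\<infinity>\<close> (infimum of the empty set) if there is no representation.\<close>

definition A_cost :: "real \<Rightarrow> real \<Rightarrow> (nat \<Rightarrow> 'a::euclidean_space \<Rightarrow> complex) \<Rightarrow> ennreal" where
  "A_cost s p h =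
     ennpowr (\<Sum>j. ennreal (2 powr (real j * s * p)) *
                  ennpowr (Lp_norm p (\<lambda>x. ennreal (norm (h j x)))) p) (1 / p)"

definition A_space :: "'a::euclidean_space \<Rightarrow> real \<Rightarrow> real \<Rightarrow> 'a dist set" where
  "A_space b s p = {f \<in> tempered. \<exists>h. Lp_representation b p h f \<and> A_cost s p h < \<infinity>}"

definition A_norm :: "'a::euclidean_space \<Rightarrow> real \<Rightarrow> real \<Rightarrow> 'a dist \<Rightarrow> ennreal" where
  "A_norm b s p f = (INF h \<in> {h. Lp_representation b p h f}. A_cost s p h)"

text \<open>Continuity for the topologies induced by the quasi-norms \<open>N\<close> and \<open>M\<close>.\<close>

definition quasi_continuous_on ::
    "'a::euclidean_space dist set \<Rightarrow> ('a dist \<Rightarrow> ennreal) \<Rightarrow> ('b::euclidean_space dist \<Rightarrow> ennreal) \<Rightarrow>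
     ('a dist \<Rightarrow> 'b dist) \<Rightarrow> bool" where
  "quasi_continuous_on X N M T \<longleftrightarrow>
     (\<forall>f\<in>X. \<forall>\<epsilon>::real. \<epsilon> > 0 \<longrightarrow> (\<exists>\<delta>::real. \<delta> > 0 \<and>
        (\<forall>g\<in>X. N (dist_diff g f) < ennreal \<delta> \<longrightarrow> M (dist_diff (T g) (T f)) < ennreal \<epsilon>)))"

definition has_trace ::
    "('a::euclidean_space \<times> real \<Rightarrow> complex) \<Rightarrow> 'a \<times> real \<Rightarrow> ('a \<times> real) dist \<Rightarrow> 'a dist \<Rightarrow> bool" where
  "has_trace \<psi> a f g \<longleftrightarrow>
     dist_tendsto (\<lambda>N. dist_of_fun (\<lambda>x'. \<Sum>j\<le>N. LP_piece a \<psi> j f (x', 0))) g"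

definition trace_op ::
    "('a::euclidean_space \<times> real \<Rightarrow> complex) \<Rightarrow> 'a \<times> real \<Rightarrow> ('a \<times> real) dist \<Rightarrow> 'a dist" where
  "trace_op \<psi> a f = (THE g. has_trace \<psi> a f g)"

definition extension_kernels :: "(real \<Rightarrow> complex) \<Rightarrow> (real \<Rightarrow> complex) \<Rightarrow> bool" where
  "extension_kernels \<eta>0 \<eta> \<longleftrightarrow> \<eta>0 \<in> schwartz \<and> \<eta> \<in> schwartz \<and>
     fun_support \<eta>0 \<subseteq> {-1<..<1} \<and> fun_support \<eta> \<subseteq> {1<..<2} \<and>
     inv_fourier \<eta>0 0 = 1 \<and> inv_fourier \<eta> 0 = 1"

definition extension_kernel ::
    "real \<Rightarrow> (real \<Rightarrow> complex) \<Rightarrow> (real \<Rightarrow> complex) \<Rightarrow> nat \<Rightarrow> real \<Rightarrow> complex" where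
  "extension_kernel an \<eta>0 \<eta> j =
     (if j = 0 then \<eta>0 else (\<lambda>t. \<eta> (2 powr (- (real j * an)) * t)))"

definition is_extension ::
    "'a::euclidean_space \<times> real \<Rightarrow> (real \<Rightarrow> complex) \<Rightarrow> (real \<Rightarrow> complex) \<Rightarrow>
     'a dist \<Rightarrow> ('a \<times> real) dist \<Rightarrow> bool" where
  "is_extension a \<eta>0 \<eta> f Ef \<longleftrightarrow>
     (\<exists>h. band_representation (fst a) h f \<and>
          dist_sums (\<lambda>j. dist_tensor (h j)
            (\<lambda>t. of_real (2 powr (- (real j * snd a))) *
                 inv_fourier (extension_kernel (snd a) \<eta>0 \<eta> j) t)) Ef)"

end

theory Submission
  imports Defs "HOL-Probability.Characteristic_Functions"
begin

text \<open>Band-limited functions are estimated at unit scale, to which each piece is brought by an anisotropic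
  dilation. The restriction of \<open>\<F>\<^sup>-\<^sup>1(\<phi>\<^sub>j \<F>f)\<close> to \<open>x\<^sub>n = 0\<close> is band-limited, and Peetre's inequality
  with an exponent below \<open>p\<close> bounds its \<open>p\<close>-th power integral by that of the whole piece against a
  weight in \<open>2\<^bsup>j a\<^sub>n\<^esup> x\<^sub>n\<close> which vanishes at \<open>0\<close> and at \<open>\<infinity>\<close>. The sum of these weights over \<open>j\<close> is bounded,
  so the supremum over \<open>j\<close> already controls the trace: this is why \<open>q\<close> plays no role. Since \<open>p < 1\<close>, the
  \<open>L\<^sub>1\<close> norm of a band-limited function is bounded by its \<open>L\<^sub>p\<close> quasi-norm, with exactly the power of
  \<open>2\<^sup>j\<close> given by \<open>t\<close>; hence all series in question converge absolutely in \<open>L\<^sub>1\<close>.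

  Conversely, if \<open>f = \<Sum>\<^sub>j h\<^sub>j\<close>, the supports of the \<open>\<eta>\<^sub>j\<close> let only boundedly many pieces of \<open>E f\<close> see
  \<open>h\<^sub>j\<close>. These are bounded by a common function times \<open>min(|\<tau>|\<^sup>1\<^sup>/\<^sup>2, |\<tau>|\<^sup>-\<^sup>1\<^sup>/\<^sup>2)\<close> with \<open>\<tau> = 2\<^bsup>(j+1) a\<^sub>n\<^esup> x\<^sub>n\<close>, which
  decays geometrically away from one scale, so again all \<open>l\<^sub>q\<close> norms are comparable.\<close>

section \<open>Smooth and Schwartz functions\<close>

text \<open>The only smooth cutoff in the development is \<open>\<psi>\<close> itself, supplied by
  the theorem: its restriction to x_n = 0 cuts off the tangential frequencies, |psi|^2 serves as
  mollifier, its dilated translates replace a partition of unity, and psi(e xi) with small e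
  truncates at infinity. So no bump function has to be constructed. On the distribution side
  everything rests on one fact: a tempered T may be moved under an integral of translates of a
  Schwartz function. It makes F^-1(phi F T) an explicit convolution, lets that convolution reproduce
  itself under a wider cutoff, and locates the spectrum of a trace. The exponents fit because s p =
  t p + a_n: piece j sees its trace on a layer of thickness 2^(-j a_n) about x_n = 0, and this
  thickness is the difference between the p-th power integrals on the two spaces.\<close>

definition pd :: "'a::euclidean_space \<Rightarrow> ('a \<Rightarrow> complex) \<Rightarrow> 'a \<Rightarrow> complex" where
  "pd v f = (\<lambda>x. frechet_derivative f (at x) v)"

lemma iter_pderiv_Cons_pd: "iter_pderiv (v # vs) f = pd v (iter_pderiv vs f)"
  by (simp add: pd_def)

lemma iter_pderiv_append: "iter_pderiv (vs @ ws) f = iter_pderiv vs (iter_pderiv ws f)"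
  by (induction vs) auto

lemma pd_eqI: "(f has_derivative f') (at x) \<Longrightarrow> pd v f x = f' v"
  unfolding pd_def by (metis frechet_derivative_at)

lemma differentiable_has_derivative_pd:
  fixes f :: "'a::euclidean_space \<Rightarrow> complex"
  assumes "f differentiable (at x)"
  shows "(f has_derivative (\<lambda>h. \<Sum>b\<in>Basis. (h \<bullet> b) *\<^sub>R pd b f x)) (at x)"
proof -
  have D: "(f has_derivative frechet_derivative f (at x)) (at x)"
    using assms frechet_derivative_works by blast
  then have "linear (frechet_derivative f (at x))"
    using has_derivative_linear by blast
  then have "frechet_derivative f (at x) h = (\<Sum>b\<in>Basis. (h \<bullet> b) *\<^sub>R pd b f x)" for h
    unfolding pd_def by (subst euclidean_representation[of h, symmetric])
      (simp add: linear_sum linear_cmul del: euclidean_representation)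
  then show ?thesis using D by (metis (no_types, lifting) ext)
qed

section \<open>Calculus of partial derivatives\<close>

lemma pd_add:
  assumes "f differentiable (at x)" "g differentiable (at x)"
  shows "pd v (\<lambda>x. f x + g x) x = pd v f x + pd v g x"
  using assms unfolding frechet_derivative_works
  by (intro pd_eqI[THEN trans, OF has_derivative_add]) (auto simp: pd_def)

lemma pd_cmult:
  assumes "f differentiable (at x)"
  shows "pd v (\<lambda>x. c * f x) x = c * pd v f x"
  using assms unfolding frechet_derivative_works
  by (intro pd_eqI[THEN trans, OF has_derivative_mult_right]) (auto simp: pd_def)

lemma pd_mult:
  assumes "f differentiable (at x)" "g differentiable (at x)"
  shows "pd v (\<lambda>x. f x * g x) x = pd v f x * g x + f x * pd v g x"
  using assms unfolding frechet_derivative_works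
  by (intro pd_eqI[THEN trans, OF has_derivative_mult]) (auto simp: pd_def algebra_simps)

lemma iter_pderiv_mem:
  assumes "\<And>f v. f \<in> C \<Longrightarrow> v \<in> Basis \<Longrightarrow> pd v f \<in> C" and "f \<in> C" and "set vs \<subseteq> Basis"
  shows "iter_pderiv vs f \<in> C"
  using assms(3) by (induction vs) (auto simp: assms(1,2) iter_pderiv_Cons_pd simp del: iter_pderiv.simps(2))

text \<open>Smoothness is the largest class of differentiable functions closed under partial
  derivatives; it suffices to check closure up to finite linear combinations.\<close>

inductive_set fspan :: "('a \<Rightarrow> complex) set \<Rightarrow> ('a \<Rightarrow> complex) set" for G where
  base: "g \<in> G \<Longrightarrow> g \<in> fspan G"
| add: "f \<in> fspan G \<Longrightarrow> g \<in> fspan G \<Longrightarrow> (\<lambda>x. f x + g x) \<in> fspan G"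
| cmult: "f \<in> fspan G \<Longrightarrow> (\<lambda>x. c * f x) \<in> fspan G"

lemma fspan_closed:
  assumes diff: "\<And>f x. f \<in> G \<Longrightarrow> f differentiable (at x)"
    and pd: "\<And>f v. f \<in> G \<Longrightarrow> v \<in> Basis \<Longrightarrow> pd v f \<in> fspan G"
    and f: "f \<in> fspan G"
  shows "(\<forall>x. f differentiable (at x)) \<and> (\<forall>v\<in>Basis. pd v f \<in> fspan G)"
  using f
proof induction
  case (base g) then show ?case using diff pd by blast
next
  case (add f g)
  have "pd v (\<lambda>x. f x + g x) = (\<lambda>x. pd v f x + pd v g x)" for v
    using add pd_add by blast
  then show ?case using add by (auto intro: fspan.add)
next
  case (cmult f c)
  have "pd v (\<lambda>x. c * f x) = (\<lambda>x. c * pd v f x)" for v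
    using cmult pd_cmult by blast
  then show ?case using cmult by (auto intro: fspan.cmult)
qed

lemma fspan_iter:
  assumes diff: "\<And>f x. f \<in> G \<Longrightarrow> f differentiable (at x)"
    and pd: "\<And>f v. f \<in> G \<Longrightarrow> v \<in> Basis \<Longrightarrow> pd v f \<in> fspan G"
    and f: "f \<in> G" and vs: "set vs \<subseteq> Basis"
  shows "iter_pderiv vs f \<in> fspan G"
  by (rule iter_pderiv_mem) (use fspan_closed[OF diff pd] f vs in \<open>auto intro: fspan.base\<close>)

lemma smooth_fspanI:
  assumes diff: "\<And>f x. f \<in> G \<Longrightarrow> f differentiable (at x)"
    and pd: "\<And>f v. f \<in> G \<Longrightarrow> v \<in> Basis \<Longrightarrow> pd v f \<in> fspan G"
    and f: "f \<in> G"
  shows "smooth f"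
  unfolding smooth_def
proof (intro allI impI)
  fix vs :: "'a list" assume "set vs \<subseteq> Basis"
  then have "iter_pderiv vs f \<in> fspan G" using fspan_iter[OF diff pd f] by blast
  then show "iter_pderiv vs f differentiable_on UNIV"
    using fspan_closed[OF diff pd] by (auto simp: differentiable_on_def)
qed

text \<open>The weight 1 + |x| instead of the |x| of \<open>schwartz\<close>: it is
  submultiplicative under translation (\<open>one_plus_norm_le\<close>), which all convolution
  estimates use. \<open>rapid_iff_bounded\<close> shows that nothing changes.\<close>

definition rapid :: "('a::real_normed_vector \<Rightarrow> complex) \<Rightarrow> bool" where
  "rapid f \<longleftrightarrow> (\<forall>k. \<exists>C. \<forall>x. (1 + norm x) ^ k * norm (f x) \<le> C)"

lemma rapidE:
  assumes "rapid f"
  obtains C where "C > 0" "\<And>x. (1 + norm x) ^ k * norm (f x) \<le> C"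
proof -
  obtain C where C: "\<And>x. (1 + norm x) ^ k * norm (f x) \<le> C" using assms unfolding rapid_def by blast
  have "(1 + norm x) ^ k * norm (f x) \<le> max C 1" for x using C[of x] by linarith
  then show thesis using that[of "max C 1"] by simp
qed

lemma rapid_iff_bounded:
  "rapid f \<longleftrightarrow> (\<forall>k. bounded (range (\<lambda>x. norm x ^ k *\<^sub>R f x)))"
proof
  assume f: "rapid f"
  show "\<forall>k. bounded (range (\<lambda>x. norm x ^ k *\<^sub>R f x))"
  proof
    fix k
    obtain C where C: "\<And>x. (1 + norm x) ^ k * norm (f x) \<le> C" using f unfolding rapid_def by blast
    have "norm (norm x ^ k *\<^sub>R f x) \<le> C" for x
    proof -
      have "norm x ^ k * norm (f x) \<le> (1 + norm x) ^ k * norm (f x)"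
        by (intro mult_right_mono power_mono) auto
      then show ?thesis using C[of x] by simp
    qed
    then show "bounded (range (\<lambda>x. norm x ^ k *\<^sub>R f x))" by (auto simp: bounded_iff)
  qed
next
  assume B: "\<forall>k. bounded (range (\<lambda>x. norm x ^ k *\<^sub>R f x))"
  show "rapid f" unfolding rapid_def
  proof
    fix k
    obtain C1 where C1: "\<And>x. norm x ^ k * norm (f x) \<le> C1"
      using B[rule_format, of k] by (auto simp: bounded_iff)
    obtain C0 where C0: "\<And>x. norm (f x) \<le> C0"
      using B[rule_format, of 0] by (auto simp: bounded_iff)
    have "(1 + norm x) ^ k * norm (f x) \<le> 2 ^ k * (C0 + C1)" for x
    proof -
      have "(1 + norm x) ^ k \<le> 2 ^ k * (1 + norm x ^ k)"
      proof (cases "norm x \<le> 1")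
        case True
        then have "(1 + norm x) ^ k \<le> 2 ^ k" by (intro power_mono) auto
        also have "\<dots> \<le> 2 ^ k * (1 + norm x ^ k)" by simp
        finally show ?thesis .
      next
        case False
        then have "(1 + norm x) ^ k \<le> (2 * norm x) ^ k" by (intro power_mono) auto
        also have "\<dots> \<le> 2 ^ k * (1 + norm x ^ k)" by (simp add: power_mult_distrib)
        finally show ?thesis .
      qed
      then have "(1 + norm x) ^ k * norm (f x) \<le> 2 ^ k * (1 + norm x ^ k) * norm (f x)"
        by (intro mult_right_mono) auto
      also have "\<dots> = 2 ^ k * (norm (f x) + norm x ^ k * norm (f x))" by (simp add: algebra_simps)
      also have "\<dots> \<le> 2 ^ k * (C0 + C1)" using C0[of x] C1[of x] by (intro mult_left_mono) auto
      finally show ?thesis .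
    qed
    then show "\<exists>C. \<forall>x. (1 + norm x) ^ k * norm (f x) \<le> C" by blast
  qed
qed

lemma schwartz_iff_rapid:
  "f \<in> schwartz \<longleftrightarrow> smooth f \<and> (\<forall>vs. set vs \<subseteq> Basis \<longrightarrow> rapid (iter_pderiv vs f))"
  unfolding schwartz_def rapid_iff_bounded by blast

lemma rapid_add:
  assumes "rapid f" "rapid g" shows "rapid (\<lambda>x. f x + g x)"
  unfolding rapid_def
proof
  fix k
  obtain C where C: "C > 0" "\<And>x. (1 + norm x) ^ k * norm (f x) \<le> C"
    using rapidE[OF assms(1), where k = k] by blast
  obtain D where D: "D > 0" "\<And>x. (1 + norm x) ^ k * norm (g x) \<le> D"
    using rapidE[OF assms(2), where k = k] by blast
  have "(1 + norm x) ^ k * norm (f x + g x) \<le> C + D" for x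
  proof -
    have "(1 + norm x) ^ k * norm (f x + g x) \<le> (1 + norm x) ^ k * (norm (f x) + norm (g x))"
      by (intro mult_left_mono norm_triangle_ineq) auto
    then show ?thesis using C(2)[of x] D(2)[of x] by (simp add: algebra_simps)
  qed
  then show "\<exists>C. \<forall>x. (1 + norm x) ^ k * norm (f x + g x) \<le> C" by blast
qed

lemma rapid_mult_bounded:
  assumes "rapid f" "\<And>x. norm (g x) \<le> B * (1 + norm x) ^ m"
  shows "rapid (\<lambda>x. g x * f x)"
  unfolding rapid_def
proof
  fix k
  obtain C where C: "C > 0" "\<And>x. (1 + norm x) ^ (k + m) * norm (f x) \<le> C"
    using rapidE[OF assms(1), where k = "k + m"] by blast
  have "norm (g 0) \<le> B" using assms(2)[of 0] by simp
  then have B0: "0 \<le> B" using norm_ge_zero order_trans by blast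
  have "(1 + norm x) ^ k * norm (g x * f x) \<le> B * C" for x
  proof -
    have "(1 + norm x) ^ k * norm (g x * f x) = (1 + norm x) ^ k * (norm (g x) * norm (f x))"
      by (simp add: norm_mult)
    also have "\<dots> \<le> (1 + norm x) ^ k * ((B * (1 + norm x) ^ m) * norm (f x))"
      by (intro mult_left_mono mult_right_mono assms) auto
    also have "\<dots> = B * ((1 + norm x) ^ (k + m) * norm (f x))" by (simp add: power_add algebra_simps)
    also have "\<dots> \<le> B * C" using C B0 by (intro mult_left_mono) auto
    finally show ?thesis .
  qed
  then show "\<exists>C. \<forall>x. (1 + norm x) ^ k * norm (g x * f x) \<le> C" by blast
qed

lemma rapid_cmult: "rapid f \<Longrightarrow> rapid (\<lambda>x. c * f x)"
  by (rule rapid_mult_bounded[where m = 0 and B = "norm c"]) auto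

lemma schwartz_fspanI:
  assumes diff: "\<And>f x. f \<in> G \<Longrightarrow> f differentiable (at x)"
    and pd: "\<And>f v. f \<in> G \<Longrightarrow> v \<in> Basis \<Longrightarrow> pd v f \<in> fspan G"
    and rapid: "\<And>f. f \<in> G \<Longrightarrow> rapid f"
    and f: "f \<in> G"
  shows "f \<in> schwartz"
proof -
  have "rapid h" if "h \<in> fspan G" for h
    using that by induction (auto intro: rapid rapid_add rapid_cmult)
  then show ?thesis
    using smooth_fspanI[OF diff pd f] fspan_iter[OF diff pd f] by (auto simp: schwartz_iff_rapid)
qed

lemma smooth_differentiable: "smooth f \<Longrightarrow> f differentiable (at x)"
  unfolding smooth_def differentiable_on_def by (metis UNIV_I empty_subsetI iter_pderiv.simps(1) list.set(1))

lemma smooth_pd: "smooth f \<Longrightarrow> v \<in> Basis \<Longrightarrow> smooth (pd v f)"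
  unfolding smooth_def
proof (intro allI impI)
  fix vs :: "'a list"
  assume "\<forall>vs. set vs \<subseteq> Basis \<longrightarrow> iter_pderiv vs f differentiable_on UNIV" "v \<in> Basis" "set vs \<subseteq> Basis"
  \<comment> \<open>The head of the list is the derivative taken last, so one that is taken first
    goes to the end.\<close>
  then have "iter_pderiv (vs @ [v]) f differentiable_on UNIV" by (simp del: iter_pderiv.simps)
  then show "iter_pderiv vs (pd v f) differentiable_on UNIV"
    by (simp only: iter_pderiv_append) (simp add: pd_def)
qed

lemma schwartz_smooth: "f \<in> schwartz \<Longrightarrow> smooth f"
  by (simp add: schwartz_def)

lemma schwartz_differentiable: "f \<in> schwartz \<Longrightarrow> f differentiable (at x)"
  by (simp add: schwartz_smooth smooth_differentiable)

lemma schwartz_rapid: "f \<in> schwartz \<Longrightarrow> rapid f"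
  unfolding schwartz_iff_rapid by (metis empty_subsetI iter_pderiv.simps(1) list.set(1))

lemma schwartz_pd: "f \<in> schwartz \<Longrightarrow> v \<in> Basis \<Longrightarrow> pd v f \<in> schwartz"
  unfolding schwartz_iff_rapid
proof (intro conjI allI impI)
  fix vs :: "'a list"
  assume "smooth f \<and> (\<forall>vs. set vs \<subseteq> Basis \<longrightarrow> rapid (iter_pderiv vs f))" "v \<in> Basis" "set vs \<subseteq> Basis"
  then have "rapid (iter_pderiv (vs @ [v]) f)" by (simp del: iter_pderiv.simps)
  then show "rapid (iter_pderiv vs (pd v f))"
    by (simp only: iter_pderiv_append) (simp add: pd_def)
qed (auto intro: smooth_pd)

lemma smooth_continuous: "smooth f \<Longrightarrow> continuous_on UNIV f"
  by (simp add: continuous_on_eq_continuous_at differentiable_imp_continuous_within smooth_differentiable)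

lemma schwartz_continuous: "f \<in> schwartz \<Longrightarrow> continuous_on UNIV f"
  by (simp add: schwartz_smooth smooth_continuous)

lemma schwartz_measurable: "f \<in> schwartz \<Longrightarrow> f \<in> borel_measurable borel"
  by (simp add: borel_measurable_continuous_onI schwartz_continuous)

lemma schwartz_iter: "f \<in> schwartz \<Longrightarrow> set vs \<subseteq> Basis \<Longrightarrow> iter_pderiv vs f \<in> schwartz"
  by (rule iter_pderiv_mem) (auto intro: schwartz_pd)

lemma smooth_add:
  assumes "smooth f" "smooth g" shows "smooth (\<lambda>x. f x + g x)"
proof (rule smooth_fspanI[where G = "{\<lambda>x. f x + g x |f g. smooth f \<and> smooth g}"])
  fix h :: "'a \<Rightarrow> complex" and v :: 'a assume "h \<in> {\<lambda>x. f x + g x |f g. smooth f \<and> smooth g}" and v: "v \<in> Basis"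
  then obtain f g where h: "h = (\<lambda>x. f x + g x)" "smooth f" "smooth g" by blast
  then have "pd v h = (\<lambda>x. pd v f x + pd v g x)" using pd_add smooth_differentiable by blast
  then show "pd v h \<in> fspan {\<lambda>x. f x + g x |f g. smooth f \<and> smooth g}"
    using smooth_pd[OF h(2) v] smooth_pd[OF h(3) v] by (intro fspan.base) blast
qed (use assms in \<open>auto intro: differentiable_add smooth_differentiable\<close>)

lemma schwartz_add:
  assumes "f \<in> schwartz" "g \<in> schwartz" shows "(\<lambda>x. f x + g x) \<in> schwartz"
proof (rule schwartz_fspanI[where G = "{\<lambda>x. f x + g x |f g. f \<in> schwartz \<and> g \<in> schwartz}"])
  fix h :: "'a \<Rightarrow> complex" and v :: 'a assume "h \<in> {\<lambda>x. f x + g x |f g. f \<in> schwartz \<and> g \<in> schwartz}" and v: "v \<in> Basis"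
  then obtain f g where h: "h = (\<lambda>x. f x + g x)" "f \<in> schwartz" "g \<in> schwartz" by blast
  then have "pd v h = (\<lambda>x. pd v f x + pd v g x)" using pd_add schwartz_differentiable by blast
  then show "pd v h \<in> fspan {\<lambda>x. f x + g x |f g. f \<in> schwartz \<and> g \<in> schwartz}"
    using schwartz_pd[OF h(2) v] schwartz_pd[OF h(3) v] by (intro fspan.base) blast
qed (use assms in \<open>auto intro: differentiable_add schwartz_differentiable rapid_add schwartz_rapid\<close>)

text \<open>The Leibniz rule turns a product into a sum of two products; the class of products is
  therefore closed only up to \<open>fspan\<close>.\<close>

lemma smooth_mult:
  assumes "smooth f" "smooth g" shows "smooth (\<lambda>x. f x * g x)"
proof (rule smooth_fspanI[where G = "{\<lambda>x. f x * g x |f g. smooth f \<and> smooth g}"])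
  fix h :: "'a \<Rightarrow> complex" and v :: 'a assume "h \<in> {\<lambda>x. f x * g x |f g. smooth f \<and> smooth g}" and v: "v \<in> Basis"
  then obtain f g where h: "h = (\<lambda>x. f x * g x)" "smooth f" "smooth g" by blast
  then have eq: "pd v h = (\<lambda>x. pd v f x * g x + f x * pd v g x)" using pd_mult smooth_differentiable by blast
  show "pd v h \<in> fspan {\<lambda>x. f x * g x |f g. smooth f \<and> smooth g}"
    unfolding eq
    by (rule fspan.add; rule fspan.base) (use smooth_pd[OF h(2) v] smooth_pd[OF h(3) v] h in blast)+
qed (use assms in \<open>auto intro: differentiable_mult smooth_differentiable\<close>)

lemma schwartz_bounded:
  assumes "f \<in> schwartz" obtains B where "B > 0" "\<And>x. norm (f x) \<le> B"
  using rapidE[OF schwartz_rapid[OF assms], where k = 0] by auto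

lemma schwartz_mult:
  assumes "f \<in> schwartz" "g \<in> schwartz" shows "(\<lambda>x. f x * g x) \<in> schwartz"
proof (rule schwartz_fspanI[where G = "{\<lambda>x. f x * g x |f g. f \<in> schwartz \<and> g \<in> schwartz}"])
  fix h :: "'a \<Rightarrow> complex" and v :: 'a assume "h \<in> {\<lambda>x. f x * g x |f g. f \<in> schwartz \<and> g \<in> schwartz}" and v: "v \<in> Basis"
  then obtain f g where h: "h = (\<lambda>x. f x * g x)" "f \<in> schwartz" "g \<in> schwartz" by blast
  then have eq: "pd v h = (\<lambda>x. pd v f x * g x + f x * pd v g x)" using pd_mult schwartz_differentiable by blast
  show "pd v h \<in> fspan {\<lambda>x. f x * g x |f g. f \<in> schwartz \<and> g \<in> schwartz}"
    unfolding eq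
    by (rule fspan.add; rule fspan.base) (use schwartz_pd[OF h(2) v] schwartz_pd[OF h(3) v] h in blast)+
next
  fix h :: "'a \<Rightarrow> complex" assume "h \<in> {\<lambda>x. f x * g x |f g. f \<in> schwartz \<and> g \<in> schwartz}"
  then obtain f g where h: "h = (\<lambda>x. f x * g x)" "f \<in> schwartz" "g \<in> schwartz" by blast
  obtain B where B: "\<And>x. norm (f x) \<le> B" using schwartz_bounded[OF h(2)] by blast
  show "rapid h" unfolding h(1)
    by (rule rapid_mult_bounded[where m = 0 and B = B]) (use B h schwartz_rapid in auto)
qed (use assms in \<open>auto intro: differentiable_mult schwartz_differentiable\<close>)

lemma schwartz_cmult:
  assumes "f \<in> schwartz" shows "(\<lambda>x. c * f x) \<in> schwartz"
proof (rule schwartz_fspanI[where G = "{\<lambda>x. c * f x |f. f \<in> schwartz}"])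
  fix h :: "'a \<Rightarrow> complex" and v :: 'a assume "h \<in> {\<lambda>x. c * f x |f. f \<in> schwartz}" and v: "v \<in> Basis"
  then obtain f where h: "h = (\<lambda>x. c * f x)" "f \<in> schwartz" by blast
  then have "pd v h = (\<lambda>x. c * pd v f x)" using pd_cmult schwartz_differentiable by blast
  then show "pd v h \<in> fspan {\<lambda>x. c * f x |f. f \<in> schwartz}"
    using schwartz_pd[OF h(2) v] by (intro fspan.base) blast
qed (use assms in \<open>auto intro: differentiable_mult schwartz_differentiable rapid_cmult schwartz_rapid\<close>)

lemma smooth_const: "smooth (\<lambda>x. c)"
proof (rule smooth_fspanI[where G = "range (\<lambda>c x. c)"])
  fix h :: "'a \<Rightarrow> complex" and v :: 'a assume "h \<in> range (\<lambda>c x. c)"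
  then obtain c where "h = (\<lambda>x. c)" by blast
  then have "pd v h = (\<lambda>x. 0)" by (auto simp: pd_def)
  then show "pd v h \<in> fspan (range (\<lambda>c x. c))" by (auto intro: fspan.base)
qed auto

lemma schwartz_zero: "(\<lambda>x. 0) \<in> schwartz"
proof (rule schwartz_fspanI[where G = "{\<lambda>x. 0}"])
  fix h :: "'a \<Rightarrow> complex" and v :: 'a assume "h \<in> {\<lambda>x. 0}"
  then have "pd v h = (\<lambda>x. 0)" by (auto simp: pd_def)
  then show "pd v h \<in> fspan {\<lambda>x. 0}" by (auto intro: fspan.base)
qed (auto simp: rapid_def)

lemma schwartz_diff:
  assumes "f \<in> schwartz" "g \<in> schwartz" shows "(\<lambda>x. f x - g x) \<in> schwartz"
  using schwartz_add[OF assms(1) schwartz_cmult[OF assms(2), of "-1"]] by simp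

lemma schwartz_sum:
  assumes "\<And>i. i \<in> I \<Longrightarrow> f i \<in> schwartz" shows "(\<lambda>x. \<Sum>i\<in>I. f i x) \<in> schwartz"
  using assms by (induction I rule: infinite_finite_induct) (auto simp: schwartz_zero intro: schwartz_add)

lemma iter_pderiv_add:
  assumes "smooth f" "smooth g" "set vs \<subseteq> Basis"
  shows "iter_pderiv vs (\<lambda>x. f x + g x) = (\<lambda>x. iter_pderiv vs f x + iter_pderiv vs g x)"
  using assms(3)
proof (induction vs)
  case (Cons v vs)
  then have "iter_pderiv vs f differentiable (at x)" "iter_pderiv vs g differentiable (at x)" for x
    using assms(1,2) by (auto simp: smooth_def differentiable_on_def)
  then show ?case using Cons pd_add[of "iter_pderiv vs f" _ "iter_pderiv vs g" v]
    unfolding iter_pderiv_Cons_pd by (auto intro!: ext)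
qed auto

lemma iter_pderiv_cmult:
  assumes "smooth f" "set vs \<subseteq> Basis"
  shows "iter_pderiv vs (\<lambda>x. c * f x) = (\<lambda>x. c * iter_pderiv vs f x)"
  using assms(2)
proof (induction vs)
  case (Cons v vs)
  then have "iter_pderiv vs f differentiable (at x)" for x
    using assms(1) by (auto simp: smooth_def differentiable_on_def)
  then show ?case using Cons pd_cmult[of "iter_pderiv vs f" _ v c]
    unfolding iter_pderiv_Cons_pd by (auto intro!: ext)
qed auto

lemma pd_cnj:
  assumes "f differentiable (at x)" shows "pd v (\<lambda>x. cnj (f x)) x = cnj (pd v f x)"
  using assms unfolding frechet_derivative_works
  by (intro pd_eqI[THEN trans, OF has_derivative_cnj]) (auto simp: pd_def)

lemma smooth_cnj:
  assumes "smooth f" shows "smooth (\<lambda>x. cnj (f x))"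
proof (rule smooth_fspanI[where G = "{\<lambda>x. cnj (f x) |f. smooth f}"])
  fix h :: "'a \<Rightarrow> complex" and v :: 'a assume "h \<in> {\<lambda>x. cnj (f x) |f. smooth f}" and v: "v \<in> Basis"
  then obtain f where h: "h = (\<lambda>x. cnj (f x))" "smooth f" by blast
  then have "pd v h = (\<lambda>x. cnj (pd v f x))" using pd_cnj smooth_differentiable by blast
  then show "pd v h \<in> fspan {\<lambda>x. cnj (f x) |f. smooth f}"
    using smooth_pd[OF h(2) v] by (intro fspan.base) blast
next
  fix h :: "'a \<Rightarrow> complex" and x :: 'a assume "h \<in> {\<lambda>x. cnj (f x) |f. smooth f}"
  then obtain f where h: "h = (\<lambda>x. cnj (f x))" "smooth f" by blast
  have "(f has_derivative frechet_derivative f (at x)) (at x)"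
    using smooth_differentiable[OF h(2)] frechet_derivative_works by blast
  then show "h differentiable (at x)" unfolding h(1) by (rule differentiableI[OF has_derivative_cnj])
qed (use assms in blast)

lemma schwartz_coord_mult:
  assumes "f \<in> schwartz" shows "(\<lambda>x. of_real (x \<bullet> b) * f x) \<in> schwartz"
proof -
  \<comment> \<open>Differentiating the coordinate leaves a constant factor, so the class must
    contain all affine factors.\<close>
  define G where "G = {\<lambda>x. (\<alpha> + \<beta> * of_real (x \<bullet> b)) * f x |\<alpha> \<beta> f. f \<in> schwartz}"
  have "(\<lambda>x. (0 + 1 * of_real (x \<bullet> b)) * f x) \<in> G" unfolding G_def using assms by blast
  moreover have "G \<subseteq> schwartz"
  proof
    fix h assume hG: "h \<in> G"
    show "h \<in> schwartz"
    proof (rule schwartz_fspanI[OF _ _ _ hG])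
      fix h :: "'a \<Rightarrow> complex" and x :: 'a assume "h \<in> G"
      then obtain \<alpha> \<beta> f where h: "h = (\<lambda>x. (\<alpha> + \<beta> * of_real (x \<bullet> b)) * f x)" "f \<in> schwartz"
        unfolding G_def by blast
      have lin: "((\<lambda>x. \<alpha> + \<beta> * of_real (x \<bullet> b)) has_derivative (\<lambda>h. \<beta> * of_real (h \<bullet> b))) (at x)" for x :: 'a
        by (auto intro!: derivative_eq_intros)
      show "h differentiable (at x)" unfolding h(1)
        by (intro differentiable_mult schwartz_differentiable h differentiableI[OF lin])
      fix v :: 'a assume v: "v \<in> Basis"
      have eq: "pd v h = (\<lambda>x. (\<beta> * of_real (v \<bullet> b) + 0 * of_real (x \<bullet> b)) * f x
          + (\<alpha> + \<beta> * of_real (x \<bullet> b)) * pd v f x)"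
        unfolding h(1) using pd_mult[OF differentiableI[OF lin] schwartz_differentiable[OF h(2)]]
          pd_eqI[OF lin] by auto
      show "pd v h \<in> fspan G"
        unfolding G_def eq
        by (rule fspan.add; rule fspan.base; use schwartz_pd[OF h(2) v] h(2) in blast)
    next
      fix h :: "'a \<Rightarrow> complex" assume "h \<in> G"
      then obtain \<alpha> \<beta> f where h: "h = (\<lambda>x. (\<alpha> + \<beta> * of_real (x \<bullet> b)) * f x)" "f \<in> schwartz"
        unfolding G_def by blast
      have "norm (\<alpha> + \<beta> * of_real (x \<bullet> b)) \<le> (norm \<alpha> + norm \<beta> * norm b) * (1 + norm x) ^ 1" for x
      proof -
        have "norm (\<alpha> + \<beta> * of_real (x \<bullet> b)) \<le> norm \<alpha> + norm \<beta> * (norm x * norm b)"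
          by (rule order_trans[OF norm_triangle_ineq])
            (auto simp: norm_mult intro!: mult_left_mono Cauchy_Schwarz_ineq2)
        also have "\<dots> \<le> (norm \<alpha> + norm \<beta> * norm b) * (1 + norm x) ^ 1"
          by (simp add: algebra_simps)
        finally show ?thesis .
      qed
      then show "rapid h" unfolding h(1) by (intro rapid_mult_bounded schwartz_rapid h)
    qed
  qed
  ultimately show ?thesis by auto
qed

text \<open>This covers translations, reflections, dilations, restrictions to coordinate subspaces and
  coordinate projections.\<close>

lemma pd_affine:
  assumes f: "smooth f" and L: "linear L" and v: "L v = c *\<^sub>R w"
  shows "pd v (\<lambda>x. f (t + L x)) x = of_real c * pd w f (t + L x)"
proof -
  have bl: "bounded_linear L" using L linear_conv_bounded_linear by blast
  have aff: "((\<lambda>x. t + L x) has_derivative L) (at x)"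
    using bounded_linear_imp_has_derivative[OF bl] by (auto intro!: derivative_eq_intros)
  have D: "(f has_derivative frechet_derivative f (at (t + L x))) (at (t + L x))"
    using smooth_differentiable[OF f] frechet_derivative_works by blast
  have "pd v (\<lambda>x. f (t + L x)) x = frechet_derivative f (at (t + L x)) (L v)"
    by (rule pd_eqI[OF has_derivative_compose[OF aff D]])
  also have "\<dots> = of_real c * pd w f (t + L x)"
    using has_derivative_linear[OF D] v by (simp add: pd_def linear_cmul scaleR_conv_of_real)
  finally show ?thesis .
qed

text \<open>As basis vectors go to multiples of basis vectors, each partial derivative of the
  composition is a multiple of one composed partial derivative. The multiple may be 0, which admits
  coordinate projections.\<close>

lemma smooth_affine:
  fixes L :: "'b::euclidean_space \<Rightarrow> 'a::euclidean_space"
  assumes f: "smooth f" and L: "linear L" and v: "\<And>v. v \<in> Basis \<Longrightarrow> \<exists>c. \<exists>w\<in>Basis. L v = c *\<^sub>R w"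
  shows "smooth (\<lambda>x. f (t + L x))"
proof (rule smooth_fspanI[where G = "{\<lambda>x. f (t + L x) |f. smooth f}"])
  fix h :: "'b \<Rightarrow> complex" and u :: 'b
  assume "h \<in> {\<lambda>x. f (t + L x) |f. smooth f}" and u: "u \<in> Basis"
  then obtain f where h: "h = (\<lambda>x. f (t + L x))" "smooth f" by blast
  obtain c w where w: "w \<in> Basis" "L u = c *\<^sub>R w" using v[OF u] by blast
  then have eq: "pd u h = (\<lambda>x. of_real c * pd w f (t + L x))"
    unfolding h using pd_affine[OF h(2) L w(2)] by blast
  show "pd u h \<in> fspan {\<lambda>x. f (t + L x) |f. smooth f}"
    unfolding eq by (rule fspan.cmult, rule fspan.base) (use smooth_pd[OF h(2) w(1)] in blast)
next
  fix h :: "'b \<Rightarrow> complex" and x :: 'b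
  assume "h \<in> {\<lambda>x. f (t + L x) |f. smooth f}"
  then obtain f where h: "h = (\<lambda>x. f (t + L x))" "smooth f" by blast
  have bl: "bounded_linear L" using L linear_conv_bounded_linear by blast
  have aff: "((\<lambda>x. t + L x) has_derivative L) (at x)"
    using bounded_linear_imp_has_derivative[OF bl] by (auto intro!: derivative_eq_intros)
  have D: "(f has_derivative frechet_derivative f (at (t + L x))) (at (t + L x))"
    using smooth_differentiable[OF h(2)] frechet_derivative_works by blast
  show "h differentiable (at x)" unfolding h(1)
    by (rule differentiableI[OF has_derivative_compose[OF aff D]])
qed (use f in blast)

lemma rapid_affine:
  assumes f: "rapid f" and m: "m > 0" and L: "\<And>x. norm (L x) \<ge> m * norm x"
  shows "rapid (\<lambda>x. f (t + L x))"
  unfolding rapid_def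
proof
  fix k
  obtain C where C: "C > 0" "\<And>x. (1 + norm x) ^ k * norm (f x) \<le> C"
    using rapidE[OF f, where k = k] by blast
  \<comment> \<open>From m |x| <= |t| + |t + L x| one gets 1 + |x| <= M (1 + |t + L x|).\<close>
  define M where "M = (1 + (1 + norm t) / m)"
  have M0: "M \<ge> 0" using m by (simp add: M_def)
  have "(1 + norm x) ^ k * norm (f (t + L x)) \<le> M ^ k * C" for x
  proof -
    have "m * norm x \<le> norm t + norm (t + L x)"
      using L[of x] norm_triangle_ineq4[of "t + L x" t] by simp
    then have "norm x \<le> (norm t + norm (t + L x)) / m" using m by (simp add: field_simps)
    also have "\<dots> \<le> (1 + norm t) / m * (1 + norm (t + L x))"
      using m by (simp add: field_simps)
    finally have "norm x \<le> (1 + norm t) / m * (1 + norm (t + L x))" .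
    moreover have "1 \<le> 1 + norm (t + L x)" by simp
    ultimately have "1 + norm x \<le> M * (1 + norm (t + L x))"
      unfolding M_def distrib_right by (simp only: mult_1 add_mono)
    then have "(1 + norm x) ^ k * norm (f (t + L x)) \<le> (M * (1 + norm (t + L x))) ^ k * norm (f (t + L x))"
      by (intro mult_right_mono power_mono) auto
    also have "\<dots> = M ^ k * ((1 + norm (t + L x)) ^ k * norm (f (t + L x)))"
      by (simp add: power_mult_distrib)
    also have "\<dots> \<le> M ^ k * C" using C M0 by (intro mult_left_mono) auto
    finally show ?thesis .
  qed
  then show "\<exists>C. \<forall>x. (1 + norm x) ^ k * norm (f (t + L x)) \<le> C" by blast
qed

lemma schwartz_affine:
  fixes L :: "'b::euclidean_space \<Rightarrow> 'a::euclidean_space"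
  assumes f: "f \<in> schwartz" and L: "linear L" and v: "\<And>v. v \<in> Basis \<Longrightarrow> \<exists>c. \<exists>w\<in>Basis. L v = c *\<^sub>R w"
    and m: "m > 0" "\<And>x. norm (L x) \<ge> m * norm x"
  shows "(\<lambda>x. f (t + L x)) \<in> schwartz"
proof (rule schwartz_fspanI[where G = "{\<lambda>x. f (t + L x) |f. f \<in> schwartz}"])
  fix h :: "'b \<Rightarrow> complex" and u :: 'b
  assume "h \<in> {\<lambda>x. f (t + L x) |f. f \<in> schwartz}" and u: "u \<in> Basis"
  then obtain f where h: "h = (\<lambda>x. f (t + L x))" "f \<in> schwartz" by blast
  obtain c w where w: "w \<in> Basis" "L u = c *\<^sub>R w" using v[OF u] by blast
  then have eq: "pd u h = (\<lambda>x. of_real c * pd w f (t + L x))"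
    unfolding h using pd_affine[OF schwartz_smooth[OF h(2)] L w(2)] by blast
  show "pd u h \<in> fspan {\<lambda>x. f (t + L x) |f. f \<in> schwartz}"
    unfolding eq by (rule fspan.cmult, rule fspan.base) (use schwartz_pd[OF h(2) w(1)] in blast)
next
  fix h :: "'b \<Rightarrow> complex" and x :: 'b
  assume "h \<in> {\<lambda>x. f (t + L x) |f. f \<in> schwartz}"
  then obtain f where h: "h = (\<lambda>x. f (t + L x))" "f \<in> schwartz" by blast
  show "h differentiable (at x)" unfolding h(1)
    by (rule smooth_differentiable[OF smooth_affine[OF schwartz_smooth[OF h(2)] L v]])
  show "rapid h" unfolding h(1) by (rule rapid_affine[OF schwartz_rapid[OF h(2)] m])
qed (use f in blast)

lemma schwartz_translate:
  assumes "f \<in> schwartz" shows "(\<lambda>z. f (z - x)) \<in> schwartz"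
proof -
  have "(\<lambda>z. f (- x + id z)) \<in> schwartz"
    by (rule schwartz_affine[OF assms linear_id, of 1]) (auto intro!: exI[of _ "1::real"])
  then show ?thesis by simp
qed

lemma schwartz_reflect:
  assumes "f \<in> schwartz" shows "(\<lambda>z. f (x - z)) \<in> schwartz"
proof -
  have "(\<lambda>z. f (x + - z)) \<in> schwartz"
    by (rule schwartz_affine[OF assms, of uminus 1])
      (auto simp: linear_iff intro!: exI[of _ "-1::real"])
  then show ?thesis by simp
qed

lemma pd_translate: "f \<in> schwartz \<Longrightarrow> pd v (\<lambda>z. f (z - x)) z = pd v f (z - x)"
  using pd_affine[OF schwartz_smooth linear_id, of f v 1 v "- x"] by simp

lemma iter_pderiv_translate:
  assumes "f \<in> schwartz" "set vs \<subseteq> Basis"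
  shows "iter_pderiv vs (\<lambda>z. f (z - x)) = (\<lambda>z. iter_pderiv vs f (z - x))"
  using assms(2)
proof (induction vs)
  case (Cons v vs)
  then have "iter_pderiv vs f \<in> schwartz" using schwartz_iter assms(1) by auto
  then show ?case using Cons pd_translate[of "iter_pderiv vs f" v x]
    unfolding iter_pderiv_Cons_pd by (auto intro!: ext)
qed auto

subsection \<open>Test functions\<close>

lemma fun_support_superset: "f x \<noteq> 0 \<Longrightarrow> x \<in> fun_support f"
  unfolding fun_support_def by (meson closure_subset mem_Collect_eq subsetD)

lemma compact_fun_supportI:
  fixes f :: "'a::euclidean_space \<Rightarrow> complex"
  assumes "bounded S" "\<And>x. f x \<noteq> 0 \<Longrightarrow> x \<in> S"
  shows "compact (fun_support f)"
proof -
  have "{x. f x \<noteq> 0} \<subseteq> S" using assms(2) by auto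
  then show ?thesis
    unfolding fun_support_def using assms(1) bounded_subset by (simp add: compact_closure)
qed

lemma pd_zero_outside:
  assumes "open U" "x \<in> U" "\<And>y. y \<in> U \<Longrightarrow> f y = 0"
  shows "pd v f x = 0"
proof -
  have "(f has_derivative (\<lambda>h. 0)) (at x)"
    by (rule has_derivative_transform_within_open[of "\<lambda>x. 0" _ x UNIV U])
      (use assms in auto)
  then show ?thesis by (rule pd_eqI)
qed

lemma test_functions_pd:
  assumes "f \<in> test_functions" "v \<in> Basis" shows "pd v f \<in> test_functions"
proof -
  have c: "compact (fun_support f)" and s: "smooth f" using assms by (auto simp: test_functions_def)
  have "pd v f x \<noteq> 0 \<Longrightarrow> x \<in> fun_support f" for x
    using pd_zero_outside[of "- fun_support f" x f v] fun_support_superset[of f]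
    by (metis ComplI closed_closure fun_support_def open_Compl ComplD)
  then have "compact (fun_support (pd v f))"
    by (intro compact_fun_supportI[OF compact_imp_bounded[OF c]])
  then show ?thesis using smooth_pd[OF s assms(2)] by (simp add: test_functions_def)
qed

lemma test_functions_smooth: "f \<in> test_functions \<Longrightarrow> smooth f"
  by (simp add: test_functions_def)

lemma test_functions_schwartz:
  assumes "f \<in> test_functions" shows "f \<in> schwartz"
proof (rule schwartz_fspanI[OF _ _ _ assms])
  fix f :: "'a \<Rightarrow> complex" assume f: "f \<in> test_functions"
  then have c: "compact (fun_support f)" and s: "smooth f" by (auto simp: test_functions_def)
  show "rapid f" unfolding rapid_def
  proof
    fix k
    have "compact ((\<lambda>x. (1 + norm x) ^ k * norm (f x)) ` fun_support f)"
      by (intro compact_continuous_image c continuous_intros continuous_on_subset[OF smooth_continuous[OF s]]) auto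
    then obtain C where C: "\<And>x. x \<in> fun_support f \<Longrightarrow> norm ((1 + norm x) ^ k * norm (f x)) \<le> C"
      by (meson bounded_iff compact_imp_bounded imageI)
    have "(1 + norm x) ^ k * norm (f x) \<le> max C 0" for x
      using C[of x] fun_support_superset[of f x] by (cases "f x = 0") auto
    then show "\<exists>C. \<forall>x. (1 + norm x) ^ k * norm (f x) \<le> C" by blast
  qed
next
  fix f :: "'a \<Rightarrow> complex" and v :: 'a assume "f \<in> test_functions" "v \<in> Basis"
  then show "pd v f \<in> fspan test_functions" by (auto intro: fspan.base test_functions_pd)
qed (auto intro: smooth_differentiable test_functions_smooth)

lemma test_functions_mult:
  assumes "f \<in> test_functions" "smooth g" shows "(\<lambda>x. f x * g x) \<in> test_functions"
proof -
  have "compact (fun_support (\<lambda>x. f x * g x))"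
    by (rule compact_fun_supportI[of "fun_support f"])
      (use assms in \<open>auto simp: test_functions_def compact_imp_bounded intro: fun_support_superset\<close>)
  then show ?thesis using assms smooth_mult by (auto simp: test_functions_def)
qed

lemma test_functions_diff:
  assumes "f \<in> test_functions" "g \<in> test_functions" shows "(\<lambda>x. f x - g x) \<in> test_functions"
proof -
  have "smooth (\<lambda>x. f x + (-1) * g x)"
    by (intro smooth_add smooth_mult smooth_const test_functions_smooth assms)
  moreover have "compact (fun_support (\<lambda>x. f x - g x))"
  proof (rule compact_fun_supportI[of "fun_support f \<union> fun_support g"])
    show "x \<in> fun_support f \<union> fun_support g" if "f x - g x \<noteq> 0" for x
      using that fun_support_superset[of f x] fun_support_superset[of g x] by (cases "g x = 0") auto
  qed (use assms in \<open>simp add: test_functions_def compact_imp_bounded\<close>)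
  ultimately show ?thesis by (simp add: test_functions_def)
qed

lemma test_functions_affine:
  fixes L :: "'b::euclidean_space \<Rightarrow> 'a::euclidean_space"
  assumes f: "f \<in> test_functions" and L: "linear L" and v: "\<And>v. v \<in> Basis \<Longrightarrow> \<exists>c. \<exists>w\<in>Basis. L v = c *\<^sub>R w"
    and m: "m > 0" "\<And>x. norm (L x) \<ge> m * norm x"
  shows "(\<lambda>x. f (t + L x)) \<in> test_functions"
proof -
  have "bounded (fun_support f)" using f by (simp add: test_functions_def compact_imp_bounded)
  then obtain R where R: "\<And>x. x \<in> fun_support f \<Longrightarrow> norm x \<le> R" by (auto simp: bounded_iff)
  have "norm x \<le> (R + norm t) / m" if "f (t + L x) \<noteq> 0" for x
  proof -
    have "m * norm x \<le> norm (L x)" by (rule m)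
    also have "\<dots> \<le> norm (t + L x) + norm t" using norm_triangle_ineq4[of "t + L x" t] by simp
    also have "\<dots> \<le> R + norm t" using R fun_support_superset[of f, OF that] by simp
    finally show ?thesis using m(1) by (simp add: field_simps)
  qed
  then have "compact (fun_support (\<lambda>x. f (t + L x)))"
    by (intro compact_fun_supportI[of "cball 0 ((R + norm t) / m)"]) auto
  then show ?thesis using smooth_affine[OF test_functions_smooth[OF f] L v] by (simp add: test_functions_def)
qed

section \<open>Integration\<close>

lemma ennreal_prod_lt_top:
  fixes f :: "'a \<Rightarrow> ennreal"
  assumes "\<And>i. i \<in> I \<Longrightarrow> f i < top" shows "prod f I < top"
  using assms by (induction I rule: infinite_finite_induct) (auto simp: ennreal_mult_less_top)

lemma integral_lborel_prod:
  fixes f :: "'a::euclidean_space \<Rightarrow> real \<Rightarrow> complex"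
  assumes f: "\<And>b. b \<in> Basis \<Longrightarrow> integrable lborel (f b)"
  shows "(LINT x|lborel. (\<Prod>b\<in>Basis. f b (x \<bullet> b))) = (\<Prod>b\<in>Basis. LINT t|lborel. f b t)"
proof -
  interpret product_sigma_finite "\<lambda>_::'a. lborel :: real measure" ..
  have [measurable]: "f b \<in> borel_measurable borel" if "b \<in> Basis" for b
    using borel_measurable_integrable[OF f[OF that]] by simp
  have "(LINT x|lborel. (\<Prod>b\<in>Basis. f b (x \<bullet> b))) =
      (LINT g|(\<Pi>\<^sub>M b\<in>Basis. lborel). (\<Prod>b\<in>Basis. f b ((\<Sum>i\<in>Basis. g i *\<^sub>R i) \<bullet> b)))"
    by (subst lborel_eq, subst integral_distr) auto
  also have "\<dots> = (LINT g|(\<Pi>\<^sub>M b\<in>Basis. lborel). (\<Prod>b\<in>Basis. f b (g b)))"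
    by (intro Bochner_Integration.integral_cong prod.cong) (auto simp: inner_sum_left_Basis)
  also have "\<dots> = (\<Prod>b\<in>Basis. LINT t|lborel. f b t)"
    by (rule product_integral_prod) (auto simp: f)
  finally show ?thesis .
qed

lemma integrable_lborel_prod:
  fixes f :: "'a::euclidean_space \<Rightarrow> real \<Rightarrow> complex"
  assumes f: "\<And>b. b \<in> Basis \<Longrightarrow> integrable lborel (f b)"
  shows "integrable lborel (\<lambda>x. (\<Prod>b\<in>Basis. f b (x \<bullet> b)))"
proof -
  have [measurable]: "f b \<in> borel_measurable borel" if "b \<in> Basis" for b
    using borel_measurable_integrable[OF f[OF that]] by simp
  have "(\<integral>\<^sup>+x. norm (\<Prod>b\<in>Basis. f b (x \<bullet> b)) \<partial>lborel) = (\<integral>\<^sup>+x. (\<Prod>b\<in>Basis. ennreal (norm (f b (x \<bullet> b)))) \<partial>lborel)"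
    by (simp add: prod_norm prod_ennreal)
  also have "\<dots> = (\<Prod>b\<in>Basis. \<integral>\<^sup>+t. ennreal (norm (f b t)) \<partial>lborel)"
    by (rule nn_integral_lborel_prod) auto
  also have "\<dots> < \<infinity>"
    using f by (auto simp: integrable_iff_bounded less_top intro!: ennreal_prod_lt_top)
  finally show ?thesis by (intro integrableI_bounded) auto
qed

lemma nn_integral_inverse_square: "(\<integral>\<^sup>+t. ennreal (1 / (1 + \<bar>t\<bar>) ^ 2) \<partial>lborel) < \<infinity>"
proof -
  let ?f = "\<lambda>t::real. 1 / (1 + \<bar>t\<bar>) ^ 2"
  have lim: "((\<lambda>t::real. - (1 / (1 + t))) \<longlongrightarrow> 0) at_top" by real_asymp
  have 1: "(\<integral>\<^sup>+t. ennreal (?f t) * indicator {0..} t \<partial>lborel) = ennreal 1"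
  proof -
    have "(\<integral>\<^sup>+t. ennreal (?f t) * indicator {0..} t \<partial>lborel) = ennreal (0 - (- (1 / (1 + 0))))"
    proof (rule nn_integral_FTC_atLeast[OF _ _ _ lim])
      show "((\<lambda>t. - (1 / (1 + t))) has_real_derivative ?f t) (at t)" if "0 \<le> t" for t
        using that by (auto intro!: derivative_eq_intros simp: power2_eq_square)
    qed auto
    then show ?thesis by simp
  qed
  have 2: "(\<integral>\<^sup>+t. ennreal (?f t) * indicator {..0} t \<partial>lborel) = (\<integral>\<^sup>+t. ennreal (?f t) * indicator {0..} t \<partial>lborel)"
    by (subst nn_integral_real_affine[where c = "-1" and t = 0])
      (auto intro!: nn_integral_cong simp: indicator_def)
  have "(\<integral>\<^sup>+t. ennreal (?f t) \<partial>lborel) \<le> (\<integral>\<^sup>+t. ennreal (?f t) * indicator {0..} t + ennreal (?f t) * indicator {..0} t \<partial>lborel)"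
    by (intro nn_integral_mono) (auto simp: indicator_def)
  also have "\<dots> < \<infinity>" by (subst nn_integral_add) (auto simp: 1 2)
  finally show ?thesis .
qed

text \<open>1 + |x| dominates each 1 + |x_b|, so two powers per coordinate bound the weight by a
  product of integrable functions of one variable.\<close>

lemma nn_integral_decay:
  "(\<integral>\<^sup>+x. ennreal (1 / (1 + norm (x::'a::euclidean_space)) ^ (2 * DIM('a))) \<partial>lborel) < \<infinity>"
proof -
  have "1 / (1 + norm x) ^ (2 * DIM('a)) \<le> (\<Prod>b\<in>Basis. 1 / (1 + \<bar>x \<bullet> b\<bar>) ^ 2)" for x :: 'a
  proof -
    have "1 / (1 + norm x) ^ (2 * DIM('a)) = (\<Prod>b\<in>(Basis::'a set). 1 / (1 + norm x) ^ 2)"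
      by (simp add: power_mult power_divide)
    also have "\<dots> \<le> (\<Prod>b\<in>Basis. 1 / (1 + \<bar>x \<bullet> b\<bar>) ^ 2)"
    proof (intro prod_mono conjI divide_left_mono power_mono)
      show "0 < (1 + norm x)\<^sup>2 * (1 + \<bar>x \<bullet> i\<bar>)\<^sup>2" for i
        by (intro mult_pos_pos zero_less_power) (auto simp: add_pos_nonneg)
    qed (auto simp: Basis_le_norm)
    finally show ?thesis .
  qed
  then have "(\<integral>\<^sup>+x. ennreal (1 / (1 + norm (x::'a)) ^ (2 * DIM('a))) \<partial>lborel)
     \<le> (\<integral>\<^sup>+x. (\<Prod>b\<in>Basis. ennreal (1 / (1 + \<bar>(x::'a) \<bullet> b\<bar>) ^ 2)) \<partial>lborel)"
    by (intro nn_integral_mono) (subst prod_ennreal, auto intro!: ennreal_leI)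
  also have "\<dots> = (\<Prod>b\<in>(Basis::'a set). (\<integral>\<^sup>+t. ennreal (1 / (1 + \<bar>t\<bar>) ^ 2) \<partial>lborel))"
    by (subst nn_integral_lborel_prod) auto
  also have "\<dots> < \<infinity>" unfolding infinity_ennreal_def by (rule ennreal_prod_lt_top) (use nn_integral_inverse_square in \<open>simp add: less_top\<close>)
  finally show ?thesis .
qed

lemma integrable_decay:
  "integrable lborel (\<lambda>x. 1 / (1 + norm (x::'a::euclidean_space)) ^ (2 * DIM('a)))"
  using nn_integral_decay by (intro integrableI_bounded) auto

lemma integrable_of_decay:
  fixes f :: "'a::euclidean_space \<Rightarrow> 'b::{banach, second_countable_topology}"
  assumes "f \<in> borel_measurable borel" and "\<And>x. (1 + norm x) ^ (2 * DIM('a)) * norm (f x) \<le> C"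
  shows "integrable lborel f"
proof (rule Bochner_Integration.integrable_bound)
  show "integrable lborel (\<lambda>x. C * (1 / (1 + norm (x::'a)) ^ (2 * DIM('a))))"
    using integrable_decay by (rule integrable_mult_right)
  have "norm (f x) \<le> norm (C * (1 / (1 + norm x) ^ (2 * DIM('a))))" for x
    using assms(2)[of x] by (simp add: field_simps abs_if) (smt (verit) divide_nonneg_nonneg mult_nonneg_nonneg norm_ge_zero pos_le_divide_eq zero_less_power mult.commute)
  then show "AE x in lborel. norm (f x) \<le> norm (C * (1 / (1 + norm x) ^ (2 * DIM('a))))" by simp
qed (use assms in simp)

lemma rapid_integrable_weight:
  fixes f :: "'a::euclidean_space \<Rightarrow> complex"
  assumes "rapid f" "f \<in> borel_measurable borel"
  shows "integrable lborel (\<lambda>x. (1 + norm x) ^ k * norm (f x))"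
proof -
  obtain C where C: "\<And>x. (1 + norm x) ^ (2 * DIM('a) + k) * norm (f x) \<le> C"
    using rapidE[OF assms(1)] by metis
  show ?thesis
    by (rule integrable_of_decay[where C = C]) (use assms C in \<open>auto simp: power_add algebra_simps\<close>)
qed

lemma rapid_integrable:
  fixes f :: "'a::euclidean_space \<Rightarrow> complex"
  assumes "rapid f" "f \<in> borel_measurable borel" shows "integrable lborel f"
proof -
  have "integrable lborel (\<lambda>x. norm (f x))" using rapid_integrable_weight[OF assms, of 0] by simp
  then show ?thesis using assms(2) by (simp add: integrable_norm_iff)
qed

lemma schwartz_integrable: "f \<in> schwartz \<Longrightarrow> integrable lborel f"
  by (simp add: rapid_integrable schwartz_measurable schwartz_rapid)

text \<open>The default value 0 for a non-integrable \<open>f\<close> keeps the bound true, so that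
  callers only have to estimate \<open>f\<close> pointwise.\<close>

lemma Bochner_integral_norm_bound:
  fixes f :: "'a \<Rightarrow> 'b::{banach, second_countable_topology}"
  assumes "integrable M g" "\<And>x. x \<in> space M \<Longrightarrow> norm (f x) \<le> g x"
  shows "norm (LINT x|M. f x) \<le> (LINT x|M. g x)"
proof (cases "integrable M f")
  case True
  have "norm (LINT x|M. f x) \<le> (LINT x|M. norm (f x))" by (rule integral_norm_bound)
  also have "\<dots> \<le> (LINT x|M. g x)" using True assms by (intro integral_mono) auto
  finally show ?thesis .
next
  case False
  have "0 \<le> (LINT x|M. g x)"
    by (rule Bochner_Integration.integral_nonneg) (use assms(2) norm_ge_zero order_trans in blast)
  then show ?thesis using False by (simp add: not_integrable_integral_eq)
qed

text \<open>Dominated convergence for the remainder of the difference quotient: the mean value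
  inequality on the convex set \<open>S\<close> and the bound on \<open>F'\<close> majorise it by 2
  \<open>w\<close>.\<close>

lemma has_derivative_lebesgue_integral:
  fixes F :: "'a::euclidean_space \<Rightarrow> 'c \<Rightarrow> complex"
  assumes S: "open S" "convex S" "x0 \<in> S"
    and int: "\<And>x. x \<in> S \<Longrightarrow> integrable M (F x)"
    and D: "\<And>x y. x \<in> S \<Longrightarrow> y \<in> space M \<Longrightarrow> ((\<lambda>x. F x y) has_derivative F' x y) (at x)"
    and meas: "\<And>h. (\<lambda>y. F' x0 y h) \<in> borel_measurable M"
    and dom: "\<And>x y h. x \<in> S \<Longrightarrow> y \<in> space M \<Longrightarrow> norm (F' x y h) \<le> w y * norm h"
    and w: "integrable M w"
  shows "((\<lambda>x. LINT y|M. F x y) has_derivative (\<lambda>h. LINT y|M. F' x0 y h)) (at x0)"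
proof -
  have w0: "0 \<le> w y" if "y \<in> space M" for y
  proof -
    obtain b :: 'a where "b \<in> Basis" using nonempty_Basis by blast
    then have "norm (F' x0 y b) \<le> w y" using dom[OF S(3) that, of b] by simp
    then show ?thesis by (rule order_trans[OF norm_ge_zero])
  qed
  have lip: "norm (F x y - F x0 y) \<le> w y * norm (x - x0)" if "x \<in> S" "y \<in> space M" for x y
  proof (rule differentiable_bound[OF S(2)])
    show "((\<lambda>x. F x y) has_derivative F' z y) (at z within S)" if "z \<in> S" for z
      using D[OF that \<open>y \<in> space M\<close>] has_derivative_at_withinI by blast
    show "onorm (F' z y) \<le> w y" if "z \<in> S" for z
      by (rule onorm_bound[OF w0]) (use dom that \<open>y \<in> space M\<close> in auto)
  qed (use that S in auto)
  have lin: "bounded_linear (F' x0 y)" if "y \<in> space M" for y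
    using D[OF S(3) that] has_derivative_bounded_linear by blast
  have intF': "integrable M (\<lambda>y. F' x0 y h)" for h
  proof (rule Bochner_Integration.integrable_bound)
    show "integrable M (\<lambda>y. w y * norm h)" using w by simp
    show "AE y in M. norm (F' x0 y h) \<le> norm (w y * norm h)"
      using dom[OF S(3)] w0 by (intro AE_I2) (metis abs_of_nonneg mult_nonneg_nonneg norm_ge_zero real_norm_def)
  qed (rule meas)
  have bl: "bounded_linear (\<lambda>h. LINT y|M. F' x0 y h)"
  proof (rule bounded_linear_intro)
    show "(LINT y|M. F' x0 y (a + b)) = (LINT y|M. F' x0 y a) + (LINT y|M. F' x0 y b)" for a b
      by (subst Bochner_Integration.integral_add[symmetric, OF intF' intF'])
        (auto intro!: Bochner_Integration.integral_cong simp: linear_add bounded_linear.linear[OF lin])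
    show "(LINT y|M. F' x0 y (r *\<^sub>R a)) = r *\<^sub>R (LINT y|M. F' x0 y a)" for r a
    proof -
      have "(LINT y|M. F' x0 y (r *\<^sub>R a)) = (LINT y|M. r *\<^sub>R F' x0 y a)"
        by (intro Bochner_Integration.integral_cong) (auto simp: linear_cmul bounded_linear.linear[OF lin])
      then show ?thesis by simp
    qed
    show "norm (LINT y|M. F' x0 y a) \<le> norm a * (LINT y|M. w y)" for a
    proof -
      have "norm (LINT y|M. F' x0 y a) \<le> (LINT y|M. w y * norm a)"
        by (rule Bochner_integral_norm_bound) (use w dom[OF S(3)] intF' in auto)
      then show ?thesis by (simp add: mult.commute)
    qed
  qed
  define R where "R x y = (F x y - F x0 y - F' x0 y (x - x0)) /\<^sub>R norm (x - x0)" for x y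
  have "((\<lambda>x. ((LINT y|M. F x y) - (LINT y|M. F x0 y) - (LINT y|M. F' x0 y (x - x0))) /\<^sub>R norm (x - x0)) \<longlongrightarrow> 0)
     (at x0)"
    unfolding tendsto_at_iff_sequentially
  proof (intro allI impI)
    fix X assume X: "\<forall>i. X i \<in> UNIV - {x0}" "X \<longlonglongrightarrow> x0"
    have "eventually (\<lambda>i. X i \<in> S) sequentially"
      using X(2) S(1,3) topological_tendstoD by blast
    \<comment> \<open>The domination is known on \<open>S\<close> only, which the sequence enters
      from index \<open>N\<close> on; hence the shifted sequence.\<close>
    then obtain N where N: "\<And>i. i \<ge> N \<Longrightarrow> X i \<in> S" unfolding eventually_sequentially by blast
    have "(\<lambda>i. LINT y|M. R (X (i + N)) y) \<longlonglongrightarrow> (LINT y|M. (0::complex))"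
    proof (rule integral_dominated_convergence[where w = "\<lambda>y. 2 * w y"])
      show "AE y in M. (\<lambda>i. R (X (i + N)) y) \<longlonglongrightarrow> 0"
      proof (rule AE_I2)
        fix y assume y: "y \<in> space M"
        have "((\<lambda>x. R x y) \<longlongrightarrow> 0) (at x0)"
          using D[OF S(3) y] unfolding has_derivative_at_within R_def by blast
        then have "(\<lambda>i. R (X i) y) \<longlonglongrightarrow> 0"
          using X unfolding tendsto_at_iff_sequentially o_def by blast
        then show "(\<lambda>i. R (X (i + N)) y) \<longlonglongrightarrow> 0" by (rule LIMSEQ_ignore_initial_segment)
      qed
      show "AE y in M. norm (R (X (i + N)) y) \<le> 2 * w y" for i
      proof (rule AE_I2)
        fix y assume y: "y \<in> space M"
        let ?x = "X (i + N)"
        have "norm (F ?x y - F x0 y - F' x0 y (?x - x0)) \<le> w y * norm (?x - x0) + w y * norm (?x - x0)"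
          by (rule order_trans[OF norm_triangle_ineq4 add_mono[OF lip dom]]) (use N y S in auto)
        moreover have "norm (?x - x0) > 0" using X(1) by auto
        ultimately have "norm (F ?x y - F x0 y - F' x0 y (?x - x0)) / norm (?x - x0) \<le> 2 * w y"
          by (subst pos_divide_le_eq) auto
        then show "norm (R ?x y) \<le> 2 * w y"
          by (simp add: R_def divide_inverse mult.commute)
      qed
      show "R (X (i + N)) \<in> borel_measurable M" for i
        unfolding R_def using int[OF N[of "i + N"]] int[OF S(3)] intF'
        by (auto intro!: borel_measurable_scaleR borel_measurable_diff borel_measurable_integrable)
    qed (use w in auto)
    moreover have "(LINT y|M. R (X (i + N)) y) =
        ((\<lambda>x. ((LINT y|M. F x y) - (LINT y|M. F x0 y) - (LINT y|M. F' x0 y (x - x0))) /\<^sub>R norm (x - x0)) \<circ> X) (i + N)" for i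
      unfolding R_def o_def using int[OF N[of "i + N"]] int[OF S(3)] intF'
      by simp
    ultimately have "(\<lambda>i. ((\<lambda>x. ((LINT y|M. F x y) - (LINT y|M. F x0 y) - (LINT y|M. F' x0 y (x - x0))) /\<^sub>R norm (x - x0)) \<circ> X) (i + N)) \<longlonglongrightarrow> 0"
      by simp
    then show "((\<lambda>x. ((LINT y|M. F x y) - (LINT y|M. F x0 y) - (LINT y|M. F' x0 y (x - x0))) /\<^sub>R norm (x - x0)) \<circ> X) \<longlonglongrightarrow> 0"
      by (rule LIMSEQ_offset)
  qed
  then show ?thesis using bl unfolding has_derivative_at_within by blast
qed

lemma frechet_derivative_bound:
  fixes f :: "'a::euclidean_space \<Rightarrow> complex"
  assumes "f differentiable (at x)"
  shows "norm (frechet_derivative f (at x) h) \<le> (\<Sum>b\<in>Basis. norm (pd b f x)) * norm h"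
proof -
  have "frechet_derivative f (at x) h = (\<Sum>b\<in>Basis. (h \<bullet> b) *\<^sub>R pd b f x)"
    using frechet_derivative_at[OF differentiable_has_derivative_pd[OF assms]] by metis
  also have "norm \<dots> \<le> (\<Sum>b\<in>Basis. norm h * norm (pd b f x))"
    by (rule sum_norm_le) (auto intro!: mult_right_mono Basis_le_norm)
  finally show ?thesis by (simp add: sum_distrib_left mult.commute)
qed

lemma schwartz_frechet_bound:
  fixes f :: "'a::euclidean_space \<Rightarrow> complex"
  assumes "f \<in> schwartz"
  obtains C where "C > 0" "\<And>x h. (1 + norm x) ^ k * norm (frechet_derivative f (at x) h) \<le> C * norm h"
proof -
  have "\<exists>C. C > 0 \<and> (\<forall>x. (1 + norm x) ^ k * norm (pd b f x) \<le> C)" if "b \<in> Basis" for b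
    using rapidE[OF schwartz_rapid[OF schwartz_pd[OF assms that]], where k = k] by metis
  then obtain C where C: "\<And>b. b \<in> Basis \<Longrightarrow> C b > 0"
      "\<And>b x. b \<in> Basis \<Longrightarrow> (1 + norm x) ^ k * norm (pd b f x) \<le> C b"
    by metis
  show ?thesis
  proof
    show "(\<Sum>b\<in>(Basis::'a set). C b) > 0" by (intro sum_pos C) auto
    fix x h
    have "(1 + norm x) ^ k * norm (frechet_derivative f (at x) h)
        \<le> (1 + norm x) ^ k * ((\<Sum>b\<in>Basis. norm (pd b f x)) * norm h)"
      by (intro mult_left_mono frechet_derivative_bound schwartz_differentiable assms) auto
    also have "\<dots> = (\<Sum>b\<in>Basis. (1 + norm x) ^ k * norm (pd b f x)) * norm h"
      by (simp add: sum_distrib_left mult.assoc)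
    also have "\<dots> \<le> (\<Sum>b\<in>Basis. C b) * norm h"
      by (intro mult_right_mono sum_mono C) auto
    finally show "(1 + norm x) ^ k * norm (frechet_derivative f (at x) h) \<le> (\<Sum>b\<in>Basis. C b) * norm h" .
  qed
qed

text \<open>The integral of g(x + t v) does not depend on t; differentiate it under the integral at
  t = 0.\<close>

lemma integral_pd_zero:
  fixes g :: "'a::euclidean_space \<Rightarrow> complex"
  assumes g: "g \<in> schwartz" and v: "v \<in> Basis"
  shows "(LINT x|lborel. pd v g x) = 0"
proof -
  let ?k = "2 * DIM('a)"
  obtain C where C: "C > 0" "\<And>x. (1 + norm x) ^ ?k * norm (pd v g x) \<le> C"
    using rapidE[OF schwartz_rapid[OF schwartz_pd[OF g v]], where k = ?k] by blast
  have vn: "norm v = 1" using v by simp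
  have trans: "((\<lambda>t::real. x + t *\<^sub>R v) has_derivative (\<lambda>h. h *\<^sub>R v)) (at t)" for x t
    by (auto intro!: derivative_eq_intros)
  have "((\<lambda>t. LINT x|lborel. g (x + t *\<^sub>R v)) has_derivative (\<lambda>h. LINT x|lborel. of_real h * pd v g (x + 0 *\<^sub>R v))) (at (0::real))"
  \<comment> \<open>For |t| < 1 one has 1 + |x| <= 2 (1 + |x + t v|), which accounts for the power
    of 2 in the majorant.\<close>
  proof (rule has_derivative_lebesgue_integral[where S = "{-1<..<1}" and w = "\<lambda>x. 2 ^ ?k * C * (1 / (1 + norm x) ^ ?k)"])
    show "integrable lborel (\<lambda>x. g (x + t *\<^sub>R v))" for t
      using schwartz_integrable[OF schwartz_translate[OF g, of "- t *\<^sub>R v"]] by simp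
    show "((\<lambda>t. g (x + t *\<^sub>R v)) has_derivative (\<lambda>h. of_real h * pd v g (x + t *\<^sub>R v))) (at t)" for t x
    proof -
      have D: "(g has_derivative frechet_derivative g (at (x + t *\<^sub>R v))) (at (x + t *\<^sub>R v))"
        using schwartz_differentiable[OF g] frechet_derivative_works by blast
      have "frechet_derivative g (at (x + t *\<^sub>R v)) (h *\<^sub>R v) = of_real h * pd v g (x + t *\<^sub>R v)" for h
        using has_derivative_linear[OF D] by (simp add: pd_def linear_cmul scaleR_conv_of_real)
      then show ?thesis using has_derivative_compose[OF trans D] by simp
    qed
    show "(\<lambda>x. complex_of_real h * pd v g (x + 0 *\<^sub>R v)) \<in> borel_measurable lborel" for h
      using schwartz_measurable[OF schwartz_pd[OF g v]] by simp
    show "norm (complex_of_real h * pd v g (x + t *\<^sub>R v)) \<le> 2 ^ ?k * C * (1 / (1 + norm x) ^ ?k) * norm h"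
      if t: "t \<in> {-1<..<1}" for t h x
    proof -
      have "norm x \<le> norm (x + t *\<^sub>R v) + 1"
        using norm_triangle_ineq4[of "x + t *\<^sub>R v" "t *\<^sub>R v"] t vn by auto
      then have "1 + norm x \<le> 2 * (1 + norm (x + t *\<^sub>R v))"
        using norm_ge_zero[of "x + t *\<^sub>R v"] unfolding distrib_left by linarith
      then have "(1 + norm x) ^ ?k \<le> (2 * (1 + norm (x + t *\<^sub>R v))) ^ ?k" by (intro power_mono) auto
      then have "(1 + norm x) ^ ?k * norm (pd v g (x + t *\<^sub>R v)) \<le>
         (2 * (1 + norm (x + t *\<^sub>R v))) ^ ?k * norm (pd v g (x + t *\<^sub>R v))"
        by (intro mult_right_mono) auto
      also have "\<dots> = 2 ^ ?k * ((1 + norm (x + t *\<^sub>R v)) ^ ?k * norm (pd v g (x + t *\<^sub>R v)))"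
        by (simp only: power_mult_distrib mult.assoc)
      also have "\<dots> \<le> 2 ^ ?k * C" by (intro mult_left_mono C) auto
      finally have "norm (pd v g (x + t *\<^sub>R v)) \<le> 2 ^ ?k * C / (1 + norm x) ^ ?k"
        by (subst pos_le_divide_eq) (auto simp: mult.commute add_pos_nonneg)
      from mult_right_mono[OF this, of "norm h"] show ?thesis
        by (simp add: norm_mult mult.commute)
    qed
    show "integrable lborel (\<lambda>x::'a. 2 ^ ?k * C * (1 / (1 + norm x) ^ ?k))"
      by (intro integrable_mult_right integrable_decay)
  qed auto
  moreover have "(LINT x|lborel. g (x + t *\<^sub>R v)) = (LINT x|lborel. g x)" for t
  proof -
    have "(LINT x|lborel. g x) = (LINT x|distr lborel borel ((+) (t *\<^sub>R v)). g x)"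
      by (simp add: lborel_distr_plus)
    also have "\<dots> = (LINT x|lborel. g (t *\<^sub>R v + x))"
      by (subst integral_distr) (auto simp: schwartz_measurable[OF g])
    finally show ?thesis by (simp add: add.commute)
  qed
  ultimately have "((\<lambda>t. LINT x|lborel. g x) has_derivative (\<lambda>h. LINT x|lborel. of_real h * pd v g x)) (at (0::real))"
    by simp
  then have "(\<lambda>h::real. LINT x|lborel. of_real h * pd v g x) = (\<lambda>h. 0)"
    by (rule has_derivative_unique) (rule has_derivative_const)
  from fun_cong[OF this, of 1] show ?thesis by simp
qed

subsection \<open>Substitution and Fubini\<close>

lemma integral_affine_euclidean:
  fixes f :: "'a::euclidean_space \<Rightarrow> complex"
  assumes f[measurable]: "f \<in> borel_measurable borel" and c: "\<And>j. j \<in> Basis \<Longrightarrow> c j \<noteq> 0"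
  shows "(LINT x|lborel. f x) = of_real (\<Prod>j\<in>Basis. \<bar>c j\<bar>) * (LINT x|lborel. f (t + (\<Sum>j\<in>Basis. (c j * (x \<bullet> j)) *\<^sub>R j)))"
proof -
  have "(LINT x|lborel. f x) = (\<Prod>j\<in>Basis. \<bar>c j\<bar>) *\<^sub>R (LINT x|lborel. f (t + (\<Sum>j\<in>Basis. (c j * (x \<bullet> j)) *\<^sub>R j)))"
    by (subst lborel_affine_euclidean[OF c, where t = t], simp)
      (subst integral_density, auto simp: prod_nonneg integral_distr)
  then show ?thesis by (simp add: scaleR_conv_of_real)
qed

lemma nn_integral_affine_euclidean:
  fixes f :: "'a::euclidean_space \<Rightarrow> ennreal"
  assumes f[measurable]: "f \<in> borel_measurable borel" and c: "\<And>j. j \<in> Basis \<Longrightarrow> c j \<noteq> 0"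
  shows "(\<integral>\<^sup>+x. f x \<partial>lborel) = ennreal (\<Prod>j\<in>Basis. \<bar>c j\<bar>) * (\<integral>\<^sup>+x. f (t + (\<Sum>j\<in>Basis. (c j * (x \<bullet> j)) *\<^sub>R j)) \<partial>lborel)"
  by (subst lborel_affine_euclidean[OF c, where t = t], simp)
    (subst nn_integral_density, auto simp: nn_integral_distr nn_integral_cmult)

lemma integral_reflect:
  fixes f :: "'a::euclidean_space \<Rightarrow> complex"
  assumes f: "f \<in> borel_measurable borel"
  shows "(LINT x|lborel. f (t - x)) = (LINT x|lborel. f x)"
  using integral_affine_euclidean[OF f, where c = "\<lambda>_. -1" and t = t]
  by (simp add: sum_negf euclidean_representation)

lemma integral_translate:
  fixes f :: "'a::euclidean_space \<Rightarrow> complex"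
  assumes f: "f \<in> borel_measurable borel"
  shows "(LINT x|lborel. f (t + x)) = (LINT x|lborel. f x)"
  using integral_affine_euclidean[OF f, where c = "\<lambda>_. 1" and t = t]
  by (simp add: euclidean_representation)

lemma nn_integral_reflect:
  fixes f :: "'a::euclidean_space \<Rightarrow> ennreal"
  assumes f: "f \<in> borel_measurable borel"
  shows "(\<integral>\<^sup>+x. f (t - x) \<partial>lborel) = (\<integral>\<^sup>+x. f x \<partial>lborel)"
  using nn_integral_affine_euclidean[OF f, where c = "\<lambda>_. -1" and t = t]
  by (simp add: sum_negf euclidean_representation)

lemma nn_integral_translate:
  fixes f :: "'a::euclidean_space \<Rightarrow> ennreal"
  assumes f: "f \<in> borel_measurable borel"
  shows "(\<integral>\<^sup>+x. f (x - t) \<partial>lborel) = (\<integral>\<^sup>+x. f x \<partial>lborel)"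
  using nn_integral_affine_euclidean[OF f, where c = "\<lambda>_. 1" and t = "- t"]
  by (simp add: euclidean_representation)

text \<open>The interchanges of complex-valued integrals below have this form: the kernel is an
  exponential, a translate of a bounded Schwartz function, or a mollifier.\<close>

lemma integrable_kernel:
  fixes f :: "'a::euclidean_space \<Rightarrow> complex" and g :: "'b::euclidean_space \<Rightarrow> complex"
  assumes f: "integrable lborel f" and g: "integrable lborel g"
    and K[measurable]: "case_prod K \<in> borel_measurable (borel \<Otimes>\<^sub>M borel)"
    and B: "\<And>x y. norm (K x y) \<le> B"
  shows "integrable (lborel \<Otimes>\<^sub>M lborel) (\<lambda>(x, y). K x y * (f x * g y))"
proof (rule lborel_pair.Fubini_integrable)
  have [measurable]: "f \<in> borel_measurable borel" "g \<in> borel_measurable borel"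
    using borel_measurable_integrable[OF f] borel_measurable_integrable[OF g] by auto
  show meas: "(\<lambda>(x, y). K x y * (f x * g y)) \<in> borel_measurable (lborel \<Otimes>\<^sub>M lborel)"
    using K by measurable
  have Kx: "K x \<in> borel_measurable borel" for x
    using measurable_compose[OF measurable_Pair1' K, of x] by simp
  have bnd: "norm (K x y * (f x * g y)) \<le> B * norm (f x) * norm (g y)" for x y
    using mult_right_mono[OF B, of "norm (f x) * norm (g y)" x y] by (simp add: norm_mult mult.assoc)
  show 2: "AE x in lborel. integrable lborel (\<lambda>y. case (x, y) of (x, y) \<Rightarrow> K x y * (f x * g y))"
  proof (rule AE_I2, simp)
    fix x
    show "integrable lborel (\<lambda>y. K x y * (f x * g y))"
    proof (rule Bochner_Integration.integrable_bound)
      show "integrable lborel (\<lambda>y. B * norm (f x) * norm (g y))" using g by auto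
      show "AE y in lborel. norm (K x y * (f x * g y)) \<le> norm (B * norm (f x) * norm (g y))"
        by (intro AE_I2 order_trans[OF bnd]) (simp only: real_norm_def abs_ge_self)
    qed (use Kx in simp)
  qed
  show "integrable lborel (\<lambda>x. LINT y|lborel. norm (case (x, y) of (x, y) \<Rightarrow> K x y * (f x * g y)))"
  proof (rule Bochner_Integration.integrable_bound)
    show "integrable lborel (\<lambda>x. norm (f x) * (B * (LINT y|lborel. norm (g y))))" using f by auto
    have "norm (LINT y|lborel. norm (K x y * (f x * g y))) \<le> norm (f x) * (B * (LINT y|lborel. norm (g y)))" for x
    proof -
      have "norm (LINT y|lborel. norm (K x y * (f x * g y))) \<le> (LINT y|lborel. B * norm (f x) * norm (g y))"
        by (rule Bochner_integral_norm_bound) (use g bnd in auto)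
      then show ?thesis by (simp add: mult_ac)
    qed
    then show "AE x in lborel. norm (LINT y|lborel. norm (case (x, y) of (x, y) \<Rightarrow> K x y * (f x * g y)))
        \<le> norm (norm (f x) * (B * (LINT y|lborel. norm (g y))))"
      by (intro AE_I2) (simp only: case_prod_conv real_norm_def order_trans[OF _ abs_ge_self])
    show "(\<lambda>x. LINT y|lborel. norm (case (x, y) of (x, y) \<Rightarrow> K x y * (f x * g y))) \<in> borel_measurable lborel"
      using meas by measurable
  qed
qed

lemma fubini_kernel:
  fixes f :: "'a::euclidean_space \<Rightarrow> complex" and g :: "'b::euclidean_space \<Rightarrow> complex"
  assumes f: "integrable lborel f" and g: "integrable lborel g"
    and K: "case_prod K \<in> borel_measurable (borel \<Otimes>\<^sub>M borel)"
    and B: "\<And>x y. norm (K x y) \<le> B"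
  shows "(LINT x|lborel. f x * (LINT y|lborel. K x y * g y)) = (LINT y|lborel. g y * (LINT x|lborel. K x y * f x))"
proof -
  have "(LINT y|lborel. (LINT x|lborel. K x y * (f x * g y))) = (LINT x|lborel. (LINT y|lborel. K x y * (f x * g y)))"
    by (rule lborel_pair.Fubini_integral) (use integrable_kernel[OF assms] in simp)
  moreover have "(LINT x|lborel. K x y * (f x * g y)) = g y * (LINT x|lborel. K x y * f x)" for y
    by (subst integral_mult_right_zero[symmetric]) (simp add: mult_ac)
  moreover have "(LINT y|lborel. K x y * (f x * g y)) = f x * (LINT y|lborel. K x y * g y)" for x
    by (subst integral_mult_right_zero[symmetric]) (simp add: mult_ac)
  ultimately show ?thesis by simp
qed

section \<open>The Fourier transform on the Schwartz space\<close>

lemma norm_exp_i[simp]: "norm (exp (\<i> * complex_of_real t)) = 1" "norm (exp (- (\<i> * complex_of_real t))) = 1"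
  by (simp_all add: norm_exp_eq_Re)

lemma char_derivative:
  "((\<lambda>x. exp (- (\<i> * complex_of_real (x \<bullet> \<xi>)))) has_derivative
    (\<lambda>h. - (\<i> * complex_of_real (h \<bullet> \<xi>)) * exp (- (\<i> * complex_of_real (x \<bullet> \<xi>))))) (at x)"
proof -
  have D: "((\<lambda>x. - (\<i> * complex_of_real (x \<bullet> \<xi>))) has_derivative (\<lambda>h. - (\<i> * complex_of_real (h \<bullet> \<xi>)))) (at x)"
    by (auto intro!: derivative_eq_intros)
  show ?thesis
    using has_derivative_compose[OF D DERIV_exp[THEN has_field_derivative_imp_has_derivative]]
    by (simp add: mult_ac)
qed

lemma char_derivative':
  "((\<lambda>\<xi>. exp (- (\<i> * complex_of_real (x \<bullet> \<xi>)))) has_derivative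
    (\<lambda>h. - (\<i> * complex_of_real (x \<bullet> h)) * exp (- (\<i> * complex_of_real (x \<bullet> \<xi>))))) (at \<xi>)"
proof -
  have D: "((\<lambda>\<xi>. - (\<i> * complex_of_real (x \<bullet> \<xi>))) has_derivative (\<lambda>h. - (\<i> * complex_of_real (x \<bullet> h)))) (at \<xi>)"
    by (auto intro!: derivative_eq_intros)
  show ?thesis
    using has_derivative_compose[OF D DERIV_exp[THEN has_field_derivative_imp_has_derivative]]
    by (simp add: mult_ac)
qed

lemma schwartz_modulate:
  assumes "f \<in> schwartz"
  shows "(\<lambda>x. exp (- (\<i> * complex_of_real (x \<bullet> \<xi>))) * f x) \<in> schwartz"
proof (rule schwartz_fspanI[where G = "{\<lambda>x. exp (- (\<i> * complex_of_real (x \<bullet> \<xi>))) * f x |f. f \<in> schwartz}"])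
  fix h :: "'a \<Rightarrow> complex" and v :: 'a
  assume "h \<in> {\<lambda>x. exp (- (\<i> * complex_of_real (x \<bullet> \<xi>))) * f x |f. f \<in> schwartz}" and v: "v \<in> Basis"
  then obtain f where h: "h = (\<lambda>x. exp (- (\<i> * complex_of_real (x \<bullet> \<xi>))) * f x)" "f \<in> schwartz" by blast
  have eq: "pd v h = (\<lambda>x. (- (\<i> * complex_of_real (v \<bullet> \<xi>))) * (exp (- (\<i> * complex_of_real (x \<bullet> \<xi>))) * f x)
      + exp (- (\<i> * complex_of_real (x \<bullet> \<xi>))) * pd v f x)"
    unfolding h(1)
    by (rule ext, subst pd_mult[OF differentiableI[OF char_derivative] schwartz_differentiable[OF h(2)]],
      subst pd_eqI[OF char_derivative]) (simp add: mult.assoc)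
  show "pd v h \<in> fspan {\<lambda>x. exp (- (\<i> * complex_of_real (x \<bullet> \<xi>))) * f x |f. f \<in> schwartz}"
    unfolding eq
    by (rule fspan.add, rule fspan.cmult; rule fspan.base) (use schwartz_pd[OF h(2) v] h(2) in blast)+
next
  fix h :: "'a \<Rightarrow> complex" and x :: 'a
  assume "h \<in> {\<lambda>x. exp (- (\<i> * complex_of_real (x \<bullet> \<xi>))) * f x |f. f \<in> schwartz}"
  then obtain f where h: "h = (\<lambda>x. exp (- (\<i> * complex_of_real (x \<bullet> \<xi>))) * f x)" "f \<in> schwartz" by blast
  show "h differentiable (at x)" unfolding h(1)
    by (intro differentiable_mult schwartz_differentiable h differentiableI[OF char_derivative])
  show "rapid h" unfolding h(1)
    by (rule rapid_mult_bounded[OF schwartz_rapid[OF h(2)], where B = 1 and m = 0]) simp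
qed (use assms in blast)

lemma fourier_has_derivative:
  fixes f :: "'a::euclidean_space \<Rightarrow> complex"
  assumes f: "f \<in> schwartz"
  shows "(fourier f has_derivative
      (\<lambda>h. LINT x|lborel. - (\<i> * complex_of_real (x \<bullet> h)) * exp (- (\<i> * complex_of_real (x \<bullet> \<xi>))) * f x)) (at \<xi>)"
  unfolding fourier_def
proof (rule has_derivative_lebesgue_integral[where S = UNIV and w = "\<lambda>x. (1 + norm x) ^ 1 * norm (f x)"])
  have [measurable]: "f \<in> borel_measurable borel" by (rule schwartz_measurable[OF f])
  show "integrable lborel (\<lambda>x. exp (- (\<i> * complex_of_real (x \<bullet> \<xi>))) * f x)" for \<xi>
    by (rule schwartz_integrable[OF schwartz_modulate[OF f]])
  show "((\<lambda>\<xi>. exp (- (\<i> * complex_of_real (x \<bullet> \<xi>))) * f x) has_derivative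
     (\<lambda>h. - (\<i> * complex_of_real (x \<bullet> h)) * exp (- (\<i> * complex_of_real (x \<bullet> \<xi>))) * f x)) (at \<xi>)" for \<xi> x
    by (rule has_derivative_mult_left[OF char_derivative'])
  show "(\<lambda>x. - (\<i> * complex_of_real (x \<bullet> h)) * exp (- (\<i> * complex_of_real (x \<bullet> \<xi>))) * f x) \<in> borel_measurable lborel" for h
    by measurable
  show "norm (- (\<i> * complex_of_real (x \<bullet> h)) * exp (- (\<i> * complex_of_real (x \<bullet> \<xi>))) * f x)
      \<le> (1 + norm x) ^ 1 * norm (f x) * norm h" for \<xi> x h
  proof -
    have "norm (- (\<i> * complex_of_real (x \<bullet> h)) * exp (- (\<i> * complex_of_real (x \<bullet> \<xi>))) * f x) = \<bar>x \<bullet> h\<bar> * norm (f x)"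
      by (simp add: norm_mult)
    also have "\<dots> \<le> (1 + norm x) * norm h * norm (f x)"
      by (intro mult_right_mono order_trans[OF Cauchy_Schwarz_ineq2]) auto
    finally show ?thesis by (simp add: mult_ac)
  qed
  show "integrable lborel (\<lambda>x. (1 + norm x) ^ 1 * norm (f x))"
    by (rule rapid_integrable_weight[OF schwartz_rapid[OF f]]) simp
qed auto

lemma pd_fourier:
  assumes "f \<in> schwartz"
  shows "pd v (fourier f) = fourier (\<lambda>x. - \<i> * (complex_of_real (x \<bullet> v) * f x))"
  by (rule ext, subst pd_eqI[OF fourier_has_derivative[OF assms]]) (simp add: fourier_def mult_ac)

lemma fourier_pd:
  assumes f: "f \<in> schwartz" and v: "v \<in> Basis"
  shows "fourier (pd v f) \<xi> = \<i> * complex_of_real (\<xi> \<bullet> v) * fourier f \<xi>"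
proof -
  let ?e = "\<lambda>x. exp (- (\<i> * complex_of_real (x \<bullet> \<xi>)))"
  have 1: "integrable lborel (\<lambda>x. ?e x * f x)" and 2: "integrable lborel (\<lambda>x. ?e x * pd v f x)"
    by (intro schwartz_integrable schwartz_modulate f schwartz_pd v)+
  have "pd v (\<lambda>x. ?e x * f x) x = (- (\<i> * complex_of_real (v \<bullet> \<xi>))) * (?e x * f x) + ?e x * pd v f x" for x
    by (subst pd_mult[OF differentiableI[OF char_derivative] schwartz_differentiable[OF f]],
      subst pd_eqI[OF char_derivative]) (simp add: mult.assoc)
  then have "pd v (\<lambda>x. ?e x * f x) = (\<lambda>x. (- (\<i> * complex_of_real (v \<bullet> \<xi>))) * (?e x * f x) + ?e x * pd v f x)"
    by (rule ext)
  then have "0 = (LINT x|lborel. (- (\<i> * complex_of_real (v \<bullet> \<xi>))) * (?e x * f x) + ?e x * pd v f x)"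
    using integral_pd_zero[OF schwartz_modulate[OF f, of \<xi>] v] by metis
  also have "\<dots> = (- (\<i> * complex_of_real (v \<bullet> \<xi>))) * fourier f \<xi> + fourier (pd v f) \<xi>"
    unfolding fourier_def using 1 2
    by (subst Bochner_Integration.integral_add) auto
  finally show ?thesis by (simp add: inner_commute algebra_simps add_eq_0_iff2)
qed

lemma fourier_bounded:
  assumes "f \<in> schwartz" shows "norm (fourier f \<xi>) \<le> (LINT x|lborel. norm (f x))"
  unfolding fourier_def
  by (rule Bochner_integral_norm_bound) (use schwartz_integrable[OF assms] in \<open>auto simp: norm_mult\<close>)

text \<open>Induction on the power of |xi|: by |xi| <= sum of |xi_b| one power is traded for the
  factors xi_b, and each of these is absorbed by a derivative of \<open>f\<close>.\<close>

lemma fourier_rapid: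
  fixes f :: "'a::euclidean_space \<Rightarrow> complex"
  assumes "f \<in> schwartz" shows "rapid (fourier f)"
proof -
  have "\<exists>C. \<forall>\<xi>. norm \<xi> ^ k * norm (fourier f \<xi>) \<le> C" for k
    using assms
  proof (induction k arbitrary: f)
    case 0 then show ?case using fourier_bounded by auto
  next
    case (Suc k)
    have "\<exists>C. \<forall>\<xi>. norm \<xi> ^ k * norm (fourier (pd b f) \<xi>) \<le> C" if "b \<in> Basis" for b
      by (rule Suc.IH[OF schwartz_pd[OF Suc.prems that]])
    then obtain C where C: "\<And>b \<xi>. b \<in> Basis \<Longrightarrow> norm \<xi> ^ k * norm (fourier (pd b f) \<xi>) \<le> C b"
      by metis
    have "norm \<xi> ^ Suc k * norm (fourier f \<xi>) \<le> (\<Sum>b\<in>Basis. C b)" for \<xi>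
    proof -
      have "norm \<xi> ^ Suc k * norm (fourier f \<xi>) \<le> (\<Sum>b\<in>Basis. \<bar>\<xi> \<bullet> b\<bar>) * (norm \<xi> ^ k * norm (fourier f \<xi>))"
        by (simp only: power_Suc mult.assoc) (intro mult_right_mono norm_le_l1, auto)
      also have "\<dots> = (\<Sum>b\<in>Basis. norm \<xi> ^ k * norm (fourier (pd b f) \<xi>))"
        by (subst sum_distrib_right) (simp add: fourier_pd[OF Suc.prems] norm_mult mult_ac)
      also have "\<dots> \<le> (\<Sum>b\<in>Basis. C b)" by (intro sum_mono C)
      finally show ?thesis .
    qed
    then show ?case by blast
  qed
  then show ?thesis unfolding rapid_iff_bounded by (simp add: bounded_iff)
qed

lemma schwartz_fourier:
  fixes f :: "'a::euclidean_space \<Rightarrow> complex"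
  assumes "f \<in> schwartz" shows "fourier f \<in> schwartz"
proof (rule schwartz_fspanI[where G = "fourier ` schwartz"])
  fix h :: "'a \<Rightarrow> complex" and v :: 'a assume "h \<in> fourier ` schwartz" "v \<in> Basis"
  then obtain f where h: "h = fourier f" "f \<in> schwartz" by blast
  then have "(\<lambda>x. - \<i> * (complex_of_real (x \<bullet> v) * f x)) \<in> schwartz"
    by (intro schwartz_cmult schwartz_coord_mult)
  then show "pd v h \<in> fspan (fourier ` schwartz)"
    unfolding h(1) pd_fourier[OF h(2)] by (intro fspan.base) blast
qed (use assms fourier_rapid fourier_has_derivative differentiableI in blast)+

lemma inv_fourier_eq_fourier:
  "inv_fourier f x = fourier f (- x) / of_real ((2 * pi) ^ DIM('a))" for f :: "'a::euclidean_space \<Rightarrow> complex"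
  by (simp add: inv_fourier_def fourier_def inner_commute)

lemma schwartz_uminus:
  assumes "f \<in> schwartz" shows "(\<lambda>z. f (- z)) \<in> schwartz"
  using schwartz_reflect[OF assms, of 0] by simp

lemma schwartz_inv_fourier:
  assumes "f \<in> schwartz" shows "inv_fourier f \<in> schwartz"
proof -
  have "(\<lambda>x. (1 / of_real ((2 * pi) ^ DIM('a))) * fourier f (- x)) \<in> schwartz"
    by (intro schwartz_cmult schwartz_uminus schwartz_fourier assms)
  then show ?thesis by (simp add: inv_fourier_eq_fourier[abs_def])
qed

subsection \<open>Fourier inversion\<close>

text \<open>Up to sqrt(2 pi) this is the characteristic function of the standard normal
  distribution; \<open>char\<close> uses exp(+ i t x), hence its argument - t.\<close>

lemma gaussian_integral_real:
  "integrable lborel (\<lambda>x. complex_of_real (exp (- x\<^sup>2 / 2)))"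
  "(LINT x|lborel. exp (- (\<i> * complex_of_real (x * t))) * complex_of_real (exp (- x\<^sup>2 / 2)))
     = complex_of_real (sqrt (2 * pi) * exp (- t\<^sup>2 / 2))"
proof -
  have eq: "complex_of_real (exp (- x\<^sup>2 / 2)) = of_real (sqrt (2 * pi)) * complex_of_real (std_normal_density x)" for x
    by (simp add: std_normal_density_def)
  show "integrable lborel (\<lambda>x. complex_of_real (exp (- x\<^sup>2 / 2)))"
    unfolding eq by (intro integrable_mult_right integrable_of_real integrable_normal_density) simp
  have "char std_normal_distribution (- t) = complex_of_real (exp (- t\<^sup>2 / 2))"
    by (simp add: char_std_normal_distribution)
  moreover have "char std_normal_distribution (- t) = (LINT x|lborel. complex_of_real (std_normal_density x) * exp (- (\<i> * complex_of_real (x * t))))"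
    unfolding char_def
    by (subst integral_density) (auto simp: scaleR_conv_of_real mult_ac)
  ultimately have "(LINT x|lborel. complex_of_real (std_normal_density x) * exp (- (\<i> * complex_of_real (x * t)))) = complex_of_real (exp (- t\<^sup>2 / 2))"
    by simp
  moreover have "(LINT x|lborel. exp (- (\<i> * complex_of_real (x * t))) * complex_of_real (exp (- x\<^sup>2 / 2))) =
     of_real (sqrt (2 * pi)) * (LINT x|lborel. complex_of_real (std_normal_density x) * exp (- (\<i> * complex_of_real (x * t))))"
    unfolding eq by (subst integral_mult_right_zero[symmetric]) (simp add: mult_ac)
  ultimately show "(LINT x|lborel. exp (- (\<i> * complex_of_real (x * t))) * complex_of_real (exp (- x\<^sup>2 / 2)))
     = complex_of_real (sqrt (2 * pi) * exp (- t\<^sup>2 / 2))" by simp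
qed

definition gaussian :: "'a::euclidean_space \<Rightarrow> complex" where
  "gaussian x = (\<Prod>b\<in>Basis. complex_of_real (exp (- (x \<bullet> b)\<^sup>2 / 2)))"

lemma gaussian_integrable: "integrable lborel (gaussian :: 'a::euclidean_space \<Rightarrow> complex)"
proof -
  have "integrable lborel (\<lambda>x::'a. \<Prod>b\<in>Basis. complex_of_real (exp (- (x \<bullet> b)\<^sup>2 / 2)))"
    by (rule integrable_lborel_prod[where f = "\<lambda>_ t. complex_of_real (exp (- t\<^sup>2 / 2))"]) (rule gaussian_integral_real)
  then show ?thesis by (simp add: gaussian_def[abs_def])
qed

lemma fourier_gaussian:
  "fourier (gaussian :: 'a::euclidean_space \<Rightarrow> complex) \<xi> = of_real (sqrt (2 * pi)) ^ DIM('a) * gaussian \<xi>"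
proof -
  have e: "exp (- (\<i> * complex_of_real (x \<bullet> \<xi>))) = (\<Prod>b\<in>Basis. exp (- (\<i> * complex_of_real ((x \<bullet> b) * (\<xi> \<bullet> b)))))" for x
    by (simp add: exp_sum[symmetric] euclidean_inner[of x \<xi>] sum_negf sum_distrib_left)
  have int: "integrable lborel (\<lambda>t. exp (- (\<i> * complex_of_real (t * (\<xi> \<bullet> b)))) * complex_of_real (exp (- t\<^sup>2 / 2)))" for b
    by (rule Bochner_Integration.integrable_bound[OF gaussian_integral_real(1)]) (auto simp: norm_mult)
  have "fourier gaussian \<xi> = (LINT x|lborel. (\<Prod>b\<in>Basis. (\<lambda>b t. exp (- (\<i> * complex_of_real (t * (\<xi> \<bullet> b)))) * complex_of_real (exp (- t\<^sup>2 / 2))) b ((x::'a) \<bullet> b)))"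
    unfolding fourier_def gaussian_def e prod.distrib by simp
  also have "\<dots> = (\<Prod>b\<in>(Basis::'a set). complex_of_real (sqrt (2 * pi) * exp (- (\<xi> \<bullet> b)\<^sup>2 / 2)))"
    by (subst integral_lborel_prod) (simp_all only: int gaussian_integral_real(2))
  also have "\<dots> = of_real (sqrt (2 * pi)) ^ DIM('a) * gaussian \<xi>"
    by (simp add: gaussian_def prod.distrib)
  finally show ?thesis .
qed

lemma integral_gaussian:
  "(LINT x|lborel. gaussian (x::'a::euclidean_space)) = of_real (sqrt (2 * pi)) ^ DIM('a)"
  using fourier_gaussian[of "0::'a"] by (simp add: fourier_def gaussian_def)

lemma norm_gaussian_le: "norm (gaussian x) \<le> 1"
  unfolding gaussian_def prod_norm[symmetric] by (intro prod_le_1) auto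

lemma continuous_gaussian: "continuous_on UNIV gaussian"
  unfolding gaussian_def by (intro continuous_intros) auto

lemma char_kernel_measurable:
  "(\<lambda>(x, y). exp (- (\<i> * complex_of_real (x \<bullet> y)))) \<in> borel_measurable (borel \<Otimes>\<^sub>M (borel :: 'a::euclidean_space measure))"
  by measurable

lemma fourier_multiplication:
  fixes f g :: "'a::euclidean_space \<Rightarrow> complex"
  assumes f: "integrable lborel f" and g: "integrable lborel g"
  shows "(LINT x|lborel. fourier f x * g x) = (LINT x|lborel. f x * fourier g x)"
proof -
  have "(LINT x|lborel. f x * fourier g x) = (LINT y|lborel. g y * (LINT x|lborel. exp (- (\<i> * complex_of_real (x \<bullet> y))) * f x))"
    unfolding fourier_def
    using fubini_kernel[OF f g char_kernel_measurable, of 1] by (simp add: inner_commute)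
  then show ?thesis by (simp add: fourier_def mult.commute)
qed

lemma integral_scale:
  fixes f :: "'a::euclidean_space \<Rightarrow> complex"
  assumes f: "f \<in> borel_measurable borel" and c: "c > 0"
  shows "(LINT x|lborel. f x) = of_real (c ^ DIM('a)) * (LINT x|lborel. f (c *\<^sub>R x))"
proof -
  have "(\<Sum>j\<in>Basis. (c * (x \<bullet> j)) *\<^sub>R j) = c *\<^sub>R x" for x :: 'a
    by (simp add: euclidean_representation scaleR_sum_right[symmetric] flip: scaleR_scaleR)
  then show ?thesis using integral_affine_euclidean[OF f, where c = "\<lambda>_. c" and t = 0] c by simp
qed

text \<open>Insert a Gaussian in e xi as convergence factor, move the transform onto it by the
  multiplication formula, and let e tend to 0: the transformed Gaussian concentrates at the origin
  and picks out f(0).\<close>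

lemma fourier_integral_at_0:
  fixes f :: "'a::euclidean_space \<Rightarrow> complex"
  assumes f: "f \<in> schwartz"
  shows "(LINT \<xi>|lborel. fourier f \<xi>) = of_real ((2 * pi) ^ DIM('a)) * f 0"
proof -
  let ?G = "gaussian :: 'a \<Rightarrow> complex" and ?s = "complex_of_real (sqrt (2 * pi)) ^ DIM('a)"
  have [measurable]: "f \<in> borel_measurable borel" "fourier f \<in> borel_measurable borel"
    "?G \<in> borel_measurable borel"
    using schwartz_measurable f schwartz_fourier borel_measurable_continuous_onI[OF continuous_gaussian] by auto
  obtain B where B: "B > 0" "\<And>x. norm (f x) \<le> B" using schwartz_bounded[OF f] by blast
  define e where "e n = 1 / real (Suc n)" for n
  have e0: "e n > 0" for n by (simp add: e_def)
  have elim: "e \<longlonglongrightarrow> 0" unfolding e_def by (rule LIMSEQ_Suc[OF lim_1_over_n])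
  have elim': "(\<lambda>n. e n *\<^sub>R x) \<longlonglongrightarrow> 0" for x :: 'a
    using tendsto_scaleR[OF elim tendsto_const[of x]] by simp
  have G0: "?G 0 = 1" by (simp add: gaussian_def)
  have "(LINT \<xi>|lborel. fourier f \<xi> * ?G (e n *\<^sub>R \<xi>)) = ?s * (LINT y|lborel. f (e n *\<^sub>R y) * ?G y)" for n
  proof -
    have gi: "integrable lborel (\<lambda>\<xi>. ?G (e n *\<^sub>R \<xi>))"
      using integrable_lborel_prod[where f = "\<lambda>(b::'a) t. complex_of_real (exp (- (e n * t)\<^sup>2 / 2))"]
        lborel_integrable_real_affine[OF gaussian_integral_real(1), of "e n" 0] e0[of n]
      by (simp add: gaussian_def[abs_def])
    have "fourier (\<lambda>\<xi>. ?G (e n *\<^sub>R \<xi>)) (e n *\<^sub>R y) * of_real (e n ^ DIM('a)) = ?s * ?G y" for y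
    proof -
      have "fourier ?G y = of_real (e n ^ DIM('a)) * (LINT \<xi>|lborel. exp (- (\<i> * complex_of_real ((e n *\<^sub>R \<xi>) \<bullet> y))) * ?G (e n *\<^sub>R \<xi>))"
        unfolding fourier_def by (rule integral_scale[OF _ e0]) measurable
      then show ?thesis using fourier_gaussian[of y] by (simp add: fourier_def inner_commute mult.commute)
    qed
    note F = this
    have meas: "(\<lambda>x. f x * fourier (\<lambda>\<xi>. ?G (e n *\<^sub>R \<xi>)) x) \<in> borel_measurable borel"
    proof -
      have "continuous_on UNIV (\<lambda>x. ?s * ?G ((1 / e n) *\<^sub>R x) / of_real (e n ^ DIM('a)))"
        by (intro continuous_intros continuous_on_compose2[OF continuous_gaussian]) (use e0[of n] in auto)
      moreover have "fourier (\<lambda>\<xi>. ?G (e n *\<^sub>R \<xi>)) x = ?s * ?G ((1 / e n) *\<^sub>R x) / of_real (e n ^ DIM('a))" for x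
        using F[of "(1 / e n) *\<^sub>R x"] e0[of n] by (simp add: field_simps)
      ultimately have "continuous_on UNIV (fourier (\<lambda>\<xi>. ?G (e n *\<^sub>R \<xi>)))"
        by (simp add: continuous_on_cong[OF refl, of UNIV "fourier (\<lambda>\<xi>. ?G (e n *\<^sub>R \<xi>))"])
      then have "fourier (\<lambda>\<xi>. ?G (e n *\<^sub>R \<xi>)) \<in> borel_measurable borel"
        by (rule borel_measurable_continuous_onI)
      then show ?thesis by measurable
    qed
    have "(LINT \<xi>|lborel. fourier f \<xi> * ?G (e n *\<^sub>R \<xi>)) = (LINT x|lborel. f x * fourier (\<lambda>\<xi>. ?G (e n *\<^sub>R \<xi>)) x)"
      by (rule fourier_multiplication[OF schwartz_integrable[OF f] gi])
    also have "\<dots> = of_real (e n ^ DIM('a)) * (LINT y|lborel. f (e n *\<^sub>R y) * fourier (\<lambda>\<xi>. ?G (e n *\<^sub>R \<xi>)) (e n *\<^sub>R y))"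
      by (rule integral_scale[OF meas e0])
    also have "\<dots> = (LINT y|lborel. f (e n *\<^sub>R y) * (fourier (\<lambda>\<xi>. ?G (e n *\<^sub>R \<xi>)) (e n *\<^sub>R y) * of_real (e n ^ DIM('a))))"
      by (subst integral_mult_right_zero[symmetric]) (simp add: mult_ac)
    also have "\<dots> = (LINT y|lborel. ?s * (f (e n *\<^sub>R y) * ?G y))"
      unfolding F by (simp add: mult_ac)
    finally show ?thesis by simp
  qed
  moreover have "(\<lambda>n. LINT \<xi>|lborel. fourier f \<xi> * ?G (e n *\<^sub>R \<xi>)) \<longlonglongrightarrow> (LINT \<xi>|lborel. fourier f \<xi>)"
  proof (rule integral_dominated_convergence[where w = "\<lambda>\<xi>. norm (fourier f \<xi>)"])
    show "AE \<xi> in lborel. (\<lambda>n. fourier f \<xi> * ?G (e n *\<^sub>R \<xi>)) \<longlonglongrightarrow> fourier f \<xi>"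
    proof (rule AE_I2)
      fix \<xi> :: 'a
      have "(\<lambda>n. ?G (e n *\<^sub>R \<xi>)) \<longlonglongrightarrow> ?G 0"
        by (rule continuous_on_tendsto_compose[OF continuous_gaussian elim']) auto
      then show "(\<lambda>n. fourier f \<xi> * ?G (e n *\<^sub>R \<xi>)) \<longlonglongrightarrow> fourier f \<xi>"
        using tendsto_mult[OF tendsto_const[of "fourier f \<xi>"]] G0 by fastforce
    qed
    show "AE \<xi> in lborel. norm (fourier f \<xi> * ?G (e n *\<^sub>R \<xi>)) \<le> norm (fourier f \<xi>)" for n
      by (intro AE_I2) (simp add: norm_mult mult_left_le norm_gaussian_le)
  qed (use schwartz_integrable[OF schwartz_fourier[OF f]] in auto)
  moreover have "(\<lambda>n. LINT y|lborel. f (e n *\<^sub>R y) * ?G y) \<longlonglongrightarrow> (LINT y|lborel. f 0 * ?G y)"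
  proof (rule integral_dominated_convergence[where w = "\<lambda>y. B * norm (?G y)"])
    show "AE y in lborel. (\<lambda>n. f (e n *\<^sub>R y) * ?G y) \<longlonglongrightarrow> f 0 * ?G y"
      by (intro AE_I2 tendsto_mult tendsto_const continuous_on_tendsto_compose[OF schwartz_continuous[OF f] elim']) auto
    show "AE y in lborel. norm (f (e n *\<^sub>R y) * ?G y) \<le> B * norm (?G y)" for n
      using B by (auto simp: norm_mult intro!: mult_right_mono)
  qed (use gaussian_integrable in auto)
  ultimately have "(LINT \<xi>|lborel. fourier f \<xi>) = ?s * (LINT y|lborel. f 0 * ?G y)"
    by (auto intro!: LIMSEQ_unique tendsto_mult tendsto_const)
  also have "\<dots> = (?s * ?s) * f 0" by (simp add: integral_gaussian)
  \<comment> \<open>One factor stems from the transform of the Gaussian, the other from its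
    integral.\<close>
  also have "?s * ?s = complex_of_real ((sqrt (2 * pi) * sqrt (2 * pi)) ^ DIM('a))"
    by (simp only: power_mult_distrib of_real_mult of_real_power)
  also have "sqrt (2 * pi) * sqrt (2 * pi) = 2 * pi"
    by (rule real_sqrt_mult_self[THEN trans]) simp
  finally show ?thesis .
qed

text \<open>Translating \<open>f\<close> multiplies its transform by a character, which reduces
  inversion at x to inversion at the origin.\<close>

theorem inv_fourier_fourier:
  fixes f :: "'a::euclidean_space \<Rightarrow> complex"
  assumes f: "f \<in> schwartz"
  shows "inv_fourier (fourier f) = f"
proof
  fix x :: 'a
  let ?g = "\<lambda>z. f (z - (- x))"
  have g: "?g \<in> schwartz" by (rule schwartz_translate[OF f])
  have [measurable]: "f \<in> borel_measurable borel" by (rule schwartz_measurable[OF f])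
  have "fourier ?g \<xi> = exp (\<i> * complex_of_real (x \<bullet> \<xi>)) * fourier f \<xi>" for \<xi>
  proof -
    have "fourier ?g \<xi> = (LINT z|lborel. exp (\<i> * complex_of_real (x \<bullet> \<xi>)) * (exp (- (\<i> * complex_of_real ((x + z) \<bullet> \<xi>))) * f (x + z)))"
      unfolding fourier_def
      by (intro Bochner_Integration.integral_cong)
        (auto simp: inner_add_left algebra_simps exp_add exp_diff exp_minus add.commute)
    also have "\<dots> = exp (\<i> * complex_of_real (x \<bullet> \<xi>)) * fourier f \<xi>"
      unfolding fourier_def
      by (simp add: integral_translate[where t = x and f = "\<lambda>z. exp (- (\<i> * complex_of_real (z \<bullet> \<xi>))) * f z"])
    finally show ?thesis .
  qed
  then show "inv_fourier (fourier f) x = f x"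
    using fourier_integral_at_0[OF g] by (simp add: inv_fourier_def)
qed

text \<open>The substitution x -> - x turns this composition into the opposite one.\<close>

theorem fourier_inv_fourier:
  fixes f :: "'a::euclidean_space \<Rightarrow> complex"
  assumes f: "f \<in> schwartz"
  shows "fourier (inv_fourier f) = f"
proof
  fix \<xi> :: 'a
  have [measurable]: "fourier f \<in> borel_measurable borel" by (rule schwartz_measurable[OF schwartz_fourier[OF f]])
  have "fourier (inv_fourier f) \<xi> = (LINT x|lborel. exp (\<i> * complex_of_real ((0 - x) \<bullet> \<xi>)) * fourier f (0 - x)) / of_real ((2 * pi) ^ DIM('a))"
    unfolding fourier_def[of "inv_fourier f"] inv_fourier_eq_fourier by simp
  also have "\<dots> = (LINT x|lborel. exp (\<i> * complex_of_real (x \<bullet> \<xi>)) * fourier f x) / of_real ((2 * pi) ^ DIM('a))"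
    by (subst integral_reflect) auto
  also have "\<dots> = inv_fourier (fourier f) \<xi>" by (simp add: inv_fourier_def inner_commute)
  finally show "fourier (inv_fourier f) \<xi> = f \<xi>" using inv_fourier_fourier[OF f] by simp
qed

text \<open>After Fubini the integral in y is the transform of \<open>inv_fourier \<mu>\<close>,
  that is \<open>\<mu>\<close> by inversion.\<close>

lemma inv_fourier_mult:
  fixes \<phi> \<mu> :: "'a::euclidean_space \<Rightarrow> complex"
  assumes \<phi>: "\<phi> \<in> schwartz" and \<mu>: "\<mu> \<in> schwartz"
  shows "inv_fourier (\<lambda>\<xi>. \<phi> \<xi> * \<mu> \<xi>) x = (LINT y|lborel. inv_fourier \<phi> (x - y) * inv_fourier \<mu> y)"
proof -
  let ?c = "complex_of_real ((2 * pi) ^ DIM('a))"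
  let ?K = "\<lambda>y \<xi>. exp (- (\<i> * complex_of_real (y \<bullet> \<xi>)))"
  let ?p = "\<lambda>\<xi>. exp (\<i> * complex_of_real (x \<bullet> \<xi>)) * \<phi> \<xi>"
  have p: "integrable lborel ?p"
    using schwartz_integrable[OF schwartz_modulate[OF \<phi>, of "- x"]] by (simp add: inner_commute)
  have "(LINT y|lborel. inv_fourier \<phi> (x - y) * inv_fourier \<mu> y) = (LINT y|lborel. inv_fourier \<mu> y * (LINT \<xi>|lborel. ?K y \<xi> * ?p \<xi>)) / ?c"
    unfolding inv_fourier_def[of \<phi>]
    by (subst integral_divide_zero[symmetric])
      (simp add: inner_diff_left algebra_simps exp_diff exp_minus divide_inverse)
  also have "(LINT y|lborel. inv_fourier \<mu> y * (LINT \<xi>|lborel. ?K y \<xi> * ?p \<xi>))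
      = (LINT \<xi>|lborel. ?p \<xi> * (LINT y|lborel. ?K y \<xi> * inv_fourier \<mu> y))"
    by (rule fubini_kernel[OF schwartz_integrable[OF schwartz_inv_fourier[OF \<mu>]] p char_kernel_measurable, of 1]) simp
  also have "\<dots> = (LINT \<xi>|lborel. ?p \<xi> * \<mu> \<xi>)"
    using fourier_inv_fourier[OF \<mu>] by (simp add: fourier_def fun_eq_iff)
  finally show ?thesis by (simp add: inv_fourier_def mult.assoc)
qed

text \<open>The left side is what a distribution is tested with when a Fourier multiplier is
  transposed onto the test function. It is the convolution formula above after reflections.\<close>

lemma fourier_mult_inv_fourier:
  fixes \<phi> g :: "'a::euclidean_space \<Rightarrow> complex"
  assumes \<phi>: "\<phi> \<in> schwartz" and g: "g \<in> schwartz"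
  shows "fourier (\<lambda>\<xi>. \<phi> \<xi> * inv_fourier g \<xi>) z = (LINT x|lborel. fourier \<phi> (z - x) / of_real ((2 * pi) ^ DIM('a)) * g x)"
proof -
  have f: "fourier h z = of_real ((2 * pi) ^ DIM('a)) * inv_fourier h (- z)" for h :: "'a \<Rightarrow> complex" and z
    by (simp add: inv_fourier_eq_fourier)
  have [measurable]: "\<phi> \<in> borel_measurable borel" "g \<in> borel_measurable borel"
    "inv_fourier \<phi> \<in> borel_measurable borel" "fourier g \<in> borel_measurable borel"
    by (intro schwartz_measurable schwartz_inv_fourier schwartz_fourier \<phi> g)+
  have ii: "inv_fourier (inv_fourier g) y = g (- y) / of_real ((2 * pi) ^ DIM('a))" for y
    using fourier_inv_fourier[OF g] inv_fourier_eq_fourier[of "inv_fourier g" y] by simp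
  have "fourier (\<lambda>\<xi>. \<phi> \<xi> * inv_fourier g \<xi>) z = of_real ((2 * pi) ^ DIM('a)) * (LINT y|lborel. inv_fourier \<phi> (- z - y) * inv_fourier (inv_fourier g) y)"
    unfolding f[of "\<lambda>\<xi>. \<phi> \<xi> * inv_fourier g \<xi>"] by (subst inv_fourier_mult[OF \<phi> schwartz_inv_fourier[OF g]]) simp
  also have "\<dots> = (LINT y|lborel. inv_fourier \<phi> (- z - y) * g (- y))"
    unfolding ii by (subst integral_mult_right_zero[symmetric]) simp
  also have "\<dots> = (LINT y|lborel. inv_fourier \<phi> (- z - (0 - y)) * g (- (0 - y)))"
    by (rule integral_reflect[symmetric, of "\<lambda>y. inv_fourier \<phi> (- z - y) * g (- y)" 0]) measurable
  also have "\<dots> = (LINT x|lborel. fourier \<phi> (z - x) / of_real ((2 * pi) ^ DIM('a)) * g x)"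
    by (simp add: inv_fourier_eq_fourier)
  finally show ?thesis .
qed

section \<open>Tempered distributions\<close>

lemma finite_multiindices: "finite {vs :: 'a::euclidean_space list. set vs \<subseteq> Basis \<and> length vs \<le> N}"
  by (rule finite_lists_length_le) simp

lemma schwartz_seminorm_leI:
  fixes f :: "'a::euclidean_space \<Rightarrow> complex"
  assumes "\<And>vs x. set vs \<subseteq> Basis \<Longrightarrow> length vs \<le> N \<Longrightarrow> (1 + norm x) ^ N * norm (iter_pderiv vs f x) \<le> B"
  shows "schwartz_seminorm N f \<le> B"
  unfolding schwartz_seminorm_def
proof (rule cSUP_least)
  have "([], 0) \<in> {vs :: 'a list. set vs \<subseteq> Basis \<and> length vs \<le> N} \<times> (UNIV :: 'a set)" by simp
  then show "{vs :: 'a list. set vs \<subseteq> Basis \<and> length vs \<le> N} \<times> (UNIV :: 'a set) \<noteq> {}" by blast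
qed (use assms in auto)

text \<open>A real supremum is only an upper bound if the set is bounded: here finitely many
  derivatives occur, each with its own bound, and the sum of these bounds serves.\<close>

lemma le_schwartz_seminorm:
  fixes f :: "'a::euclidean_space \<Rightarrow> complex"
  assumes f: "f \<in> schwartz" and vs: "set vs \<subseteq> Basis" "length vs \<le> N"
  shows "(1 + norm x) ^ N * norm (iter_pderiv vs f x) \<le> schwartz_seminorm N f"
proof -
  let ?I = "{vs :: 'a list. set vs \<subseteq> Basis \<and> length vs \<le> N}"
  have "\<forall>vs\<in>?I. \<exists>C. C > 0 \<and> (\<forall>x. (1 + norm x) ^ N * norm (iter_pderiv vs f x) \<le> C)"
  proof
    fix vs assume that: "vs \<in> ?I"
    have "rapid (iter_pderiv vs f)" using that schwartz_rapid schwartz_iter f by blast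
    from rapidE[OF this, where k = N] show "\<exists>C. C > 0 \<and> (\<forall>x. (1 + norm x) ^ N * norm (iter_pderiv vs f x) \<le> C)" by blast
  qed
  from bchoice[OF this] obtain C where C: "\<And>vs. vs \<in> ?I \<Longrightarrow> C vs > 0"
      "\<And>vs x. vs \<in> ?I \<Longrightarrow> (1 + norm x) ^ N * norm (iter_pderiv vs f x) \<le> C vs"
    by blast
  have le: "(1 + norm x) ^ N * norm (iter_pderiv vs f x) \<le> (\<Sum>vs\<in>?I. C vs)" if "vs \<in> ?I" for vs x
  proof -
    have "C vs \<le> (\<Sum>vs\<in>?I. C vs)"
      by (rule member_le_sum[OF that _ finite_multiindices]) (use C(1) less_imp_le in blast)
    then show ?thesis using C(2)[OF that, of x] by linarith
  qed
  have "bdd_above ((\<lambda>(vs, x). (1 + norm x) ^ N * norm (iter_pderiv vs f x)) ` (?I \<times> UNIV))"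
    by (rule bdd_aboveI2[where M = "\<Sum>vs\<in>?I. C vs"]) (use le in auto)
  then show ?thesis
    unfolding schwartz_seminorm_def
    using cSUP_upper[of "(vs, x)" "?I \<times> UNIV" "\<lambda>(vs, x). (1 + norm x) ^ N * norm (iter_pderiv vs f x)"] vs
    by auto
qed

lemma schwartz_seminorm_nonneg: "f \<in> schwartz \<Longrightarrow> 0 \<le> schwartz_seminorm N f"
  using le_schwartz_seminorm[of f "[]" N 0] by (simp add: order_trans[OF norm_ge_zero])

lemma tempered_linear:
  "T \<in> tempered \<Longrightarrow> f \<in> schwartz \<Longrightarrow> g \<in> schwartz \<Longrightarrow> T (\<lambda>x. c * f x + g x) = c * T f + T g"
  by (simp add: tempered_def)

lemma tempered_outside: "T \<in> tempered \<Longrightarrow> f \<notin> schwartz \<Longrightarrow> T f = 0"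
  by (simp add: tempered_def)

lemma tempered_add:
  "T \<in> tempered \<Longrightarrow> f \<in> schwartz \<Longrightarrow> g \<in> schwartz \<Longrightarrow> T (\<lambda>x. f x + g x) = T f + T g"
  using tempered_linear[of T f g 1] by simp

lemma tempered_zero: assumes "T \<in> tempered" shows "T (\<lambda>x. 0) = 0"
  using tempered_add[OF assms schwartz_zero schwartz_zero] by simp

lemma tempered_cmult:
  "T \<in> tempered \<Longrightarrow> f \<in> schwartz \<Longrightarrow> T (\<lambda>x. c * f x) = c * T f"
  using tempered_linear[of T f "\<lambda>x. 0" c] tempered_zero[of T] schwartz_zero by simp

lemma tempered_diff:
  assumes "T \<in> tempered" "f \<in> schwartz" "g \<in> schwartz" shows "T (\<lambda>x. f x - g x) = T f - T g"
  using tempered_linear[OF assms(1,3,2), of "-1"] by simp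

lemma tempered_sum:
  assumes "T \<in> tempered" "\<And>i. i \<in> I \<Longrightarrow> f i \<in> schwartz"
  shows "T (\<lambda>x. \<Sum>i\<in>I. f i x) = (\<Sum>i\<in>I. T (f i))"
  using assms(2)
proof (induction I rule: infinite_finite_induct)
  case (insert i I)
  then show ?case using tempered_add[OF assms(1), of "f i" "\<lambda>x. \<Sum>i\<in>I. f i x"] by (simp add: schwartz_sum)
qed (simp_all add: tempered_zero[OF assms(1)])

lemma temperedE:
  assumes "T \<in> tempered"
  obtains N C where "C > 0" "\<And>f. f \<in> schwartz \<Longrightarrow> norm (T f) \<le> C * schwartz_seminorm N f"
proof -
  obtain N C where C: "\<And>f. f \<in> schwartz \<Longrightarrow> norm (T f) \<le> C * schwartz_seminorm N f"
    using assms unfolding tempered_def by blast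
  have "norm (T f) \<le> max C 1 * schwartz_seminorm N f" if "f \<in> schwartz" for f
    using C[OF that] mult_right_mono[OF max.cobounded1[of C 1] schwartz_seminorm_nonneg[OF that, of N]] by linarith
  then show ?thesis using that[of "max C 1" N] by simp
qed

section \<open>Continuity of translations in the Schwartz space\<close>

lemma one_plus_norm_le: "1 + norm z \<le> (1 + norm x) * (1 + norm (z - x))" for x z :: "'a::real_normed_vector"
proof -
  have "norm z \<le> norm (z - x) + norm x" using norm_triangle_ineq[of "z - x" x] by simp
  moreover have "0 \<le> norm x * norm (z - x)" by simp
  ultimately show ?thesis unfolding distrib_left distrib_right by linarith
qed

text \<open>The common modulus of continuity of all the maps \<open>x \<mapsto> f(\<cdot> - x)\<close> into the Schwartz space.\<close>

definition tmod :: "nat \<Rightarrow> 'a::euclidean_space \<Rightarrow> 'a \<Rightarrow> real" where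
  "tmod N x y = min 1 (norm (x - y)) * ((1 + norm x) ^ N + (1 + norm y) ^ N)"

lemma schwartz_translate_bound:
  assumes f: "f \<in> schwartz"
  obtains C where "C > 0" "\<And>x z. (1 + norm z) ^ N * norm (f (z - x)) \<le> C * (1 + norm x) ^ N"
proof -
  obtain C where C: "C > 0" "\<And>x. (1 + norm x) ^ N * norm (f x) \<le> C"
    using rapidE[OF schwartz_rapid[OF f]] by blast
  have "(1 + norm z) ^ N * norm (f (z - x)) \<le> C * (1 + norm x) ^ N" for x z
  proof -
    have "(1 + norm z) ^ N * norm (f (z - x)) \<le> ((1 + norm x) * (1 + norm (z - x))) ^ N * norm (f (z - x))"
      by (intro mult_right_mono power_mono one_plus_norm_le) auto
    also have "\<dots> = (1 + norm x) ^ N * ((1 + norm (z - x)) ^ N * norm (f (z - x)))"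
      by (simp only: power_mult_distrib mult.assoc)
    also have "\<dots> \<le> (1 + norm x) ^ N * C" by (intro mult_left_mono C) auto
    finally show ?thesis by (simp add: mult.commute)
  qed
  then show thesis using that C(1) by blast
qed

text \<open>For |x - y| > 1 the sizes of both translates suffice; for |x - y| <= 1 the mean value
  inequality along the segment gives the factor |x - y|. The minimum in \<open>tmod\<close> joins
  the two cases.\<close>

lemma schwartz_tmod1:
  fixes f :: "'a::euclidean_space \<Rightarrow> complex"
  assumes f: "f \<in> schwartz"
  shows "\<exists>C>0. \<forall>x y z. (1 + norm z) ^ N * norm (f (z - x) - f (z - y)) \<le> C * tmod N x y"
proof -
  obtain C0 where C0: "C0 > 0" "\<And>x z. (1 + norm z) ^ N * norm (f (z - x)) \<le> C0 * (1 + norm x) ^ N"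
    using schwartz_translate_bound[OF f] by blast
  obtain C1 where C1: "C1 > 0" "\<And>x h. (1 + norm x) ^ N * norm (frechet_derivative f (at x) h) \<le> C1 * norm h"
    using schwartz_frechet_bound[OF f] by blast
  let ?C = "max C0 (2 ^ N * C1)"
  have "(1 + norm z) ^ N * norm (f (z - x) - f (z - y)) \<le> ?C * tmod N x y" for x y z
  proof (cases "norm (x - y) \<le> 1")
    case False
    have "(1 + norm z) ^ N * norm (f (z - x) - f (z - y)) \<le> (1 + norm z) ^ N * (norm (f (z - x)) + norm (f (z - y)))"
      by (intro mult_left_mono norm_triangle_ineq4) auto
    also have "\<dots> \<le> C0 * ((1 + norm x) ^ N + (1 + norm y) ^ N)"
      using add_mono[OF C0(2)[of z x] C0(2)[of z y]] by (simp add: algebra_simps)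
    also have "\<dots> \<le> ?C * ((1 + norm x) ^ N + (1 + norm y) ^ N)" by (intro mult_right_mono) auto
    finally show ?thesis using False by (simp add: tmod_def)
  next
    case True
    let ?B = "2 ^ N * C1 * (1 + norm y) ^ N / (1 + norm z) ^ N"
    have pos: "(1 + norm z) ^ N > 0" by (simp add: add_pos_nonneg)
    have "norm (f (z - x) - f (z - y)) \<le> ?B * norm ((z - x) - (z - y))"
    proof (rule differentiable_bound[where S = "closed_segment (z - x) (z - y)"])
      fix w assume w: "w \<in> closed_segment (z - x) (z - y)"
      have D: "(f has_derivative frechet_derivative f (at w)) (at w)"
        using schwartz_differentiable[OF f] frechet_derivative_works by blast
      show "(f has_derivative frechet_derivative f (at w)) (at w within closed_segment (z - x) (z - y))"
        using D has_derivative_at_withinI by blast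
      have "norm (w - (z - y)) \<le> norm ((z - x) - (z - y))"
        using segment_bound(2)[OF w] by (simp add: norm_minus_commute)
      then have "norm (z - y) \<le> norm w + 1"
        using True norm_triangle_ineq[of "w" "(z - y) - w"] by (simp add: norm_minus_commute)
      \<comment> \<open>Points w of the segment stay within distance 1 of z - y, which costs the
        factor 2 behind the 2^N in \<open>?B\<close>.\<close>
      then have le: "1 + norm z \<le> 2 * (1 + norm y) * (1 + norm w)"
      proof -
        have "1 + norm z \<le> (1 + norm y) * (1 + norm (z - y))" by (rule one_plus_norm_le)
        also have "\<dots> \<le> (1 + norm y) * (2 * (1 + norm w))"
        proof (rule mult_left_mono)
          show "1 + norm (z - y) \<le> 2 * (1 + norm w)"
            using \<open>norm (z - y) \<le> norm w + 1\<close> norm_ge_zero[of w] unfolding distrib_left by linarith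
        qed simp
        finally show ?thesis by (simp add: algebra_simps)
      qed
      show "onorm (frechet_derivative f (at w)) \<le> ?B"
      proof (rule onorm_bound)
        fix h
        have "(1 + norm z) ^ N * norm (frechet_derivative f (at w) h) \<le>
            (2 * (1 + norm y) * (1 + norm w)) ^ N * norm (frechet_derivative f (at w) h)"
          by (intro mult_right_mono power_mono le) auto
        also have "\<dots> = 2 ^ N * (1 + norm y) ^ N * ((1 + norm w) ^ N * norm (frechet_derivative f (at w) h))"
          by (simp only: power_mult_distrib mult.assoc)
        also have "\<dots> \<le> 2 ^ N * (1 + norm y) ^ N * (C1 * norm h)"
          by (intro mult_left_mono C1) auto
        finally have "norm (frechet_derivative f (at w) h) \<le> 2 ^ N * (1 + norm y) ^ N * (C1 * norm h) / (1 + norm z) ^ N"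
          using pos by (simp add: pos_le_divide_eq mult.commute)
        then show "norm (frechet_derivative f (at w) h) \<le> ?B * norm h" by (simp add: mult_ac)
      qed (use C1 pos in \<open>auto intro!: divide_nonneg_pos mult_nonneg_nonneg\<close>)
    qed auto
    then have "norm (f (z - x) - f (z - y)) \<le> ?B * norm (x - y)" by (simp add: norm_minus_commute)
    then have "(1 + norm z) ^ N * norm (f (z - x) - f (z - y)) \<le> (1 + norm z) ^ N * (?B * norm (x - y))"
      by (intro mult_left_mono) auto
    also have "\<dots> = 2 ^ N * C1 * ((1 + norm y) ^ N * norm (x - y))"
    proof -
      have "1 + norm z \<noteq> 0" using norm_ge_zero[of z] by linarith
      then show ?thesis by simp
    qed
    also have "\<dots> \<le> ?C * (((1 + norm x) ^ N + (1 + norm y) ^ N) * norm (x - y))"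
      by (intro mult_mono mult_right_mono) (use C1 C0 in auto)
    finally show ?thesis using True by (simp add: tmod_def mult_ac)
  qed
  then show ?thesis using C0(1) by (intro exI[of _ ?C]) auto
qed

lemma schwartz_tmod:
  fixes f :: "'a::euclidean_space \<Rightarrow> complex"
  assumes f: "f \<in> schwartz"
  obtains C where "C > 0" "\<And>vs x y z. set vs \<subseteq> Basis \<Longrightarrow> length vs \<le> N \<Longrightarrow>
    (1 + norm z) ^ N * norm (iter_pderiv vs f (z - x) - iter_pderiv vs f (z - y)) \<le> C * tmod N x y"
proof -
  let ?I = "{vs :: 'a list. set vs \<subseteq> Basis \<and> length vs \<le> N}"
  have "\<forall>vs\<in>?I. \<exists>C>0. \<forall>x y z. (1 + norm z) ^ N * norm (iter_pderiv vs f (z - x) - iter_pderiv vs f (z - y)) \<le> C * tmod N x y"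
  proof
    fix vs assume "vs \<in> ?I"
    then have "iter_pderiv vs f \<in> schwartz" using schwartz_iter[OF f] by blast
    then show "\<exists>C>0. \<forall>x y z. (1 + norm z) ^ N * norm (iter_pderiv vs f (z - x) - iter_pderiv vs f (z - y)) \<le> C * tmod N x y"
      by (rule schwartz_tmod1)
  qed
  from bchoice[OF this] obtain C where C: "\<And>vs. vs \<in> ?I \<Longrightarrow> C vs > 0"
      "\<And>vs x y z. vs \<in> ?I \<Longrightarrow> (1 + norm z) ^ N * norm (iter_pderiv vs f (z - x) - iter_pderiv vs f (z - y)) \<le> C vs * tmod N x y"
    by blast
  have nn: "0 \<le> tmod N x y" for x y :: 'a by (simp add: tmod_def)
  show thesis
  proof
    show "(\<Sum>vs\<in>?I. C vs) > 0" using C(1) by (intro sum_pos[OF finite_multiindices]) (auto intro!: exI[of _ "[]"])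
    fix vs :: "'a list" and x y z :: 'a assume "set vs \<subseteq> Basis" "length vs \<le> N"
    then have vs: "vs \<in> ?I" by simp
    have "C vs \<le> (\<Sum>vs\<in>?I. C vs)"
      by (rule member_le_sum[OF vs _ finite_multiindices]) (use C(1) less_imp_le in blast)
    then show "(1 + norm z) ^ N * norm (iter_pderiv vs f (z - x) - iter_pderiv vs f (z - y)) \<le> (\<Sum>vs\<in>?I. C vs) * tmod N x y"
      using C(2)[OF vs, of z x y] mult_right_mono[OF _ nn] order_trans by blast
  qed
qed

lemma real_le_norm: "x \<le> norm (x :: real)"
  by simp

text \<open>The convolution of \<open>T\<close> with the reflection of \<open>\<Theta>\<close>. For
  \<open>\<Theta> = kern \<phi>\<close> it is the function F^-1(phi F T), see
  \<open>fourier_multiplier_dist\<close>.\<close>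

definition tconv :: "'a::euclidean_space dist \<Rightarrow> ('a \<Rightarrow> complex) \<Rightarrow> 'a \<Rightarrow> complex" where
  "tconv T \<Theta> x = T (\<lambda>z. \<Theta> (z - x))"

lemma tconv_tmod:
  assumes T: "T \<in> tempered" "\<And>f. f \<in> schwartz \<Longrightarrow> norm (T f) \<le> A * schwartz_seminorm N f" "A > 0"
    and f: "\<Theta> \<in> schwartz"
  obtains C where "C > 0" "\<And>x y. norm (tconv T \<Theta> x - tconv T \<Theta> y) \<le> C * tmod N x y"
proof -
  obtain C where C: "C > 0" "\<And>vs x y z. set vs \<subseteq> Basis \<Longrightarrow> length vs \<le> N \<Longrightarrow>
    (1 + norm z) ^ N * norm (iter_pderiv vs \<Theta> (z - x) - iter_pderiv vs \<Theta> (z - y)) \<le> C * tmod N x y"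
    using schwartz_tmod[OF f] by metis
  have "norm (tconv T \<Theta> x - tconv T \<Theta> y) \<le> A * C * tmod N x y" for x y
  proof -
    have S: "(\<lambda>z. \<Theta> (z - x)) \<in> schwartz" "(\<lambda>z. \<Theta> (z - y)) \<in> schwartz" "(\<lambda>z. - 1 * \<Theta> (z - y)) \<in> schwartz"
      by (intro schwartz_cmult schwartz_translate f)+
    have "tconv T \<Theta> x - tconv T \<Theta> y = T (\<lambda>z. \<Theta> (z - x) + (- 1) * \<Theta> (z - y))"
      using tempered_diff[OF T(1) S(1,2)] by (simp add: tconv_def)
    also have "norm \<dots> \<le> A * schwartz_seminorm N (\<lambda>z. \<Theta> (z - x) + (- 1) * \<Theta> (z - y))"
      by (intro T schwartz_add S)
    also have "\<dots> \<le> A * (C * tmod N x y)"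
    proof (intro mult_left_mono schwartz_seminorm_leI)
      fix vs :: "'a list" and z assume vs: "set vs \<subseteq> Basis" "length vs \<le> N"
      have "iter_pderiv vs (\<lambda>z. \<Theta> (z - x) + (- 1) * \<Theta> (z - y)) z = iter_pderiv vs \<Theta> (z - x) - iter_pderiv vs \<Theta> (z - y)"
        using vs S by (simp only: iter_pderiv_add iter_pderiv_cmult schwartz_smooth iter_pderiv_translate f) simp
      then show "(1 + norm z) ^ N * norm (iter_pderiv vs (\<lambda>z. \<Theta> (z - x) + (- 1) * \<Theta> (z - y)) z) \<le> C * tmod N x y"
        using C(2)[OF vs] by simp
    qed (use T(3) in simp)
    finally show ?thesis by simp
  qed
  then show thesis using that[of "A * C"] C(1) T(3) by simp
qed

lemma continuous_tconv:
  assumes "T \<in> tempered" "\<Theta> \<in> schwartz" shows "continuous_on UNIV (tconv T \<Theta>)"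
proof -
  obtain N A where A: "A > 0" "\<And>f. f \<in> schwartz \<Longrightarrow> norm (T f) \<le> A * schwartz_seminorm N f"
    using temperedE[OF assms(1)] by metis
  obtain C where C: "C > 0" "\<And>x y. norm (tconv T \<Theta> x - tconv T \<Theta> y) \<le> C * tmod N x y"
    using tconv_tmod[OF assms(1) A(2,1) assms(2)] by metis
  show ?thesis unfolding continuous_on_def
  proof
    fix x :: 'a
    have "((\<lambda>y. C * tmod N y x) \<longlongrightarrow> C * tmod N x x) (at x)"
      unfolding tmod_def by (intro tendsto_intros)
    then have lim0: "((\<lambda>y. C * tmod N y x) \<longlongrightarrow> 0) (at x)" by (simp add: tmod_def)
    have "((\<lambda>y. tconv T \<Theta> y - tconv T \<Theta> x) \<longlongrightarrow> 0) (at x)"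
      by (rule Lim_null_comparison[OF always_eventually lim0]) (use C(2) in blast)
    then show "(tconv T \<Theta> \<longlongrightarrow> tconv T \<Theta> x) (at x)" using LIM_zero_cancel by blast
  qed
qed

lemma tconv_growth:
  assumes "T \<in> tempered" "\<Theta> \<in> schwartz"
  obtains N C where "C > 0" "\<And>x. norm (tconv T \<Theta> x) \<le> C * (1 + norm x) ^ N"
proof -
  obtain N A where A: "A > 0" "\<And>f. f \<in> schwartz \<Longrightarrow> norm (T f) \<le> A * schwartz_seminorm N f"
    using temperedE[OF assms(1)] by metis
  obtain C where C: "C > 0" "\<And>x y. norm (tconv T \<Theta> x - tconv T \<Theta> y) \<le> C * tmod N x y"
    using tconv_tmod[OF assms(1) A(2,1) assms(2)] by metis
  have "norm (tconv T \<Theta> x) \<le> (norm (tconv T \<Theta> 0) + C * 2) * (1 + norm x) ^ N" for x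
  proof -
    have 1: "1 \<le> (1 + norm x) ^ N" by simp
    have "tmod N x 0 \<le> 1 * (2 * (1 + norm x) ^ N)"
      unfolding tmod_def by (intro mult_mono) (use 1 in auto)
    then have "C * tmod N x 0 \<le> C * (2 * (1 + norm x) ^ N)" using C(1) by (intro mult_left_mono) auto
    moreover have "norm (tconv T \<Theta> x) \<le> norm (tconv T \<Theta> 0) + norm (tconv T \<Theta> x - tconv T \<Theta> 0)"
      using norm_triangle_ineq[of "tconv T \<Theta> 0" "tconv T \<Theta> x - tconv T \<Theta> 0"] by simp
    moreover have "norm (tconv T \<Theta> 0) \<le> norm (tconv T \<Theta> 0) * (1 + norm x) ^ N"
      using mult_left_mono[OF 1, of "norm (tconv T \<Theta> 0)"] by simp
    ultimately show ?thesis using C(2)[of x 0] by (simp add: algebra_simps)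
  qed
  then show thesis using that[of "norm (tconv T \<Theta> 0) + C * 2" N] C(1)
    by (simp add: add_nonneg_pos)
qed

subsection \<open>Superposition of translates\<close>

lemma conv_integrable:
  fixes \<Theta> :: "'a::euclidean_space \<Rightarrow> complex" and g :: "'b::euclidean_space \<Rightarrow> complex"
  assumes \<Theta>: "\<Theta> \<in> schwartz" and [measurable]: "L \<in> borel_measurable borel" "g \<in> borel_measurable borel"
    and g: "integrable lborel g"
  shows "integrable lborel (\<lambda>y. \<Theta> (z - L y) * g y)"
proof -
  obtain B where B: "\<And>x. norm (\<Theta> x) \<le> B" using schwartz_bounded[OF \<Theta>] by blast
  have [measurable]: "\<Theta> \<in> borel_measurable borel" by (rule schwartz_measurable[OF \<Theta>])
  show ?thesis
    by (rule Bochner_Integration.integrable_bound[where f = "\<lambda>y. B * norm (g y)"])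
      (use g in \<open>auto simp: norm_mult intro!: order_trans[OF mult_right_mono[OF B] abs_ge_self]\<close>)
qed

text \<open>The map \<open>L\<close> of at most linear growth serves three purposes: the identity
  for convolutions, x' -> (x', 0) for restrictions to x_n = 0, and the simple functions that
  approximate either of them.\<close>

lemma conv_schwartz:
  fixes \<Theta> :: "'a::euclidean_space \<Rightarrow> complex" and g :: "'b::euclidean_space \<Rightarrow> complex"
  assumes \<Theta>: "\<Theta> \<in> schwartz" and L[measurable]: "L \<in> borel_measurable borel" and LB: "\<And>y. norm (L y) \<le> B * norm y"
    and g: "rapid g" and gm[measurable]: "g \<in> borel_measurable borel"
  shows "(\<lambda>z. LINT y|lborel. \<Theta> (z - L y) * g y) \<in> schwartz"
    and "set vs \<subseteq> Basis \<Longrightarrow> iter_pderiv vs (\<lambda>z. LINT y|lborel. \<Theta> (z - L y) * g y)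
       = (\<lambda>z. LINT y|lborel. iter_pderiv vs \<Theta> (z - L y) * g y)"
proof -
  let ?c = "\<lambda>\<Theta> z. LINT y|lborel. \<Theta> (z - L y) * g y"
  have gi: "integrable lborel g" by (rule rapid_integrable[OF g gm])
  have D: "((?c \<Theta>) has_derivative (\<lambda>h. LINT y|lborel. (\<Sum>b\<in>Basis. (h \<bullet> b) *\<^sub>R pd b \<Theta> (z - L y)) * g y)) (at z)"
    if \<Theta>: "\<Theta> \<in> schwartz" for \<Theta> :: "'a \<Rightarrow> complex" and z
  proof -
    obtain C where C: "C > 0" "\<And>x h. (1 + norm x) ^ 0 * norm (frechet_derivative \<Theta> (at x) h) \<le> C * norm h"
      using schwartz_frechet_bound[OF \<Theta>, where k = 0] by blast
    have C: "norm (frechet_derivative \<Theta> (at x) h) \<le> C * norm h" for x h using C(2)[of x h] by simp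
    have fd: "frechet_derivative \<Theta> (at x) h = (\<Sum>b\<in>Basis. (h \<bullet> b) *\<^sub>R pd b \<Theta> x)" for x h
      by (rule fun_cong[OF frechet_derivative_at[OF differentiable_has_derivative_pd[OF schwartz_differentiable[OF \<Theta>]], symmetric]])
    have m[measurable]: "pd b \<Theta> \<in> borel_measurable borel" if "b \<in> Basis" for b
      by (rule schwartz_measurable[OF schwartz_pd[OF \<Theta> that]])
    show ?thesis
    proof (rule has_derivative_lebesgue_integral[where S = UNIV and w = "\<lambda>y. C * norm (g y)"])
      show "integrable lborel (\<lambda>y. \<Theta> (x - L y) * g y)" for x
        by (rule conv_integrable[OF \<Theta> L gm gi])
      show "((\<lambda>x. \<Theta> (x - L y) * g y) has_derivative (\<lambda>h. (\<Sum>b\<in>Basis. (h \<bullet> b) *\<^sub>R pd b \<Theta> (x - L y)) * g y)) (at x)" for x y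
      proof -
        have "((\<lambda>x. x - L y) has_derivative (\<lambda>h. h)) (at x)" by (auto intro!: derivative_eq_intros)
        from has_derivative_compose[OF this differentiable_has_derivative_pd[OF schwartz_differentiable[OF \<Theta>]]]
        show ?thesis by (rule has_derivative_mult_left)
      qed
      show "(\<lambda>y. (\<Sum>b\<in>Basis. (h \<bullet> b) *\<^sub>R pd b \<Theta> (z - L y)) * g y) \<in> borel_measurable lborel" for h
      proof -
        have "(\<lambda>y. pd b \<Theta> (z - L y)) \<in> borel_measurable borel" if "b \<in> Basis" for b
          by (rule measurable_compose[OF _ m[OF that]]) measurable
        then have "(\<lambda>y. (\<Sum>b\<in>Basis. (h \<bullet> b) *\<^sub>R pd b \<Theta> (z - L y)) * g y) \<in> borel_measurable borel"
          by (intro borel_measurable_times borel_measurable_sum borel_measurable_scaleR borel_measurable_const gm)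
        then show ?thesis by simp
      qed
      show "norm ((\<Sum>b\<in>Basis. (h \<bullet> b) *\<^sub>R pd b \<Theta> (x - L y)) * g y) \<le> C * norm (g y) * norm h" for x y h
        using mult_right_mono[OF C[of "x - L y" h], of "norm (g y)"] unfolding fd by (simp add: norm_mult mult_ac)
    qed (use gi in auto)
  qed
  have pdc: "pd v (?c \<Theta>) = ?c (pd v \<Theta>)" if "\<Theta> \<in> schwartz" "v \<in> Basis" for \<Theta> v
  proof
    fix z
    have "(\<Sum>b\<in>Basis. (v \<bullet> b) *\<^sub>R pd b \<Theta> x) = pd v \<Theta> x" for x
      using that(2) by (simp add: inner_Basis if_distrib[of "\<lambda>c. c *\<^sub>R _"] cong: if_cong)
    then show "pd v (?c \<Theta>) z = ?c (pd v \<Theta>) z" using pd_eqI[OF D[OF that(1)], of v z] by simp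
  qed
  show "?c \<Theta> \<in> schwartz"
  proof (rule schwartz_fspanI[where G = "?c ` schwartz"])
    fix h assume "h \<in> ?c ` schwartz"
    then obtain \<Theta> where h: "h = ?c \<Theta>" and \<Theta>: "\<Theta> \<in> schwartz" by blast
    show "rapid h" unfolding rapid_def
    proof
      fix k
      obtain C where C: "C > 0" "\<And>x z. (1 + norm z) ^ k * norm (\<Theta> (z - x)) \<le> C * (1 + norm x) ^ k"
        using schwartz_translate_bound[OF \<Theta>] by blast
      have "(1 + norm z) ^ k * norm (h z) \<le> (LINT y|lborel. C * (1 + \<bar>B\<bar>) ^ k * ((1 + norm y) ^ k * norm (g y)))" for z
      proof -
        have "(1 + norm z) ^ k * norm (h z) = norm (LINT y|lborel. of_real ((1 + norm z) ^ k) * (\<Theta> (z - L y) * g y))"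
          unfolding h by (subst integral_mult_right_zero) (simp add: norm_mult norm_power del: of_real_power)
        also have "\<dots> \<le> (LINT y|lborel. C * (1 + \<bar>B\<bar>) ^ k * ((1 + norm y) ^ k * norm (g y)))"
        proof (rule Bochner_integral_norm_bound)
          show "integrable lborel (\<lambda>y. C * (1 + \<bar>B\<bar>) ^ k * ((1 + norm y) ^ k * norm (g y)))"
            by (intro integrable_mult_right rapid_integrable_weight g gm)
          fix y
          have "norm (of_real ((1 + norm z) ^ k) * (\<Theta> (z - L y) * g y)) = (1 + norm z) ^ k * norm (\<Theta> (z - L y)) * norm (g y)"
            by (simp add: norm_mult norm_power del: of_real_power)
          also have "\<dots> \<le> C * (1 + norm (L y)) ^ k * norm (g y)"
            by (intro mult_right_mono C) auto
          also have "\<dots> \<le> C * ((1 + \<bar>B\<bar>) * (1 + norm y)) ^ k * norm (g y)"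
          proof (intro mult_right_mono mult_left_mono power_mono)
            have "norm (L y) \<le> \<bar>B\<bar> * norm y" by (rule order_trans[OF LB mult_right_mono]) auto
            then show "1 + norm (L y) \<le> (1 + \<bar>B\<bar>) * (1 + norm y)"
              unfolding distrib_left distrib_right using norm_ge_zero[of y] abs_ge_zero[of B] by linarith
          qed (use C in auto)
          finally show "norm (of_real ((1 + norm z) ^ k) * (\<Theta> (z - L y) * g y)) \<le> C * (1 + \<bar>B\<bar>) ^ k * ((1 + norm y) ^ k * norm (g y))"
            by (simp add: power_mult_distrib mult_ac)
        qed
        finally show ?thesis .
      qed
      then show "\<exists>C. \<forall>z. (1 + norm z) ^ k * norm (h z) \<le> C" by blast
    qed
    show "h differentiable (at x)" for x unfolding h by (rule differentiableI[OF D[OF \<Theta>]])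
    show "pd v h \<in> fspan (?c ` schwartz)" if "v \<in> Basis" for v
      unfolding h pdc[OF \<Theta> that] by (intro fspan.base imageI schwartz_pd \<Theta> that)
  qed (use \<Theta> in blast)
  show "iter_pderiv vs (?c \<Theta>) = ?c (iter_pderiv vs \<Theta>)" if "set vs \<subseteq> Basis"
    using that
  proof (induction vs)
    case (Cons v vs)
    then show ?case unfolding iter_pderiv_Cons_pd
      using pdc[OF schwartz_iter[OF \<Theta>], of vs v] by simp
  qed simp
qed

lemma integral_simple_function_mult:
  fixes S :: "'b::euclidean_space \<Rightarrow> 'a" and g :: "'b \<Rightarrow> complex"
  assumes S: "simple_function lborel S" and g: "integrable lborel g"
  shows "(LINT y|lborel. h (S y) * g y) = (\<Sum>c\<in>S ` UNIV. h c * (LINT y|lborel. indicator (S -` {c}) y * g y))"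
proof -
  have fin: "finite (S ` UNIV)" and ms: "S -` {c} \<in> sets lborel" if "c \<in> S ` UNIV" for c
    using S that unfolding simple_function_def by auto
  have fin: "finite (S ` UNIV)" using S unfolding simple_function_def by auto
  have "h (S y) * g y = (\<Sum>c\<in>S ` UNIV. h c * (indicator (S -` {c}) y * g y))" for y
  proof -
    have "(\<Sum>c\<in>S ` UNIV. h c * (indicator (S -` {c}) y * g y)) = (\<Sum>c\<in>{S y}. h c * (indicator (S -` {c}) y * g y))"
      by (rule sum.mono_neutral_right[OF fin]) (auto simp: indicator_def)
    then show ?thesis by simp
  qed
  then have "(LINT y|lborel. h (S y) * g y) = (LINT y|lborel. (\<Sum>c\<in>S ` UNIV. h c * (indicator (S -` {c}) y * g y)))"
    by simp
  also have "\<dots> = (\<Sum>c\<in>S ` UNIV. h c * (LINT y|lborel. indicator (S -` {c}) y * g y))"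
  proof (subst Bochner_Integration.integral_sum)
    fix c assume c: "c \<in> S ` UNIV"
    have "integrable lborel (\<lambda>y. indicator (S -` {c}) y *\<^sub>R g y)"
      by (rule integrable_mult_indicator[OF ms[OF c] g])
    then have "integrable lborel (\<lambda>y. indicator (S -` {c}) y * g y)"
      by (rule Bochner_Integration.integrable_cong[THEN iffD1, rotated 2]) (auto simp: indicator_def)
    then show "integrable lborel (\<lambda>y. h c * (indicator (S -` {c}) y * g y))" by simp
  qed simp
  finally show ?thesis .
qed

text \<open>A tempered distribution may be applied under the integral sign: the integral is the limit
  of finite superpositions obtained from simple functions approximating \<open>L\<close>.\<close>

theorem tempered_conv:
  fixes T :: "'a::euclidean_space dist" and L :: "'b::euclidean_space \<Rightarrow> 'a" and g :: "'b \<Rightarrow> complex"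
  assumes T: "T \<in> tempered" and \<Theta>: "\<Theta> \<in> schwartz" and L[measurable]: "L \<in> borel_measurable borel"
    and LB: "\<And>y. norm (L y) \<le> B * norm y" and g: "rapid g" and gm[measurable]: "g \<in> borel_measurable borel"
  shows "T (\<lambda>z. LINT y|lborel. \<Theta> (z - L y) * g y) = (LINT y|lborel. tconv T \<Theta> (L y) * g y)"
proof -
  let ?c = "\<lambda>\<Theta> L z. LINT y|lborel. \<Theta> (z - L y) * g y"
  have gi: "integrable lborel g" by (rule rapid_integrable[OF g gm])
  obtain N A where A: "A > 0" "\<And>f. f \<in> schwartz \<Longrightarrow> norm (T f) \<le> A * schwartz_seminorm N f"
    using temperedE[OF T] by metis
  obtain C where C: "C > 0" "\<And>x y. norm (tconv T \<Theta> x - tconv T \<Theta> y) \<le> C * tmod N x y"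
    using tconv_tmod[OF T A(2,1) \<Theta>] by metis
  obtain D where D: "D > 0" "\<And>vs x y z. set vs \<subseteq> Basis \<Longrightarrow> length vs \<le> N \<Longrightarrow>
    (1 + norm z) ^ N * norm (iter_pderiv vs \<Theta> (z - x) - iter_pderiv vs \<Theta> (z - y)) \<le> D * tmod N x y"
    using schwartz_tmod[OF \<Theta>] by metis
  have B0: "norm (L y) \<le> \<bar>B\<bar> * norm y" for y by (rule order_trans[OF LB mult_right_mono]) auto
  \<comment> \<open>The approximants are dominated by 2 |L|, hence the constant 2 |B| in all later
    bounds.\<close>
  obtain S where S: "\<And>n. simple_function lborel (S n)" "\<And>x. (\<lambda>n. S n x) \<longlonglongrightarrow> L x"
    "\<And>n x. dist (S n x) 0 \<le> 2 * dist (L x) 0"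
    using borel_measurable_implies_sequence_metric[of L lborel 0] by (auto simp: L)
  have Sm[measurable]: "S n \<in> borel_measurable borel" for n
    using borel_measurable_simple_function[OF S(1)] by simp
  have SB: "norm (S n y) \<le> (2 * \<bar>B\<bar>) * norm y" for n y
    using S(3)[of n y] B0[of y] by simp
  have LB2: "norm (L y) \<le> (2 * \<bar>B\<bar>) * norm y" for y
    using B0[of y] by (rule order_trans) (auto intro!: mult_right_mono)
  have tb: "tmod N (S n y) (L y) \<le> 2 * (1 + 2 * \<bar>B\<bar>) ^ N * (1 + norm y) ^ N" for n y
  proof -
    have p: "(1 + norm w) ^ N \<le> ((1 + 2 * \<bar>B\<bar>) * (1 + norm y)) ^ N" if "norm w \<le> (2 * \<bar>B\<bar>) * norm y" for w :: 'a
    proof (intro power_mono)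
      show "1 + norm w \<le> (1 + 2 * \<bar>B\<bar>) * (1 + norm y)"
        using that norm_ge_zero[of y] abs_ge_zero[of B] unfolding distrib_left distrib_right by linarith
    qed auto
    have "tmod N (S n y) (L y) \<le> 1 * (((1 + 2 * \<bar>B\<bar>) * (1 + norm y)) ^ N + ((1 + 2 * \<bar>B\<bar>) * (1 + norm y)) ^ N)"
      unfolding tmod_def by (intro mult_mono add_mono p SB LB2) auto
    then show ?thesis by (simp add: power_mult_distrib mult_ac)
  qed
  have tm[measurable]: "(\<lambda>y. tmod N (S n y) (L y)) \<in> borel_measurable borel" for n
    unfolding tmod_def by measurable
  have t0: "0 \<le> tmod N x y" for x y :: 'a by (simp add: tmod_def)
  let ?w = "\<lambda>y. 2 * (1 + 2 * \<bar>B\<bar>) ^ N * ((1 + norm y) ^ N * norm (g y))"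
  have wi: "integrable lborel ?w" by (intro integrable_mult_right rapid_integrable_weight g gm)
  \<comment> \<open>A single error functional: with the modulus \<open>tmod\<close> it bounds the
    change of both sides when \<open>L\<close> is replaced by \<open>S n\<close>.\<close>
  define E where "E n = (LINT y|lborel. tmod N (S n y) (L y) * norm (g y))" for n
  have dom: "norm (tmod N (S n y) (L y) * norm (g y)) \<le> ?w y" for n y
    using mult_right_mono[OF tb[of n y], of "norm (g y)"] t0 by (simp add: mult_ac)
  have Ei: "integrable lborel (\<lambda>y. tmod N (S n y) (L y) * norm (g y))" for n
    by (rule Bochner_Integration.integrable_bound[OF wi])
      (use order_trans[OF dom real_le_norm] in auto)
  have E: "E \<longlonglongrightarrow> 0"
  proof -
    have "E \<longlonglongrightarrow> (LINT y::'b|lborel. (0::real))" unfolding E_def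
    proof (rule integral_dominated_convergence[where w = ?w])
      show "AE y in lborel. (\<lambda>n. tmod N (S n y) (L y) * norm (g y)) \<longlonglongrightarrow> 0"
      proof (rule AE_I2)
        fix y
        have "(\<lambda>n. tmod N (S n y) (L y) * norm (g y)) \<longlonglongrightarrow> tmod N (L y) (L y) * norm (g y)"
          unfolding tmod_def by (intro tendsto_intros S(2))
        then show "(\<lambda>n. tmod N (S n y) (L y) * norm (g y)) \<longlonglongrightarrow> 0" by (simp add: tmod_def)
      qed
    qed (use wi dom in auto)
    then show ?thesis by simp
  qed
  have cs: "?c \<Theta> (S n) \<in> schwartz" "?c \<Theta> L \<in> schwartz" for n
    by (rule conv_schwartz(1)[OF \<Theta> _ SB g gm], simp) (rule conv_schwartz(1)[OF \<Theta> _ LB g gm], simp)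
  have 1: "norm (T (?c \<Theta> (S n)) - T (?c \<Theta> L)) \<le> A * D * E n" for n
  proof -
    have "norm (T (?c \<Theta> (S n)) - T (?c \<Theta> L)) = norm (T (\<lambda>z. ?c \<Theta> (S n) z + (- 1) * ?c \<Theta> L z))"
      using tempered_diff[OF T cs] by simp
    also have "\<dots> \<le> A * schwartz_seminorm N (\<lambda>z. ?c \<Theta> (S n) z + (- 1) * ?c \<Theta> L z)"
      by (intro A schwartz_add schwartz_cmult cs)
    also have "\<dots> \<le> A * (D * E n)"
    proof (intro mult_left_mono schwartz_seminorm_leI)
      fix vs :: "'a list" and z assume vs: "set vs \<subseteq> Basis" "length vs \<le> N"
      let ?\<Psi> = "iter_pderiv vs \<Theta>"
      have \<Psi>: "?\<Psi> \<in> schwartz" by (rule schwartz_iter[OF \<Theta> vs(1)])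
      have ci: "integrable lborel (\<lambda>y. ?\<Psi> (z - S n y) * g y)" "integrable lborel (\<lambda>y. ?\<Psi> (z - L y) * g y)"
        by (rule conv_integrable[OF \<Psi> _ gm gi], simp)+
      have "iter_pderiv vs (\<lambda>z. ?c \<Theta> (S n) z + (- 1) * ?c \<Theta> L z) z = ?c ?\<Psi> (S n) z - ?c ?\<Psi> L z"
        using vs cs by (subst iter_pderiv_add, simp_all only: schwartz_smooth schwartz_cmult)
          (subst iter_pderiv_cmult, simp_all only: schwartz_smooth conv_schwartz(2)[OF \<Theta> Sm SB g gm] conv_schwartz(2)[OF \<Theta> L LB g gm], simp)
      also have "\<dots> = (LINT y|lborel. (?\<Psi> (z - S n y) - ?\<Psi> (z - L y)) * g y)"
        unfolding left_diff_distrib by (rule Bochner_Integration.integral_diff[OF ci, symmetric])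
      finally have "(1 + norm z) ^ N * norm (iter_pderiv vs (\<lambda>z. ?c \<Theta> (S n) z + (- 1) * ?c \<Theta> L z) z)
         = norm (LINT y|lborel. of_real ((1 + norm z) ^ N) * ((?\<Psi> (z - S n y) - ?\<Psi> (z - L y)) * g y))"
        by (subst integral_mult_right_zero) (simp add: norm_mult norm_power del: of_real_power)
      also have "\<dots> \<le> (LINT y|lborel. D * (tmod N (S n y) (L y) * norm (g y)))"
      proof (rule Bochner_integral_norm_bound)
        show "integrable lborel (\<lambda>y. D * (tmod N (S n y) (L y) * norm (g y)))" by (intro integrable_mult_right Ei)
        show "norm (of_real ((1 + norm z) ^ N) * ((?\<Psi> (z - S n y) - ?\<Psi> (z - L y)) * g y)) \<le> D * (tmod N (S n y) (L y) * norm (g y))" for y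
          using mult_right_mono[OF D(2)[OF vs, of z "S n y" "L y"], of "norm (g y)"]
          by (simp add: norm_mult norm_power mult_ac del: of_real_power)
      qed
      finally show "(1 + norm z) ^ N * norm (iter_pderiv vs (\<lambda>z. ?c \<Theta> (S n) z + (- 1) * ?c \<Theta> L z) z) \<le> D * E n"
        unfolding E_def by simp
    qed (use A in simp)
    finally show ?thesis by simp
  qed
  have uc: "continuous_on UNIV (tconv T \<Theta>)" by (rule continuous_tconv[OF T \<Theta>])
  have um[measurable]: "tconv T \<Theta> \<in> borel_measurable borel" by (rule borel_measurable_continuous_onI[OF uc])
  obtain M K where K: "K > 0" "\<And>x. norm (tconv T \<Theta> x) \<le> K * (1 + norm x) ^ M"
    using tconv_growth[OF T \<Theta>] by metis
  have ui: "integrable lborel (\<lambda>y. tconv T \<Theta> (H y) * g y)" if [measurable]: "H \<in> borel_measurable borel" and HB: "\<And>y. norm (H y) \<le> (2 * \<bar>B\<bar>) * norm y" for H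
  proof (rule Bochner_Integration.integrable_bound)
    show "integrable lborel (\<lambda>y. K * (1 + 2 * \<bar>B\<bar>) ^ M * ((1 + norm y) ^ M * norm (g y)))"
      by (intro integrable_mult_right rapid_integrable_weight g gm)
    have "norm (tconv T \<Theta> (H y) * g y) \<le> K * (1 + 2 * \<bar>B\<bar>) ^ M * ((1 + norm y) ^ M * norm (g y))" for y
    proof -
      have "norm (tconv T \<Theta> (H y) * g y) \<le> K * (1 + norm (H y)) ^ M * norm (g y)"
        unfolding norm_mult by (intro mult_right_mono K) auto
      also have "\<dots> \<le> K * ((1 + 2 * \<bar>B\<bar>) * (1 + norm y)) ^ M * norm (g y)"
      proof (intro mult_right_mono mult_left_mono power_mono)
        show "1 + norm (H y) \<le> (1 + 2 * \<bar>B\<bar>) * (1 + norm y)"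
          using HB[of y] norm_ge_zero[of y] abs_ge_zero[of B] unfolding distrib_left distrib_right by linarith
      qed (use K in auto)
      finally show ?thesis by (simp add: power_mult_distrib mult_ac)
    qed
    then show "AE y in lborel. norm (tconv T \<Theta> (H y) * g y) \<le> norm (K * (1 + 2 * \<bar>B\<bar>) ^ M * ((1 + norm y) ^ M * norm (g y)))"
      by (intro AE_I2 order_trans[OF _ real_le_norm])
  qed measurable
  have 2: "norm ((LINT y|lborel. tconv T \<Theta> (S n y) * g y) - (LINT y|lborel. tconv T \<Theta> (L y) * g y)) \<le> C * E n" for n
  proof -
    have "(LINT y|lborel. tconv T \<Theta> (S n y) * g y) - (LINT y|lborel. tconv T \<Theta> (L y) * g y)
      = (LINT y|lborel. (tconv T \<Theta> (S n y) - tconv T \<Theta> (L y)) * g y)"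
      unfolding left_diff_distrib
      by (rule Bochner_Integration.integral_diff[OF ui[OF Sm SB] ui[OF L LB2], symmetric])
    also have "norm \<dots> \<le> (LINT y|lborel. C * (tmod N (S n y) (L y) * norm (g y)))"
    proof (rule Bochner_integral_norm_bound)
      show "integrable lborel (\<lambda>y. C * (tmod N (S n y) (L y) * norm (g y)))" by (intro integrable_mult_right Ei)
      show "norm ((tconv T \<Theta> (S n y) - tconv T \<Theta> (L y)) * g y) \<le> C * (tmod N (S n y) (L y) * norm (g y))" for y
        using mult_right_mono[OF C(2)[of "S n y" "L y"], of "norm (g y)"] by (simp add: norm_mult mult_ac)
    qed
    finally show ?thesis by (simp add: E_def)
  qed
  \<comment> \<open>For a simple function the superposition is a finite linear combination of
    translates, so linearity of \<open>T\<close> is enough.\<close>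
  have 3: "T (?c \<Theta> (S n)) = (LINT y|lborel. tconv T \<Theta> (S n y) * g y)" for n
  proof -
    let ?G = "\<lambda>c. LINT y|lborel. indicator (S n -` {c}) y * g y"
    have "T (?c \<Theta> (S n)) = T (\<lambda>z. \<Sum>c\<in>S n ` UNIV. ?G c * \<Theta> (z - c))"
      by (subst integral_simple_function_mult[OF S(1) gi]) (simp add: mult.commute)
    also have "\<dots> = (\<Sum>c\<in>S n ` UNIV. T (\<lambda>z. ?G c * \<Theta> (z - c)))"
      by (rule tempered_sum[OF T]) (intro schwartz_cmult schwartz_translate \<Theta>)
    also have "\<dots> = (\<Sum>c\<in>S n ` UNIV. tconv T \<Theta> c * ?G c)"
      by (intro sum.cong refl, subst tempered_cmult[OF T schwartz_translate[OF \<Theta>]])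
        (simp add: tconv_def mult.commute)
    also have "\<dots> = (LINT y|lborel. tconv T \<Theta> (S n y) * g y)"
      by (rule integral_simple_function_mult[OF S(1) gi, symmetric])
    finally show ?thesis .
  qed
  have l1: "(\<lambda>n. A * D * E n) \<longlonglongrightarrow> 0" and l2: "(\<lambda>n. C * E n) \<longlonglongrightarrow> 0"
    using tendsto_mult_left[OF E, of "A * D"] tendsto_mult_left[OF E, of C] by simp_all
  have "(\<lambda>n. T (?c \<Theta> (S n))) \<longlonglongrightarrow> T (?c \<Theta> L)"
    by (rule LIM_zero_cancel, rule Lim_null_comparison[OF always_eventually l1]) (use 1 in blast)
  moreover have "(\<lambda>n. T (?c \<Theta> (S n))) \<longlonglongrightarrow> (LINT y|lborel. tconv T \<Theta> (L y) * g y)"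
    unfolding 3
    by (rule LIM_zero_cancel, rule Lim_null_comparison[OF always_eventually l2]) (use 2 in blast)
  ultimately show ?thesis by (rule LIMSEQ_unique)
qed

subsection \<open>Functions as distributions\<close>

lemma dist_of_fun_apply: "f \<in> schwartz \<Longrightarrow> dist_of_fun g f = (LINT x|lborel. g x * f x)"
  by (simp add: dist_of_fun_def)

lemma integrable_growth:
  fixes u :: "'a::euclidean_space \<Rightarrow> complex"
  assumes [measurable]: "u \<in> borel_measurable borel" and u: "\<And>x. norm (u x) \<le> C * (1 + norm x) ^ N"
    and f: "rapid f" and [measurable]: "f \<in> borel_measurable borel"
  shows "integrable lborel (\<lambda>x. u x * f x)"
proof (rule Bochner_Integration.integrable_bound)
  show "integrable lborel (\<lambda>x. C * ((1 + norm x) ^ N * norm (f x)))"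
    by (intro integrable_mult_right rapid_integrable_weight f) simp
  have "norm (u x * f x) \<le> C * ((1 + norm x) ^ N * norm (f x))" for x
    using mult_right_mono[OF u[of x], of "norm (f x)"] by (simp add: norm_mult mult_ac)
  then show "AE x in lborel. norm (u x * f x) \<le> norm (C * ((1 + norm x) ^ N * norm (f x)))"
    by (intro AE_I2 order_trans[OF _ real_le_norm])
qed simp

lemma tempered_dist_of_funI:
  fixes u :: "'a::euclidean_space \<Rightarrow> complex"
  assumes int: "\<And>f. f \<in> schwartz \<Longrightarrow> integrable lborel (\<lambda>x. u x * f x)"
    and bnd: "\<And>f. f \<in> schwartz \<Longrightarrow> norm (LINT x|lborel. u x * f x) \<le> C * schwartz_seminorm N f"
  shows "dist_of_fun u \<in> tempered"
  unfolding tempered_def mem_Collect_eq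
proof (intro conjI allI impI ballI)
  show "\<exists>N C. \<forall>f\<in>schwartz. norm (dist_of_fun u f) \<le> C * schwartz_seminorm N f"
    using bnd by (intro exI[of _ N] exI[of _ C]) (simp add: dist_of_fun_apply)
  fix f g :: "'a \<Rightarrow> complex" and c assume f: "f \<in> schwartz" and g: "g \<in> schwartz"
  have "(LINT x|lborel. u x * (c * f x + g x)) = (LINT x|lborel. c * (u x * f x) + u x * g x)"
    by (simp add: algebra_simps)
  also have "\<dots> = c * (LINT x|lborel. u x * f x) + (LINT x|lborel. u x * g x)"
    using int[OF f] int[OF g] by simp
  finally show "dist_of_fun u (\<lambda>x. c * f x + g x) = c * dist_of_fun u f + dist_of_fun u g"
    using f g by (simp add: dist_of_fun_apply schwartz_add schwartz_cmult)
qed (simp add: dist_of_fun_def)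

lemma tempered_fun_growth:
  fixes u :: "'a::euclidean_space \<Rightarrow> complex"
  assumes um: "u \<in> borel_measurable borel" and u: "\<And>x. norm (u x) \<le> C * (1 + norm x) ^ N"
  shows "tempered_fun u"
proof -
  have int: "integrable lborel (\<lambda>x. u x * f x)" if "f \<in> schwartz" for f
    by (rule integrable_growth[OF um u]) (use that schwartz_rapid schwartz_measurable in auto)
  have C0: "0 \<le> C" using u[of 0] order_trans[OF norm_ge_zero, of "u 0" C] by simp
  \<comment> \<open>N powers of the weight absorb the growth of \<open>u\<close>, and 2 DIM further
    ones make the integral converge.\<close>
  let ?M = "2 * DIM('a) + N"
  let ?I = "LINT x|lborel. 1 / (1 + norm (x::'a)) ^ (2 * DIM('a))"
  have "dist_of_fun u \<in> tempered"
  proof (rule tempered_dist_of_funI[OF int, where N = ?M and C = "C * ?I"])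
    fix f :: "'a \<Rightarrow> complex" assume f: "f \<in> schwartz"
    have "norm (LINT x|lborel. u x * f x) \<le> (LINT x|lborel. C * schwartz_seminorm ?M f * (1 / (1 + norm (x::'a)) ^ (2 * DIM('a))))"
    proof (rule Bochner_integral_norm_bound)
      show "integrable lborel (\<lambda>x. C * schwartz_seminorm ?M f * (1 / (1 + norm (x::'a)) ^ (2 * DIM('a))))"
        by (intro integrable_mult_right integrable_decay)
      fix x :: 'a
      have pos: "(1 + norm x) ^ (2 * DIM('a)) > 0" by (simp add: add_pos_nonneg)
      have "(1 + norm x) ^ (2 * DIM('a)) * norm (u x * f x) \<le> (1 + norm x) ^ (2 * DIM('a)) * (C * (1 + norm x) ^ N * norm (f x))"
        unfolding norm_mult by (intro mult_left_mono mult_right_mono u) auto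
      also have "\<dots> = C * ((1 + norm x) ^ ?M * norm (iter_pderiv [] f x))"
        by (simp add: power_add mult_ac)
      also have "\<dots> \<le> C * schwartz_seminorm ?M f"
        by (intro mult_left_mono le_schwartz_seminorm f C0) auto
      finally have "norm (u x * f x) \<le> C * schwartz_seminorm ?M f / (1 + norm x) ^ (2 * DIM('a))"
        using pos by (simp add: pos_le_divide_eq mult.commute)
      then show "norm (u x * f x) \<le> C * schwartz_seminorm ?M f * (1 / (1 + norm x) ^ (2 * DIM('a)))" by simp
    qed
    also have "\<dots> = C * ?I * schwartz_seminorm ?M f"
      by (subst integral_mult_right_zero) (simp only: mult_ac)
    finally show "norm (LINT x|lborel. u x * f x) \<le> C * ?I * schwartz_seminorm ?M f" .
  qed
  then show ?thesis using int um by (simp add: tempered_fun_def)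
qed

lemma tempered_fun_tconv:
  assumes "T \<in> tempered" "\<Theta> \<in> schwartz" shows "tempered_fun (tconv T \<Theta>)"
  using tconv_growth[OF assms] tempered_fun_growth[OF borel_measurable_continuous_onI[OF continuous_tconv[OF assms]]] by metis

text \<open>The reflection of F^-1 phi: \<open>tconv\<close> pairs with a translate without
  reflecting it, so the reflection is put into the kernel.\<close>

definition kern :: "('a::euclidean_space \<Rightarrow> complex) \<Rightarrow> 'a \<Rightarrow> complex" where
  "kern \<phi> w = fourier \<phi> w / of_real ((2 * pi) ^ DIM('a))"

lemma kern_eq: "kern \<phi> w = inv_fourier \<phi> (- w)"
  by (simp add: kern_def inv_fourier_eq_fourier)

lemma schwartz_kern: "\<phi> \<in> schwartz \<Longrightarrow> kern \<phi> \<in> schwartz"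
  using schwartz_uminus[OF schwartz_inv_fourier, of \<phi>] by (simp add: kern_eq[abs_def])

text \<open>Transposed onto the test function f, the multiplier produces F(phi F^-1 f), an integral
  of translates of \<open>kern \<phi>\<close> against f, and \<open>tempered_conv\<close> lets
  \<open>T\<close> act under that integral.\<close>

theorem fourier_multiplier_dist:
  assumes T: "T \<in> tempered" and \<phi>: "\<phi> \<in> schwartz"
  shows "dist_inv_fourier (dist_mult \<phi> (dist_fourier T)) = dist_of_fun (tconv T (kern \<phi>))"
proof
  fix f :: "'a \<Rightarrow> complex"
  show "dist_inv_fourier (dist_mult \<phi> (dist_fourier T)) f = dist_of_fun (tconv T (kern \<phi>)) f"
  proof (cases "f \<in> schwartz")
    case True
    have "dist_inv_fourier (dist_mult \<phi> (dist_fourier T)) f = T (fourier (\<lambda>\<xi>. \<phi> \<xi> * inv_fourier f \<xi>))"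
      using True by (simp add: dist_inv_fourier_def dist_mult_def dist_fourier_def schwartz_inv_fourier schwartz_mult \<phi>)
    also have "\<dots> = T (\<lambda>z. LINT x|lborel. kern \<phi> (z - x) * f x)"
      by (subst fourier_mult_inv_fourier[OF \<phi> True, abs_def]) (simp add: kern_def)
    also have "\<dots> = (LINT x|lborel. tconv T (kern \<phi>) x * f x)"
      by (rule tempered_conv[OF T schwartz_kern[OF \<phi>], where L = "\<lambda>x. x" and B = 1])
        (use True in \<open>auto simp: schwartz_rapid schwartz_measurable\<close>)
    finally show ?thesis using True by (simp add: dist_of_fun_apply)
  qed (simp add: dist_inv_fourier_def dist_of_fun_def)
qed

text \<open>Since phi rho = phi, convolving F^-1 phi with F^-1 rho changes nothing. This supplies
  the reproducing formula that \<open>peetre\<close> starts from.\<close>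

lemma tconv_reproduce:
  assumes T: "T \<in> tempered" and \<phi>: "\<phi> \<in> schwartz" and \<rho>: "\<rho> \<in> schwartz" and eq: "\<And>\<xi>. \<phi> \<xi> * \<rho> \<xi> = \<phi> \<xi>"
  shows "tconv T (kern \<phi>) x = (LINT y|lborel. inv_fourier \<rho> (x - y) * tconv T (kern \<phi>) y)"
proof -
  have [measurable]: "inv_fourier \<rho> \<in> borel_measurable borel" "inv_fourier \<phi> \<in> borel_measurable borel"
    by (intro schwartz_measurable schwartz_inv_fourier \<phi> \<rho>)+
  have g: "(\<lambda>y. inv_fourier \<rho> (x - y)) \<in> schwartz" by (intro schwartz_reflect schwartz_inv_fourier \<rho>)
  have "(LINT y|lborel. tconv T (kern \<phi>) y * inv_fourier \<rho> (x - y)) = T (\<lambda>z. LINT y|lborel. kern \<phi> (z - y) * inv_fourier \<rho> (x - y))"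
    by (rule tempered_conv[OF T schwartz_kern[OF \<phi>], where L = "\<lambda>x. x" and B = 1, symmetric])
      (use g in \<open>auto simp: schwartz_rapid schwartz_measurable\<close>)
  also have "(\<lambda>z. LINT y|lborel. kern \<phi> (z - y) * inv_fourier \<rho> (x - y)) = (\<lambda>z. kern \<phi> (z - x))"
  proof
    fix z
    have "(LINT y|lborel. kern \<phi> (z - y) * inv_fourier \<rho> (x - y)) = (LINT y|lborel. (\<lambda>y. inv_fourier \<phi> (y - z) * inv_fourier \<rho> (x - y)) (x - y))"
      by (subst integral_reflect) (auto simp: kern_eq)
    also have "\<dots> = (LINT y|lborel. inv_fourier \<phi> ((x - z) - y) * inv_fourier \<rho> y)"
      by (simp add: algebra_simps)
    also have "\<dots> = inv_fourier \<phi> (x - z)"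
      using inv_fourier_mult[OF \<phi> \<rho>, of "x - z"] eq by simp
    finally show "(LINT y|lborel. kern \<phi> (z - y) * inv_fourier \<rho> (x - y)) = kern \<phi> (z - x)" by (simp add: kern_eq)
  qed
  finally show ?thesis by (simp add: tconv_def mult.commute)
qed

subsection \<open>The fundamental lemma of the calculus of variations\<close>

lemma scaled_test_function:
  assumes "f \<in> test_functions" "c > 0"
  shows "(\<lambda>x. f (c *\<^sub>R (x - t))) \<in> test_functions"
proof -
  have "(\<lambda>x. f (- c *\<^sub>R t + c *\<^sub>R x)) \<in> test_functions"
    by (rule test_functions_affine[OF assms(1), of _ c]) (use assms in \<open>auto simp: linear_iff algebra_simps\<close>)
  then show ?thesis by (simp add: algebra_simps)
qed

lemma test_function_support_bound:
  assumes "f \<in> test_functions"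
  obtains R where "R > 0" "\<And>x. f x \<noteq> 0 \<Longrightarrow> norm x \<le> R"
proof -
  have "bounded (fun_support f)" using assms by (simp add: test_functions_def compact_imp_bounded)
  then obtain R where R: "\<And>x. x \<in> fun_support f \<Longrightarrow> norm x \<le> R" by (auto simp: bounded_iff)
  have "norm x \<le> max R 1" if "f x \<noteq> 0" for x
    using R[OF fun_support_superset[of f, OF that]] by simp
  then show thesis using that[of "max R 1"] by simp
qed

lemma AE_zero_continuous:
  fixes u :: "'a::euclidean_space \<Rightarrow> 'b::real_normed_vector"
  assumes "AE x in lborel. u x = 0" and u: "continuous_on UNIV u"
  shows "u = (\<lambda>x. 0)"
proof -
  have op: "open {x. u x \<noteq> 0}" by (intro open_Collect_neq u continuous_on_const)
  then have "{x. u x \<noteq> 0} \<in> sets lborel" by simp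
  from AE_iff_null_sets[OF this] have "{x. u x \<noteq> 0} \<in> null_sets lborel" using assms(1) by simp
  then have "negligible {x. u x \<noteq> 0}" using negligible_iff_null_sets null_sets_completionI by blast
  then have "{x. u x \<noteq> 0} = {}" using open_not_negligible[OF op] by blast
  then show ?thesis by auto
qed

text \<open>Mollifying \<open>s\<close> writes it as a limit of superpositions of translated and
  scaled test functions. Fubini makes the pairing of \<open>w\<close> with each of them zero, and
  the mollified functions converge boundedly to a non-zero multiple of \<open>s\<close>.\<close>

lemma test_orthogonal_continuous:
  fixes w :: "'a::euclidean_space \<Rightarrow> complex" and \<psi> :: "'a \<Rightarrow> complex"
  assumes wm[measurable]: "w \<in> borel_measurable borel"
    and int: "\<And>g. g \<in> test_functions \<Longrightarrow> integrable lborel (\<lambda>x. w x * g x)"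
    and zero: "\<And>g. g \<in> test_functions \<Longrightarrow> (LINT x|lborel. w x * g x) = 0"
    and wloc: "\<And>R. integrable lborel (\<lambda>x. indicator (cball 0 R) x * w x)"
    and \<psi>: "\<psi> \<in> test_functions" "\<psi> 0 = 1"
    and s: "continuous_on UNIV s" "\<And>x. s x \<noteq> 0 \<Longrightarrow> norm x \<le> R"
  shows "(LINT x|lborel. w x * s x) = 0"
proof -
  \<comment> \<open>|psi|^2 is non-negative, so its integral cannot vanish, while that of
    \<open>\<psi>\<close> might.\<close>
  define \<Phi> where "\<Phi> x = \<psi> x * cnj (\<psi> x)" for x
  have \<Phi>t: "\<Phi> \<in> test_functions" unfolding \<Phi>_def[abs_def]
    by (intro test_functions_mult smooth_cnj test_functions_smooth \<psi>)
  have \<Phi>s: "\<Phi> \<in> schwartz" by (rule test_functions_schwartz[OF \<Phi>t])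
  have \<Phi>i: "integrable lborel \<Phi>" by (rule schwartz_integrable[OF \<Phi>s])
  have [measurable]: "\<Phi> \<in> borel_measurable borel" "s \<in> borel_measurable borel"
    using schwartz_measurable[OF \<Phi>s] borel_measurable_continuous_onI[OF s(1)] by auto
  obtain r where r: "r > 0" "\<And>x. \<Phi> x \<noteq> 0 \<Longrightarrow> norm x \<le> r" using test_function_support_bound[OF \<Phi>t] by blast
  obtain B where B: "\<And>x. norm (\<Phi> x) \<le> B" using schwartz_bounded[OF \<Phi>s] by blast
  have \<Phi>r: "\<Phi> x = of_real ((norm (\<psi> x))\<^sup>2)" for x
    unfolding \<Phi>_def by (metis complex_norm_square of_real_power)
  have c: "(LINT x|lborel. \<Phi> x) \<noteq> 0"
  proof
    assume "(LINT x|lborel. \<Phi> x) = 0"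
    then have I0: "(LINT x|lborel. (norm (\<psi> x))\<^sup>2) = 0" unfolding \<Phi>r integral_complex_of_real by simp
    have "integrable lborel (\<lambda>x. (norm (\<psi> x))\<^sup>2)"
      using \<Phi>i unfolding \<Phi>r[abs_def] by (simp only: complex_of_real_integrable_eq)
    then have "AE x in lborel. (norm (\<psi> x))\<^sup>2 = 0"
      using I0 by (subst (asm) integral_nonneg_eq_0_iff_AE) auto
    then have "\<psi> = (\<lambda>x. 0)"
      by (intro AE_zero_continuous smooth_continuous[OF test_functions_smooth[OF \<psi>(1)]]) simp
    then show False using \<psi>(2) by simp
  qed
  have "bounded (s ` cball 0 (max R 0))"
    by (intro compact_imp_bounded compact_continuous_image continuous_on_subset[OF s(1)]) auto
  then obtain Ms where Ms: "\<And>x. x \<in> cball 0 (max R 0) \<Longrightarrow> norm (s x) \<le> Ms"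
    unfolding bounded_iff by blast
  define M where "M = max Ms 0"
  have M: "norm (s x) \<le> M" for x
  proof (cases "s x = 0")
    case False
    then have "x \<in> cball 0 (max R 0)" using s(2)[OF False] by simp
    from Ms[OF this] show ?thesis by (simp add: M_def)
  qed (simp add: M_def)
  have si: "integrable lborel s"
  proof (rule Bochner_Integration.integrable_bound)
    show "integrable lborel (\<lambda>x::'a. M * indicator (cball 0 R) x :: real)"
      using emeasure_bounded_finite[OF bounded_cball, of "0::'a" R]
      by (intro integrable_mult_right integrable_real_indicator) auto
    show "AE x in lborel. norm (s x) \<le> norm (M * indicator (cball 0 R) x :: real)"
    proof (rule AE_I2)
      fix x
      show "norm (s x) \<le> norm (M * indicator (cball 0 R) x :: real)"
        using M[of x] s(2)[of x] by (cases "s x = 0") (auto simp: M_def)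
    qed
  qed simp
  define e where "e n = 1 / real (Suc n)" for n
  have e0: "e n > 0" "e n \<le> 1" for n by (auto simp: e_def)
  have elim: "e \<longlonglongrightarrow> 0" unfolding e_def by (rule LIMSEQ_Suc[OF lim_1_over_n])
  \<comment> \<open>Since e n <= 1, all mollified functions live in this ball, and \<open>w\<close>
    may be cut down to an integrable function.\<close>
  define R' where "R' = \<bar>R\<bar> + r"
  let ?Q = "\<lambda>x. indicator (cball 0 R') x * w x"
  let ?S = "\<lambda>n x. LINT y|lborel. s (x - e n *\<^sub>R y) * \<Phi> y"
  have 0: "(LINT x|lborel. ?Q x * ?S n x) = 0" for n
  proof -
    let ?K = "\<lambda>x y. \<Phi> ((1 / e n) *\<^sub>R (x - y))"
    have K: "case_prod ?K \<in> borel_measurable (borel \<Otimes>\<^sub>M borel)" by measurable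
    have "(LINT x|lborel. ?Q x * (LINT y|lborel. ?K x y * s y)) = (LINT y|lborel. s y * (LINT x|lborel. ?K x y * ?Q x))"
      by (rule fubini_kernel[OF wloc si K B])
    also have "\<dots> = (LINT y|lborel. s y * (LINT x|lborel. w x * ?K x y))"
    proof (intro Bochner_Integration.integral_cong refl)
      fix y :: 'a
      show "s y * (LINT x|lborel. ?K x y * ?Q x) = s y * (LINT x|lborel. w x * ?K x y)"
      proof (cases "s y = 0")
        case False
        then have y: "norm y \<le> R" by (rule s(2))
        have "?K x y * ?Q x = w x * ?K x y" for x
        proof (cases "?K x y = 0")
          case False
          then have "norm ((1 / e n) *\<^sub>R (x - y)) \<le> r" by (rule r(2))
          then have "norm (x - y) / e n \<le> r" unfolding norm_scaleR using e0[of n] by simp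
          then have "norm (x - y) \<le> r * e n" using e0[of n] by (simp add: pos_divide_le_eq)
          also have "\<dots> \<le> r" using e0[of n] r(1) by (simp add: mult_left_le)
          finally have "norm x \<le> R'" using y norm_triangle_ineq[of "x - y" y] by (simp add: R'_def)
          then show ?thesis by simp
        qed simp
        then show ?thesis by (simp only:)
      qed simp
    qed
    also have "\<dots> = 0"
      using zero[OF scaled_test_function[OF \<Phi>t, of "1 / e n"]] e0 by simp
    finally have Z: "(LINT x|lborel. ?Q x * (LINT y|lborel. ?K x y * s y)) = 0" .
    have "(LINT y|lborel. ?K x y * s y) = of_real (e n ^ DIM('a)) * ?S n x" for x
    proof -
      have "(LINT y|lborel. ?K x y * s y) = (LINT y|lborel. (\<lambda>y. ?K x y * s y) (x - y))"
        by (rule integral_reflect[symmetric]) measurable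
      also have "\<dots> = of_real (e n ^ DIM('a)) * (LINT y|lborel. (\<lambda>y. (\<lambda>y. ?K x y * s y) (x - y)) (e n *\<^sub>R y))"
        by (rule integral_scale[OF _ e0(1)]) measurable
      also have "(LINT y|lborel. (\<lambda>y. (\<lambda>y. ?K x y * s y) (x - y)) (e n *\<^sub>R y)) = ?S n x"
        using e0(1)[of n] by (simp add: mult.commute)
      finally show ?thesis .
    qed
    then have "of_real (e n ^ DIM('a)) * (LINT x|lborel. ?Q x * ?S n x) = 0"
      using Z by (subst integral_mult_right_zero[symmetric]) (simp add: mult_ac)
    then show ?thesis using e0(1)[of n] by simp
  qed
  have Slim: "(\<lambda>n. ?S n x) \<longlonglongrightarrow> (LINT y|lborel. s x * \<Phi> y)" for x
  proof (rule integral_dominated_convergence[where w = "\<lambda>y. M * norm (\<Phi> y)"])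
    show "AE y in lborel. (\<lambda>n. s (x - e n *\<^sub>R y) * \<Phi> y) \<longlonglongrightarrow> s x * \<Phi> y"
    proof (rule AE_I2)
      fix y
      have "(\<lambda>n. x - e n *\<^sub>R y) \<longlonglongrightarrow> x - 0 *\<^sub>R y" by (intro tendsto_intros elim)
      then have "(\<lambda>n. s (x - e n *\<^sub>R y)) \<longlonglongrightarrow> s x"
        by (intro continuous_on_tendsto_compose[OF s(1)]) auto
      then show "(\<lambda>n. s (x - e n *\<^sub>R y) * \<Phi> y) \<longlonglongrightarrow> s x * \<Phi> y" by (intro tendsto_intros)
    qed
    show "AE y in lborel. norm (s (x - e n *\<^sub>R y) * \<Phi> y) \<le> M * norm (\<Phi> y)" for n
      using M by (intro AE_I2) (auto simp: norm_mult intro!: mult_right_mono)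
  qed (use \<Phi>i in auto)
  have Sb: "norm (?S n x) \<le> M * (LINT y|lborel. norm (\<Phi> y))" for n x
  proof -
    have "norm (?S n x) \<le> (LINT y|lborel. M * norm (\<Phi> y))"
      by (rule Bochner_integral_norm_bound) (use \<Phi>i M in \<open>auto simp: norm_mult intro!: mult_right_mono\<close>)
    then show ?thesis by simp
  qed
  have Qi: "integrable lborel (\<lambda>x. norm (?Q x))" using wloc[of R'] by (rule integrable_norm)
  have Sm: "(\<lambda>x. ?S n x) \<in> borel_measurable borel" for n by measurable
  have "(\<lambda>n. LINT x|lborel. ?Q x * ?S n x) \<longlonglongrightarrow> (LINT x|lborel. ?Q x * (LINT y|lborel. s x * \<Phi> y))"
  proof (rule integral_dominated_convergence[where w = "\<lambda>x. (M * (LINT y|lborel. norm (\<Phi> y))) * norm (?Q x)"])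
    show "AE x in lborel. (\<lambda>n. ?Q x * ?S n x) \<longlonglongrightarrow> ?Q x * (LINT y|lborel. s x * \<Phi> y)"
      by (intro AE_I2 tendsto_mult tendsto_const Slim)
    show "AE x in lborel. norm (?Q x * ?S n x) \<le> (M * (LINT y|lborel. norm (\<Phi> y))) * norm (?Q x)" for n
      unfolding norm_mult[of "?Q _"] by (intro AE_I2) (subst mult.commute, intro mult_right_mono Sb, simp)
    show "(\<lambda>x. ?Q x * ?S n x) \<in> borel_measurable lborel" for n
      by (rule borel_measurable_times[OF borel_measurable_integrable[OF wloc]]) (use Sm in simp)
    show "(\<lambda>x. ?Q x * (LINT y|lborel. s x * \<Phi> y)) \<in> borel_measurable lborel"
      by (rule borel_measurable_times[OF borel_measurable_integrable[OF wloc]]) measurable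
  qed (use Qi in \<open>auto intro: integrable_mult_right\<close>)
  then have "(LINT x|lborel. ?Q x * (LINT y|lborel. s x * \<Phi> y)) = 0"
    unfolding 0 by (simp add: LIMSEQ_const_iff)
  moreover have "?Q x * (LINT y|lborel. s x * \<Phi> y) = (LINT y|lborel. \<Phi> y) * (w x * s x)" for x
  proof (cases "s x = 0")
    case False
    then have "norm x \<le> R'" using s(2)[OF False] r(1) by (simp add: R'_def)
    then show ?thesis by simp
  qed simp
  ultimately have "(LINT x|lborel. (LINT y|lborel. \<Phi> y) * (w x * s x)) = 0" by (simp only:)
  then show ?thesis using c by simp
qed

text \<open>Distance functions extend orthogonality from continuous functions of bounded support to
  indicators of closed sets, and Dynkin's argument extends it to all Borel sets. An integrable
  function whose integrals over all Borel sets vanish is null.\<close>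

lemma test_orthogonal_AE_zero:
  fixes w :: "'a::euclidean_space \<Rightarrow> complex" and \<psi> :: "'a \<Rightarrow> complex"
  assumes wm[measurable]: "w \<in> borel_measurable borel"
    and int: "\<And>g. g \<in> test_functions \<Longrightarrow> integrable lborel (\<lambda>x. w x * g x)"
    and zero: "\<And>g. g \<in> test_functions \<Longrightarrow> (LINT x|lborel. w x * g x) = 0"
    and \<psi>: "\<psi> \<in> test_functions" "\<psi> 0 = 1"
  shows "AE x in lborel. w x = 0"
proof -
  have "isCont \<psi> 0"
    using smooth_continuous[OF test_functions_smooth[OF \<psi>(1)]] by (simp add: continuous_on_eq_continuous_at)
  then obtain d where d: "d > 0" "\<And>x. norm x < d \<Longrightarrow> norm (\<psi> x - 1) < 1/2"
    unfolding continuous_at_eps_delta using \<psi>(2) by (auto simp: dist_norm dest!: spec[of _ "1/2"])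
  have big: "norm (\<psi> x) \<ge> 1/2" if "norm x < d" for x
    using d(2)[OF that] norm_triangle_ineq2[of 1 "1 - \<psi> x"] by (simp add: norm_minus_commute)
  \<comment> \<open>|psi| >= 1/2 near the origin; a small dilation factor spreads this lower bound
    over any given ball.\<close>
  have wloc: "integrable lborel (\<lambda>x. indicator (cball 0 R) x * w x)" for R
  proof -
    have [measurable]: "cball 0 R \<in> sets (borel :: 'a measure)" by simp
    define c where "c = d / (2 * (\<bar>R\<bar> + 1))"
    have c: "c > 0" using d(1) by (simp add: c_def add_nonneg_pos)
    have cR: "norm (c *\<^sub>R x) < d" if "norm x \<le> R" for x :: 'a
    proof -
      have "norm (c *\<^sub>R x) \<le> c * (\<bar>R\<bar> + 1)" using that c by simp
      also have "\<dots> = d / 2" by (simp add: c_def field_simps)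
      finally show ?thesis using d(1) by simp
    qed
    have "integrable lborel (\<lambda>x. w x * \<psi> (c *\<^sub>R (x - 0)))" by (intro int scaled_test_function \<psi> c)
    then have "integrable lborel (\<lambda>x. 2 * norm (w x * \<psi> (c *\<^sub>R x)))" by simp
    then show ?thesis
    proof (rule Bochner_Integration.integrable_bound)
      show "AE x in lborel. norm (indicator (cball 0 R) x * w x) \<le> norm (2 * norm (w x * \<psi> (c *\<^sub>R x)))"
      proof (rule AE_I2)
        fix x :: 'a
        show "norm (indicator (cball 0 R) x * w x) \<le> norm (2 * norm (w x * \<psi> (c *\<^sub>R x)))"
        proof (cases "norm x \<le> R")
          case True
          then show ?thesis using mult_left_mono[OF big[OF cR[OF True]], of "norm (w x)"]
            by (simp add: norm_mult)
        qed simp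
      qed
    qed measurable
  qed
  note cont = test_orthogonal_continuous[OF wm int zero wloc \<psi>]
  have "AE x in lborel. indicator (cball 0 R) x * w x = 0" if R: "R > 0" for R
  proof -
    let ?W = "\<lambda>x. indicator (cball 0 R) x * w x"
    have closed: "(LINT x|lborel. indicator C x *\<^sub>R ?W x) = 0" if C: "closed C" for C
    proof (cases "C \<inter> cball 0 R = {}")
      case True
      then have "(\<lambda>x. indicator C x *\<^sub>R ?W x) = (\<lambda>x. 0)" by (auto simp: fun_eq_iff indicator_def)
      then show ?thesis by (simp only: Bochner_Integration.integral_zero)
    next
      case False
      let ?K = "C \<inter> cball 0 R"
      have clK: "closed ?K" using C by (intro closed_Int) auto
      define s where "s k x = complex_of_real (max 0 (1 - real k * infdist x ?K))" for k x
      have s0: "norm x \<le> R + 1" if "s k x \<noteq> 0" "k \<ge> 1" for k x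
      proof -
        have "real k * infdist x ?K < 1" using that by (auto simp: s_def max_def split: if_splits)
        moreover have "infdist x ?K \<le> real k * infdist x ?K"
          using that(2) mult_right_mono[of 1 "real k" "infdist x ?K"] infdist_nonneg by auto
        ultimately have "infdist x ?K < 1" by linarith
        moreover obtain y where "y \<in> ?K" "infdist x ?K = dist x y"
          using infdist_attains_inf[OF clK False] by blast
        ultimately show ?thesis
          using norm_triangle_ineq[of "x - y" y] by (simp add: dist_norm)
      qed
      have sc: "continuous_on UNIV (s k)" for k
        unfolding s_def by (intro continuous_intros)
      have sb: "norm (s k x) \<le> 1" for k x
        by (auto simp: s_def infdist_nonneg)
      \<comment> \<open>The function \<open>s 0\<close> is identically 1; from index 1 on,
        \<open>s k\<close> vanishes at distance 1 or more from \<open>?K\<close>.\<close>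
      have "(\<lambda>k. LINT x|lborel. w x * s (Suc k) x) \<longlonglongrightarrow> (LINT x|lborel. indicator ?K x * w x)"
      proof (rule integral_dominated_convergence[where w = "\<lambda>x. norm (indicator (cball 0 (R + 1)) x * w x)"])
        show "AE x in lborel. (\<lambda>k. w x * s (Suc k) x) \<longlonglongrightarrow> indicator ?K x * w x"
        proof (rule AE_I2)
          fix x
          have "(\<lambda>k. s k x) \<longlonglongrightarrow> indicator ?K x"
          proof (cases "x \<in> ?K")
            case True
            then have "s k x = 1" for k by (simp add: s_def)
            then show ?thesis using True by simp
          next
            case x: False
            then have "infdist x ?K \<noteq> 0" using in_closed_iff_infdist_zero[OF clK False, of x] by blast
            then have "infdist x ?K > 0" using infdist_nonneg[of x ?K] by linarith
            then obtain k0 where k0: "1 < real k0 * infdist x ?K" by (metis reals_Archimedean3)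
            have "s k x = 0" if "k \<ge> k0" for k
            proof -
              have "real k0 * infdist x ?K \<le> real k * infdist x ?K"
                using that infdist_nonneg by (intro mult_right_mono) auto
              then show ?thesis using k0 by (simp add: s_def)
            qed
            then have "eventually (\<lambda>k. s k x = indicator ?K x) sequentially"
              using x by (auto simp: eventually_sequentially indicator_def intro!: exI[of _ k0])
            then show ?thesis by (simp add: tendsto_eventually)
          qed
          then have "(\<lambda>k. w x * s (Suc k) x) \<longlonglongrightarrow> w x * indicator ?K x"
            by (intro tendsto_mult tendsto_const LIMSEQ_Suc)
          then show "(\<lambda>k. w x * s (Suc k) x) \<longlonglongrightarrow> indicator ?K x * w x" by (simp add: mult.commute)
        qed
        show "AE x in lborel. norm (w x * s (Suc k) x) \<le> norm (indicator (cball 0 (R + 1)) x * w x)" for k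
        proof (rule AE_I2)
          fix x
          show "norm (w x * s (Suc k) x) \<le> norm (indicator (cball 0 (R + 1)) x * w x)"
          proof (cases "s (Suc k) x = 0")
            case False
            then have "norm x \<le> R + 1" using s0 by simp
            then show ?thesis using sb by (simp add: norm_mult mult_left_le)
          qed simp
        qed
        show "(\<lambda>x. w x * s (Suc k) x) \<in> borel_measurable lborel" for k
          using borel_measurable_continuous_onI[OF sc] by simp
        show "(\<lambda>x. indicator ?K x * w x) \<in> borel_measurable lborel" 
          by (intro borel_measurable_times borel_measurable_indicator) (use clK wm in auto)
      qed (use wloc in \<open>intro integrable_norm\<close>)
      moreover have "(LINT x|lborel. w x * s (Suc k) x) = 0" for k
        by (rule cont[where R = "R + 1"])
          (use s0[of "Suc k"] sc in auto)
      ultimately have "(LINT x|lborel. indicator ?K x * w x) = 0" by (simp add: LIMSEQ_const_iff)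
      moreover have "indicator C x *\<^sub>R ?W x = indicator ?K x * w x" for x
        by (auto simp: indicator_def)
      ultimately show ?thesis by simp
    qed
    have ind: "integrable lborel (\<lambda>x. indicator A x *\<^sub>R ?W x)" if "A \<in> sets lborel" for A
      by (rule integrable_mult_indicator[OF that wloc])
    have all: "(LINT x|lborel. indicator A x *\<^sub>R ?W x) = 0" if A: "A \<in> sets lborel" for A
    proof -
      have A: "A \<in> sigma_sets UNIV (Collect closed)"
        using A by (simp add: borel_eq_closed sets_measure_of)
      have "Int_stable (Collect closed :: 'a set set)" by (auto simp: Int_stable_def)
      then show ?thesis using subset_UNIV[of "Collect closed :: 'a set set", folded Pow_UNIV] A
      proof (induction rule: sigma_sets_induct_disjoint)
        case (compl A)
        then have A: "A \<in> sigma_sets UNIV (Collect closed)" and IH: "(LINT x|lborel. indicator A x *\<^sub>R ?W x) = 0" by auto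
        then have A': "A \<in> sets lborel" by (simp add: borel_eq_closed sets_measure_of)
        have "(LINT x|lborel. indicator (UNIV - A) x *\<^sub>R ?W x) = (LINT x|lborel. indicator UNIV x *\<^sub>R ?W x - indicator A x *\<^sub>R ?W x)"
          by (intro Bochner_Integration.integral_cong) (auto simp: indicator_def)
        also have "\<dots> = 0"
          by (subst Bochner_Integration.integral_diff[OF ind ind[OF A']], simp)
            (simp only: closed[OF closed_UNIV] IH diff_zero)
        finally show ?case .
      next
        case (union F)
        then have disj: "disjoint_family F" and F: "range F \<subseteq> sigma_sets UNIV (Collect closed)"
          and IH: "\<And>i. (LINT x|lborel. indicator (F i) x *\<^sub>R ?W x) = 0" by auto
        have F': "F i \<in> sets lborel" for i using F by (auto simp: borel_eq_closed sets_measure_of)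
        have "set_lebesgue_integral lborel (\<Union>i. F i) ?W = (\<Sum>i. set_lebesgue_integral lborel (F i) ?W)"
          by (rule lebesgue_integral_countable_add[OF F'])
            (use disj F' ind in \<open>auto simp: disjoint_family_on_def set_integrable_def intro!: sets.countable_UN\<close>)
        then show ?case
          using IH by (simp add: set_lebesgue_integral_def)
      qed (use closed in \<open>auto simp: indicator_def\<close>)
    qed
    show ?thesis
      by (rule sigma_finite_measure.density_unique_banach[OF sigma_finite_lborel, of ?W "\<lambda>_. 0"])
        (use wloc all in \<open>auto simp: set_lebesgue_integral_def\<close>)
  qed
  then have "AE x in lborel. \<forall>n. indicator (cball 0 (real (Suc n))) x * w x = 0"
    unfolding AE_all_countable by auto
  then show ?thesis
  proof eventually_elim
    case (elim x)
    obtain n where "norm x \<le> real n" using real_arch_simple by blast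
    then have "x \<in> cball 0 (real (Suc n))" by simp
    then show ?case using elim[rule_format, of n] by simp
  qed
qed

lemma tempered_fun_measurable: "tempered_fun g \<Longrightarrow> g \<in> borel_measurable borel"
  and tempered_fun_integrable: "tempered_fun g \<Longrightarrow> f \<in> schwartz \<Longrightarrow> integrable lborel (\<lambda>x. g x * f x)"
  and tempered_fun_tempered: "tempered_fun g \<Longrightarrow> dist_of_fun g \<in> tempered"
  by (simp_all add: tempered_fun_def)

lemma dist_of_fun_eq_AE:
  fixes u v \<psi> :: "'a::euclidean_space \<Rightarrow> complex"
  assumes u: "tempered_fun u" and v: "tempered_fun v" and eq: "dist_of_fun u = dist_of_fun v"
    and \<psi>: "\<psi> \<in> test_functions" "\<psi> 0 = 1"
  shows "AE x in lborel. u x = v x"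
proof -
  have "AE x in lborel. u x - v x = 0"
  proof (rule test_orthogonal_AE_zero[OF _ _ _ \<psi>])
    show "(\<lambda>x. u x - v x) \<in> borel_measurable borel"
      using tempered_fun_measurable[OF u] tempered_fun_measurable[OF v] by simp
    fix g :: "'a \<Rightarrow> complex" assume "g \<in> test_functions"
    then have g: "g \<in> schwartz" by (rule test_functions_schwartz)
    note i = tempered_fun_integrable[OF u g] tempered_fun_integrable[OF v g]
    show "integrable lborel (\<lambda>x. (u x - v x) * g x)"
      unfolding left_diff_distrib by (intro Bochner_Integration.integrable_diff i)
    have "(LINT x|lborel. (u x - v x) * g x) = dist_of_fun u g - dist_of_fun v g"
      unfolding left_diff_distrib dist_of_fun_apply[OF g] by (rule Bochner_Integration.integral_diff[OF i])
    then show "(LINT x|lborel. (u x - v x) * g x) = 0" using eq by simp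
  qed
  then show ?thesis by simp
qed

text \<open>Makes the definite description in \<open>fun_of_dist\<close> legitimate: two continuous
  representatives agree almost everywhere, hence everywhere.\<close>

lemma fun_of_dist_of_fun:
  fixes u \<psi> :: "'a::euclidean_space \<Rightarrow> complex"
  assumes u: "continuous_on UNIV u" "tempered_fun u" and \<psi>: "\<psi> \<in> test_functions" "\<psi> 0 = 1"
  shows "fun_of_dist (dist_of_fun u) = u"
  unfolding fun_of_dist_def
proof (rule the_equality)
  fix g assume g: "continuous_on UNIV g \<and> tempered_fun g \<and> dist_of_fun g = dist_of_fun u"
  then have "AE x in lborel. g x - u x = 0" using dist_of_fun_eq_AE[OF _ u(2) _ \<psi>] by fastforce
  moreover have "continuous_on UNIV (\<lambda>x. g x - u x)" using g u by (intro continuous_on_diff) auto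
  ultimately have "(\<lambda>x. g x - u x) = (\<lambda>x. 0)" by (rule AE_zero_continuous)
  then show "g = u" by (simp add: fun_eq_iff)
qed (use u in simp)

subsection \<open>Supports\<close>

text \<open>In place of a partition of unity, \<open>Q\<close> is multiplied successively by 1 -
  b_x, where the bumps b_x are dilated translates of \<open>\<psi>\<close> so narrow that T vanishes
  on test functions living on them. No factor changes T Q, and in the end the product is 0 because
  every point of the compact support has some b_x equal to 1.\<close>

lemma dist_support_vanish:
  fixes T :: "'a::euclidean_space dist" and \<psi> Q :: "'a \<Rightarrow> complex"
  assumes diff: "\<And>f g. f \<in> test_functions \<Longrightarrow> g \<in> test_functions \<Longrightarrow> T (\<lambda>x. f x - g x) = T f - T g"
    and \<psi>: "\<psi> \<in> test_functions" "\<And>x. norm x \<le> 1 \<Longrightarrow> \<psi> x = 1"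
    and Q: "Q \<in> test_functions" and supp: "fun_support Q \<inter> dist_support T = {}"
  shows "T Q = 0"
proof -
  obtain R where R: "R > 0" "\<And>x. \<psi> x \<noteq> 0 \<Longrightarrow> norm x \<le> R" using test_function_support_bound[OF \<psi>(1)] by blast
  let ?K = "fun_support Q"
  let ?b = "\<lambda>c x y. \<psi> (c *\<^sub>R (y - x))"
  have K: "compact ?K" using Q by (simp add: test_functions_def)
  have "\<forall>x\<in>?K. \<exists>c>0. \<forall>g\<in>test_functions. (\<forall>y. g y \<noteq> 0 \<longrightarrow> ?b c x y \<noteq> 0) \<longrightarrow> T g = 0"
  proof
    fix x assume "x \<in> ?K"
    then have "x \<notin> dist_support T" using supp by blast
    then obtain U where U: "open U" "x \<in> U" "\<And>g. g \<in> test_functions \<Longrightarrow> fun_support g \<subseteq> U \<Longrightarrow> T g = 0"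
      unfolding dist_support_def by blast
    obtain d where d: "d > 0" "cball x d \<subseteq> U" using open_contains_cball U(1,2) by blast
    define c where "c = R / d"
    have "T g = 0" if g: "g \<in> test_functions" "\<forall>y. g y \<noteq> 0 \<longrightarrow> ?b c x y \<noteq> 0" for g
    proof (rule U(3)[OF g(1)])
      have "y \<in> cball x d" if "g y \<noteq> 0" for y
      proof -
        have "norm (c *\<^sub>R (y - x)) \<le> R" using R(2) g(2) that by blast
        then have "(R / d) * norm (y - x) \<le> R" unfolding norm_scaleR c_def using R(1) d(1) by simp
        then have "norm (y - x) \<le> d" using R(1) d(1) by (simp add: field_simps)
        then show ?thesis by (simp add: dist_norm norm_minus_commute)
      qed
      then have "fun_support g \<subseteq> cball x d" unfolding fun_support_def by (intro closure_minimal) auto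
      then show "fun_support g \<subseteq> U" using d by blast
    qed
    moreover have "c > 0" using R d by (simp add: c_def)
    ultimately show "\<exists>c>0. \<forall>g\<in>test_functions. (\<forall>y. g y \<noteq> 0 \<longrightarrow> ?b c x y \<noteq> 0) \<longrightarrow> T g = 0" by blast
  qed
  from bchoice[OF this] obtain c where c: "\<And>x. x \<in> ?K \<Longrightarrow> c x > 0"
    "\<And>x g. x \<in> ?K \<Longrightarrow> g \<in> test_functions \<Longrightarrow> (\<And>y. g y \<noteq> 0 \<Longrightarrow> ?b (c x) x y \<noteq> 0) \<Longrightarrow> T g = 0"
    by blast
  have "?K \<subseteq> (\<Union>x\<in>?K. ball x (1 / c x))" using c(1) by fastforce
  then obtain C where C: "C \<subseteq> ?K" "finite C" "?K \<subseteq> (\<Union>x\<in>C. ball x (1 / c x))"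
    using compactE_image[OF K, of ?K "\<lambda>x. ball x (1 / c x)"] by (metis open_ball)
  have "(\<lambda>y. Q y * (\<Prod>x\<in>F. 1 - ?b (c x) x y)) \<in> test_functions \<and> T (\<lambda>y. Q y * (\<Prod>x\<in>F. 1 - ?b (c x) x y)) = T Q"
    if "F \<subseteq> C" for F
    using finite_subset[OF that C(2)] that
  proof (induction F rule: finite_induct)
    case empty
    then show ?case using Q by simp
  next
    case (insert x F)
    let ?g = "\<lambda>y. Q y * (\<Prod>x\<in>F. 1 - ?b (c x) x y)"
    have x: "x \<in> ?K" using insert C(1) by auto
    have g: "?g \<in> test_functions" "T ?g = T Q" using insert by auto
    have gb: "(\<lambda>y. ?g y * ?b (c x) x y) \<in> test_functions"
      by (intro test_functions_mult g test_functions_smooth scaled_test_function \<psi> c x)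
    have eq: "(\<lambda>y. Q y * (\<Prod>x\<in>insert x F. 1 - ?b (c x) x y)) = (\<lambda>y. ?g y - ?g y * ?b (c x) x y)"
      using insert by (simp add: algebra_simps)
    have "T (\<lambda>y. ?g y * ?b (c x) x y) = 0" by (rule c(2)[OF x gb]) auto
    then show ?case unfolding eq using diff[OF g(1) gb] g(2) test_functions_diff[OF g(1) gb] by simp
  qed
  from this[OF subset_refl] have *: "T (\<lambda>y. Q y * (\<Prod>x\<in>C. 1 - ?b (c x) x y)) = T Q" by blast
  have "Q y * (\<Prod>x\<in>C. 1 - ?b (c x) x y) = 0" for y
  proof (cases "Q y = 0")
    case False
    then have "y \<in> ?K" by (rule fun_support_superset)
    then obtain x where x: "x \<in> C" "y \<in> ball x (1 / c x)" using C(3) by blast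
    have "c x > 0" using x C(1) c(1) by blast
    then have "norm (c x *\<^sub>R (y - x)) \<le> 1"
      using x(2) unfolding norm_scaleR by (simp add: dist_norm norm_minus_commute field_simps)
    then have "?b (c x) x y = 1" by (rule \<psi>(2))
    then show ?thesis using x(1) C(2) by (auto simp: prod_zero_iff)
  qed simp
  then have "T Q = T (\<lambda>y. 0)" using * by (simp only:)
  moreover have "T (\<lambda>y. 0) = 0" using diff[OF Q Q] by simp
  ultimately show ?thesis by simp
qed

lemma fourier_diff:
  assumes "f \<in> schwartz" "g \<in> schwartz"
  shows "fourier (\<lambda>x. f x - g x) = (\<lambda>\<xi>. fourier f \<xi> - fourier g \<xi>)"
  unfolding fourier_def
  using schwartz_integrable[OF schwartz_modulate[OF assms(1)]] schwartz_integrable[OF schwartz_modulate[OF assms(2)]]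
  by (simp add: right_diff_distrib)

text \<open>\<open>Q\<close> vanishes near the spectrum but lacks compact support, so it is cut off
  by psi(e_n xi). Convergence of the truncated functions in the Schwartz space is avoided: the
  pairings are integrals of the continuous function \<open>?u\<close> against an approximate
  identity, and the limit is \<open>?u 0\<close> up to a constant.\<close>

lemma fourier_vanish:
  fixes S :: "'a::euclidean_space dist" and \<psi> Q :: "'a \<Rightarrow> complex"
  assumes S: "S \<in> tempered" and \<psi>: "\<psi> \<in> test_functions" "\<And>x. norm x \<le> 1 \<Longrightarrow> \<psi> x = 1"
    and Q: "Q \<in> schwartz" and V: "open V" "dist_support (dist_fourier S) \<subseteq> V" "\<And>\<xi>. \<xi> \<in> V \<Longrightarrow> Q \<xi> = 0"
  shows "S (fourier Q) = 0"
proof -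
  define e where "e n = 1 / real (Suc n)" for n
  have e0: "e n > 0" "e n \<le> 1" for n by (auto simp: e_def)
  have elim: "e \<longlonglongrightarrow> 0" unfolding e_def by (rule LIMSEQ_Suc[OF lim_1_over_n])
  have \<psi>s: "\<psi> \<in> schwartz" by (rule test_functions_schwartz[OF \<psi>(1)])
  have kQ: "kern Q \<in> schwartz" by (rule schwartz_kern[OF Q])
  let ?u = "tconv S (kern Q)"
  have uc: "continuous_on UNIV ?u" by (rule continuous_tconv[OF S kQ])
  have [measurable]: "?u \<in> borel_measurable borel" by (rule borel_measurable_continuous_onI[OF uc])
  obtain N K where K: "K > 0" "\<And>x. norm (?u x) \<le> K * (1 + norm x) ^ N"
    using tconv_growth[OF S kQ] by blast
  have F\<psi>: "fourier \<psi> \<in> schwartz" by (rule schwartz_fourier[OF \<psi>s])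
  have [measurable]: "fourier \<psi> \<in> borel_measurable borel" by (rule schwartz_measurable[OF F\<psi>])
  have Z: "(LINT y|lborel. ?u (e n *\<^sub>R y) * fourier \<psi> y) = 0" for n
  proof -
    let ?p = "\<lambda>\<xi>. \<psi> (e n *\<^sub>R (\<xi> - 0))"
    have pt: "?p \<in> test_functions" by (intro scaled_test_function \<psi> e0)
    have ps: "?p \<in> schwartz" by (rule test_functions_schwartz[OF pt])
    have Fp: "fourier ?p \<in> schwartz" by (rule schwartz_fourier[OF ps])
    have [measurable]: "\<psi> \<in> borel_measurable borel" "fourier ?p \<in> borel_measurable borel"
      using schwartz_measurable \<psi>s Fp by auto
    have Qp: "(\<lambda>\<xi>. ?p \<xi> * Q \<xi>) \<in> test_functions"
      by (intro test_functions_mult pt schwartz_smooth Q)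
    \<comment> \<open>The transforms of psi(e_n xi) are rescaled copies of one function and
      concentrate at the origin.\<close>
    have F: "of_real (e n ^ DIM('a)) * fourier ?p (e n *\<^sub>R y) = fourier \<psi> y" for y
    proof -
      have "fourier \<psi> y = of_real (e n ^ DIM('a)) * (LINT \<xi>|lborel. exp (- (\<i> * complex_of_real ((e n *\<^sub>R \<xi>) \<bullet> y))) * \<psi> (e n *\<^sub>R \<xi>))"
        unfolding fourier_def by (rule integral_scale[OF _ e0(1)]) measurable
      then show ?thesis by (simp add: fourier_def)
    qed
    have "dist_fourier S (\<lambda>\<xi>. ?p \<xi> * Q \<xi>) = 0"
    proof (rule dist_support_vanish[OF _ \<psi> Qp])
      show "dist_fourier S (\<lambda>x. f x - g x) = dist_fourier S f - dist_fourier S g"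
        if "f \<in> test_functions" "g \<in> test_functions" for f g
      proof -
        have "f \<in> schwartz" "g \<in> schwartz" using that test_functions_schwartz by auto
        then show ?thesis
          by (simp add: dist_fourier_def schwartz_diff fourier_diff tempered_diff[OF S] schwartz_fourier)
      qed
      have "fun_support (\<lambda>\<xi>. ?p \<xi> * Q \<xi>) \<subseteq> - V"
        unfolding fun_support_def by (intro closure_minimal) (use V in auto)
      then show "fun_support (\<lambda>\<xi>. ?p \<xi> * Q \<xi>) \<inter> dist_support (dist_fourier S) = {}" using V(2) by blast
    qed
    then have "0 = S (fourier (\<lambda>\<xi>. Q \<xi> * ?p \<xi>))"
      using test_functions_schwartz[OF Qp] by (simp add: dist_fourier_def mult.commute)
    also have "(\<lambda>\<xi>. Q \<xi> * ?p \<xi>) = (\<lambda>\<xi>. Q \<xi> * inv_fourier (fourier ?p) \<xi>)"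
      by (simp only: inv_fourier_fourier[OF ps])
    also have "fourier \<dots> = (\<lambda>z. LINT x|lborel. kern Q (z - x) * fourier ?p x)"
      by (rule ext, subst fourier_mult_inv_fourier[OF Q Fp]) (simp add: kern_def)
    also have "S \<dots> = (LINT x|lborel. ?u x * fourier ?p x)"
      by (rule tempered_conv[OF S kQ, where L = "\<lambda>x. x" and B = 1])
        (use schwartz_rapid[OF Fp] schwartz_measurable[OF Fp] in auto)
    also have "\<dots> = of_real (e n ^ DIM('a)) * (LINT y|lborel. ?u (e n *\<^sub>R y) * fourier ?p (e n *\<^sub>R y))"
      by (rule integral_scale[OF _ e0(1)]) measurable
    also have "\<dots> = (LINT y|lborel. ?u (e n *\<^sub>R y) * (of_real (e n ^ DIM('a)) * fourier ?p (e n *\<^sub>R y)))"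
      by (subst integral_mult_right_zero[symmetric]) (simp add: mult_ac)
    also have "\<dots> = (LINT y|lborel. ?u (e n *\<^sub>R y) * fourier \<psi> y)" by (simp only: F)
    finally show ?thesis by simp
  qed
  have "(\<lambda>n. LINT y|lborel. ?u (e n *\<^sub>R y) * fourier \<psi> y) \<longlonglongrightarrow> (LINT y|lborel. ?u 0 * fourier \<psi> y)"
  proof (rule integral_dominated_convergence[where w = "\<lambda>y. K * ((1 + norm y) ^ N * norm (fourier \<psi> y))"])
    show "AE y in lborel. (\<lambda>n. ?u (e n *\<^sub>R y) * fourier \<psi> y) \<longlonglongrightarrow> ?u 0 * fourier \<psi> y"
    proof (rule AE_I2)
      fix y :: 'a
      have "(\<lambda>n. e n *\<^sub>R y) \<longlonglongrightarrow> 0 *\<^sub>R y" by (intro tendsto_intros elim)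
      then have "(\<lambda>n. ?u (e n *\<^sub>R y)) \<longlonglongrightarrow> ?u 0"
        by (intro continuous_on_tendsto_compose[OF uc]) auto
      then show "(\<lambda>n. ?u (e n *\<^sub>R y) * fourier \<psi> y) \<longlonglongrightarrow> ?u 0 * fourier \<psi> y" by (intro tendsto_intros)
    qed
    show "AE y in lborel. norm (?u (e n *\<^sub>R y) * fourier \<psi> y) \<le> K * ((1 + norm y) ^ N * norm (fourier \<psi> y))" for n
    proof (rule AE_I2)
      fix y :: 'a
      have le: "norm (e n *\<^sub>R y) \<le> norm y" using e0[of n] by (simp add: mult_left_le_one_le)
      have "norm (?u (e n *\<^sub>R y)) \<le> K * (1 + norm (e n *\<^sub>R y)) ^ N" by (rule K)
      also have "\<dots> \<le> K * (1 + norm y) ^ N" using le K(1) by (intro mult_left_mono power_mono) auto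
      finally show "norm (?u (e n *\<^sub>R y) * fourier \<psi> y) \<le> K * ((1 + norm y) ^ N * norm (fourier \<psi> y))"
        by (simp add: norm_mult mult_right_mono flip: mult.assoc)
    qed
    show "integrable lborel (\<lambda>y. K * ((1 + norm y) ^ N * norm (fourier \<psi> y)))"
      by (intro integrable_mult_right rapid_integrable_weight schwartz_rapid F\<psi> schwartz_measurable)
  qed auto
  then have "(LINT y|lborel. ?u 0 * fourier \<psi> y) = 0" unfolding Z by (simp add: LIMSEQ_const_iff)
  then have "?u 0 * (of_real ((2 * pi) ^ DIM('a)) * \<psi> 0) = 0"
    using fourier_integral_at_0[OF \<psi>s] by simp
  then have "?u 0 = 0" using \<psi>(2)[of 0] by simp
  moreover have "?u 0 = S (\<lambda>z. (1 / of_real ((2 * pi) ^ DIM('a))) * fourier Q z)"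
    by (simp add: tconv_def kern_def[abs_def])
  moreover have "\<dots> = (1 / of_real ((2 * pi) ^ DIM('a))) * S (fourier Q)"
    by (rule tempered_cmult[OF S schwartz_fourier[OF Q]])
  ultimately show ?thesis by simp
qed

text \<open>The part of a test function cut away by 1 - rho lives off a neighbourhood of the
  spectrum and is annihilated. The equality holds almost everywhere because \<open>h\<close> is an
  arbitrary measurable representative, the right side the continuous one.\<close>

lemma band_reproduce:
  fixes h \<psi> \<rho> :: "'a::euclidean_space \<Rightarrow> complex"
  assumes h: "tempered_fun h" and \<psi>: "\<psi> \<in> test_functions" "\<And>x. norm x \<le> 1 \<Longrightarrow> \<psi> x = 1"
    and V: "open V" "dist_support (dist_fourier (dist_of_fun h)) \<subseteq> V"
    and \<rho>: "\<rho> \<in> schwartz" "\<And>\<xi>. \<xi> \<in> V \<Longrightarrow> \<rho> \<xi> = 1"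
  shows "AE x in lborel. h x = tconv (dist_of_fun h) (kern \<rho>) x"
proof (rule dist_of_fun_eq_AE[OF h tempered_fun_tconv[OF tempered_fun_tempered[OF h] schwartz_kern[OF \<rho>(1)]] _ \<psi>(1)])
  let ?T = "dist_of_fun h"
  have T: "?T \<in> tempered" by (rule tempered_fun_tempered[OF h])
  show "?T = dist_of_fun (tconv ?T (kern \<rho>))"
  proof
    fix g :: "'a \<Rightarrow> complex"
    show "?T g = dist_of_fun (tconv ?T (kern \<rho>)) g"
    proof (cases "g \<in> schwartz")
      case True
      let ?G = "inv_fourier g"
      have G: "?G \<in> schwartz" by (rule schwartz_inv_fourier[OF True])
      have \<rho>G: "(\<lambda>\<xi>. \<rho> \<xi> * ?G \<xi>) \<in> schwartz" by (intro schwartz_mult \<rho> G)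
      have "?T (fourier (\<lambda>\<xi>. ?G \<xi> - \<rho> \<xi> * ?G \<xi>)) = 0"
        by (rule fourier_vanish[OF T \<psi> _ V]) (use \<rho> in \<open>auto intro!: schwartz_diff G \<rho>G\<close>)
      then have "?T g = ?T (fourier (\<lambda>\<xi>. \<rho> \<xi> * ?G \<xi>))"
        unfolding fourier_diff[OF G \<rho>G]
        using tempered_diff[OF T schwartz_fourier[OF G] schwartz_fourier[OF \<rho>G]] fourier_inv_fourier[OF True] by simp
      also have "\<dots> = dist_inv_fourier (dist_mult \<rho> (dist_fourier ?T)) g"
        using True by (simp add: dist_inv_fourier_def dist_mult_def dist_fourier_def G \<rho>G)
      finally show ?thesis by (simp add: fourier_multiplier_dist[OF T \<rho>(1)])
    qed (simp add: dist_of_fun_def)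
  qed
qed (use \<psi> in auto)

lemma tconv_dist_of_fun:
  assumes "\<Theta> \<in> schwartz"
  shows "tconv (dist_of_fun h) \<Theta> x = (LINT y|lborel. h y * \<Theta> (y - x))"
  by (simp add: tconv_def dist_of_fun_apply schwartz_translate assms)

section \<open>Anisotropic dilations and the Littlewood--Paley decomposition\<close>

lemma aniso_dilation_inner[simp]:
  "i \<in> Basis \<Longrightarrow> aniso_dilation b t x \<bullet> i = t powr (b \<bullet> i) * (x \<bullet> i)"
  unfolding aniso_dilation_def by (simp add: inner_sum_left inner_Basis if_distrib cong: if_cong)

lemma aniso_dilation_dilation:
  "s > 0 \<Longrightarrow> t > 0 \<Longrightarrow> aniso_dilation b s (aniso_dilation b t x) = aniso_dilation b (s * t) x"
  by (rule euclidean_eqI) (simp add: powr_mult)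

lemma aniso_dilation_1[simp]: "aniso_dilation b 1 x = x"
  by (rule euclidean_eqI) simp

lemma aniso_dilation_inverse:
  "t > 0 \<Longrightarrow> aniso_dilation b t (aniso_dilation b (1 / t) x) = x"
  by (simp add: aniso_dilation_dilation)

lemma aniso_dilation_diff: "aniso_dilation b t (x - y) = aniso_dilation b t x - aniso_dilation b t y"
  by (rule euclidean_eqI) (simp add: inner_diff_left right_diff_distrib)

lemma aniso_dilation_adjoint: "aniso_dilation b t x \<bullet> y = x \<bullet> aniso_dilation b t y"
  unfolding euclidean_inner[of "aniso_dilation b t x" y] euclidean_inner[of x "aniso_dilation b t y"]
  by (intro sum.cong) (simp_all add: mult_ac)

lemma linear_aniso_dilation: "linear (aniso_dilation b t)"
  by (rule linearI; rule euclidean_eqI) (simp_all add: inner_add_left algebra_simps)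

lemma continuous_aniso_dilation[continuous_intros]:
  "continuous_on S (aniso_dilation b t)"
  by (simp add: linear_aniso_dilation linear_continuous_on linear_linear)

lemma measurable_aniso_dilation[measurable]: "aniso_dilation b t \<in> borel_measurable borel"
  by (intro borel_measurable_continuous_onI continuous_aniso_dilation)

lemma aniso_dilation_Basis: "v \<in> Basis \<Longrightarrow> aniso_dilation b t v = (t powr (b \<bullet> v)) *\<^sub>R v"
  by (rule euclidean_eqI) (simp add: inner_Basis)

lemma norm_square_sum: "(norm x)\<^sup>2 = (\<Sum>i\<in>Basis. (x \<bullet> i)\<^sup>2)" for x :: "'a::euclidean_space"
  unfolding power2_norm_eq_inner euclidean_inner[of x x] by (simp only: power2_eq_square)

lemma aniso_dilation_bound_below:
  assumes "t > 0" obtains m where "m > 0" "\<And>x. norm (aniso_dilation b t x) \<ge> m * norm x"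
proof -
  define m where "m = Min ((\<lambda>i. t powr (b \<bullet> i)) ` Basis)"
  have m: "m > 0" unfolding m_def using assms by simp
  have "m * norm x \<le> norm (aniso_dilation b t x)" for x
  proof (rule power2_le_imp_le)
    have "(m * norm x)\<^sup>2 = (\<Sum>i\<in>Basis. (m * (x \<bullet> i))\<^sup>2)"
      by (simp add: power_mult_distrib norm_square_sum sum_distrib_left)
    also have "\<dots> \<le> (\<Sum>i\<in>Basis. (t powr (b \<bullet> i) * (x \<bullet> i))\<^sup>2)"
    proof (rule sum_mono)
      fix i :: 'a assume "i \<in> Basis"
      then have "m \<le> t powr (b \<bullet> i)" unfolding m_def by (intro Min_le) auto
      then have "m\<^sup>2 \<le> (t powr (b \<bullet> i))\<^sup>2" using m by (intro power_mono) auto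
      then show "(m * (x \<bullet> i))\<^sup>2 \<le> (t powr (b \<bullet> i) * (x \<bullet> i))\<^sup>2"
        unfolding power_mult_distrib by (rule mult_right_mono) simp
    qed
    also have "\<dots> = (norm (aniso_dilation b t x))\<^sup>2"
      by (simp add: norm_square_sum)
    finally show "(m * norm x)\<^sup>2 \<le> (norm (aniso_dilation b t x))\<^sup>2" .
  qed simp
  then show thesis using m that by blast
qed

lemma test_functions_dilation:
  assumes "f \<in> test_functions" "t > 0"
  shows "(\<lambda>x. f (aniso_dilation b t x)) \<in> test_functions"
proof -
  obtain m where m: "m > 0" "\<And>x. norm (aniso_dilation b t x) \<ge> m * norm x"
    using aniso_dilation_bound_below[OF assms(2)] by blast
  have "(\<lambda>x. f (0 + aniso_dilation b t x)) \<in> test_functions"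
    by (rule test_functions_affine[OF assms(1) linear_aniso_dilation _ m]) (auto simp: aniso_dilation_Basis)
  then show ?thesis by simp
qed

lemma integral_dilation:
  fixes f :: "'a::euclidean_space \<Rightarrow> complex"
  assumes "f \<in> borel_measurable borel" "t > 0"
  shows "(LINT x|lborel. f x) = of_real (t powr weight_sum b) * (LINT x|lborel. f (aniso_dilation b t x))"
  using integral_affine_euclidean[OF assms(1), where c = "\<lambda>i. t powr (b \<bullet> i)" and t = 0] assms(2)
  by (simp add: aniso_dilation_def[symmetric] weight_sum_def powr_sum)

lemma nn_integral_dilation:
  fixes f :: "'a::euclidean_space \<Rightarrow> ennreal"
  assumes "f \<in> borel_measurable borel" "t > 0"
  shows "(\<integral>\<^sup>+x. f x \<partial>lborel) = ennreal (t powr weight_sum b) * (\<integral>\<^sup>+x. f (aniso_dilation b t x) \<partial>lborel)"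
  using nn_integral_affine_euclidean[OF assms(1), where c = "\<lambda>i. t powr (b \<bullet> i)" and t = 0] assms(2)
  by (simp add: aniso_dilation_def[symmetric] weight_sum_def powr_sum)

lemma inv_fourier_dilation:
  fixes f :: "'a::euclidean_space \<Rightarrow> complex"
  assumes [measurable]: "f \<in> borel_measurable borel" and t: "t > 0"
  shows "inv_fourier (\<lambda>\<xi>. f (aniso_dilation b t \<xi>)) x = of_real (t powr (- weight_sum b)) * inv_fourier f (aniso_dilation b (1 / t) x)"
proof -
  have 1: "(LINT \<xi>|lborel. exp (\<i> * of_real (x \<bullet> \<xi>)) * f (aniso_dilation b t \<xi>)) =
     of_real ((1 / t) powr weight_sum b) * (LINT \<xi>|lborel. exp (\<i> * of_real (x \<bullet> aniso_dilation b (1 / t) \<xi>)) * f (aniso_dilation b t (aniso_dilation b (1 / t) \<xi>)))"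
    using integral_dilation[where f = "\<lambda>\<xi>. exp (\<i> * of_real (x \<bullet> \<xi>)) * f (aniso_dilation b t \<xi>)" and t = "1 / t" and b = b] t
    by auto
  have "(1 / t) powr weight_sum b = t powr (- weight_sum b)"
    using t by (subst powr_divide) (simp_all add: powr_minus_divide)
  note 3 = this
  have "exp (\<i> * of_real (x \<bullet> aniso_dilation b (1 / t) \<xi>)) * f (aniso_dilation b t (aniso_dilation b (1 / t) \<xi>))
      = exp (\<i> * of_real (aniso_dilation b (1 / t) x \<bullet> \<xi>)) * f \<xi>" for \<xi>
    by (subst aniso_dilation_inverse[OF t], subst aniso_dilation_adjoint, rule refl)
  note 4 = this
  show ?thesis
    unfolding inv_fourier_def 1
    unfolding 3
    unfolding 4
    by (rule times_divide_eq_right[symmetric])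
qed

text \<open>The sum whose value 1 defines the anisotropic norm. It is explicit and monotone in t, so
  all comparisons of frequency regions are made with it; \<open>aniso_norm_le_iff\<close> and
  \<open>le_aniso_norm_iff\<close> translate.\<close>

definition aq :: "'a::euclidean_space \<Rightarrow> real \<Rightarrow> 'a \<Rightarrow> real" where
  "aq b t x = (\<Sum>i\<in>Basis. (x \<bullet> i)\<^sup>2 / t powr (2 * (b \<bullet> i)))"

lemma aq_dilation:
  assumes "s > 0" "t > 0" shows "aq b t (aniso_dilation b s x) = aq b (t / s) x"
proof -
  have "(s powr c * y)\<^sup>2 / t powr (2 * c) = y\<^sup>2 / (t / s) powr (2 * c)" for c y :: real
  proof -
    have "(t / s) powr (2 * c) = t powr (2 * c) / s powr (2 * c)" by (rule powr_divide)
    moreover have "s powr (2 * c) = (s powr c)\<^sup>2" by (simp only: mult_2 powr_add power2_eq_square)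
    ultimately show ?thesis by (simp add: power_mult_distrib mult.commute)
  qed
  then show ?thesis by (simp add: aq_def)
qed

lemma aq_antimono:
  assumes "\<And>i. i \<in> Basis \<Longrightarrow> b \<bullet> i > 0" "0 < s" "s \<le> t" shows "aq b t x \<le> aq b s x"
  unfolding aq_def
proof (intro sum_mono divide_left_mono)
  fix i :: 'a assume "i \<in> Basis"
  then have "b \<bullet> i > 0" by (rule assms)
  then show "s powr (2 * (b \<bullet> i)) \<le> t powr (2 * (b \<bullet> i))" using assms by (intro powr_mono2) auto
qed (use assms in auto)

lemma aq_strict_antimono:
  assumes b: "\<And>i. i \<in> Basis \<Longrightarrow> b \<bullet> i > 0" and "0 < s" "s < t" "x \<noteq> 0" shows "aq b t x < aq b s x"
  unfolding aq_def
proof (rule sum_strict_mono_ex1)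
  have lt: "s powr (2 * (b \<bullet> i)) < t powr (2 * (b \<bullet> i))" if "i \<in> Basis" for i
    using assms b[OF that] by (intro powr_less_mono2) auto
  show "\<forall>i\<in>Basis. (x \<bullet> i)\<^sup>2 / t powr (2 * (b \<bullet> i)) \<le> (x \<bullet> i)\<^sup>2 / s powr (2 * (b \<bullet> i))"
    using lt assms by (intro ballI divide_left_mono) (auto intro: less_imp_le)
  obtain i where i: "i \<in> Basis" "x \<bullet> i \<noteq> 0" using \<open>x \<noteq> 0\<close> euclidean_all_zero_iff by blast
  have "(x \<bullet> i)\<^sup>2 / t powr (2 * (b \<bullet> i)) < (x \<bullet> i)\<^sup>2 / s powr (2 * (b \<bullet> i))"
    using i lt[OF i(1)] assms by (intro divide_strict_left_mono) auto
  then show "\<exists>i\<in>Basis. (x \<bullet> i)\<^sup>2 / t powr (2 * (b \<bullet> i)) < (x \<bullet> i)\<^sup>2 / s powr (2 * (b \<bullet> i))" using i(1) by blast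
qed simp

text \<open>At t1 one summand alone equals 1, for large t the sum is below 1: the intermediate value
  theorem gives a solution, strict monotonicity its uniqueness.\<close>

lemma aniso_norm_unique:
  assumes b: "\<And>i. i \<in> Basis \<Longrightarrow> b \<bullet> i > 0" and x: "x \<noteq> 0"
  shows "aniso_norm b x > 0" "aq b (aniso_norm b x) x = 1"
proof -
  obtain i where i: "i \<in> Basis" "x \<bullet> i \<noteq> 0" using x euclidean_all_zero_iff by blast
  define t1 where "t1 = \<bar>x \<bullet> i\<bar> powr (1 / (b \<bullet> i))"
  have t1: "t1 > 0" using i by (simp add: t1_def)
  have "1 = (x \<bullet> i)\<^sup>2 / t1 powr (2 * (b \<bullet> i))"
  proof -
    have "t1 powr (2 * (b \<bullet> i)) = \<bar>x \<bullet> i\<bar> powr 2"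
      unfolding t1_def powr_powr using b[OF i(1)] by simp
    also have "\<dots> = (x \<bullet> i)\<^sup>2" using i by simp
    finally show ?thesis using i by simp
  qed
  also have "\<dots> \<le> aq b t1 x"
    unfolding aq_def by (rule member_le_sum[OF i(1)]) auto
  finally have g1: "1 \<le> aq b t1 x" .
  have "((\<lambda>t. aq b t x) \<longlongrightarrow> (\<Sum>i\<in>(Basis::'a set). 0)) at_top"
    unfolding aq_def
  proof (rule tendsto_sum)
    fix i :: 'a assume i: "i \<in> Basis"
    have "((\<lambda>t. (x \<bullet> i)\<^sup>2 * t powr (- (2 * (b \<bullet> i)))) \<longlongrightarrow> (x \<bullet> i)\<^sup>2 * 0) at_top"
      by (intro tendsto_mult tendsto_const tendsto_neg_powr filterlim_ident) (use b[OF i] in simp)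
    then show "((\<lambda>t. (x \<bullet> i)\<^sup>2 / t powr (2 * (b \<bullet> i))) \<longlongrightarrow> 0) at_top"
      by (simp add: powr_minus_divide)
  qed
  then have "eventually (\<lambda>t. aq b t x < 1) at_top" by (intro order_tendstoD(2)[where y = 0]) auto
  then have "eventually (\<lambda>t. aq b t x < 1 \<and> t > t1) at_top" by (intro eventually_conj eventually_gt_at_top)
  then obtain t2 where t2: "aq b t2 x < 1" "t2 > t1" using eventually_happens by force
  have cont: "continuous_on {t1..t2} (\<lambda>t. aq b t x)"
    unfolding aq_def using t1 by (intro continuous_intros) auto
  obtain t where t: "t1 \<le> t" "t \<le> t2" "aq b t x = 1"
    using IVT2'[of "\<lambda>t. aq b t x" t2 1 t1] g1 t2 cont by auto
  have uniq: "s = t" if "s > 0 \<and> aq b s x = 1" for s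
    using aq_strict_antimono[OF b, of s t x] aq_strict_antimono[OF b, of t s x] that t t1 x by (cases s t rule: linorder_cases) auto
  have "aniso_norm b x = t"
    unfolding aniso_norm_def using x uniq t t1
    by (simp add: aq_def[symmetric]) (rule the_equality, auto)
  then show "aniso_norm b x > 0" "aq b (aniso_norm b x) x = 1" using t t1 by auto
qed

lemma aniso_norm_le_iff:
  assumes b: "\<And>i. i \<in> Basis \<Longrightarrow> b \<bullet> i > 0" and t: "t > 0"
  shows "aniso_norm b x \<le> t \<longleftrightarrow> aq b t x \<le> 1"
proof (cases "x = 0")
  case True then show ?thesis using t by (simp add: aniso_norm_def aq_def)
next
  case False
  note u = aniso_norm_unique[OF b False]
  show ?thesis
    using aq_antimono[OF b u(1), of t x] aq_strict_antimono[OF b t, of "aniso_norm b x" x] u(2) False by force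
qed

lemma le_aniso_norm_iff:
  assumes b: "\<And>i. i \<in> Basis \<Longrightarrow> b \<bullet> i > 0" and t: "t > 0"
  shows "t \<le> aniso_norm b x \<longleftrightarrow> 1 \<le> aq b t x"
proof (cases "x = 0")
  case True then show ?thesis using t by (simp add: aniso_norm_def aq_def)
next
  case False
  note u = aniso_norm_unique[OF b False]
  show ?thesis
    using aq_antimono[OF b t, of "aniso_norm b x" x] aq_strict_antimono[OF b u(1), of t x] u(2) False by force
qed

section \<open>Littlewood-Paley functions\<close>

lemma anisotropy_ge_1: "anisotropy a \<Longrightarrow> i \<in> Basis \<Longrightarrow> a \<bullet> i \<ge> 1"
  unfolding anisotropy_def by (metis Min_le finite_Basis finite_imageI imageI)

text \<open>The partial sum of the Littlewood-Paley functions up to index j, by telescoping; see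
  \<open>sum_LP_fun\<close>.\<close>

definition LPc :: "'a::euclidean_space \<Rightarrow> ('a \<Rightarrow> complex) \<Rightarrow> nat \<Rightarrow> 'a \<Rightarrow> complex" where
  "LPc a \<psi> j x = \<psi> (aniso_dilation a (2 powr (- real j)) x)"

locale LP_setup =
  fixes a :: "'a::euclidean_space" and \<psi> :: "'a \<Rightarrow> complex"
  assumes aniso: "anisotropy a" and gen: "LP_generator a \<psi>"
begin

lemma a_pos: "i \<in> Basis \<Longrightarrow> a \<bullet> i > 0"
  using anisotropy_ge_1[OF aniso] by (smt (verit))

lemma \<psi>_test: "\<psi> \<in> test_functions" using gen by (simp add: LP_generator_def)

lemma \<psi>_one: "aq a 1 x \<le> 1 \<Longrightarrow> \<psi> x = 1"
  using gen aniso_norm_le_iff[OF a_pos, of 1 x] by (simp add: LP_generator_def)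

text \<open>For t = 1 the form \<open>aq\<close> is the squared Euclidean norm, whatever the weights
  are.\<close>

lemma \<psi>_unit: "norm x \<le> 1 \<Longrightarrow> \<psi> x = 1"
proof (rule \<psi>_one)
  assume "norm x \<le> 1"
  then have "(norm x)\<^sup>2 \<le> 1" by (simp add: power_le_one)
  then show "aq a 1 x \<le> 1"
    by (simp add: aq_def norm_square_sum)
qed

lemma \<psi>_zero: "1 \<le> aq a 2 x \<Longrightarrow> \<psi> x = 0"
  using gen le_aniso_norm_iff[OF a_pos, of 2 x] by (simp add: LP_generator_def)

lemma \<psi>_0: "\<psi> 0 = 1" by (rule \<psi>_unit) simp

lemma LPc_test: "LPc a \<psi> j \<in> test_functions"
  unfolding LPc_def[abs_def] by (rule test_functions_dilation[OF \<psi>_test]) simp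

lemma LPc_one: "aq a (2 ^ j) x \<le> 1 \<Longrightarrow> LPc a \<psi> j x = 1"
  unfolding LPc_def by (rule \<psi>_one) (simp add: aq_dilation powr_minus powr_realpow divide_inverse)

lemma LPc_zero: "1 \<le> aq a (2 ^ Suc j) x \<Longrightarrow> LPc a \<psi> j x = 0"
  unfolding LPc_def by (rule \<psi>_zero) (simp add: aq_dilation powr_minus powr_realpow divide_inverse)

lemma LP_fun_0: "LP_fun a \<psi> 0 = LPc a \<psi> 0"
  by (rule ext) (simp add: LP_fun_def LPc_def)

lemma LP_fun_Suc: "LP_fun a \<psi> (Suc j) = (\<lambda>x. LPc a \<psi> (Suc j) x - LPc a \<psi> j x)"
  by (rule ext) (simp add: LP_fun_def LPc_def)

lemma LP_fun_test: "LP_fun a \<psi> j \<in> test_functions"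
  by (cases j) (simp_all add: LP_fun_0 LP_fun_Suc LPc_test test_functions_diff)

lemma LP_fun_schwartz: "LP_fun a \<psi> j \<in> schwartz"
  by (rule test_functions_schwartz[OF LP_fun_test])

lemma LP_fun_zero: assumes "1 \<le> aq a (2 ^ Suc j) x" shows "LP_fun a \<psi> j x = 0"
proof (cases j)
  case (Suc i)
  have "aq a (2 ^ Suc j) x \<le> aq a (2 ^ j) x"
    by (rule aq_antimono[OF a_pos]) (auto intro: power_increasing)
  then have "LPc a \<psi> j x = 0" "LPc a \<psi> i x = 0" using assms Suc by (auto intro!: LPc_zero)
  then show ?thesis by (simp add: Suc LP_fun_Suc)
qed (use assms LPc_zero[of 0] in \<open>simp add: LP_fun_0\<close>)

lemma LP_fun_zero': assumes "aq a (2 ^ j) x \<le> 1" shows "LP_fun a \<psi> (Suc j) x = 0"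
proof -
  have "aq a (2 ^ Suc j) x \<le> aq a (2 ^ j) x"
    by (rule aq_antimono[OF a_pos]) (auto intro: power_increasing)
  then show ?thesis using assms by (simp add: LP_fun_Suc LPc_one)
qed

text \<open>Where phi_j does not vanish, \<open>aq\<close> at 2^(j+1) is below 1, so the partial sum
  of index j + 1 equals 1 there.\<close>

lemma LP_fun_mult_LPc: "LP_fun a \<psi> j \<xi> * LPc a \<psi> (Suc j) \<xi> = LP_fun a \<psi> j \<xi>"
  using LP_fun_zero[of j \<xi>] LPc_one[of "Suc j" \<xi>] by (cases "1 \<le> aq a (2 ^ Suc j) \<xi>") auto

lemma sum_LP_fun: "(\<Sum>j\<le>N. LP_fun a \<psi> j x) = LPc a \<psi> N x"
  by (induction N) (simp_all add: LP_fun_0 LP_fun_Suc)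

text \<open>Replaces the definite description by an explicit continuous convolution.\<close>

lemma LP_piece_eq:
  assumes "f \<in> tempered" shows "LP_piece a \<psi> j f = tconv f (kern (LP_fun a \<psi> j))"
  unfolding LP_piece_def fourier_multiplier_dist[OF assms LP_fun_schwartz]
  by (rule fun_of_dist_of_fun[OF continuous_tconv tempered_fun_tconv \<psi>_test \<psi>_0])
    (intro assms schwartz_kern LP_fun_schwartz)+

end

section \<open>Quasi-norm inequalities for band-limited functions\<close>

subsection \<open>Powers of extended nonnegative reals\<close>

lemma ennpowr_ennreal[simp]: "0 \<le> a \<Longrightarrow> ennpowr (ennreal a) r = ennreal (a powr r)"
  by (simp add: ennpowr_def)

lemma ennpowr_top[simp]: "ennpowr \<infinity> r = \<infinity>" "ennpowr top r = top"
  by (simp_all add: ennpowr_def)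

lemma ennpowr_0[simp]: "ennpowr 0 r = 0"
  using ennpowr_ennreal[of 0 r] by (simp del: ennpowr_ennreal add: ennpowr_def)

lemma ennpowr_mono:
  assumes "x \<le> y" "0 < r" shows "ennpowr x r \<le> ennpowr y r"
proof (cases y)
  case (real b)
  then obtain a where a: "x = ennreal a" "0 \<le> a" using assms(1) by (cases x) (auto simp: top_unique)
  then have "a \<le> b" using assms(1) real by (simp add: ennreal_le_iff)
  then show ?thesis using a real assms(2) by (simp add: ennreal_leI powr_mono2)
qed simp

lemma ennpowr_mult:
  assumes "0 < r" shows "ennpowr (x * y) r = ennpowr x r * ennpowr y r"
proof (cases "x = 0 \<or> y = 0")
  case True then show ?thesis by auto
next
  case False
  show ?thesis
  proof (cases x)
    case x: (real a)
    show ?thesis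
    proof (cases y)
      case y: (real b)
      then show ?thesis using x by (simp flip: ennreal_mult add: powr_mult)
    next
      case top
      moreover have "ennreal (a powr r) \<noteq> 0" using False x by auto
      ultimately show ?thesis using x False by (simp add: ennreal_mult_top)
    qed
  next
    case top
    show ?thesis
    proof (cases y)
      case y: (real b)
      moreover have "ennreal (b powr r) \<noteq> 0" using False y by auto
      ultimately show ?thesis using top False by (simp add: ennreal_top_mult)
    qed (use top in simp)
  qed
qed

lemma ennpowr_ennpowr: "ennpowr (ennpowr x r) s = ennpowr x (r * s)"
  by (cases x) (auto simp: powr_powr)

lemma ennpowr_1[simp]: "ennpowr x 1 = x"
  by (cases x) auto

lemma ennpowr_inverse: "0 < r \<Longrightarrow> ennpowr (ennpowr x r) (1 / r) = x" "0 < r \<Longrightarrow> ennpowr (ennpowr x (1 / r)) r = x"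
  by (simp_all add: ennpowr_ennpowr)

lemma ennpowr_less_top: "ennpowr x r < top \<longleftrightarrow> x < top"
  by (cases x) auto

lemma ennpowr_measurable[measurable]:
  assumes [measurable]: "f \<in> borel_measurable M"
  shows "(\<lambda>x. ennpowr (f x) r) \<in> borel_measurable M"
proof -
  have "{x \<in> space M. f x = \<infinity>} = f -` {\<infinity>} \<inter> space M" by auto
  then have "{x \<in> space M. f x = \<infinity>} \<in> sets M" using measurable_sets[OF assms, of "{\<infinity>}"] by simp
  moreover have "(\<lambda>x. ennreal (enn2real (f x) powr r)) \<in> borel_measurable M" by measurable
  ultimately show ?thesis unfolding ennpowr_def by (intro measurable_If) auto
qed

lemma ennpowr_Lp_norm: "0 < p \<Longrightarrow> ennpowr (Lp_norm p F) p = (\<integral>\<^sup>+x. ennpowr (F x) p \<partial>lborel)"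
  by (simp add: Lp_norm_def ennpowr_inverse)

lemma Lp_norm_real: "Lp_norm p (\<lambda>x. ennreal (norm (f x))) = ennpowr (\<integral>\<^sup>+x. ennreal (norm (f x) powr p) \<partial>lborel) (1 / p)"
  by (simp add: Lp_norm_def)

lemma ennreal_norm_integral_le:
  fixes f :: "'a \<Rightarrow> 'b::{banach, second_countable_topology}"
  shows "ennreal (norm (LINT x|M. f x)) \<le> (\<integral>\<^sup>+x. ennreal (norm (f x)) \<partial>M)"
  by (cases "integrable M f") (auto simp: integral_norm_bound_ennreal not_integrable_integral_eq)

subsection \<open>The Peetre--Stroemberg--Torchinsky inequality\<close>

text \<open>The maximal quantity M = sup_y |v y| / (1 + |x - y|)^N is bounded by itself: in the
  reproducing integral |v| = |v|^r |v|^(1-r), and the second factor is at most a weight times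
  M^(1-r). This gives M <= A M^(1-r) I with I the integral on the right. Division by M^(1-r)
  requires M to be finite, which is the purpose of the growth hypothesis with the same exponent
  N.\<close>

lemma peetre:
  fixes v K :: "'a::euclidean_space \<Rightarrow> complex"
  assumes vm[measurable]: "v \<in> borel_measurable borel"
    and A: "A > 0" "\<And>z. (1 + norm z) ^ N * norm (K z) \<le> A"
    and rep: "\<And>y. v y = (LINT z|lborel. K (y - z) * v z)"
    and growth: "\<And>y. norm (v y) \<le> B * (1 + norm y) ^ N"
    and r: "0 < r" "r < 1"
  shows "ennreal (norm (v y) powr r) \<le> ennreal (A * (1 + norm (x - y)) powr (real N * r)) *
     (\<integral>\<^sup>+z. ennreal (norm (v z) powr r * (1 + norm (x - z)) powr (- (real N * r))) \<partial>lborel)"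
    (is "_ \<le> _ * ?I")
proof (cases "?I = top")
  case True
  have "A * (1 + norm (x - y)) powr (real N * r) > 0"
    using A(1) by (intro mult_pos_pos) (auto simp: add_nonneg_eq_0_iff)
  then have "ennreal (A * (1 + norm (x - y)) powr (real N * r)) \<noteq> 0"
    unfolding ennreal_eq_0_iff by linarith
  then show ?thesis unfolding True by (simp only: ennreal_mult_top if_False top_greatest)
next
  case False
  define i where "i = enn2real ?I"
  have i: "?I = ennreal i" "0 \<le> i" using False by (auto simp: i_def less_top)
  have pos: "1 + norm z > 0" for z :: 'a by (simp add: add_pos_nonneg)
  define M where "M = (SUP y. norm (v y) / (1 + norm (x - y)) ^ N)"
  have B0: "0 \<le> B" using growth[of 0] order_trans[OF norm_ge_zero] by fastforce
  have bdd: "bdd_above (range (\<lambda>y. norm (v y) / (1 + norm (x - y)) ^ N))"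
  proof (rule bdd_aboveI2)
    fix y
    have "norm (v y) \<le> B * (1 + norm y) ^ N" by (rule growth)
    also have "\<dots> \<le> B * ((1 + norm x) * (1 + norm (x - y))) ^ N"
      using one_plus_norm_le[of y x] B0 by (intro mult_left_mono power_mono) (auto simp: norm_minus_commute)
    finally show "norm (v y) / (1 + norm (x - y)) ^ N \<le> B * (1 + norm x) ^ N"
      using pos[of "x - y"] by (simp add: pos_divide_le_eq power_mult_distrib mult.assoc)
  qed
  have le: "norm (v y) \<le> M * (1 + norm (x - y)) ^ N" for y
    using cSUP_upper[OF UNIV_I bdd, of y] pos[of "x - y"] unfolding M_def[symmetric] by (simp add: pos_divide_le_eq)
  have M0: "0 \<le> M"
    using le[of x] order_trans[OF norm_ge_zero] by fastforce
  have kern: "norm (K (y - z) * v z) \<le> A * M powr (1 - r) * (1 + norm (x - y)) ^ N *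
      (norm (v z) powr r * (1 + norm (x - z)) powr (- (real N * r)))" for y z
  proof (cases "v z = 0")
    case v0: False
    let ?a = "1 + norm (x - z)" and ?b = "1 + norm (x - y)" and ?c = "1 + norm (y - z)"
    have a: "?a \<le> ?b * ?c" using one_plus_norm_le[of "x - z" "x - y"] by (simp add: algebra_simps)
    have "norm (K (y - z)) * ?a ^ N \<le> norm (K (y - z)) * (?b * ?c) ^ N"
      by (intro mult_left_mono power_mono a) auto
    also have "\<dots> = (?c ^ N * norm (K (y - z))) * ?b ^ N" by (simp add: power_mult_distrib)
    also have "\<dots> \<le> A * ?b ^ N" by (intro mult_right_mono A) auto
    finally have K: "norm (K (y - z)) \<le> A * ?b ^ N / ?a ^ N" using pos[of "x - z"] by (simp add: pos_le_divide_eq)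
    have "norm (v z) = norm (v z) powr r * norm (v z) powr (1 - r)"
      using v0 by (simp flip: powr_add)
    also have "\<dots> \<le> norm (v z) powr r * (M * ?a ^ N) powr (1 - r)"
      using le[of z] r by (intro mult_left_mono powr_mono2) auto
    also have "\<dots> = norm (v z) powr r * (M powr (1 - r) * ?a powr (real N * (1 - r)))"
      using M0 pos[of "x - z"] by (simp add: powr_mult powr_powr flip: powr_realpow)
    finally have V: "norm (v z) \<le> norm (v z) powr r * (M powr (1 - r) * ?a powr (real N * (1 - r)))" .
    have "norm (K (y - z) * v z) \<le> (A * ?b ^ N / ?a ^ N) * (norm (v z) powr r * (M powr (1 - r) * ?a powr (real N * (1 - r))))"
      unfolding norm_mult by (intro mult_mono K V) (use A in auto)
    also have "\<dots> = A * M powr (1 - r) * ?b ^ N * (norm (v z) powr r * (?a powr (real N * (1 - r)) / ?a ^ N))"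
      by (simp add: mult_ac)
    also have "?a powr (real N * (1 - r)) / ?a ^ N = ?a powr (- (real N * r))"
      using pos[of "x - z"] by (simp add: powr_realpow[symmetric] powr_diff[symmetric] algebra_simps)
    finally show ?thesis .
  qed simp
  have est: "norm (v y) \<le> A * M powr (1 - r) * (1 + norm (x - y)) ^ N * i" for y
  proof -
    let ?c = "A * M powr (1 - r) * (1 + norm (x - y)) ^ N"
    have c0: "0 \<le> ?c" using A(1) by simp
    have "ennreal (norm (v y)) \<le> (\<integral>\<^sup>+z. ennreal (norm (K (y - z) * v z)) \<partial>lborel)"
      by (subst rep) (rule ennreal_norm_integral_le)
    also have "\<dots> \<le> (\<integral>\<^sup>+z. ennreal ?c * ennreal (norm (v z) powr r * (1 + norm (x - z)) powr (- (real N * r))) \<partial>lborel)"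
      using c0 by (intro nn_integral_mono) (auto simp flip: ennreal_mult intro!: ennreal_leI kern)
    also have "\<dots> = ennreal ?c * ?I" by (rule nn_integral_cmult) measurable
    also have "\<dots> = ennreal (?c * i)" using i c0 by (simp add: ennreal_mult)
    finally show ?thesis using i c0 by (simp add: ennreal_le_iff)
  qed
  have MA: "M \<le> A * M powr (1 - r) * i"
    unfolding M_def
  proof (rule cSUP_least)
    fix y
    show "norm (v y) / (1 + norm (x - y)) ^ N \<le> A * (SUP y. norm (v y) / (1 + norm (x - y)) ^ N) powr (1 - r) * i"
      using est[of y] pos[of "x - y"] unfolding M_def[symmetric] by (simp add: pos_divide_le_eq mult_ac)
  qed simp
  have Mr: "M powr r \<le> A * i"
  proof (cases "M = 0")
    case False
    then have Mp: "M > 0" using M0 by simp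
    have "M powr r * M powr (1 - r) = M" using Mp by (simp flip: powr_add)
    then have "M powr r * M powr (1 - r) \<le> (A * i) * M powr (1 - r)" using MA by (simp add: mult_ac)
    then show ?thesis using Mp by (simp add: mult_le_cancel_right)
  qed (use A i in simp)
  have "norm (v y) powr r \<le> (M * (1 + norm (x - y)) ^ N) powr r" using r by (intro powr_mono2 le) auto
  also have "\<dots> = M powr r * (1 + norm (x - y)) powr (real N * r)"
    using M0 pos[of "x - y"] by (simp add: powr_mult powr_powr flip: powr_realpow)
  also have "\<dots> \<le> A * i * (1 + norm (x - y)) powr (real N * r)" by (intro mult_right_mono Mr) auto
  finally have "norm (v y) powr r \<le> A * (1 + norm (x - y)) powr (real N * r) * i" by (simp add: mult_ac)
  then show ?thesis unfolding i(1) using A(1) i(2) by (simp flip: ennreal_mult add: ennreal_leI)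
qed

section \<open>Band-limited functions with p-th power integrable, p < 1\<close>

definition Lp_pow :: "real \<Rightarrow> ('a::euclidean_space \<Rightarrow> complex) \<Rightarrow> ennreal" where
  "Lp_pow p v = (\<integral>\<^sup>+z. ennreal (norm (v z) powr p) \<partial>lborel)"

text \<open>Functions whose spectrum lies in the set where the Fourier transform of \<open>K\<close> equals 1.\<close>

definition band_limited :: "('a::euclidean_space \<Rightarrow> complex) \<Rightarrow> ('a \<Rightarrow> complex) \<Rightarrow> bool" where
  "band_limited K v \<longleftrightarrow> v \<in> borel_measurable borel \<and> (\<forall>y. v y = (LINT z|lborel. K (y - z) * v z)) \<and>
     (\<exists>B N. \<forall>y. norm (v y) \<le> B * (1 + norm y) ^ N)"

lemma peetre_weight_le:
  assumes "real m \<le> s" shows "(1 + norm x) powr (- s) \<le> 1 / (1 + norm x) ^ m"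
proof -
  have "(1 + norm x) powr (- s) \<le> (1 + norm x) powr (- real m)" using assms by (intro powr_mono) auto
  also have "\<dots> = 1 / (1 + norm x) ^ m"
    by (simp add: powr_minus_divide powr_realpow add_pos_nonneg)
  finally show ?thesis .
qed

text \<open>Peetre's inequality is used twice. With the growth exponent N of \<open>v\<close> it
  shows that \<open>v\<close> is bounded, but the constant depends on N and so on \<open>v\<close>.
  Boundedness admits the exponent 0, and then the constant depends on \<open>K\<close> only.\<close>

lemma band_limited_sup:
  fixes K :: "'a::euclidean_space \<Rightarrow> complex"
  assumes K: "rapid K" and p: "0 < p" "p < 1"
  obtains C where "C > 0" "\<And>v y. band_limited K v \<Longrightarrow> Lp_pow p v < top \<Longrightarrow> ennreal (norm (v y) powr p) \<le> ennreal C * Lp_pow p v"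
proof -
  obtain A0 where A0: "A0 > 0" "\<And>x. (1 + norm x) ^ 0 * norm (K x) \<le> A0" using rapidE[OF K] by blast
  have "ennreal (norm (v y) powr p) \<le> ennreal A0 * Lp_pow p v" if v: "band_limited K v" and fin: "Lp_pow p v < top" for v y
  proof -
    obtain B N where BN: "\<And>y. norm (v y) \<le> B * (1 + norm y) ^ N" and vm[measurable]: "v \<in> borel_measurable borel"
      and rep: "\<And>y. v y = (LINT z|lborel. K (y - z) * v z)" using v unfolding band_limited_def by blast
    obtain A where A: "A > 0" "\<And>x. (1 + norm x) ^ N * norm (K x) \<le> A" using rapidE[OF K] by blast
    have "ennreal (norm (v y) powr p) \<le> ennreal A * Lp_pow p v" for y
    proof -
      have "ennreal (norm (v y) powr p) \<le> ennreal (A * (1 + norm (y - y)) powr (real N * p)) *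
        (\<integral>\<^sup>+z. ennreal (norm (v z) powr p * (1 + norm (y - z)) powr (- (real N * p))) \<partial>lborel)"
        by (rule peetre[OF vm A rep BN p])
      also have "\<dots> \<le> ennreal A * Lp_pow p v"
        unfolding Lp_pow_def
      proof (intro mult_mono nn_integral_mono ennreal_leI)
        fix z
        have "(1 + norm (y - z)) powr (- (real N * p)) \<le> 1"
          using peetre_weight_le[of 0 "real N * p" "y - z"] p by simp
        then show "norm (v z) powr p * (1 + norm (y - z)) powr (- (real N * p)) \<le> norm (v z) powr p"
          by (simp add: mult_left_le)
      qed auto
      finally show ?thesis .
    qed
    then have b1: "norm (v y) powr p \<le> enn2real (ennreal A * Lp_pow p v)" for y
      using fin by (metis ennreal_le_iff ennreal_mult_less_top enn2real_nonneg ennreal_enn2real ennreal_less_top)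
    define B' where "B' = enn2real (ennreal A * Lp_pow p v) powr (1 / p)"
    have bb: "norm (v y) \<le> B' * (1 + norm y) ^ 0" for y
    proof -
      have "norm (v y) = (norm (v y) powr p) powr (1 / p)" using p by (simp add: powr_powr)
      also have "\<dots> \<le> B'" unfolding B'_def using p by (intro powr_mono2 b1) auto
      finally show ?thesis by simp
    qed
    \<comment> \<open>The second application, with N = 0 and the bound \<open>bb\<close> just
      obtained.\<close>
    have "ennreal (norm (v y) powr p) \<le> ennreal (A0 * (1 + norm (y - y)) powr (real 0 * p)) *
        (\<integral>\<^sup>+z. ennreal (norm (v z) powr p * (1 + norm (y - z)) powr (- (real 0 * p))) \<partial>lborel)"
      by (rule peetre[OF vm A0 rep bb p])
    also have "\<dots> = ennreal A0 * Lp_pow p v" by (simp add: Lp_pow_def add_nonneg_eq_0_iff)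
    finally show ?thesis .
  qed
  then show thesis using that A0(1) by blast
qed

lemma band_limited_bounded:
  assumes K: "rapid K" and p: "0 < p" "p < 1" and v: "band_limited K v" "Lp_pow p v < top"
  obtains B where "\<And>y. norm (v y) \<le> B"
proof -
  obtain C where C: "C > 0" "\<And>y. ennreal (norm (v y) powr p) \<le> ennreal C * Lp_pow p v"
    using band_limited_sup[OF K p] v by metis
  have b1: "norm (v y) powr p \<le> enn2real (ennreal C * Lp_pow p v)" for y
    using C(2)[of y] v(2) by (metis ennreal_le_iff ennreal_mult_less_top enn2real_nonneg ennreal_enn2real ennreal_less_top)
  have "norm (v y) \<le> enn2real (ennreal C * Lp_pow p v) powr (1 / p)" for y
  proof -
    have "norm (v y) = (norm (v y) powr p) powr (1 / p)" using p by (simp add: powr_powr)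
    also have "\<dots> \<le> enn2real (ennreal C * Lp_pow p v) powr (1 / p)" using p by (intro powr_mono2 b1) auto
    finally show ?thesis by simp
  qed
  then show thesis using that by blast
qed

text \<open>Write |v| = |v|^(1-p) |v|^p and bound the first factor by the supremum.\<close>

lemma band_limited_L1:
  assumes K: "rapid K" and p: "0 < p" "p < 1"
  obtains C where "C > 0" "\<And>v. band_limited K v \<Longrightarrow> Lp_pow p v < top \<Longrightarrow>
    (\<integral>\<^sup>+z. ennreal (norm (v z)) \<partial>lborel) \<le> ennreal C * ennpowr (Lp_pow p v) (1 / p)"
proof -
  obtain C where C: "C > 0" "\<And>v y. band_limited K v \<Longrightarrow> Lp_pow p v < top \<Longrightarrow> ennreal (norm (v y) powr p) \<le> ennreal C * Lp_pow p v"
    using band_limited_sup[OF K p] by metis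
  have "(\<integral>\<^sup>+z. ennreal (norm (v z)) \<partial>lborel) \<le> ennreal (C powr ((1 - p) / p)) * ennpowr (Lp_pow p v) (1 / p)"
    if v: "band_limited K v" "Lp_pow p v < top" for v
  proof -
    have [measurable]: "v \<in> borel_measurable borel" using v unfolding band_limited_def by blast
    define s where "s = enn2real (Lp_pow p v)"
    have s: "Lp_pow p v = ennreal s" "0 \<le> s" using v(2) by (auto simp: s_def)
    have b: "norm (v y) powr p \<le> C * s" for y
      using C(2)[OF v, of y] C(1) s by (simp flip: ennreal_mult)
    have "norm (v z) \<le> (C * s) powr ((1 - p) / p) * norm (v z) powr p" for z
    proof (cases "v z = 0")
      case False
      have "norm (v z) powr (1 - p) = (norm (v z) powr p) powr ((1 - p) / p)" using p by (simp add: powr_powr)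
      also have "\<dots> \<le> (C * s) powr ((1 - p) / p)" using p by (intro powr_mono2 b) auto
      finally have "norm (v z) powr (1 - p) * norm (v z) powr p \<le> (C * s) powr ((1 - p) / p) * norm (v z) powr p"
        by (intro mult_right_mono) auto
      then show ?thesis using False by (simp flip: powr_add)
    qed simp
    then have "(\<integral>\<^sup>+z. ennreal (norm (v z)) \<partial>lborel) \<le> (\<integral>\<^sup>+z. ennreal ((C * s) powr ((1 - p) / p)) * ennreal (norm (v z) powr p) \<partial>lborel)"
      by (intro nn_integral_mono) (simp flip: ennreal_mult add: ennreal_leI)
    also have "\<dots> = ennreal ((C * s) powr ((1 - p) / p)) * Lp_pow p v"
      unfolding Lp_pow_def by (rule nn_integral_cmult) measurable
    also have "\<dots> = ennreal (C powr ((1 - p) / p) * (s powr ((1 - p) / p) * s))"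
      unfolding s using s C(1) by (simp flip: ennreal_mult add: powr_mult)
    also have "s powr ((1 - p) / p) * s = s powr (1 / p)"
    proof (cases "s = 0")
      case False
      then have "s powr ((1 - p) / p) * s powr 1 = s powr ((1 - p) / p + 1)" by (simp only: powr_add)
      also have "(1 - p) / p + 1 = 1 / p" using p by (simp add: field_simps)
      finally show ?thesis using s False by simp
    qed simp
    finally show ?thesis using s C(1) by (simp flip: ennreal_mult)
  qed
  moreover have "C powr ((1 - p) / p) > 0" using C by simp
  ultimately show thesis using that by blast
qed

text \<open>Takes the place of a maximal function: the convolution of |v|^p with an integrable
  weight, whose integral is a multiple of the p-th power integral of \<open>v\<close>
  (\<open>integral_Hconv\<close>).\<close>

definition Hconv :: "real \<Rightarrow> ('a::euclidean_space \<Rightarrow> complex) \<Rightarrow> 'a \<Rightarrow> ennreal" where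
  "Hconv p v x = (\<integral>\<^sup>+z. ennreal (norm (v z) powr p) * ennreal (1 / (1 + norm (x - z)) ^ (2 * DIM('a))) \<partial>lborel)"

definition W_int :: "'a::euclidean_space itself \<Rightarrow> real" where
  "W_int _ = enn2real (\<integral>\<^sup>+x. ennreal (1 / (1 + norm (x::'a)) ^ (2 * DIM('a))) \<partial>lborel)"

lemma W_int: "(\<integral>\<^sup>+x. ennreal (1 / (1 + norm (x::'a::euclidean_space)) ^ (2 * DIM('a))) \<partial>lborel) = ennreal (W_int TYPE('a))"
  using nn_integral_decay[where 'a = 'a] by (simp add: W_int_def less_top)

lemma W_int_nonneg[simp]: "0 \<le> W_int TYPE('a::euclidean_space)"
  by (simp add: W_int_def)

lemma W_int_reflect: "(\<integral>\<^sup>+z. ennreal (1 / (1 + norm (x - z :: 'a::euclidean_space)) ^ (2 * DIM('a))) \<partial>lborel) = ennreal (W_int TYPE('a))"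
  unfolding W_int[symmetric] by (rule nn_integral_reflect) measurable

lemma W_int_translate: "(\<integral>\<^sup>+x. ennreal (1 / (1 + norm (x - z :: 'a::euclidean_space)) ^ (2 * DIM('a))) \<partial>lborel) = ennreal (W_int TYPE('a))"
  unfolding W_int[symmetric] by (rule nn_integral_translate) measurable

lemma Hconv_measurable[measurable]:
  assumes [measurable]: "v \<in> borel_measurable borel" shows "Hconv p v \<in> borel_measurable borel"
  unfolding Hconv_def[abs_def] by measurable

lemma integral_Hconv:
  fixes v :: "'a::euclidean_space \<Rightarrow> complex"
  assumes [measurable]: "v \<in> borel_measurable borel"
  shows "(\<integral>\<^sup>+x. Hconv p v x \<partial>lborel) = ennreal (W_int TYPE('a)) * Lp_pow p v"
proof -
  have "(\<integral>\<^sup>+x. Hconv p v x \<partial>lborel) = (\<integral>\<^sup>+z. (\<integral>\<^sup>+x. ennreal (norm (v z) powr p) * ennreal (1 / (1 + norm (x - z :: 'a)) ^ (2 * DIM('a))) \<partial>lborel) \<partial>lborel)"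
    unfolding Hconv_def by (rule lborel_pair.Fubini') measurable
  also have "\<dots> = (\<integral>\<^sup>+z. ennreal (W_int TYPE('a)) * ennreal (norm (v z) powr p) \<partial>lborel)"
    by (subst nn_integral_cmult, measurable) (simp only: W_int_translate, simp only: mult.commute)
  also have "\<dots> = ennreal (W_int TYPE('a)) * Lp_pow p v"
    unfolding Lp_pow_def by (rule nn_integral_cmult) measurable
  finally show ?thesis .
qed

text \<open>For p < 1 a convolution is in general not controlled by p-th powers; here Peetre's
  inequality does it. N p >= 2 DIM turns its weight into that of \<open>Hconv\<close>, and the 2 DIM
  further powers in the final exponent make the integral in y converge.\<close>

lemma band_limited_conv:
  fixes K :: "'a::euclidean_space \<Rightarrow> complex"
  assumes K: "rapid K" and p: "0 < p" "p < 1"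
  obtains N C where "C > 0" "\<And>v x. band_limited K v \<Longrightarrow> Lp_pow p v < top \<Longrightarrow>
    ennpowr (\<integral>\<^sup>+y. ennreal (norm (v y) / (1 + norm (x - y)) ^ N) \<partial>lborel) p \<le> ennreal C * Hconv p v x"
proof -
  obtain N where N: "real N \<ge> real (2 * DIM('a)) / p" using real_arch_simple by blast
  then have Np: "real (2 * DIM('a)) \<le> real N * p" using p by (simp add: pos_divide_le_eq)
  obtain A where A: "A > 0" "\<And>x. (1 + norm x) ^ N * norm (K x) \<le> A" using rapidE[OF K] by blast
  let ?W = "W_int TYPE('a)"
  \<comment> \<open>\<open>W_int\<close> is only known to be non-negative, so the maximum with 1
    secures a positive constant; \<open>trace_unit\<close> does the same.\<close>
  let ?C = "max 1 (A * ?W powr p)"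
  have "ennpowr (\<integral>\<^sup>+y. ennreal (norm (v y) / (1 + norm (x - y)) ^ (N + 2 * DIM('a))) \<partial>lborel) p \<le> ennreal ?C * Hconv p v x"
    if v: "band_limited K v" and fin: "Lp_pow p v < top" for v x
  proof -
    have vm[measurable]: "v \<in> borel_measurable borel"
      and rep: "\<And>y. v y = (LINT z|lborel. K (y - z) * v z)" using v unfolding band_limited_def by blast+
    obtain B where B: "\<And>y. norm (v y) \<le> B" using band_limited_bounded[OF K p v fin] by blast
    have BN: "norm (v y) \<le> \<bar>B\<bar> * (1 + norm y) ^ N" for y
    proof -
      have "norm (v y) \<le> \<bar>B\<bar> * 1" using B[of y] by simp
      also have "\<dots> \<le> \<bar>B\<bar> * (1 + norm y) ^ N" by (intro mult_left_mono) auto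
      finally show ?thesis .
    qed
    let ?H = "Hconv p v x"
    have pe: "ennreal (norm (v y) powr p) \<le> ennreal (A * (1 + norm (x - y)) powr (real N * p)) * ?H" for y
    proof -
      have "ennreal (norm (v y) powr p) \<le> ennreal (A * (1 + norm (x - y)) powr (real N * p)) *
        (\<integral>\<^sup>+z. ennreal (norm (v z) powr p * (1 + norm (x - z)) powr (- (real N * p))) \<partial>lborel)"
        by (rule peetre[OF vm A rep BN p])
      also have "\<dots> \<le> ennreal (A * (1 + norm (x - y)) powr (real N * p)) * ?H"
        unfolding Hconv_def
      proof (intro mult_left_mono nn_integral_mono)
        fix z
        show "ennreal (norm (v z) powr p * (1 + norm (x - z)) powr (- (real N * p))) \<le>
          ennreal (norm (v z) powr p) * ennreal (1 / (1 + norm (x - z)) ^ (2 * DIM('a)))"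
          by (subst ennreal_mult[symmetric], simp, simp)
            (intro ennreal_leI mult_left_mono peetre_weight_le Np, simp)
      qed simp
      finally show ?thesis .
    qed
    have pt: "ennreal (norm (v y) / (1 + norm (x - y)) ^ (N + 2 * DIM('a))) \<le>
      ennpowr (ennreal A * ?H) (1 / p) * ennreal (1 / (1 + norm (x - y)) ^ (2 * DIM('a)))" for y
    proof -
      have pos: "1 + norm (x - y) > 0" by (simp add: add_pos_nonneg)
      have "ennreal (norm (v y)) = ennpowr (ennreal (norm (v y) powr p)) (1 / p)" using p by (simp add: powr_powr)
      also have "\<dots> \<le> ennpowr (ennreal (A * (1 + norm (x - y)) powr (real N * p)) * ?H) (1 / p)"
        using p by (intro ennpowr_mono pe) auto
      also have "\<dots> = ennpowr (ennreal ((1 + norm (x - y)) powr (real N * p))) (1 / p) * ennpowr (ennreal A * ?H) (1 / p)"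
      proof -
        have e: "ennreal (A * q) * ?H = ennreal q * (ennreal A * ?H)" if "0 \<le> q" for q
          using that A(1) by (simp add: ennreal_mult mult_ac)
        show ?thesis unfolding e[OF powr_ge_zero] by (rule ennpowr_mult) (use p in simp)
      qed
      also have "ennpowr (ennreal ((1 + norm (x - y)) powr (real N * p))) (1 / p) = ennreal ((1 + norm (x - y)) ^ N)"
        using p pos by (simp add: powr_powr powr_realpow)
      finally have "ennreal (norm (v y)) \<le> ennreal ((1 + norm (x - y)) ^ N) * ennpowr (ennreal A * ?H) (1 / p)" .
      note 1 = mult_right_mono[OF this, of "ennreal (1 / (1 + norm (x - y)) ^ (N + 2 * DIM('a)))"]
      have 2: "ennreal (norm (v y)) * ennreal (1 / (1 + norm (x - y)) ^ (N + 2 * DIM('a))) = ennreal (norm (v y) / (1 + norm (x - y)) ^ (N + 2 * DIM('a)))"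
        by (simp flip: ennreal_mult')
      from 1 
      have "ennreal (norm (v y) / (1 + norm (x - y)) ^ (N + 2 * DIM('a))) \<le>
         ennpowr (ennreal A * ?H) (1 / p) * (ennreal ((1 + norm (x - y)) ^ N) * ennreal (1 / (1 + norm (x - y)) ^ (N + 2 * DIM('a))))"
        unfolding 2 by (simp only: mult_ac) simp
      also have "ennreal ((1 + norm (x - y)) ^ N) * ennreal (1 / (1 + norm (x - y)) ^ (N + 2 * DIM('a))) = ennreal (1 / (1 + norm (x - y)) ^ (2 * DIM('a)))"
        using pos by (subst ennreal_mult[symmetric]) (auto simp: power_add)
      finally show ?thesis .
    qed
    have "(\<integral>\<^sup>+y. ennreal (norm (v y) / (1 + norm (x - y)) ^ (N + 2 * DIM('a))) \<partial>lborel)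
      \<le> (\<integral>\<^sup>+y. ennpowr (ennreal A * ?H) (1 / p) * ennreal (1 / (1 + norm (x - y)) ^ (2 * DIM('a))) \<partial>lborel)"
      by (intro nn_integral_mono pt)
    also have "\<dots> = ennpowr (ennreal A * ?H) (1 / p) * ennreal ?W"
      by (subst nn_integral_cmult, measurable) (simp only: W_int_reflect)
    finally have "ennpowr (\<integral>\<^sup>+y. ennreal (norm (v y) / (1 + norm (x - y)) ^ (N + 2 * DIM('a))) \<partial>lborel) p
      \<le> ennpowr (ennpowr (ennreal A * ?H) (1 / p) * ennreal ?W) p" using p by (intro ennpowr_mono) auto
    also have "\<dots> = ennreal (A * ?W powr p) * ?H"
      unfolding ennpowr_mult[OF p(1), of "ennpowr (ennreal A * ?H) (1 / p)"] ennpowr_inverse(2)[OF p(1)]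
      using A(1) by (simp add: ennreal_mult mult_ac)
    also have "\<dots> \<le> ennreal ?C * ?H" by (intro mult_right_mono ennreal_leI) auto
    finally show ?thesis .
  qed
  then show thesis using that[of ?C "N + 2 * DIM('a)"] by simp
qed

lemma borel_measurable_fst_snd[measurable (raw)]:
  fixes f :: "'c \<Rightarrow> 'a::second_countable_topology \<times> 'b::second_countable_topology"
  assumes "f \<in> borel_measurable M"
  shows "(\<lambda>x. fst (f x)) \<in> borel_measurable M" "(\<lambda>x. snd (f x)) \<in> borel_measurable M"
  by (rule measurable_compose[OF assms], intro borel_measurable_continuous_onI continuous_intros)+

subsection \<open>Weights in the last variable\<close>

text \<open>\<open>th\<close> weights a piece in the trace estimate. \<open>om\<close> is its
  partner in the Cauchy-Schwarz inequality, singular at 0 but integrable. \<open>mn\<close> is the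
  majorant of \<open>th\<close> that is summed over the scales.\<close>

definition th :: "real \<Rightarrow> real" where "th t = \<bar>t\<bar> powr (1/2) / (1 + \<bar>t\<bar>) ^ 2"
definition om :: "real \<Rightarrow> real" where "om t = \<bar>t\<bar> powr (- (1/2)) / (1 + \<bar>t\<bar>) ^ 2"
definition mn :: "real \<Rightarrow> real" where "mn t = min (\<bar>t\<bar> powr (1/2)) (\<bar>t\<bar> powr (- (1/2)))"

lemma th_nonneg[simp]: "0 \<le> th t" and om_nonneg[simp]: "0 \<le> om t" and mn_nonneg[simp]: "0 \<le> mn t"
  by (simp_all add: th_def om_def mn_def)

lemma th_measurable[measurable]: "th \<in> borel_measurable borel" "om \<in> borel_measurable borel" "mn \<in> borel_measurable borel"
  unfolding th_def[abs_def] om_def[abs_def] mn_def[abs_def] by measurable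

lemma th_le_mn: assumes "t \<noteq> 0" shows "th t \<le> mn t"
proof -
  have t: "\<bar>t\<bar> > 0" using assms by simp
  have sq: "(1 + \<bar>t\<bar>) ^ 2 \<ge> 1" "(1 + \<bar>t\<bar>) ^ 2 \<ge> \<bar>t\<bar>"
    using t by (auto simp: power2_eq_square algebra_simps)
  have "th t \<le> \<bar>t\<bar> powr (1/2)"
    unfolding th_def using sq(1) by (simp add: divide_le_eq mult_le_cancel_left1)
  moreover have "th t \<le> \<bar>t\<bar> powr (- (1/2))"
  proof -
    have "th t \<le> \<bar>t\<bar> powr (1/2) / \<bar>t\<bar>"
      unfolding th_def using sq(2) t by (intro divide_left_mono) auto
    also have "\<dots> = \<bar>t\<bar> powr (1/2 - 1)" using t by (subst powr_diff) simp
    finally show ?thesis by simp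
  qed
  ultimately show ?thesis by (simp add: mn_def)
qed

text \<open>With l = log_2 |t| the two entries of the minimum are 2^(l/2) and 2^(-l/2). Dilations of
  t become translations of l, and sums over scales become geometric.\<close>

lemma mn_eq: assumes "t \<noteq> 0" shows "mn t = 2 powr (- \<bar>log 2 \<bar>t\<bar>\<bar> / 2)"
proof -
  define l where "l = log 2 \<bar>t\<bar>"
  have t: "\<bar>t\<bar> = 2 powr l" using assms by (simp add: l_def)
  show ?thesis unfolding mn_def t using assms
    by (simp add: powr_powr l_def[symmetric] min_def abs_if)
qed

lemma geometric_sum_le:
  assumes "0 \<le> r" "r < (1::real)" shows "(\<Sum>i<k. r ^ i) \<le> 1 / (1 - r)"
proof -
  have "(\<Sum>i<k. r ^ i) = (1 - r ^ k) / (1 - r)" using assms by (simp add: sum_gp_strict)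
  also have "\<dots> \<le> 1 / (1 - r)" using assms by (intro divide_right_mono) auto
  finally show ?thesis .
qed

lemma two_sided_geometric:
  assumes r: "0 < r" "r < (1::real)"
  shows "(\<Sum>j<n. r powr \<bar>real j - \<mu>\<bar>) \<le> 2 / (1 - r)"
proof -
  \<comment> \<open>The first index not below \<open>\<mu>\<close>. For negative
    \<open>\<mu>\<close> it is 0, and the left half of the sum is then empty.\<close>
  define m where "m = nat \<lceil>\<mu>\<rceil>"
  have m: "\<mu> \<le> real m" unfolding m_def by linarith
  have m': "real m - 1 \<le> \<mu>" if "j < m" for j using that unfolding m_def by linarith
  have "r powr \<bar>real j - \<mu>\<bar> \<le> (if m \<le> j then r ^ (j - m) else 0) + (if j < m then r ^ (m - Suc j) else 0)" for j
  proof (cases "m \<le> j")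
    case True
    have "r powr \<bar>real j - \<mu>\<bar> \<le> r powr real (j - m)" using r m True by (intro powr_mono') auto
    then show ?thesis using True r by (simp add: powr_realpow del: of_nat_diff)
  next
    case False
    have "r powr \<bar>real j - \<mu>\<bar> \<le> r powr real (m - Suc j)"
      using r m'[of j] False by (intro powr_mono') (auto simp: of_nat_diff)
    then show ?thesis using False r by (simp add: powr_realpow del: of_nat_diff)
  qed
  then have "(\<Sum>j<n. r powr \<bar>real j - \<mu>\<bar>) \<le> (\<Sum>j<n. (if m \<le> j then r ^ (j - m) else 0) + (if j < m then r ^ (m - Suc j) else 0))"
    by (intro sum_mono) auto
  also have "\<dots> = (\<Sum>j<n. (if m \<le> j then r ^ (j - m) else 0)) + (\<Sum>j<n. (if j < m then r ^ (m - Suc j) else 0))"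
    by (rule sum.distrib)
  also have "(\<Sum>j<n. (if m \<le> j then r ^ (j - m) else 0)) = (\<Sum>i<n - m. r ^ i)"
    by (induction n) (auto simp: Suc_diff_le)
  also have "\<dots> \<le> 1 / (1 - r)" using r by (intro geometric_sum_le) auto
  also have "(\<Sum>j<n. (if j < m then r ^ (m - Suc j) else 0)) \<le> (\<Sum>j<m. r ^ (m - Suc j))"
  proof -
    have "(\<Sum>j<n. (if j < m then r ^ (m - Suc j) else 0)) = (\<Sum>j\<in>{..<n} \<inter> {..<m}. r ^ (m - Suc j))"
      by (subst sum.inter_restrict) auto
    also have "\<dots> \<le> (\<Sum>j<m. r ^ (m - Suc j))" using r by (intro sum_mono2) auto
    finally show ?thesis .
  qed
  also have "(\<Sum>j<m. r ^ (m - Suc j)) = (\<Sum>i<m. r ^ i)" by (rule sum.nat_diff_reindex)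
  also have "\<dots> \<le> 1 / (1 - r)" using r by (intro geometric_sum_le) auto
  finally show ?thesis by simp
qed

text \<open>log_2 |2^(j alpha) t| = alpha (j - mu), where only mu depends on t; the bound for the
  two-sided geometric series does not depend on mu.\<close>

lemma sum_mn_le:
  assumes \<alpha>: "\<alpha> > 0" and q: "q > 0"
  obtains C where "C > 0" "\<And>t. t \<noteq> 0 \<Longrightarrow> (\<Sum>j. ennreal (mn (2 powr (real j * \<alpha>) * t) powr q)) \<le> ennreal C"
proof -
  define r where "r = (2::real) powr (- (\<alpha> * q / 2))"
  have r: "0 < r" "r < 1" using \<alpha> q by (auto simp: r_def powr_less_cancel_iff[of 2 _ 0, simplified])
  have "(\<Sum>j. ennreal (mn (2 powr (real j * \<alpha>) * t) powr q)) \<le> ennreal (2 / (1 - r))" if t: "t \<noteq> 0" for t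
  proof -
    define \<mu> where "\<mu> = - log 2 \<bar>t\<bar> / \<alpha>"
    have eq: "mn (2 powr (real j * \<alpha>) * t) powr q = r powr \<bar>real j - \<mu>\<bar>" for j
    proof -
      have "log 2 \<bar>2 powr (real j * \<alpha>) * t\<bar> = real j * \<alpha> + log 2 \<bar>t\<bar>"
        using t by (simp add: abs_mult log_mult)
      also have "\<dots> = \<alpha> * (real j - \<mu>)" using \<alpha> by (simp add: \<mu>_def field_simps)
      finally have "mn (2 powr (real j * \<alpha>) * t) = 2 powr (- (\<alpha> * \<bar>real j - \<mu>\<bar>) / 2)"
        using t \<alpha> by (simp add: mn_eq abs_mult)
      then show ?thesis by (simp add: r_def powr_powr algebra_simps)
    qed
    have "(\<Sum>j<n. ennreal (mn (2 powr (real j * \<alpha>) * t) powr q)) \<le> ennreal (2 / (1 - r))" for n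
      unfolding eq by (subst sum_ennreal, simp) (rule ennreal_leI[OF two_sided_geometric[OF r]])
    then show ?thesis unfolding suminf_eq_SUP by (rule SUP_least)
  qed
  moreover have "2 / (1 - r) > 0" using r by simp
  ultimately show thesis using that by blast
qed

lemma nn_integral_om: "(\<integral>\<^sup>+t. ennreal (om t) \<partial>lborel) < top"
proof -
  let ?f = "\<lambda>t::real. if t \<in> {0..1} then t powr (- (1/2)) else 0"
  have "((\<lambda>t::real. t powr (- (1/2))) has_integral (1 powr (- (1/2) + 1) / (- (1/2) + 1))) {0..1}"
    by (rule has_integral_powr_from_0) auto
  then have "(?f has_integral 2) UNIV" by (subst has_integral_restrict_UNIV) simp
  then have 1: "(\<integral>\<^sup>+t. ennreal (?f t) \<partial>lborel) = ennreal 2"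
    by (intro nn_integral_has_integral_lborel) auto
  have 2: "(\<integral>\<^sup>+t. ennreal (?f (- t)) \<partial>lborel) = ennreal 2"
    using nn_integral_reflect[of "\<lambda>t. ennreal (?f t)" 0] 1 unfolding diff_0 by simp
  have "om t \<le> ?f t + ?f (- t) + 1 / (1 + \<bar>t\<bar>) ^ 2" for t
  proof (cases "\<bar>t\<bar> \<le> 1")
    case True
    have "om t \<le> \<bar>t\<bar> powr (- (1/2))"
      unfolding om_def by (simp add: divide_le_eq mult_le_cancel_left1)
    also have "\<dots> \<le> ?f t + ?f (- t)" using True by (auto simp: abs_if)
    also have "\<dots> \<le> ?f t + ?f (- t) + 1 / (1 + \<bar>t\<bar>) ^ 2" by simp
    finally show ?thesis .
  next
    case False
    then have "\<bar>t\<bar> powr (- (1/2)) \<le> \<bar>t\<bar> powr 0" by (intro powr_mono) auto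
    then have "\<bar>t\<bar> powr (- (1/2)) \<le> 1" using False by (cases "t = 0") auto
    then have "om t \<le> 1 / (1 + \<bar>t\<bar>) ^ 2" unfolding om_def by (intro divide_right_mono) auto
    moreover have "0 \<le> ?f t" "0 \<le> ?f (- t)" by auto
    ultimately show ?thesis by linarith
  qed
  then have "(\<integral>\<^sup>+t. ennreal (om t) \<partial>lborel) \<le> (\<integral>\<^sup>+t. ennreal (?f t) + ennreal (?f (- t)) + ennreal (1 / (1 + \<bar>t\<bar>) ^ 2) \<partial>lborel)"
    by (intro nn_integral_mono) (simp flip: ennreal_plus add: ennreal_leI)
  also have "\<dots> = ennreal 2 + ennreal 2 + (\<integral>\<^sup>+t. ennreal (1 / (1 + \<bar>t\<bar>) ^ 2) \<partial>lborel)"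
    by (subst nn_integral_add, measurable, subst nn_integral_add, measurable) (simp only: 1 2)
  also have "\<dots> < top" using nn_integral_inverse_square by (simp add: less_top)
  finally show ?thesis .
qed

lemma nn_integral_prod_lborel:
  fixes f :: "'a::euclidean_space \<times> 'b::euclidean_space \<Rightarrow> ennreal"
  assumes [measurable]: "f \<in> borel_measurable borel"
  shows "(\<integral>\<^sup>+z. f z \<partial>lborel) = (\<integral>\<^sup>+x. (\<integral>\<^sup>+y. f (x, y) \<partial>lborel) \<partial>lborel)"
    and "(\<integral>\<^sup>+z. f z \<partial>lborel) = (\<integral>\<^sup>+y. (\<integral>\<^sup>+x. f (x, y) \<partial>lborel) \<partial>lborel)"
proof -
  have f: "f \<in> borel_measurable (lborel \<Otimes>\<^sub>M lborel)" by (simp add: lborel_prod)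
  show "(\<integral>\<^sup>+z. f z \<partial>lborel) = (\<integral>\<^sup>+x. (\<integral>\<^sup>+y. f (x, y) \<partial>lborel) \<partial>lborel)"
    unfolding lborel_prod[symmetric] by (rule lborel.nn_integral_fst[OF f, symmetric])
  show "(\<integral>\<^sup>+z. f z \<partial>lborel) = (\<integral>\<^sup>+y. (\<integral>\<^sup>+x. f (x, y) \<partial>lborel) \<partial>lborel)"
    unfolding lborel_prod[symmetric] by (rule lborel_pair.nn_integral_snd[symmetric]) (use f in simp)
qed

text \<open>On x_n = 0 the convention 0 powr r = 0 breaks the identities between the weights, so
  they are used off this null set.\<close>

lemma AE_snd_nonzero: "AE z in lborel. snd (z :: 'a::euclidean_space \<times> real) \<noteq> 0"
proof -
  have "negligible {z :: 'a \<times> real. z \<bullet> (0, 1) = 0}"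
    by (rule negligible_standard_hyperplane) (simp add: Basis_prod_def)
  then have n: "{z :: 'a \<times> real. snd z = 0} \<in> null_sets lebesgue"
    by (simp add: negligible_iff_null_sets inner_prod_def)
  have b: "{z :: 'a \<times> real. snd z = 0} \<in> sets lborel"
    unfolding sets_lborel by (intro borel_closed closed_Collect_eq continuous_intros)
  then have "{z :: 'a \<times> real. snd z = 0} \<in> null_sets lborel" using n null_sets_completion_iff by blast
  then show ?thesis using AE_iff_null_sets[OF b] by simp
qed

lemma norm_Pair_ge: "norm x \<le> norm (x, y)" "norm y \<le> norm (x, y)"
  by (simp_all add: norm_Pair real_le_rsqrt)

lemma weight_prod_le:
  fixes u :: "'a::real_normed_vector" and \<tau> :: real
  shows "1 / (1 + norm (u, \<tau>)) ^ (k + m) \<le> 1 / (1 + norm u) ^ k * (1 / (1 + \<bar>\<tau>\<bar>) ^ m)"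
proof -
  have "(1 + norm u) ^ k * (1 + \<bar>\<tau>\<bar>) ^ m \<le> (1 + norm (u, \<tau>)) ^ k * (1 + norm (u, \<tau>)) ^ m"
    using norm_Pair_ge(1)[of u \<tau>] norm_Pair_ge(2)[of \<tau> u] by (intro mult_mono power_mono) auto
  moreover have "0 < (1 + norm u) ^ k * (1 + \<bar>\<tau>\<bar>) ^ m" by (intro mult_pos_pos zero_less_power) (auto simp: add_pos_nonneg)
  ultimately have "1 / (1 + norm (u, \<tau>)) ^ (k + m) \<le> 1 / ((1 + norm u) ^ k * (1 + \<bar>\<tau>\<bar>) ^ m)"
    unfolding power_add by (intro divide_left_mono mult_pos_pos) (auto simp: add_pos_nonneg)
  then show ?thesis by simp
qed

text \<open>The factor \<open>|x\<^sub>n|\<^sup>1\<^sup>/\<^sup>2\<close>, which removes the logarithmic divergence at \<open>x\<^sub>n = 0\<close> when the scales are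
  summed, is gained by applying the Peetre inequality with exponent \<open>p/2\<close> and then the
  Cauchy--Schwarz inequality.\<close>

lemma trace_unit:
  fixes K :: "'b::euclidean_space \<times> real \<Rightarrow> complex"
  assumes K: "rapid K" and p: "0 < p" "p < 1"
  obtains C where "C > 0" "\<And>v. band_limited K v \<Longrightarrow> Lp_pow p v < top \<Longrightarrow>
    Lp_pow p (\<lambda>x'. v (x', 0)) \<le> ennreal C * (\<integral>\<^sup>+z. ennreal (norm (v z) powr p) * ennreal (th (snd z)) \<partial>lborel)"
proof -
  let ?D = "2 * DIM('b)"
  let ?w1 = "\<lambda>u::'b. 1 / (1 + norm u) ^ ?D" and ?w2 = "\<lambda>t::real. 1 / (1 + \<bar>t\<bar>) ^ 2"
  let ?r = "p / 2"
  have r: "0 < ?r" "?r < 1" using p by auto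
  \<comment> \<open>Enough decay to split off 2 DIM powers in x' and two powers in x_n, even at
    exponent p/2.\<close>
  obtain N where N: "real N \<ge> real (?D + 2) / ?r" using real_arch_simple by blast
  then have Np: "real (?D + 2) \<le> real N * ?r" using r by (simp add: pos_divide_le_eq)
  obtain A where A: "A > 0" "\<And>x. (1 + norm x) ^ N * norm (K x) \<le> A" using rapidE[OF K] by blast
  define \<Omega> where "\<Omega> = enn2real (\<integral>\<^sup>+t. ennreal (om t) \<partial>lborel)"
  have \<Omega>: "(\<integral>\<^sup>+t. ennreal (om t) \<partial>lborel) = ennreal \<Omega>" "0 \<le> \<Omega>" using nn_integral_om by (auto simp: \<Omega>_def)
  let ?W = "W_int TYPE('b)"
  let ?C = "A\<^sup>2 * (?W * \<Omega>) * ?W"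
  have "Lp_pow p (\<lambda>x'. v (x', 0)) \<le> ennreal (max 1 ?C) * (\<integral>\<^sup>+z. ennreal (norm (v z) powr p) * ennreal (th (snd z)) \<partial>lborel)"
    if v: "band_limited K v" and fin: "Lp_pow p v < top" for v
  proof -
    have vm[measurable]: "v \<in> borel_measurable borel"
      and rep: "\<And>y. v y = (LINT z|lborel. K (y - z) * v z)" using v unfolding band_limited_def by blast+
    obtain B where B: "\<And>y. norm (v y) \<le> B" using band_limited_bounded[OF K p v fin] by blast
    have BN: "norm (v y) \<le> \<bar>B\<bar> * (1 + norm y) ^ N" for y
    proof -
      have "norm (v y) \<le> \<bar>B\<bar> * 1" using B[of y] by simp
      also have "\<dots> \<le> \<bar>B\<bar> * (1 + norm y) ^ N" by (intro mult_left_mono) auto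
      finally show ?thesis .
    qed
    let ?F = "\<lambda>x' z. ennreal (norm (v z) powr p) * ennreal (th (snd z)) * ennreal (?w1 (x' - fst z))"
    have pt: "ennreal (norm (v (x', 0)) powr p) \<le> ennreal (A\<^sup>2 * (?W * \<Omega>)) * (\<integral>\<^sup>+z. ?F x' z \<partial>lborel)" for x'
    proof -
      let ?x = "(x', 0) :: 'b \<times> real"
      \<comment> \<open>The square of \<open>s\<close> is the product weight. Distributing |t|^(1/4)
        and |t|^(-1/4) over \<open>f\<close> and \<open>g\<close> makes the square of
        \<open>g\<close> carry the integrable weight \<open>om\<close> and that of \<open>f\<close>
        the weight \<open>th\<close>.\<close>
      define s where "s z = sqrt (?w1 (x' - fst z)) * (1 / (1 + \<bar>snd z\<bar>))" for z :: "'b \<times> real"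
      define f where "f z = norm (v z) powr ?r * (\<bar>snd z\<bar> powr (1/4) * s z)" for z
      define g where "g z = \<bar>snd z\<bar> powr (- (1/4)) * s z" for z :: "'b \<times> real"
      have s0: "0 \<le> s z" for z by (simp add: s_def)
      have s2: "(s z)\<^sup>2 = ?w1 (x' - fst z) * ?w2 (snd z)" for z
        unfolding s_def power_mult_distrib by (simp add: power_divide)
      have [measurable]: "s \<in> borel_measurable borel" unfolding s_def[abs_def] by measurable
      have [measurable]: "f \<in> borel_measurable borel" "g \<in> borel_measurable borel"
        unfolding f_def[abs_def] g_def[abs_def] by measurable
      have "ennreal (norm (v ?x) powr ?r) \<le> ennreal (A * (1 + norm (?x - ?x)) powr (real N * ?r)) *
        (\<integral>\<^sup>+z. ennreal (norm (v z) powr ?r * (1 + norm (?x - z)) powr (- (real N * ?r))) \<partial>lborel)"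
        by (rule peetre[OF vm A rep BN r])
      also have "\<dots> \<le> ennreal A * (\<integral>\<^sup>+z. ennreal (f z) * ennreal (g z) \<partial>lborel)"
      proof (intro mult_mono nn_integral_mono_AE)
        show "AE z in lborel. ennreal (norm (v z) powr ?r * (1 + norm (?x - z)) powr (- (real N * ?r))) \<le> ennreal (f z) * ennreal (g z)"
          using AE_snd_nonzero
        proof eventually_elim
          case (elim z)
          obtain z' t where z: "z = (z', t)" by (cases z)
          have t: "\<bar>t\<bar> > 0" using elim z by simp
          have "(1 + norm (?x - z)) powr (- (real N * ?r)) \<le> 1 / (1 + norm (?x - z)) ^ (?D + 2)"
            by (rule peetre_weight_le[OF Np])
          also have "\<dots> \<le> ?w1 (x' - z') * ?w2 t"
            using weight_prod_le[of "x' - z'" "- t" ?D 2] by (simp add: z)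
          finally have w: "(1 + norm (?x - z)) powr (- (real N * ?r)) \<le> (s z)\<^sup>2" by (simp add: s2 z)
          have "f z * g z = norm (v z) powr ?r * (\<bar>t\<bar> powr (1/4) * \<bar>t\<bar> powr (- (1/4))) * (s z)\<^sup>2"
            unfolding f_def g_def by (simp add: z power2_eq_square)
          also have "\<bar>t\<bar> powr (1/4) * \<bar>t\<bar> powr (- (1/4)) = 1" using t by (simp flip: powr_add)
          finally have fg: "f z * g z = norm (v z) powr ?r * (s z)\<^sup>2" by simp
          have "0 \<le> f z" "0 \<le> g z" using s0 by (auto simp: f_def g_def)
          then show ?case
            by (subst ennreal_mult[symmetric]) (auto simp only: fg intro!: ennreal_leI mult_left_mono w powr_ge_zero)
        qed
      qed auto
      finally have 1: "ennreal (norm (v ?x) powr ?r) \<le> ennreal A * (\<integral>\<^sup>+z. ennreal (f z) * ennreal (g z) \<partial>lborel)" .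
      have "ennreal (norm (v ?x) powr p) = (ennreal (norm (v ?x) powr ?r))\<^sup>2"
        by (simp add: power2_eq_square flip: ennreal_mult powr_add)
      also have "\<dots> \<le> (ennreal A * (\<integral>\<^sup>+z. ennreal (f z) * ennreal (g z) \<partial>lborel))\<^sup>2"
        by (intro power_mono 1) auto
      also have "\<dots> = (ennreal A)\<^sup>2 * (\<integral>\<^sup>+z. ennreal (f z) * ennreal (g z) \<partial>lborel)\<^sup>2"
        by (rule power_mult_distrib)
      also have "\<dots> \<le> (ennreal A)\<^sup>2 * ((\<integral>\<^sup>+z. (ennreal (f z))\<^sup>2 \<partial>lborel) * (\<integral>\<^sup>+z. (ennreal (g z))\<^sup>2 \<partial>lborel))"
        by (intro mult_left_mono Cauchy_Schwarz_nn_integral) measurable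
      also have "(\<integral>\<^sup>+z. (ennreal (g z))\<^sup>2 \<partial>lborel) = ennreal (?W * \<Omega>)"
      proof -
        have "(g z)\<^sup>2 = ?w1 (x' - fst z) * om (snd z)" for z
        proof -
          have "(\<bar>snd z\<bar> powr (- (1/4)))\<^sup>2 = \<bar>snd z\<bar> powr (- (1/2))"
            by (simp add: power2_eq_square flip: powr_add)
          then show ?thesis unfolding g_def power_mult_distrib s2 om_def by simp
        qed
        then have "(\<integral>\<^sup>+z. (ennreal (g z))\<^sup>2 \<partial>lborel) = (\<integral>\<^sup>+z. ennreal (?w1 (x' - fst z)) * ennreal (om (snd z)) \<partial>lborel)"
          using s0 by (intro nn_integral_cong, subst ennreal_power) (auto simp: g_def simp flip: ennreal_mult)
        also have "\<dots> = (\<integral>\<^sup>+z'. (\<integral>\<^sup>+t. ennreal (?w1 (x' - z')) * ennreal (om t) \<partial>lborel) \<partial>lborel)"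
        proof (subst nn_integral_prod_lborel(1))
          have [measurable]: "(\<lambda>z::'b \<times> real. fst z) \<in> borel_measurable borel" "(\<lambda>z::'b \<times> real. snd z) \<in> borel_measurable borel"
            by (intro borel_measurable_continuous_onI continuous_intros)+
          have "(\<lambda>z::'b \<times> real. om (snd z)) \<in> borel_measurable borel" by (rule measurable_compose[OF _ th_measurable(2)]) measurable
          then show "(\<lambda>z. ennreal (?w1 (x' - fst z)) * ennreal (om (snd z))) \<in> borel_measurable borel" by measurable
        qed simp
        also have "\<dots> = (\<integral>\<^sup>+z'. ennreal (?w1 (x' - z')) * ennreal \<Omega> \<partial>lborel)"
          by (subst nn_integral_cmult, measurable) (simp only: \<Omega>)
        also have "\<dots> = ennreal ?W * ennreal \<Omega>"
          by (subst nn_integral_multc, measurable) (simp only: W_int_reflect)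
        finally show ?thesis using \<Omega>(2) by (simp add: ennreal_mult)
      qed
      also have "(\<integral>\<^sup>+z. (ennreal (f z))\<^sup>2 \<partial>lborel) = (\<integral>\<^sup>+z. ?F x' z \<partial>lborel)"
      proof (rule nn_integral_cong)
        fix z
        have "(\<bar>snd z\<bar> powr (1/4))\<^sup>2 = \<bar>snd z\<bar> powr (1/2)" "(norm (v z) powr ?r)\<^sup>2 = norm (v z) powr p"
          by (simp_all add: power2_eq_square flip: powr_add)
        then have "(f z)\<^sup>2 = norm (v z) powr p * th (snd z) * ?w1 (x' - fst z)"
          unfolding f_def power_mult_distrib s2 th_def by simp
        moreover have "0 \<le> f z" using s0 by (auto simp: f_def)
        ultimately show "(ennreal (f z))\<^sup>2 = ?F x' z"
          by (subst ennreal_power) (simp_all flip: ennreal_mult)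
      qed
      finally show ?thesis using A(1) \<Omega>(2) by (simp add: ennreal_mult ennreal_power mult_ac)
    qed
    have [measurable]: "(\<lambda>x'. v (x', 0)) \<in> borel_measurable borel" by measurable
    \<comment> \<open>Integrating the pointwise bound in x' removes the tangential weight and leaves
      \<open>th\<close> in the last variable.\<close>
    have "Lp_pow p (\<lambda>x'. v (x', 0)) \<le> (\<integral>\<^sup>+x'. ennreal (A\<^sup>2 * (?W * \<Omega>)) * (\<integral>\<^sup>+z. ?F x' z \<partial>lborel) \<partial>lborel)"
      unfolding Lp_pow_def by (intro nn_integral_mono pt)
    also have "\<dots> = ennreal (A\<^sup>2 * (?W * \<Omega>)) * (\<integral>\<^sup>+x'. (\<integral>\<^sup>+z. ?F x' z \<partial>lborel) \<partial>lborel)"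
      by (rule nn_integral_cmult) measurable
    also have "(\<integral>\<^sup>+x'. (\<integral>\<^sup>+z. ?F x' z \<partial>lborel) \<partial>lborel) = (\<integral>\<^sup>+z. (\<integral>\<^sup>+x'. ?F x' z \<partial>lborel) \<partial>lborel)"
      by (rule lborel_pair.Fubini') measurable
    also have "\<dots> = (\<integral>\<^sup>+z. ennreal (norm (v z) powr p) * ennreal (th (snd z)) * ennreal ?W \<partial>lborel)"
      by (subst nn_integral_cmult, measurable) (simp only: W_int_translate)
    also have "\<dots> = (\<integral>\<^sup>+z. ennreal (norm (v z) powr p) * ennreal (th (snd z)) \<partial>lborel) * ennreal ?W"
      by (rule nn_integral_multc) measurable
    finally have "Lp_pow p (\<lambda>x'. v (x', 0)) \<le> ennreal ?C * (\<integral>\<^sup>+z. ennreal (norm (v z) powr p) * ennreal (th (snd z)) \<partial>lborel)"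
      using A(1) \<Omega>(2) by (simp add: ennreal_mult mult_ac)
    also have "\<dots> \<le> ennreal (max 1 ?C) * (\<integral>\<^sup>+z. ennreal (norm (v z) powr p) * ennreal (th (snd z)) \<partial>lborel)"
      by (intro mult_right_mono ennreal_leI) auto
    finally show ?thesis .
  qed
  then show thesis using that[of "max 1 ?C"] by simp
qed

section \<open>Representations by band-limited functions\<close>

lemma nn_integral_AE_cong_norm: "AE x in M. f x = g x \<Longrightarrow> (\<integral>\<^sup>+x. F (f x) \<partial>M) = (\<integral>\<^sup>+x. F (g x) \<partial>M)"
  by (rule nn_integral_cong_AE) auto

text \<open>The embedding of l_1 into l_r: one factor of each r-th power is kept, the other r - 1
  are bounded by the sum S. It is used with r = 1/p.\<close>

lemma suminf_ennpowr_le: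
  fixes x :: "nat \<Rightarrow> ennreal"
  assumes r: "1 \<le> r" shows "(\<Sum>j. ennpowr (x j) r) \<le> ennpowr (\<Sum>j. x j) r"
proof (cases "(\<Sum>j. x j) = top")
  case False
  define S where "S = enn2real (\<Sum>j. x j)"
  have S: "(\<Sum>j. x j) = ennreal S" "0 \<le> S" using False by (auto simp: S_def less_top)
  have "ennpowr (x j) r \<le> x j * ennreal (S powr (r - 1))" for j
  proof -
    have le: "x j \<le> ennreal S" unfolding S(1)[symmetric] using sum_le_suminf[of x "{j}"] by simp
    then obtain a where a: "x j = ennreal a" "0 \<le> a" by (cases "x j") (auto simp: top_unique)
    have aS: "a \<le> S" using le a S by simp
    have "a powr r \<le> a * S powr (r - 1)"
    proof (cases "a = 0")
      case False
      then have "a powr r = a * a powr (r - 1)" using a powr_add[of a 1 "r - 1"] by simp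
      also have "\<dots> \<le> a * S powr (r - 1)" using a aS r by (intro mult_left_mono powr_mono2) auto
      finally show ?thesis .
    qed simp
    then show ?thesis using a by (simp flip: ennreal_mult add: ennreal_leI)
  qed
  then have "(\<Sum>j. ennpowr (x j) r) \<le> (\<Sum>j. x j * ennreal (S powr (r - 1)))" by (intro suminf_le) auto
  also have "\<dots> = ennreal S * ennreal (S powr (r - 1))" by (simp add: S)
  also have "\<dots> = ennreal (S powr r)"
    using S(2) powr_add[of S 1 "r - 1"] by (cases "S = 0") (simp_all flip: ennreal_mult)
  finally show ?thesis using S by simp
qed simp

lemma norm_dilation_le:
  assumes "\<And>i. i \<in> Basis \<Longrightarrow> b \<bullet> i \<ge> 0" "0 < t" "t \<le> 1"
  shows "norm (aniso_dilation b t x) \<le> norm x"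
proof (rule power2_le_imp_le)
  show "(norm (aniso_dilation b t x))\<^sup>2 \<le> (norm x)\<^sup>2"
    unfolding norm_square_sum
  proof (rule sum_mono)
    fix i :: 'a assume i: "i \<in> Basis"
    have "t powr (b \<bullet> i) \<le> 1" using assms i by (simp add: powr_le1)
    then have "\<bar>t powr (b \<bullet> i) * (x \<bullet> i)\<bar> \<le> \<bar>x \<bullet> i\<bar>" by (simp add: abs_mult mult_left_le_one_le)
    then show "(aniso_dilation b t x \<bullet> i)\<^sup>2 \<le> (x \<bullet> i)\<^sup>2" using i by (simp add: abs_le_square_iff)
  qed
qed simp

lemma Lp_pow_dilation:
  assumes [measurable]: "u \<in> borel_measurable borel" and t: "t > 0"
  shows "Lp_pow p (\<lambda>x. u (aniso_dilation b t x)) = ennreal (t powr (- weight_sum b)) * Lp_pow p u"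
proof -
  have "Lp_pow p u = ennreal (t powr weight_sum b) * Lp_pow p (\<lambda>x. u (aniso_dilation b t x))"
    unfolding Lp_pow_def by (rule nn_integral_dilation[OF _ t]) measurable
  then have "ennreal (t powr (- weight_sum b)) * Lp_pow p u =
    (ennreal (t powr (- weight_sum b)) * ennreal (t powr weight_sum b)) * Lp_pow p (\<lambda>x. u (aniso_dilation b t x))"
    by (simp add: mult.assoc)
  also have "ennreal (t powr (- weight_sum b)) * ennreal (t powr weight_sum b) = 1"
    using t by (simp flip: ennreal_mult powr_add)
  finally show ?thesis by simp
qed

text \<open>Dilation turns the kernel of scale t into the fixed kernel
  \<open>inv_fourier \<rho>\<close>, so the constants of the unit scale serve all scales. For t <= 1
  the dilation does not increase norms, and the growth bound is kept.\<close>

lemma band_limited_dilation: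
  fixes u \<rho> :: "'a::euclidean_space \<Rightarrow> complex"
  assumes um[measurable]: "u \<in> borel_measurable borel" and \<rho>[measurable]: "\<rho> \<in> schwartz"
    and t: "0 < t" "t \<le> 1" and b: "\<And>i. i \<in> Basis \<Longrightarrow> b \<bullet> i \<ge> 0"
    and rep: "\<And>x. u x = (LINT y|lborel. inv_fourier (\<lambda>\<xi>. \<rho> (aniso_dilation b t \<xi>)) (x - y) * u y)"
    and growth: "\<And>x. norm (u x) \<le> C * (1 + norm x) ^ N"
  shows "band_limited (inv_fourier \<rho>) (\<lambda>x. u (aniso_dilation b t x))"
  unfolding band_limited_def
proof (intro conjI allI exI)
  show "(\<lambda>x. u (aniso_dilation b t x)) \<in> borel_measurable borel" by measurable
  have "0 \<le> C" using growth[of 0] order_trans[OF norm_ge_zero] by fastforce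
  then have "C * (1 + norm (aniso_dilation b t y)) ^ N \<le> C * (1 + norm y) ^ N" for y
    by (intro mult_left_mono power_mono add_left_mono norm_dilation_le b t) auto
  then show "norm (u (aniso_dilation b t y)) \<le> C * (1 + norm y) ^ N" for y using growth order_trans by blast
  fix x
  have [measurable]: "\<rho> \<in> borel_measurable borel" "inv_fourier \<rho> \<in> borel_measurable borel"
    by (intro schwartz_measurable schwartz_inv_fourier \<rho>)+
  have k: "inv_fourier (\<lambda>\<xi>. \<rho> (aniso_dilation b t \<xi>)) w = of_real (t powr (- weight_sum b)) * inv_fourier \<rho> (aniso_dilation b (1 / t) w)" for w
    by (rule inv_fourier_dilation[OF _ t(1)]) measurable
  have "u (aniso_dilation b t x) = (LINT y|lborel. inv_fourier (\<lambda>\<xi>. \<rho> (aniso_dilation b t \<xi>)) (aniso_dilation b t x - y) * u y)"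
    by (rule rep)
  also have "\<dots> = of_real (t powr weight_sum b) * (LINT y|lborel. inv_fourier (\<lambda>\<xi>. \<rho> (aniso_dilation b t \<xi>)) (aniso_dilation b t x - aniso_dilation b t y) * u (aniso_dilation b t y))"
    unfolding k by (rule integral_dilation[OF _ t(1)]) measurable
  also have "\<dots> = of_real (t powr weight_sum b) * (LINT y|lborel. of_real (t powr (- weight_sum b)) * (inv_fourier \<rho> (x - y) * u (aniso_dilation b t y)))"
    unfolding k using t(1) by (simp add: aniso_dilation_diff[symmetric] aniso_dilation_dilation mult.assoc)
  also have "\<dots> = (of_real (t powr weight_sum b) * of_real (t powr (- weight_sum b))) * (LINT y|lborel. inv_fourier \<rho> (x - y) * u (aniso_dilation b t y))"
    by (simp add: mult.assoc)
  also have "of_real (t powr weight_sum b) * of_real (t powr (- weight_sum b)) = (1 :: complex)"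
    using t(1) by (simp flip: of_real_mult powr_add)
  finally show "u (aniso_dilation b t x) = (LINT y|lborel. inv_fourier \<rho> (x - y) * u (aniso_dilation b t y))" by simp
qed

section \<open>Absolutely convergent series of distributions\<close>

lemma dist_tendsto_unique:
  assumes "dist_tendsto T S" "dist_tendsto T S'" shows "S = S'"
proof
  fix f
  show "S f = S' f"
  proof (cases "f \<in> schwartz")
    case True
    then show ?thesis using assms LIMSEQ_unique unfolding dist_tendsto_def by blast
  next
    case False
    then show ?thesis
      using assms tempered_outside[of S f] tempered_outside[of S' f] by (simp add: dist_tendsto_def)
  qed
qed

definition L1n :: "('a::euclidean_space \<Rightarrow> complex) \<Rightarrow> ennreal" where
  "L1n h = (\<integral>\<^sup>+z. ennreal (norm (h z)) \<partial>lborel)"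

lemma L1n_integrable:
  assumes "h \<in> borel_measurable borel" "L1n h < top" shows "integrable lborel h"
  using assms unfolding L1n_def by (intro integrableI_bounded) auto

lemma L1n_pairing:
  assumes "h \<in> borel_measurable borel" "L1n h < top" "\<And>x. norm (\<phi> x) \<le> B" "0 \<le> B"
  shows "norm (LINT x|lborel. h x * \<phi> x) \<le> B * enn2real (L1n h)"
proof -
  have i: "integrable lborel h" by (rule L1n_integrable[OF assms(1,2)])
  have "norm (LINT x|lborel. h x * \<phi> x) \<le> (LINT x|lborel. B * norm (h x))"
  proof (rule Bochner_integral_norm_bound)
    show "integrable lborel (\<lambda>x. B * norm (h x))" using i by simp
    show "norm (h x * \<phi> x) \<le> B * norm (h x)" for x
      unfolding norm_mult using mult_left_mono[OF assms(3)[of x] norm_ge_zero[of "h x"]] by (simp add: mult.commute)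
  qed
  also have "\<dots> = B * (LINT x|lborel. norm (h x))" by simp
  also have "(LINT x|lborel. norm (h x)) = enn2real (L1n h)"
    unfolding L1n_def by (rule integral_eq_nn_integral) (use assms(1) in auto)
  finally show ?thesis .
qed

lemma schwartz_sup_le_seminorm:
  assumes "f \<in> schwartz" shows "norm (f x) \<le> schwartz_seminorm 0 f"
  using le_schwartz_seminorm[OF assms, of "[]" 0 x] by simp

lemma suminf_L1_summable:
  assumes "(\<Sum>j. L1n (h j)) < top"
  shows "L1n (h j) < top" "summable (\<lambda>j. enn2real (L1n (h j)))"
    "(\<Sum>j. L1n (h j)) = ennreal (\<Sum>j. enn2real (L1n (h j)))"
proof -
  show f: "L1n (h j) < top" for j using sum_le_suminf[of "\<lambda>j. L1n (h j)" "{j}"] assms by (simp add: le_less_trans)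
  have e: "(\<lambda>j. L1n (h j)) = (\<lambda>j. ennreal (enn2real (L1n (h j))))"
    by (rule ext) (use f in simp)
  have "(\<Sum>j. ennreal (enn2real (L1n (h j)))) < top" using assms by (simp only: e[symmetric])
  then show s: "summable (\<lambda>j. enn2real (L1n (h j)))"
    using summable_suminf_not_top[of "\<lambda>j. enn2real (L1n (h j))"] by (simp add: less_top)
  have "(\<Sum>j. L1n (h j)) = (\<Sum>j. ennreal (enn2real (L1n (h j))))" by (simp only: e[symmetric])
  also have "\<dots> = ennreal (\<Sum>j. enn2real (L1n (h j)))" by (rule suminf_ennreal2) (use s in auto)
  finally show "(\<Sum>j. L1n (h j)) = ennreal (\<Sum>j. enn2real (L1n (h j)))" .
qed

text \<open>The Weierstrass test, with the order-0 seminorm, which is the supremum norm: it suits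
  series of L_1 functions and of their tensor products with L_1 kernels.\<close>

lemma dist_sums_absolute:
  fixes T :: "nat \<Rightarrow> 'a::euclidean_space dist"
  assumes T: "\<And>j. T j \<in> tempered" and c: "summable c" "\<And>j. 0 \<le> c j"
    and bound: "\<And>j f. f \<in> schwartz \<Longrightarrow> norm (T j f) \<le> c j * schwartz_seminorm 0 f"
  defines "S \<equiv> (\<lambda>f. \<Sum>j. T j f)"
  shows "S \<in> tempered" "dist_sums T S" "\<And>f. f \<in> schwartz \<Longrightarrow> (\<lambda>j. T j f) sums S f"
    "\<And>f. f \<in> schwartz \<Longrightarrow> norm (S f) \<le> (\<Sum>j. c j) * schwartz_seminorm 0 f"
proof -
  have sm: "summable (\<lambda>j. norm (T j f))" if "f \<in> schwartz" for f
    by (rule summable_comparison_test'[OF summable_mult2[OF c(1)]]) (use bound[OF that] in auto)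
  have sm': "summable (\<lambda>j. T j f)" if "f \<in> schwartz" for f
    by (rule summable_norm_cancel[OF sm[OF that]])
  show sums: "(\<lambda>j. T j f) sums S f" if "f \<in> schwartz" for f
    unfolding S_def by (rule summable_sums[OF sm'[OF that]])
  show le: "norm (S f) \<le> (\<Sum>j. c j) * schwartz_seminorm 0 f" if f: "f \<in> schwartz" for f
  proof -
    have "norm (S f) \<le> (\<Sum>j. norm (T j f))" unfolding S_def by (rule summable_norm[OF sm[OF f]])
    also have "\<dots> \<le> (\<Sum>j. c j * schwartz_seminorm 0 f)"
      by (intro suminf_le bound f sm summable_mult2 c)
    also have "\<dots> = (\<Sum>j. c j) * schwartz_seminorm 0 f" by (rule suminf_mult2[symmetric, OF c(1)])
    finally show ?thesis .
  qed
  show St: "S \<in> tempered"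
    unfolding tempered_def mem_Collect_eq
  proof (intro conjI allI impI ballI)
    show "S f = 0" if "f \<notin> schwartz" for f unfolding S_def using tempered_outside[OF T that] by simp
    show "\<exists>N C. \<forall>f\<in>schwartz. norm (S f) \<le> C * schwartz_seminorm N f"
      by (intro exI[of _ 0] exI[of _ "\<Sum>j. c j"] ballI le)
    fix f g :: "'a \<Rightarrow> complex" and k assume f: "f \<in> schwartz" and g: "g \<in> schwartz"
    have "(\<lambda>j. T j (\<lambda>x. k * f x + g x)) = (\<lambda>j. k * T j f + T j g)"
      by (rule ext) (rule tempered_linear[OF T f g])
    then show "S (\<lambda>x. k * f x + g x) = k * S f + S g"
      using sums_unique[OF sums_add[OF sums_mult[OF sums[OF f], of k] sums[OF g]]] unfolding S_def by simp
  qed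
  show "dist_sums T S"
    unfolding dist_sums_def dist_tendsto_def using St sums by (simp add: sums_def_le)
qed

lemma dist_of_fun_L1_bound:
  assumes "h \<in> borel_measurable borel" "L1n h < top" "f \<in> schwartz"
  shows "norm (dist_of_fun h f) \<le> enn2real (L1n h) * schwartz_seminorm 0 f"
  unfolding dist_of_fun_apply[OF assms(3)]
  using L1n_pairing[where \<phi> = f, OF assms(1,2) schwartz_sup_le_seminorm[OF assms(3)] schwartz_seminorm_nonneg[OF assms(3)]]
  by (simp add: mult.commute)

text \<open>The setting on R^(n-1), with an abstract cutoff \<open>\<rho>\<close> that is later the
  section of \<open>\<psi>\<close> at x_n = 0. The value of \<open>t\<close> is the one that makes
  \<open>band_L1\<close> scale correctly.\<close>

locale band_cutoff =
  fixes b :: "'a::euclidean_space" and \<rho> :: "'a \<Rightarrow> complex" and p t :: real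
  assumes b_ge: "\<And>i. i \<in> Basis \<Longrightarrow> b \<bullet> i \<ge> 1"
    and \<rho>_test: "\<rho> \<in> test_functions" and \<rho>_one: "\<And>x. aq b 1 x \<le> 1 \<Longrightarrow> \<rho> x = 1"
    and \<rho>_zero: "\<And>x. 1 \<le> aq b 2 x \<Longrightarrow> \<rho> x = 0"
    and p: "0 < p" "p < 1" and t_def: "t = weight_sum b * (1 / p - 1)"
begin

lemma b_pos: "i \<in> Basis \<Longrightarrow> b \<bullet> i > 0" using b_ge by (smt (verit))

lemma \<rho>_unit: "norm x \<le> 1 \<Longrightarrow> \<rho> x = 1"
proof (rule \<rho>_one)
  assume "norm x \<le> 1"
  then have "(norm x)\<^sup>2 \<le> 1" by (simp add: power_le_one)
  then show "aq b 1 x \<le> 1" by (simp add: aq_def norm_square_sum)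
qed

lemma \<rho>_schwartz: "\<rho> \<in> schwartz" by (rule test_functions_schwartz[OF \<rho>_test])

text \<open>Index j + 1 instead of j: the spectrum of \<open>h j\<close> lies in a closed ball of
  radius 2^j, and \<open>band_reproduce\<close> needs a cutoff equal to 1 on an open neighbourhood
  of it.\<close>

definition cut :: "nat \<Rightarrow> 'a \<Rightarrow> complex" where
  "cut j \<xi> = \<rho> (aniso_dilation b (2 powr (- real (Suc j))) \<xi>)"

lemma cut_schwartz: "cut j \<in> schwartz"
  unfolding cut_def[abs_def] by (intro test_functions_schwartz test_functions_dilation \<rho>_test) simp

text \<open>The continuous representative of a function that is only given almost everywhere;
  pointwise estimates are made for it.\<close>

definition reg :: "nat \<Rightarrow> ('a \<Rightarrow> complex) \<Rightarrow> 'a \<Rightarrow> complex" where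
  "reg j h = tconv (dist_of_fun h) (kern (cut j))"

definition band :: "nat \<Rightarrow> ('a \<Rightarrow> complex) \<Rightarrow> bool" where
  "band j h \<longleftrightarrow> tempered_fun h \<and> dist_support (dist_fourier (dist_of_fun h)) \<subseteq> {\<xi>. aniso_norm b \<xi> \<le> 2 ^ j}"

context
  fixes j h assumes band: "band j h"
begin

lemma tf: "tempered_fun h" using band by (simp add: band_def)

lemma hm[measurable]: "h \<in> borel_measurable borel" by (rule tempered_fun_measurable[OF tf])

lemma reg_AE: "AE x in lborel. h x = reg j h x"
proof -
  let ?V = "{\<xi>. aq b (2 ^ Suc j) \<xi> < 1}"
  have "open ?V" unfolding aq_def by (intro open_Collect_less continuous_intros) simp_all
  moreover have "dist_support (dist_fourier (dist_of_fun h)) \<subseteq> ?V"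
  proof
    fix \<xi> assume "\<xi> \<in> dist_support (dist_fourier (dist_of_fun h))"
    then have le: "aq b (2 ^ j) \<xi> \<le> 1" using band aniso_norm_le_iff[OF b_pos, of "2 ^ j"] unfolding band_def by fastforce
    show "\<xi> \<in> ?V"
    proof (cases "\<xi> = 0")
      case False
      then have "aq b (2 ^ Suc j) \<xi> < aq b (2 ^ j) \<xi>" by (intro aq_strict_antimono[OF b_pos]) auto
      then show ?thesis using le by simp
    qed (simp add: aq_def)
  qed
  moreover have "cut j \<xi> = 1" if "\<xi> \<in> ?V" for \<xi>
    unfolding cut_def by (rule \<rho>_one)
      (use that in \<open>simp add: aq_dilation powr_minus powr_realpow divide_inverse del: of_nat_Suc power_Suc\<close>)
  ultimately show ?thesis
    unfolding reg_def using band_reproduce[OF tf \<rho>_test \<rho>_unit _ _ cut_schwartz] by blast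
qed

lemma reg_cont: "continuous_on UNIV (reg j h)"
  unfolding reg_def by (intro continuous_tconv tempered_fun_tempered tf schwartz_kern cut_schwartz)

lemma reg_measurable[measurable]: "reg j h \<in> borel_measurable borel"
  by (rule borel_measurable_continuous_onI[OF reg_cont])

lemma reg_eq: "reg j h x = (LINT y|lborel. inv_fourier (cut j) (x - y) * h y)"
  unfolding reg_def by (subst tconv_dist_of_fun[OF schwartz_kern[OF cut_schwartz]]) (simp add: kern_eq mult.commute)

lemma reg_reproduce: "reg j h x = (LINT y|lborel. inv_fourier (cut j) (x - y) * reg j h y)"
proof -
  have [measurable]: "inv_fourier (cut j) \<in> borel_measurable borel"
    by (intro schwartz_measurable schwartz_inv_fourier cut_schwartz)
  show ?thesis unfolding reg_eq[of x]
    by (rule integral_cong_AE) (use reg_AE in \<open>auto elim: eventually_mono\<close>)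
qed

definition unit_reg :: "'a \<Rightarrow> complex" where
  "unit_reg x = reg j h (aniso_dilation b (2 powr (- real (Suc j))) x)"

lemma unit_band: "band_limited (inv_fourier \<rho>) unit_reg"
proof -
  obtain C N where "\<And>x. norm (reg j h x) \<le> C * (1 + norm x) ^ N"
    using tconv_growth[OF tempered_fun_tempered[OF tf] schwartz_kern[OF cut_schwartz]] unfolding reg_def by metis
  moreover have "2 powr (- real (Suc j)) \<le> (1::real)" using powr_mono[of "- real (Suc j)" 0 2] by simp
  ultimately show ?thesis
    unfolding unit_reg_def[abs_def]
    by (intro band_limited_dilation[OF reg_measurable \<rho>_schwartz _ _ _ reg_reproduce[unfolded cut_def[abs_def]]])
      (use b_pos in \<open>auto intro: less_imp_le simp del: of_nat_Suc\<close>)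
qed

lemma Lp_pow_reg: "Lp_pow p (reg j h) = Lp_pow p h"
  unfolding Lp_pow_def by (rule nn_integral_AE_cong_norm) (use reg_AE in \<open>auto elim: eventually_mono\<close>)

lemma Lp_pow_unit: "Lp_pow p unit_reg = ennreal (2 powr (real (Suc j) * weight_sum b)) * Lp_pow p h"
  unfolding unit_reg_def[abs_def] by (subst Lp_pow_dilation) (simp_all add: powr_powr Lp_pow_reg del: of_nat_Suc)

lemma L1n_unit: "L1n h = ennreal (2 powr (- (real (Suc j) * weight_sum b))) * L1n unit_reg"
proof -
  have "L1n h = L1n (reg j h)"
    unfolding L1n_def by (rule nn_integral_AE_cong_norm) (rule reg_AE)
  also have "\<dots> = ennreal ((2 powr (- real (Suc j))) powr weight_sum b) * L1n unit_reg"
    unfolding L1n_def unit_reg_def by (rule nn_integral_dilation) auto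
  finally show ?thesis by (simp add: powr_powr del: of_nat_Suc)
qed

end

text \<open>Nikol'skij's inequality: rescaling contributes 2^(-j |a'|) to the L_1 norm and 2^(j |a'|
  / p) to the L_p quasi-norm, up to constants, together 2^(j t).\<close>

lemma band_L1:
  obtains C where "C > 0" "\<And>j h. band j h \<Longrightarrow> Lp_pow p h < top \<Longrightarrow>
    L1n h \<le> ennreal C * ennpowr (ennreal (2 powr (real j * t * p)) * Lp_pow p h) (1 / p)"
proof -
  have K: "rapid (inv_fourier \<rho>)" by (intro schwartz_rapid schwartz_inv_fourier \<rho>_schwartz)
  obtain C where C: "C > 0" "\<And>v. band_limited (inv_fourier \<rho>) v \<Longrightarrow> Lp_pow p v < top \<Longrightarrow>
    (\<integral>\<^sup>+z. ennreal (norm (v z)) \<partial>lborel) \<le> ennreal C * ennpowr (Lp_pow p v) (1 / p)"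
    using band_limited_L1[OF K p] by metis
  have "L1n h \<le> ennreal (C * 2 powr t) * ennpowr (ennreal (2 powr (real j * t * p)) * Lp_pow p h) (1 / p)"
    if h: "band j h" and fin: "Lp_pow p h < top" for j h
  proof -
    let ?w = "weight_sum b" and ?J = "real (Suc j)"
    have "L1n h \<le> ennreal (2 powr (- (?J * ?w))) * (ennreal C * ennpowr (ennreal (2 powr (?J * ?w)) * Lp_pow p h) (1 / p))"
      unfolding L1n_unit[OF h] Lp_pow_unit[OF h, symmetric]
      unfolding L1n_def by (intro mult_left_mono C unit_band[OF h])
        (use fin in \<open>simp_all add: Lp_pow_unit[OF h] ennreal_mult_less_top\<close>)
    also have "ennpowr (ennreal (2 powr (?J * ?w)) * Lp_pow p h) (1 / p) = ennreal (2 powr (?J * ?w / p)) * ennpowr (Lp_pow p h) (1 / p)"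
      using p by (simp add: ennpowr_mult powr_powr)
    also have "ennreal (2 powr (- (?J * ?w))) * (ennreal C * (ennreal (2 powr (?J * ?w / p)) * ennpowr (Lp_pow p h) (1 / p)))
      = ennreal C * (ennreal (2 powr (- (?J * ?w))) * ennreal (2 powr (?J * ?w / p))) * ennpowr (Lp_pow p h) (1 / p)"
      by (simp only: mult_ac)
    also have "ennreal (2 powr (- (?J * ?w))) * ennreal (2 powr (?J * ?w / p)) = ennreal (2 powr (?J * t))"
    proof -
      have "- (?J * ?w) + ?J * ?w / p = ?J * t" unfolding t_def by (simp add: algebra_simps)
      then show ?thesis by (simp flip: ennreal_mult powr_add)
    qed
    \<comment> \<open>The functions were rescaled by 2^(j+1), hence the surplus 2^t.\<close>
    also have "ennreal (2 powr (?J * t)) = ennreal (2 powr t) * ennpowr (ennreal (2 powr (real j * t * p))) (1 / p)"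
      using p by (simp add: powr_powr algebra_simps powr_add flip: ennreal_mult)
    also have "ennreal C * (ennreal (2 powr t) * ennpowr (ennreal (2 powr (real j * t * p))) (1 / p)) * ennpowr (Lp_pow p h) (1 / p)
      = ennreal (C * 2 powr t) * ennpowr (ennreal (2 powr (real j * t * p)) * Lp_pow p h) (1 / p)"
      using p C(1) by (subst ennpowr_mult) (simp_all add: ennreal_mult mult.assoc)
    finally show ?thesis .
  qed
  moreover have "C * 2 powr t > 0" using C by simp
  ultimately show thesis using that by blast
qed

definition cost_pow :: "(nat \<Rightarrow> 'a \<Rightarrow> complex) \<Rightarrow> ennreal" where
  "cost_pow h = (\<Sum>j. ennreal (2 powr (real j * t * p)) * Lp_pow p (h j))"

lemma A_cost_eq: "A_cost t p h = ennpowr (cost_pow h) (1 / p)"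
  unfolding A_cost_def cost_pow_def using p by (simp add: Lp_norm_real ennpowr_inverse Lp_pow_def)

lemma Lp_representation_iff:
  "Lp_representation b p h f \<longleftrightarrow> (\<forall>j. band j (h j) \<and> Lp_pow p (h j) < top) \<and> dist_sums (\<lambda>j. dist_of_fun (h j)) f"
  unfolding Lp_representation_def band_representation_def band_def Lp_norm_real Lp_pow_def[symmetric] infinity_ennreal_def ennpowr_less_top
  using tempered_fun_tempered by blast

text \<open>Nikol'skij's inequality for each term, and then l_p inside l_1, which is where p < 1
  enters the summation.\<close>

lemma rep_L1:
  obtains C where "C > 0" "\<And>h. (\<And>j. band j (h j)) \<Longrightarrow> (\<And>j. Lp_pow p (h j) < top) \<Longrightarrow>
    (\<Sum>j. L1n (h j)) \<le> ennreal C * A_cost t p h"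
proof -
  obtain C where C: "C > 0" "\<And>j h. band j h \<Longrightarrow> Lp_pow p h < top \<Longrightarrow>
    L1n h \<le> ennreal C * ennpowr (ennreal (2 powr (real j * t * p)) * Lp_pow p h) (1 / p)"
    using band_L1 by metis
  have "(\<Sum>j. L1n (h j)) \<le> ennreal C * A_cost t p h" if h: "\<And>j. band j (h j)" "\<And>j. Lp_pow p (h j) < top" for h
  proof -
    have "(\<Sum>j. L1n (h j)) \<le> (\<Sum>j. ennreal C * ennpowr (ennreal (2 powr (real j * t * p)) * Lp_pow p (h j)) (1 / p))"
      by (intro suminf_le C h) auto
    also have "\<dots> = ennreal C * (\<Sum>j. ennpowr (ennreal (2 powr (real j * t * p)) * Lp_pow p (h j)) (1 / p))"
      by simp
    also have "\<dots> \<le> ennreal C * A_cost t p h"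
      unfolding A_cost_eq cost_pow_def using p by (intro mult_left_mono suminf_ennpowr_le) auto
    finally show ?thesis .
  qed
  then show thesis using that C(1) by blast
qed

lemma L1_sum:
  assumes h: "\<And>j. tempered_fun (h j)" and fin: "(\<Sum>j. L1n (h j)) < top"
  shows "dist_sums (\<lambda>j. dist_of_fun (h j)) (\<lambda>f. \<Sum>j. dist_of_fun (h j) f)"
    "\<And>f. f \<in> schwartz \<Longrightarrow> norm (\<Sum>j. dist_of_fun (h j) f) \<le> enn2real (\<Sum>j. L1n (h j)) * schwartz_seminorm 0 f"
proof -
  note s = suminf_L1_summable[OF fin]
  have e: "enn2real (\<Sum>j. L1n (h j)) = (\<Sum>j. enn2real (L1n (h j)))"
    unfolding s(3) by (intro enn2real_ennreal suminf_nonneg s(2)) simp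
  note d = dist_sums_absolute[OF tempered_fun_tempered[OF h] s(2) _ dist_of_fun_L1_bound[OF tempered_fun_measurable[OF h] s(1)], simplified]
  show "dist_sums (\<lambda>j. dist_of_fun (h j)) (\<lambda>f. \<Sum>j. dist_of_fun (h j) f)" by (rule d(2))
  show "norm (\<Sum>j. dist_of_fun (h j) f) \<le> enn2real (\<Sum>j. L1n (h j)) * schwartz_seminorm 0 f" if "f \<in> schwartz" for f
    unfolding e by (rule d(4)[OF that])
qed

end

section \<open>The trace\<close>

lemma ennreal_le_suminf: "f j \<le> (\<Sum>j. f j)" for f :: "nat \<Rightarrow> ennreal"
  using sum_le_suminf[of f "{j}"] by simp

text \<open>The trace estimates use no more of the inner quasi-norm than that it dominates the
  supremum.\<close>

lemma lq_norm_ge: assumes "0 < q" shows "ennreal \<bar>u j\<bar> \<le> lq_norm q u"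
proof (cases "q = \<infinity>")
  case True
  have "ennreal \<bar>u j\<bar> \<le> (SUP j. ennreal \<bar>u j\<bar>)" by (rule SUP_upper) simp
  then show ?thesis using True by (simp add: lq_norm_def)
next
  case False
  then have q: "enn2real q > 0" using assms by (simp add: enn2real_positive_iff top.not_eq_extremum)
  have "ennreal (\<bar>u j\<bar> powr enn2real q) \<le> (\<Sum>j. ennreal (\<bar>u j\<bar> powr enn2real q))"
    by (rule ennreal_le_suminf[of "\<lambda>j. ennreal (\<bar>u j\<bar> powr enn2real q)"])
  from ennpowr_mono[OF this, of "1 / enn2real q"]
  have "ennpowr (ennreal (\<bar>u j\<bar> powr enn2real q)) (1 / enn2real q) \<le> lq_norm q u"
    unfolding lq_norm_def if_not_P[OF False] using q by (simp only: zero_less_divide_1_iff)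
  moreover have "ennpowr (ennreal (\<bar>u j\<bar> powr enn2real q)) (1 / enn2real q) = ennreal \<bar>u j\<bar>"
    using q by (simp add: powr_powr)
  ultimately show ?thesis by simp
qed

lemma lq_norm_measurable[measurable]:
  assumes [measurable]: "\<And>j. u j \<in> borel_measurable M"
  shows "(\<lambda>x. lq_norm q (\<lambda>j. u j x)) \<in> borel_measurable M"
proof (cases "q = \<infinity>")
  case True
  have "(\<lambda>x. SUP j. ennreal \<bar>u j x\<bar>) \<in> borel_measurable M" by measurable
  then show ?thesis using True by (simp add: lq_norm_def)
next
  case False
  have "(\<lambda>x. ennpowr (\<Sum>j. ennreal (\<bar>u j x\<bar> powr enn2real q)) (1 / enn2real q)) \<in> borel_measurable M" by measurable
  then show ?thesis unfolding lq_norm_def if_not_P[OF False] .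
qed

section \<open>Splitting off the last coordinate, and the setting of the trace\<close>

lemma sum_Basis_prod:
  "(\<Sum>i\<in>Basis. f i) = (\<Sum>i\<in>Basis. f (i, 0)) + f (0, 1)"
  for f :: "'a::euclidean_space \<times> real \<Rightarrow> 'c::comm_monoid_add"
proof -
  have "(\<Sum>i\<in>Basis. f i) = sum f ((\<lambda>u. (u, 0)) ` Basis) + sum f ((\<lambda>v. (0, v)) ` {1})"
    unfolding Basis_prod_def Basis_real_def by (rule sum.union_disjoint) auto
  then show ?thesis by (simp add: sum.reindex inj_on_def)
qed

lemma aq_prod: "aq a t (x, y) = aq (fst a) t x + y\<^sup>2 / t powr (2 * snd a)" for a :: "'a::euclidean_space \<times> real"
  by (simp add: aq_def sum_Basis_prod inner_prod_def)

lemma weight_sum_prod: "weight_sum a = weight_sum (fst a) + snd a" for a :: "'a::euclidean_space \<times> real"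
  by (simp add: weight_sum_def sum_Basis_prod inner_prod_def)

lemma aniso_dilation_prod:
  "aniso_dilation a t (x, y) = (aniso_dilation (fst a) t x, t powr snd a * y)" for a :: "'a::euclidean_space \<times> real"
  by (simp add: aniso_dilation_def sum_Basis_prod inner_prod_def prod_eq_iff fst_sum snd_sum)

locale trace_setup = LP_setup a \<psi>
  for a :: "'b::euclidean_space \<times> real" and \<psi> +
  fixes p s t :: real and q :: ennreal
  assumes p01: "0 < p" "p < 1" and q: "0 < q"
    and s_def: "s = weight_sum a / p - weight_sum (fst a)"
    and t_def': "t = weight_sum (fst a) * (1 / p - 1)"

text \<open>The section of \<open>\<psi>\<close> inherits the cutoff property because
  \<open>aq\<close> for a at (x', 0) equals \<open>aq\<close> for a' at x'.\<close>

sublocale trace_setup \<subseteq> band_cutoff "fst a" "\<lambda>\<xi>. \<psi> (\<xi>, 0)" p t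
proof
  show "1 \<le> fst a \<bullet> i" if "i \<in> Basis" for i
    using anisotropy_ge_1[OF aniso, of "(i, 0)"] that by (simp add: inner_prod_def Basis_prod_def)
  have "(\<lambda>\<xi>. \<psi> (0 + (\<xi>, 0))) \<in> test_functions"
    by (rule test_functions_affine[OF \<psi>_test, of "\<lambda>\<xi>. (\<xi>, 0)" 1])
      (auto simp: linear_iff Basis_prod_def norm_Pair intro!: exI[of _ "1::real"])
  then show "(\<lambda>\<xi>. \<psi> (\<xi>, 0)) \<in> test_functions" by simp
  show "\<psi> (x, 0) = 1" if "aq (fst a) 1 x \<le> 1" for x by (rule \<psi>_one) (use that in \<open>simp add: aq_prod\<close>)
  show "\<psi> (x, 0) = 0" if "1 \<le> aq (fst a) 2 x" for x by (rule \<psi>_zero) (use that in \<open>simp add: aq_prod\<close>)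
qed (use p01 t_def' in auto)

context trace_setup
begin

lemma an_ge: "snd a \<ge> 1"
  using anisotropy_ge_1[OF aniso, of "(0, 1)"] by (simp add: inner_prod_def Basis_prod_def)

text \<open>Rescaling multiplies p-th power integrals by powers of 2^(j |a|) on R^n and of 2^(j
  |a'|) on R^(n-1); the discrepancy 2^(j a_n) is the smoothness lost by taking the trace.\<close>

lemma exponents: "s * p = t * p + snd a"
  unfolding s_def t_def' weight_sum_prod using p01 by (simp add: field_simps)

lemma piece_cont: "f \<in> tempered \<Longrightarrow> continuous_on UNIV (LP_piece a \<psi> j f)"
  unfolding LP_piece_eq by (intro continuous_tconv schwartz_kern LP_fun_schwartz)

lemma piece_measurable: "f \<in> tempered \<Longrightarrow> LP_piece a \<psi> j f \<in> borel_measurable borel"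
  by (intro borel_measurable_continuous_onI piece_cont)

lemma piece_growth:
  assumes "f \<in> tempered"
  obtains C N where "\<And>x. norm (LP_piece a \<psi> j f x) \<le> C * (1 + norm x) ^ N"
  using tconv_growth[OF assms schwartz_kern[OF LP_fun_schwartz]] unfolding LP_piece_eq[OF assms] by metis

text \<open>The cutoff that reproduces piece j is \<open>\<psi>\<close> dilated by 2^(-(j+1)); after
  rescaling all pieces reproduce under the one kernel \<open>inv_fourier \<psi>\<close>.\<close>

lemma piece_unit:
  assumes f: "f \<in> tempered"
  shows "band_limited (inv_fourier \<psi>) (\<lambda>z. LP_piece a \<psi> j f (aniso_dilation a (2 powr (- real (Suc j))) z))"
proof -
  obtain C N where C: "\<And>x. norm (LP_piece a \<psi> j f x) \<le> C * (1 + norm x) ^ N" using piece_growth[OF f] by metis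
  have d: "2 powr (- real (Suc j)) \<le> (1::real)" using powr_mono[of "- real (Suc j)" 0 2] by simp
  have LPc_eq: "(\<lambda>\<xi>. \<psi> (aniso_dilation a (2 powr (- real (Suc j))) \<xi>)) = LPc a \<psi> (Suc j)"
    by (rule ext) (simp only: LPc_def)
  have rep: "LP_piece a \<psi> j f x = (LINT y|lborel. inv_fourier (\<lambda>\<xi>. \<psi> (aniso_dilation a (2 powr (- real (Suc j))) \<xi>)) (x - y) * LP_piece a \<psi> j f y)" for x
    unfolding LP_piece_eq[OF f] LPc_eq
    by (rule tconv_reproduce[OF f LP_fun_schwartz test_functions_schwartz[OF LPc_test] LP_fun_mult_LPc])
  show ?thesis
    by (rule band_limited_dilation[OF piece_measurable[OF f] test_functions_schwartz[OF \<psi>_test] _ d _ rep C])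
      (use a_pos less_imp_le in auto)
qed

definition FG :: "('b \<times> real) dist \<Rightarrow> 'b \<times> real \<Rightarrow> ennreal" where
  "FG f x = lq_norm q (\<lambda>j. 2 powr (real j * s) * norm (LP_piece a \<psi> j f x))"

lemma F_norm_pow: "ennpowr (F_norm \<psi> a s p q f) p = (\<integral>\<^sup>+x. ennpowr (FG f x) p \<partial>lborel)"
  unfolding F_norm_def FG_def using p01 by (simp add: ennpowr_Lp_norm)

lemma FG_measurable: "f \<in> tempered \<Longrightarrow> FG f \<in> borel_measurable borel"
  unfolding FG_def[abs_def] by (intro lq_norm_measurable borel_measurable_times borel_measurable_norm
      borel_measurable_const measurable_compose[OF piece_measurable borel_measurable_norm] measurable_compose[OF _ borel_measurable_norm] piece_measurable)

lemma piece_le_FG: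
  "ennreal (2 powr (real j * s * p)) * ennreal (norm (LP_piece a \<psi> j f x) powr p) \<le> ennpowr (FG f x) p"
proof -
  have "ennreal (2 powr (real j * s) * norm (LP_piece a \<psi> j f x)) \<le> FG f x"
    using lq_norm_ge[OF q, of "\<lambda>j. 2 powr (real j * s) * norm (LP_piece a \<psi> j f x)" j] unfolding FG_def by (simp add: abs_mult)
  from ennpowr_mono[OF this p01(1)] show ?thesis
    using p01 by (simp add: ennreal_mult ennpowr_mult powr_powr)
qed

lemma piece_Lp:
  assumes f: "f \<in> F_space \<psi> a s p q" shows "Lp_pow p (LP_piece a \<psi> j f) < top"
proof -
  have ft: "f \<in> tempered" and fin: "F_norm \<psi> a s p q f < top" using f by (auto simp: F_space_def)
  have [measurable]: "LP_piece a \<psi> j f \<in> borel_measurable borel" by (rule piece_measurable[OF ft])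
  have "ennreal (2 powr (real j * s * p)) * Lp_pow p (LP_piece a \<psi> j f)
      = (\<integral>\<^sup>+x. ennreal (2 powr (real j * s * p)) * ennreal (norm (LP_piece a \<psi> j f x) powr p) \<partial>lborel)"
    unfolding Lp_pow_def by (rule nn_integral_cmult[symmetric]) measurable
  also have "\<dots> \<le> (\<integral>\<^sup>+x. ennpowr (FG f x) p \<partial>lborel)" by (intro nn_integral_mono piece_le_FG)
  also have "\<dots> < top" unfolding F_norm_pow[symmetric] ennpowr_less_top by (rule fin)
  finally show ?thesis by (auto simp: ennreal_mult_less_top)
qed

abbreviation tr :: "('b \<times> real) dist \<Rightarrow> nat \<Rightarrow> 'b \<Rightarrow> complex" where
  "tr f j \<equiv> (\<lambda>x'. LP_piece a \<psi> j f (x', 0))"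

lemma tr_measurable: "f \<in> tempered \<Longrightarrow> tr f j \<in> borel_measurable borel"
  by (intro borel_measurable_continuous_onI continuous_on_compose2[OF piece_cont] continuous_intros) auto

text \<open>\<open>trace_unit\<close> is applied to the piece rescaled by 2^(-(j+1)). Scaling back
  moves the weight to 2^((j+1) a_n) x_n, written so that only 2^(j a_n) depends on j, as
  \<open>sum_mn_le\<close> expects.\<close>

lemma tr_piece_bound:
  obtains C where "C > 0" "\<And>f j. f \<in> F_space \<psi> a s p q \<Longrightarrow>
    ennreal (2 powr (real j * t * p)) * Lp_pow p (tr f j) \<le>
    ennreal C * (\<integral>\<^sup>+y. ennreal (2 powr (real j * s * p)) * ennreal (norm (LP_piece a \<psi> j f y) powr p) *
      ennreal (th (2 powr (real j * snd a) * (2 powr snd a * snd y))) \<partial>lborel)"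
proof -
  have K: "rapid (inv_fourier \<psi>)"
    by (intro schwartz_rapid schwartz_inv_fourier test_functions_schwartz \<psi>_test)
  obtain C where C: "C > 0" "\<And>v. band_limited (inv_fourier \<psi>) v \<Longrightarrow> Lp_pow p v < top \<Longrightarrow>
    Lp_pow p (\<lambda>x'. v (x', 0)) \<le> ennreal C * (\<integral>\<^sup>+z. ennreal (norm (v z) powr p) * ennreal (th (snd z)) \<partial>lborel)"
    using trace_unit[OF K p01] by blast
  have "ennreal (2 powr (real j * t * p)) * Lp_pow p (tr f j) \<le>
    ennreal (C * 2 powr snd a) * (\<integral>\<^sup>+y. ennreal (2 powr (real j * s * p)) * ennreal (norm (LP_piece a \<psi> j f y) powr p) *
      ennreal (th (2 powr (real j * snd a) * (2 powr snd a * snd y))) \<partial>lborel)"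
    if f: "f \<in> F_space \<psi> a s p q" for f j
  proof -
    have ft: "f \<in> tempered" using f by (simp add: F_space_def)
    let ?u = "LP_piece a \<psi> j f" and ?d = "2 powr (- real (Suc j)) :: real"
    let ?v = "\<lambda>z. ?u (aniso_dilation a ?d z)"
    let ?t = "\<lambda>y. th (2 powr (real j * snd a) * (2 powr snd a * y))"
    have um[measurable]: "?u \<in> borel_measurable borel" by (rule piece_measurable[OF ft])
    have d0: "?d > 0" by simp
    have vfin: "Lp_pow p ?v < top"
      using piece_Lp[OF f] by (subst Lp_pow_dilation[OF um d0]) (simp add: ennreal_mult_less_top)
    have "Lp_pow p (\<lambda>x'. ?v (x', 0)) = Lp_pow p (\<lambda>x'. tr f j (aniso_dilation (fst a) ?d x'))"
      by (simp add: aniso_dilation_prod)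
    also have "\<dots> = ennreal (?d powr (- weight_sum (fst a))) * Lp_pow p (tr f j)"
      by (rule Lp_pow_dilation[OF tr_measurable[OF ft] d0])
    finally have 1: "ennreal (?d powr (- weight_sum (fst a))) * Lp_pow p (tr f j) \<le>
      ennreal C * (\<integral>\<^sup>+z. ennreal (norm (?v z) powr p) * ennreal (th (snd z)) \<partial>lborel)"
      using C(2)[OF piece_unit[OF ft] vfin] by simp
    let ?I = "\<integral>\<^sup>+y. ennreal (norm (?u y) powr p) * ennreal (?t (snd y)) \<partial>lborel"
    have mt[measurable]: "(\<lambda>y::'b \<times> real. ?t (snd y)) \<in> borel_measurable borel"
      by (rule measurable_compose[OF _ th_measurable(1)]) measurable
    have tt: "?t (snd (aniso_dilation a ?d z)) = th (snd z)" for z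
    proof -
      have "2 powr (real j * snd a) * (2 powr snd a * (?d powr snd a * y)) = y" for y :: real
      proof -
        have "2 powr (real j * snd a) * (2 powr snd a * (?d powr snd a * y)) = (2 powr (real j * snd a) * 2 powr snd a * ?d powr snd a) * y"
          by (simp only: mult.assoc)
        also have "2 powr (real j * snd a) * 2 powr snd a * ?d powr snd a = 2 powr (real j * snd a + snd a + - real (Suc j) * snd a)"
          by (simp only: powr_powr powr_add)
        also have "real j * snd a + snd a + - real (Suc j) * snd a = 0" by (simp add: algebra_simps)
        finally show ?thesis by simp
      qed
      note X = this
      show ?thesis by (cases z) (simp only: aniso_dilation_prod snd_conv X)
    qed
    have "?I = ennreal (?d powr weight_sum a) * (\<integral>\<^sup>+z. ennreal (norm (?v z) powr p) * ennreal (?t (snd (aniso_dilation a ?d z))) \<partial>lborel)"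
      by (rule nn_integral_dilation[OF _ d0]) measurable
    then have I: "?I = ennreal (?d powr weight_sum a) * (\<integral>\<^sup>+z. ennreal (norm (?v z) powr p) * ennreal (th (snd z)) \<partial>lborel)"
      by (simp only: tt)
    let ?Z = "\<integral>\<^sup>+z. ennreal (norm (?v z) powr p) * ennreal (th (snd z)) \<partial>lborel"
    have cancel: "ennreal (?d powr w) * (ennreal (?d powr (- w)) * X) = X" "ennreal (?d powr (- w)) * (ennreal (?d powr w) * X) = X" for w X
      by (simp_all flip: mult.assoc ennreal_mult powr_add)
    have Z: "?Z = ennreal (?d powr (- weight_sum a)) * ?I" unfolding I cancel ..
    \<comment> \<open>The volume factors leave 2^((j+1) a_n): the part 2^(j a_n) changes t p into s
      p, and 2^(a_n) goes into the constant.\<close>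
    have c1: "ennreal (2 powr (real j * t * p)) * (ennreal (?d powr weight_sum (fst a)) * ennreal (?d powr (- weight_sum a)))
      = ennreal (2 powr snd a) * ennreal (2 powr (real j * s * p))"
    proof -
      have "real j * t * p + (- real (Suc j) * weight_sum (fst a) + - real (Suc j) * - weight_sum a) = snd a + real j * s * p"
        using exponents unfolding weight_sum_prod mult.assoc[of "real j"] by (simp add: algebra_simps)
      then show ?thesis by (simp only: powr_powr flip: ennreal_mult[OF powr_ge_zero powr_ge_zero] powr_add)
    qed
    have "Lp_pow p (tr f j) = ennreal (?d powr weight_sum (fst a)) * (ennreal (?d powr (- weight_sum (fst a))) * Lp_pow p (tr f j))"
      by (rule cancel(1)[symmetric])
    also have "\<dots> \<le> ennreal (?d powr weight_sum (fst a)) * (ennreal C * (ennreal (?d powr (- weight_sum a)) * ?I))"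
      unfolding Z[symmetric] by (intro mult_left_mono 1) simp
    finally have "ennreal (2 powr (real j * t * p)) * Lp_pow p (tr f j) \<le>
      ennreal (2 powr (real j * t * p)) * (ennreal (?d powr weight_sum (fst a)) * (ennreal C * (ennreal (?d powr (- weight_sum a)) * ?I)))"
      by (intro mult_left_mono) simp_all
    also have "\<dots> = ennreal C * (ennreal (2 powr (real j * t * p)) * (ennreal (?d powr weight_sum (fst a)) * ennreal (?d powr (- weight_sum a)))) * ?I"
      by (simp only: mult_ac)
    also have "\<dots> = ennreal (C * 2 powr snd a) * (ennreal (2 powr (real j * s * p)) * ?I)"
      unfolding c1 using C(1) by (simp add: ennreal_mult mult.assoc)
    also have "ennreal (2 powr (real j * s * p)) * ?I = (\<integral>\<^sup>+y. ennreal (2 powr (real j * s * p)) * (ennreal (norm (?u y) powr p) * ennreal (?t (snd y))) \<partial>lborel)"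
      by (rule nn_integral_cmult[symmetric]) measurable
    finally show ?thesis by (simp only: mult.assoc)
  qed
  moreover have "C * 2 powr snd a > 0" using C by simp
  ultimately show thesis using that by blast
qed

end

context trace_setup
begin

lemma tr_cost:
  obtains C where "C > 0" "\<And>f. f \<in> F_space \<psi> a s p q \<Longrightarrow> cost_pow (tr f) \<le> ennreal C * ennpowr (F_norm \<psi> a s p q f) p"
proof -
  obtain C where C: "C > 0" "\<And>f j. f \<in> F_space \<psi> a s p q \<Longrightarrow>
    ennreal (2 powr (real j * t * p)) * Lp_pow p (tr f j) \<le>
    ennreal C * (\<integral>\<^sup>+y. ennreal (2 powr (real j * s * p)) * ennreal (norm (LP_piece a \<psi> j f y) powr p) *
      ennreal (th (2 powr (real j * snd a) * (2 powr snd a * snd y))) \<partial>lborel)"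
    using tr_piece_bound by blast
  have an0: "snd a > 0" using an_ge by simp
  obtain D where D: "D > 0" "\<And>\<tau>. \<tau> \<noteq> 0 \<Longrightarrow> (\<Sum>j. ennreal (mn (2 powr (real j * snd a) * \<tau>) powr 1)) \<le> ennreal D"
    using sum_mn_le[OF an0 zero_less_one] by blast
  have "cost_pow (tr f) \<le> ennreal (C * D) * ennpowr (F_norm \<psi> a s p q f) p" if f: "f \<in> F_space \<psi> a s p q" for f
  proof -
    have ft: "f \<in> tempered" using f by (simp add: F_space_def)
    let ?A = "\<lambda>j y. ennreal (2 powr (real j * s * p)) * ennreal (norm (LP_piece a \<psi> j f y) powr p)"
    let ?B = "\<lambda>j y. ennreal (th (2 powr (real j * snd a) * (2 powr snd a * snd (y::'b \<times> real))))"
    have [measurable]: "LP_piece a \<psi> j f \<in> borel_measurable borel" for j by (rule piece_measurable[OF ft])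
    have [measurable]: "(\<lambda>y::'b \<times> real. th (2 powr (real j * snd a) * (2 powr snd a * snd y))) \<in> borel_measurable borel" for j
      by (rule measurable_compose[OF _ th_measurable(1)]) measurable
    have FGm: "FG f \<in> borel_measurable borel" by (rule FG_measurable[OF ft])
    have "cost_pow (tr f) \<le> (\<Sum>j. ennreal C * (\<integral>\<^sup>+y. ?A j y * ?B j y \<partial>lborel))"
      unfolding cost_pow_def by (rule suminf_le[OF C(2)[OF f]]) auto
    also have "\<dots> = ennreal C * (\<Sum>j. (\<integral>\<^sup>+y. ?A j y * ?B j y \<partial>lborel))" by (rule ennreal_suminf_cmult)
    also have "(\<Sum>j. (\<integral>\<^sup>+y. ?A j y * ?B j y \<partial>lborel)) = (\<integral>\<^sup>+y. (\<Sum>j. ?A j y * ?B j y) \<partial>lborel)"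
      by (rule nn_integral_suminf[symmetric]) measurable
    also have "\<dots> \<le> (\<integral>\<^sup>+y. ennreal D * ennpowr (FG f y) p \<partial>lborel)"
    proof (rule nn_integral_mono_AE)
      show "AE y in lborel. (\<Sum>j. ?A j y * ?B j y) \<le> ennreal D * ennpowr (FG f y) p"
        using AE_snd_nonzero
      proof eventually_elim
        case (elim y)
        have \<tau>: "2 powr snd a * snd y \<noteq> 0" using elim by simp
        have "(\<Sum>j. ?A j y * ?B j y) \<le> (\<Sum>j. ennpowr (FG f y) p * ennreal (mn (2 powr (real j * snd a) * (2 powr snd a * snd y)) powr 1))"
        proof (rule suminf_le)
          fix j
          have "?B j y \<le> ennreal (mn (2 powr (real j * snd a) * (2 powr snd a * snd y)) powr 1)"
            using th_le_mn[of "2 powr (real j * snd a) * (2 powr snd a * snd y)"] \<tau> by (simp add: ennreal_leI)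
          then show "?A j y * ?B j y \<le> ennpowr (FG f y) p * ennreal (mn (2 powr (real j * snd a) * (2 powr snd a * snd y)) powr 1)"
            by (rule mult_mono[OF piece_le_FG]) simp_all
        qed auto
        also have "\<dots> = ennpowr (FG f y) p * (\<Sum>j. ennreal (mn (2 powr (real j * snd a) * (2 powr snd a * snd y)) powr 1))"
          by (rule ennreal_suminf_cmult)
        also have "\<dots> \<le> ennpowr (FG f y) p * ennreal D" by (intro mult_left_mono D(2)[OF \<tau>]) simp
        finally show ?case by (simp only: mult.commute)
      qed
    qed
    also have "\<dots> = ennreal D * ennpowr (F_norm \<psi> a s p q f) p"
      unfolding F_norm_pow by (rule nn_integral_cmult) (use FGm in measurable)
    finally show ?thesis
      using C(1) D(1) by (simp add: ennreal_mult mult.assoc mult_left_mono)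
  qed
  moreover have "C * D > 0" using C D by simp
  ultimately show thesis using that by blast
qed

text \<open>The spectrum of a restriction to \<open>x\<^sub>n = 0\<close> is contained in the projection of the spectrum.\<close>

lemma tr_band:
  assumes f: "f \<in> tempered" shows "band (Suc j) (tr f j)"
  unfolding band_def
proof
  obtain C N where C: "\<And>x. norm (LP_piece a \<psi> j f x) \<le> C * (1 + norm x) ^ N" using piece_growth[OF f] by blast
  show tf: "tempered_fun (tr f j)"
    by (rule tempered_fun_growth[OF tr_measurable[OF f], of _ C N]) (use C[of "(_, 0)"] in \<open>simp add: norm_Pair\<close>)
  let ?U = "{\<xi>. aq (fst a) (2 ^ Suc j) \<xi> > 1}" and ?\<phi> = "LP_fun a \<psi> j"
  have op: "open ?U" unfolding aq_def by (intro open_Collect_less continuous_intros) simp_all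
  have \<phi>s: "?\<phi> \<in> schwartz" by (rule LP_fun_schwartz)
  have van: "dist_fourier (dist_of_fun (tr f j)) g = 0" if g: "g \<in> test_functions" "fun_support g \<subseteq> ?U" for g
  proof -
    have gs: "g \<in> schwartz" by (rule test_functions_schwartz[OF g(1)])
    let ?F = "fourier g"
    have Fs: "?F \<in> schwartz" by (rule schwartz_fourier[OF gs])
    have i\<phi>: "integrable lborel (\<lambda>\<xi>. exp (- (\<i> * complex_of_real (\<xi> \<bullet> z))) * ?\<phi> \<xi>)" for z
      by (intro schwartz_integrable schwartz_modulate \<phi>s)
    \<comment> \<open>Adding the last coordinate can only increase \<open>aq\<close>, so phi_j
      vanishes at every point whose projection lies in \<open>?U\<close>.\<close>
    have zero: "?\<phi> \<xi> * g (fst \<xi>) = 0" for \<xi>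
    proof (cases "g (fst \<xi>) = 0")
      case False
      then have "1 < aq (fst a) (2 ^ Suc j) (fst \<xi>)" using g(2) fun_support_superset[of g "fst \<xi>"] by blast
      also have "\<dots> \<le> aq a (2 ^ Suc j) (fst \<xi>, snd \<xi>)" unfolding aq_prod by simp
      finally show ?thesis using LP_fun_zero[of j \<xi>] by simp
    qed simp
    have "(LINT x'|lborel. kern ?\<phi> (z - (x', 0)) * ?F x') = 0" for z
    proof -
      let ?c = "complex_of_real ((2 * pi) ^ DIM('b \<times> real))"
      let ?K = "\<lambda>x' \<xi>. exp (\<i> * complex_of_real (x' \<bullet> fst (\<xi> :: 'b \<times> real)))"
      let ?p = "\<lambda>\<xi>. exp (- (\<i> * complex_of_real (\<xi> \<bullet> z))) * ?\<phi> \<xi>"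
      have k: "kern ?\<phi> (z - (x', 0)) = (LINT \<xi>|lborel. ?K x' \<xi> * ?p \<xi>) / ?c" for x'
      proof -
        have "kern ?\<phi> (z - (x', 0)) = (LINT \<xi>|lborel. exp (\<i> * complex_of_real (((x', 0) - z) \<bullet> \<xi>)) * ?\<phi> \<xi>) / ?c"
          by (simp add: kern_eq inv_fourier_def)
        moreover have "exp (\<i> * complex_of_real (((x', 0) - z) \<bullet> \<xi>)) = ?K x' \<xi> * exp (- (\<i> * complex_of_real (\<xi> \<bullet> z)))" for \<xi>
          by (simp add: inner_diff_left inner_prod_def[of "(x', 0)"] inner_commute[of z] exp_diff exp_minus divide_inverse right_diff_distrib)
        ultimately show ?thesis by (simp only: mult.assoc)
      qed
      \<comment> \<open>Integrating the character in x' against the transform of g recovers g at the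
        projected frequency, by inversion on R^(n-1).\<close>
      have fi: "(LINT x'|lborel. ?K x' \<xi> * ?F x') = of_real ((2 * pi) ^ DIM('b)) * g (fst \<xi>)" for \<xi>
      proof -
        have "g (fst \<xi>) = (LINT x'|lborel. exp (\<i> * complex_of_real (fst \<xi> \<bullet> x')) * ?F x') / of_real ((2 * pi) ^ DIM('b))"
          using fun_cong[OF inv_fourier_fourier[OF gs], of "fst \<xi>"] unfolding inv_fourier_def by simp
        then show ?thesis by (simp add: inner_commute)
      qed
      have Km: "(\<lambda>(x', \<xi>). ?K x' \<xi>) \<in> borel_measurable (borel \<Otimes>\<^sub>M borel)" by measurable
      have "(LINT x'|lborel. kern ?\<phi> (z - (x', 0)) * ?F x') = (LINT x'|lborel. ?F x' * (LINT \<xi>|lborel. ?K x' \<xi> * ?p \<xi>)) / ?c"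
        unfolding k by (subst integral_divide_zero[symmetric]) (simp add: mult.commute)
      also have "(LINT x'|lborel. ?F x' * (LINT \<xi>|lborel. ?K x' \<xi> * ?p \<xi>)) = (LINT \<xi>|lborel. ?p \<xi> * (LINT x'|lborel. ?K x' \<xi> * ?F x'))"
        by (rule fubini_kernel[OF schwartz_integrable[OF Fs] i\<phi> Km, of 1]) simp
      also have "\<dots> = (LINT \<xi>::'b \<times> real|lborel. (0::complex))"
        unfolding fi
      proof (intro Bochner_Integration.integral_cong refl)
        fix \<xi> :: "'b \<times> real"
        have "?p \<xi> * (of_real ((2 * pi) ^ DIM('b)) * g (fst \<xi>)) = exp (- (\<i> * complex_of_real (\<xi> \<bullet> z))) * of_real ((2 * pi) ^ DIM('b)) * (?\<phi> \<xi> * g (fst \<xi>))"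
          by (simp only: mult_ac)
        then show "?p \<xi> * (of_real ((2 * pi) ^ DIM('b)) * g (fst \<xi>)) = 0" unfolding zero by (simp only: mult_zero_right)
      qed
      finally show ?thesis by simp
    qed
    then have z0: "(\<lambda>z. LINT x'|lborel. kern ?\<phi> (z - (x', 0)) * ?F x') = (\<lambda>z. 0)" by (rule ext)
    \<comment> \<open>Here \<open>tempered_conv\<close> is used with the embedding x' -> (x', 0), so
      that the integral runs over the hyperplane only.\<close>
    have "f (\<lambda>z. LINT x'|lborel. kern ?\<phi> (z - (x', 0)) * ?F x') = (LINT x'|lborel. tconv f (kern ?\<phi>) (x', 0) * ?F x')"
    proof (rule tempered_conv[OF f schwartz_kern[OF \<phi>s], where L = "\<lambda>x'. (x', 0)" and B = 1])
      show "(\<lambda>x'::'b. (x', 0::real)) \<in> borel_measurable borel"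
        by (intro borel_measurable_continuous_onI continuous_intros)
    qed (use schwartz_rapid[OF Fs] schwartz_measurable[OF Fs] in \<open>auto simp: norm_Pair\<close>)
    then have "(LINT x'|lborel. tr f j x' * ?F x') = 0"
      unfolding z0 tempered_zero[OF f] LP_piece_eq[OF f] by simp
    then show ?thesis using gs Fs by (simp add: dist_fourier_def dist_of_fun_apply)
  qed
  show "dist_support (dist_fourier (dist_of_fun (tr f j))) \<subseteq> {\<xi>. aniso_norm (fst a) \<xi> \<le> 2 ^ Suc j}"
  proof
    fix \<xi> assume "\<xi> \<in> dist_support (dist_fourier (dist_of_fun (tr f j)))"
    then have "\<xi> \<notin> ?U" unfolding dist_support_def using op van by blast
    then have "aq (fst a) (2 ^ Suc j) \<xi> \<le> 1" by simp
    then show "\<xi> \<in> {\<xi>. aniso_norm (fst a) \<xi> \<le> 2 ^ Suc j}"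
      using aniso_norm_le_iff[OF b_pos, of "2 ^ Suc j" \<xi>] by simp
  qed
qed

text \<open>The trace of piece j belongs to band j + 1, so the sequence is shifted by one place with
  a zero in front; this costs the factor 2^(t p) in \<open>cost_pow\<close>.\<close>

definition shift_rep :: "(nat \<Rightarrow> 'b \<Rightarrow> complex) \<Rightarrow> nat \<Rightarrow> 'b \<Rightarrow> complex" where
  "shift_rep h j = (case j of 0 \<Rightarrow> (\<lambda>x. 0) | Suc i \<Rightarrow> h i)"

lemma dist_of_fun_zero: "dist_of_fun (\<lambda>x. 0) = (\<lambda>f. 0)"
  by (rule ext) (simp add: dist_of_fun_def)

lemma band_zero: "band j (\<lambda>x. 0)"
proof -
  have "tempered_fun (\<lambda>x::'b. 0)" by (rule tempered_fun_growth[where C = 0 and N = 0]) auto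
  moreover have "dist_support (dist_fourier (dist_of_fun (\<lambda>x::'b. 0))) = {}"
    unfolding dist_support_def dist_of_fun_zero dist_fourier_def by auto
  ultimately show ?thesis unfolding band_def by simp
qed

lemma Lp_pow_zero[simp]: "Lp_pow p (\<lambda>x. 0) = 0"
  by (simp add: Lp_pow_def)

lemma suminf_shift: fixes f :: "nat \<Rightarrow> ennreal" assumes "f 0 = 0" shows "(\<Sum>j. f j) = (\<Sum>j. f (Suc j))"
  using suminf_offset[of f 1] assms by simp

text \<open>The shifted sequence of traces is itself an admissible representation of the trace, so
  its cost bounds the infimum, and the L_1 estimate gives convergence.\<close>

lemma trace_main:
  obtains C where "C > 0" "\<And>f. f \<in> F_space \<psi> a s p q \<Longrightarrow>
    \<exists>g. has_trace \<psi> a f g \<and> g \<in> A_space (fst a) t p \<and> A_norm (fst a) t p g \<le> ennreal C * F_norm \<psi> a s p q f"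
proof -
  obtain C where C: "C > 0" "\<And>f. f \<in> F_space \<psi> a s p q \<Longrightarrow> cost_pow (tr f) \<le> ennreal C * ennpowr (F_norm \<psi> a s p q f) p"
    using tr_cost by blast
  obtain D where D: "D > 0" "\<And>h. (\<And>j. band j (h j)) \<Longrightarrow> (\<And>j. Lp_pow p (h j) < top) \<Longrightarrow>
    (\<Sum>j. L1n (h j)) \<le> ennreal D * A_cost t p h"
    using rep_L1 by blast
  let ?C = "(2 powr (t * p) * C) powr (1 / p)"
  have "\<exists>g. has_trace \<psi> a f g \<and> g \<in> A_space (fst a) t p \<and> A_norm (fst a) t p g \<le> ennreal ?C * F_norm \<psi> a s p q f"
    if f: "f \<in> F_space \<psi> a s p q" for f
  proof -
    have ft: "f \<in> tempered" and fin: "F_norm \<psi> a s p q f < top" using f by (auto simp: F_space_def)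
    define h where "h = shift_rep (tr f)"
    have h0: "h 0 = (\<lambda>x. 0)" and hS: "h (Suc j) = tr f j" for j by (simp_all add: h_def shift_rep_def)
    have bh: "band j (h j)" for j by (cases j) (simp_all add: h0 hS band_zero tr_band[OF ft])
    have "cost_pow h = (\<Sum>j. ennreal (2 powr (real (Suc j) * t * p)) * Lp_pow p (tr f j))"
      unfolding cost_pow_def by (subst suminf_shift) (simp_all add: h0 hS)
    also have "\<dots> = (\<Sum>j. ennreal (2 powr (t * p)) * (ennreal (2 powr (real j * t * p)) * Lp_pow p (tr f j)))"
      by (simp add: algebra_simps powr_add ennreal_mult)
    also have "\<dots> = ennreal (2 powr (t * p)) * cost_pow (tr f)"
      unfolding cost_pow_def by (rule ennreal_suminf_cmult)
    also have "\<dots> \<le> ennreal (2 powr (t * p)) * (ennreal C * ennpowr (F_norm \<psi> a s p q f) p)"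
      by (intro mult_left_mono C f) simp
    also have "\<dots> = ennreal (2 powr (t * p) * C) * ennpowr (F_norm \<psi> a s p q f) p"
      using C(1) by (simp add: ennreal_mult mult.assoc)
    finally have cp: "cost_pow h \<le> ennreal (2 powr (t * p) * C) * ennpowr (F_norm \<psi> a s p q f) p" .
    have "A_cost t p h \<le> ennpowr (ennreal (2 powr (t * p) * C) * ennpowr (F_norm \<psi> a s p q f) p) (1 / p)"
      unfolding A_cost_eq by (rule ennpowr_mono[OF cp]) (use p01 in simp)
    also have "\<dots> = ennreal ?C * F_norm \<psi> a s p q f"
      using p01 C(1) by (subst ennpowr_mult) (simp_all add: ennpowr_inverse)
    finally have Ac: "A_cost t p h \<le> ennreal ?C * F_norm \<psi> a s p q f" .
    also have "\<dots> < top" using fin by (simp add: ennreal_mult_less_top)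
    finally have Afin: "A_cost t p h < top" .
    have cfin: "cost_pow h < top" using Afin unfolding A_cost_eq ennpowr_less_top .
    have Lfin: "Lp_pow p (h j) < top" for j
    proof -
      have "ennreal (2 powr (real j * t * p)) * Lp_pow p (h j) < top"
        using ennreal_le_suminf[of "\<lambda>j. ennreal (2 powr (real j * t * p)) * Lp_pow p (h j)" j] cfin
        unfolding cost_pow_def by (rule le_less_trans)
      then show ?thesis by (auto simp: ennreal_mult_less_top)
    qed
    have "(\<Sum>j. L1n (h j)) \<le> ennreal D * A_cost t p h" by (rule D(2)[OF bh Lfin])
    also have "\<dots> < top" using Afin by (simp add: ennreal_mult_less_top)
    finally have L1: "(\<Sum>j. L1n (h j)) < top" .
    define g where "g = (\<lambda>\<phi>. \<Sum>j. dist_of_fun (h j) \<phi>)"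
    have ds: "dist_sums (\<lambda>j. dist_of_fun (h j)) g" unfolding g_def by (rule L1_sum(1)[OF tf[OF bh] L1])
    then have gt: "g \<in> tempered" by (simp add: dist_sums_def dist_tendsto_def)
    have rep: "Lp_representation (fst a) p h g" unfolding Lp_representation_iff using bh Lfin ds by blast
    have "has_trace \<psi> a f g" unfolding has_trace_def dist_tendsto_def
    proof (intro conjI gt ballI)
      fix \<phi> :: "'b \<Rightarrow> complex" assume \<phi>: "\<phi> \<in> schwartz"
      have "(\<lambda>N. \<Sum>j\<le>N. dist_of_fun (h j) \<phi>) \<longlonglongrightarrow> g \<phi>" using ds \<phi> unfolding dist_sums_def dist_tendsto_def by blast
      \<comment> \<open>Because of the leading zero, the partial sum to N + 1 of the shifted
        sequence is the N-th partial sum in \<open>has_trace\<close>.\<close>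
      then have "(\<lambda>N. \<Sum>j\<le>Suc N. dist_of_fun (h j) \<phi>) \<longlonglongrightarrow> g \<phi>" by (rule LIMSEQ_Suc)
      moreover have "(\<Sum>j\<le>Suc N. dist_of_fun (h j) \<phi>) = dist_of_fun (\<lambda>x'. \<Sum>j\<le>N. tr f j x') \<phi>" for N
      proof -
        have "(\<Sum>j\<le>Suc N. dist_of_fun (h j) \<phi>) = (\<Sum>j\<le>N. dist_of_fun (tr f j) \<phi>)"
          by (subst sum.atMost_Suc_shift) (simp add: h0 hS dist_of_fun_zero)
        also have "\<dots> = (LINT x|lborel. (\<Sum>j\<le>N. tr f j x * \<phi> x))"
          unfolding dist_of_fun_apply[OF \<phi>]
          by (rule Bochner_Integration.integral_sum[symmetric]) (rule tempered_fun_integrable[OF tf[OF tr_band[OF ft]] \<phi>])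
        finally show ?thesis by (simp add: dist_of_fun_apply[OF \<phi>] sum_distrib_right)
      qed
      ultimately show "(\<lambda>N. dist_of_fun (\<lambda>x'. \<Sum>j\<le>N. tr f j x') \<phi>) \<longlonglongrightarrow> g \<phi>" by simp
    qed
    moreover have "g \<in> A_space (fst a) t p"
      unfolding A_space_def using gt rep Afin by auto
    moreover have "A_norm (fst a) t p g \<le> A_cost t p h"
      unfolding A_norm_def by (rule INF_lower) (use rep in simp)
    ultimately show ?thesis using Ac order_trans by blast
  qed
  moreover have "?C > 0" using C by simp
  ultimately show thesis using that by blast
qed

end

section \<open>The extension\<close>

lemma integral_tensor:
  fixes f :: "'a::euclidean_space \<Rightarrow> complex" and g :: "'b::euclidean_space \<Rightarrow> complex"
  assumes f: "integrable lborel f" and g: "integrable lborel g"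
  shows "(LINT z|lborel. f (fst z) * g (snd z)) = (LINT x|lborel. f x) * (LINT y|lborel. g y)"
proof -
  have "integrable (lborel \<Otimes>\<^sub>M lborel) (\<lambda>(x, y). 1 * (f x * g y))"
    by (rule integrable_kernel[OF f g, where B = 1]) simp_all
  then have "integrable (lborel \<Otimes>\<^sub>M lborel) (\<lambda>z. f (fst z) * g (snd z))" by (simp add: case_prod_beta')
  from lborel_pair.integral_fst'[OF this] show ?thesis by (simp add: lborel_prod)
qed

lemma inv_fourier_tensor:
  fixes f :: "'a::euclidean_space \<Rightarrow> complex" and g :: "'b::euclidean_space \<Rightarrow> complex"
  assumes f: "f \<in> schwartz" and g: "g \<in> schwartz"
  shows "inv_fourier (\<lambda>\<xi>. f (fst \<xi>) * g (snd \<xi>)) (x, y) = inv_fourier f x * inv_fourier g y"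
proof -
  have i: "integrable lborel (\<lambda>\<xi>. exp (\<i> * of_real (x \<bullet> \<xi>)) * f \<xi>)" if "f \<in> schwartz" for f :: "'c::euclidean_space \<Rightarrow> complex" and x
    using schwartz_integrable[OF schwartz_modulate[OF that, of "- x"]] by (simp add: inner_commute)
  have "(LINT \<xi>|lborel. exp (\<i> * of_real ((x, y) \<bullet> \<xi>)) * (f (fst \<xi>) * g (snd \<xi>))) =
    (LINT \<xi>|lborel. (\<lambda>u. exp (\<i> * of_real (x \<bullet> u)) * f u) (fst \<xi>) * (\<lambda>u. exp (\<i> * of_real (y \<bullet> u)) * g u) (snd \<xi>))"
    by (intro Bochner_Integration.integral_cong refl) (simp add: inner_prod_def distrib_left exp_add mult_ac)
  also have "\<dots> = (LINT \<xi>|lborel. exp (\<i> * of_real (x \<bullet> \<xi>)) * f \<xi>) * (LINT \<xi>|lborel. exp (\<i> * of_real (y \<bullet> \<xi>)) * g \<xi>)"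
    by (rule integral_tensor[OF i[OF f] i[OF g]])
  finally show ?thesis unfolding inv_fourier_def by (simp add: power_add)
qed

lemma test_functions_tensor:
  fixes f :: "'a::euclidean_space \<Rightarrow> complex" and g :: "'b::euclidean_space \<Rightarrow> complex"
  assumes f: "f \<in> test_functions" and g: "g \<in> test_functions"
  shows "(\<lambda>z. f (fst z) * g (snd z)) \<in> test_functions"
proof -
  obtain u :: 'a where u: "u \<in> Basis" using nonempty_Basis by blast
  obtain v :: 'b where v: "v \<in> Basis" using nonempty_Basis by blast
  note uv = u v
  have "smooth (\<lambda>z::'a \<times> 'b. f (0 + fst z))"
  proof (rule smooth_affine[OF test_functions_smooth[OF f] linear_fst])
    fix w :: "'a \<times> 'b" assume "w \<in> Basis"
    then consider "fst w \<in> Basis" | "fst w = 0" by (auto simp: Basis_prod_def)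
    then show "\<exists>c. \<exists>i\<in>Basis. fst w = c *\<^sub>R i"
      by cases (force intro!: exI[of _ "1::real"], use uv in \<open>force intro!: exI[of _ "0::real"]\<close>)
  qed
  moreover have "smooth (\<lambda>z::'a \<times> 'b. g (0 + snd z))"
  proof (rule smooth_affine[OF test_functions_smooth[OF g] linear_snd])
    fix w :: "'a \<times> 'b" assume "w \<in> Basis"
    then consider "snd w \<in> Basis" | "snd w = 0" by (auto simp: Basis_prod_def)
    then show "\<exists>c. \<exists>i\<in>Basis. snd w = c *\<^sub>R i"
      by cases (force intro!: exI[of _ "1::real"], use uv in \<open>force intro!: exI[of _ "0::real"]\<close>)
  qed
  ultimately have "smooth (\<lambda>z::'a \<times> 'b. f (fst z) * g (snd z))" using smooth_mult by auto
  moreover obtain R where R: "\<And>x. f x \<noteq> 0 \<Longrightarrow> norm x \<le> R" using test_function_support_bound[OF f] by blast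
  moreover obtain R' where R': "\<And>x. g x \<noteq> 0 \<Longrightarrow> norm x \<le> R'" using test_function_support_bound[OF g] by blast
  moreover have "compact (fun_support (\<lambda>z. f (fst z) * g (snd z)))"
    by (rule compact_fun_supportI[of "cball 0 R \<times> cball 0 R'"])
      (auto simp: bounded_Times mem_Times_iff intro: R R')
  ultimately show ?thesis by (simp add: test_functions_def)
qed

text \<open>\<open>dist_tensor\<close> applies its functional to such a partial integral, and a
  functional returns the default 0 off the Schwartz space.\<close>

lemma partial_integral_schwartz:
  fixes f :: "'a::euclidean_space \<times> 'b::euclidean_space \<Rightarrow> complex" and k :: "'b \<Rightarrow> complex"
  assumes f: "f \<in> schwartz" and k: "integrable lborel k"
  shows "(\<lambda>x. LINT y|lborel. k y * f (x, y)) \<in> schwartz"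
proof (rule schwartz_fspanI[where G = "(\<lambda>f x. LINT y|lborel. k y * f (x, y)) ` schwartz"])
  have [measurable]: "k \<in> borel_measurable borel" using borel_measurable_integrable[OF k] by simp
  have pm: "(\<lambda>y. (x, y)) \<in> borel_measurable borel" for x :: 'a
    by (intro borel_measurable_continuous_onI continuous_intros)
  have sm: "(\<lambda>y. g (x, y)) \<in> borel_measurable borel" if "g \<in> schwartz" for g :: "'a \<times> 'b \<Rightarrow> complex" and x
    by (rule measurable_compose[OF pm schwartz_measurable[OF that]])
  have int: "integrable lborel (\<lambda>y. k y * g (x, y))" if g: "g \<in> schwartz" for g :: "'a \<times> 'b \<Rightarrow> complex" and x
  proof -
    obtain B where B: "\<And>z. norm (g z) \<le> B" using schwartz_bounded[OF g] by blast
    have B0: "0 \<le> B" using B order_trans[OF norm_ge_zero] by blast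
    show ?thesis
    proof (rule Bochner_Integration.integrable_bound)
      show "integrable lborel (\<lambda>y. norm (k y) * B)" using k by simp
      show "AE y in lborel. norm (k y * g (x, y)) \<le> norm (norm (k y) * B)"
        using B B0 by (intro AE_I2) (simp add: norm_mult mult_left_mono)
      show "(\<lambda>y. k y * g (x, y)) \<in> borel_measurable lborel" using sm[OF g] by simp
    qed
  qed
  have D: "((\<lambda>x. LINT y|lborel. k y * g (x, y)) has_derivative (\<lambda>h. LINT y|lborel. k y * frechet_derivative g (at (x, y)) (h, 0))) (at x)"
    if g: "g \<in> schwartz" for g :: "'a \<times> 'b \<Rightarrow> complex" and x
  proof -
    obtain C where C: "C > 0" "\<And>x h. (1 + norm x) ^ 0 * norm (frechet_derivative g (at x) h) \<le> C * norm h"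
      using schwartz_frechet_bound[OF g, where k = 0] by blast
    show ?thesis
    proof (rule has_derivative_lebesgue_integral[where S = UNIV and w = "\<lambda>y. norm (k y) * C"])
      show "((\<lambda>x. k y * g (x, y)) has_derivative (\<lambda>h. k y * frechet_derivative g (at (x, y)) (h, 0))) (at x)" for x y
      proof -
        have 1: "((\<lambda>x. (x, y)) has_derivative (\<lambda>h. (h, 0))) (at x)" by (auto intro!: derivative_eq_intros)
        have "(g has_derivative frechet_derivative g (at (x, y))) (at (x, y))"
          using schwartz_differentiable[OF g] frechet_derivative_works by blast
        from has_derivative_compose[OF 1 this] show ?thesis by (rule has_derivative_mult_right)
      qed
      show "(\<lambda>y. k y * frechet_derivative g (at (x, y)) (h, 0)) \<in> borel_measurable lborel" for h
      proof -
        have e: "frechet_derivative g (at (x, y)) (h, 0) = (\<Sum>b\<in>Basis. ((h, 0) \<bullet> b) *\<^sub>R pd b g (x, y))" for y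
          by (rule fun_cong[OF frechet_derivative_at[OF differentiable_has_derivative_pd[OF schwartz_differentiable[OF g]], symmetric]])
        have "(\<lambda>y. k y * (\<Sum>b\<in>Basis. ((h, 0) \<bullet> b) *\<^sub>R pd b g (x, y))) \<in> borel_measurable borel"
          by (intro borel_measurable_times borel_measurable_sum borel_measurable_scaleR borel_measurable_const sm schwartz_pd g) simp_all
        then show ?thesis by (simp only: e measurable_lborel2)
      qed
      show "norm (k y * frechet_derivative g (at (x, y)) (h, 0)) \<le> norm (k y) * C * norm h" for x y h
        using mult_left_mono[OF C(2)[of "(x, y)" "(h, 0)"], of "norm (k y)"] by (simp add: norm_mult norm_Pair mult_ac)
    qed (use k int[OF g] in auto)
  qed
  fix h :: "'a \<Rightarrow> complex" assume "h \<in> (\<lambda>f x. LINT y|lborel. k y * f (x, y)) ` schwartz"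
  then obtain g where h: "h = (\<lambda>x. LINT y|lborel. k y * g (x, y))" and g: "g \<in> schwartz" by blast
  show "h differentiable (at x)" for x unfolding h by (rule differentiableI[OF D[OF g]])
  show "pd v h \<in> fspan ((\<lambda>f x. LINT y|lborel. k y * f (x, y)) ` schwartz)" if v: "v \<in> Basis" for v
  proof -
    have vb: "(v, 0) \<in> Basis" using v by (simp add: Basis_prod_def)
    have "pd v h = (\<lambda>x. LINT y|lborel. k y * pd (v, 0) g (x, y))"
      unfolding h by (rule ext, subst pd_eqI[OF D[OF g]]) (simp add: pd_def)
    then show ?thesis using schwartz_pd[OF g vb] by (auto intro!: fspan.base)
  qed
  show "rapid h" unfolding rapid_def
  proof
    fix n
    obtain C where C: "C > 0" "\<And>z. (1 + norm z) ^ n * norm (g z) \<le> C" using rapidE[OF schwartz_rapid[OF g]] by blast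
    have "(1 + norm x) ^ n * norm (h x) \<le> (LINT y|lborel. norm (k y) * C)" for x
    proof -
      have "(1 + norm x) ^ n * norm (h x) = norm (LINT y|lborel. of_real ((1 + norm x) ^ n) * (k y * g (x, y)))"
        unfolding h by (subst integral_mult_right_zero) (simp add: norm_mult norm_power del: of_real_power)
      also have "\<dots> \<le> (LINT y|lborel. norm (k y) * C)"
      proof (rule Bochner_integral_norm_bound)
        fix y
        have "(1 + norm x) ^ n * norm (g (x, y)) \<le> (1 + norm (x, y)) ^ n * norm (g (x, y))"
          by (intro mult_right_mono power_mono add_left_mono norm_Pair_ge) auto
        also have "\<dots> \<le> C" by (rule C)
        finally have "norm (k y) * ((1 + norm x) ^ n * norm (g (x, y))) \<le> norm (k y) * C" by (intro mult_left_mono) auto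
        then show "norm (of_real ((1 + norm x) ^ n) * (k y * g (x, y))) \<le> norm (k y) * C"
          by (simp add: norm_mult norm_power mult_ac del: of_real_power)
      qed (use k in simp)
      finally show ?thesis .
    qed
    then show "\<exists>C. \<forall>x. (1 + norm x) ^ n * norm (h x) \<le> C" by blast
  qed
qed (use f in blast)

lemma dist_tensor_apply:
  assumes "f \<in> schwartz" "integrable lborel k"
  shows "dist_tensor (dist_of_fun h) k f = (LINT x|lborel. h x * (LINT y|lborel. k y * f (x, y)))"
  unfolding dist_tensor_def using assms by (simp add: dist_of_fun_apply partial_integral_schwartz)

lemma partial_integral_bound:
  assumes "f \<in> schwartz" "integrable lborel k"
  shows "norm (LINT y|lborel. k y * f (x, y)) \<le> (LINT y|lborel. norm (k y)) * schwartz_seminorm 0 f"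
proof -
  have "norm (LINT y|lborel. k y * f (x, y)) \<le> (LINT y|lborel. norm (k y) * schwartz_seminorm 0 f)"
  proof (rule Bochner_integral_norm_bound)
    show "norm (k y * f (x, y)) \<le> norm (k y) * schwartz_seminorm 0 f" for y
      unfolding norm_mult by (intro mult_left_mono schwartz_sup_le_seminorm assms) auto
  qed (use assms(2) in simp)
  then show ?thesis by simp
qed

lemma dist_tensor_bound:
  assumes h: "h \<in> borel_measurable borel" "L1n h < top" and f: "f \<in> schwartz" and k: "integrable lborel k"
  shows "norm (dist_tensor (dist_of_fun h) k f) \<le> (LINT y|lborel. norm (k y)) * enn2real (L1n h) * schwartz_seminorm 0 f"
  unfolding dist_tensor_apply[OF f k]
  using L1n_pairing[where \<phi> = "\<lambda>x. LINT y|lborel. k y * f (x, y)", OF h partial_integral_bound[OF f k]]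
  by (simp add: schwartz_seminorm_nonneg[OF f] mult_ac)

lemma dist_tensor_tempered:
  assumes h: "tempered_fun h" "L1n h < top" and k: "integrable lborel k"
  shows "dist_tensor (dist_of_fun h) k \<in> tempered"
  unfolding tempered_def mem_Collect_eq
proof (intro conjI allI impI ballI)
  show "\<exists>N C. \<forall>f\<in>schwartz. norm (dist_tensor (dist_of_fun h) k f) \<le> C * schwartz_seminorm N f"
    by (intro exI[of _ 0] exI[of _ "(LINT y|lborel. norm (k y)) * enn2real (L1n h)"] ballI
        dist_tensor_bound tempered_fun_measurable h k)
  fix f g :: "'a \<times> 'b \<Rightarrow> complex" and c assume f: "f \<in> schwartz" and g: "g \<in> schwartz"
  have int: "integrable lborel (\<lambda>y. k y * f (x, y))" if f: "f \<in> schwartz" for f :: "'a \<times> 'b \<Rightarrow> complex" and x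
  proof -
    have pm: "(\<lambda>y. (x, y)) \<in> borel_measurable borel" by (intro borel_measurable_continuous_onI continuous_intros)
    show ?thesis
    proof (rule Bochner_Integration.integrable_bound)
      show "integrable lborel (\<lambda>y. norm (k y) * schwartz_seminorm 0 f)" using k by simp
      show "AE y in lborel. norm (k y * f (x, y)) \<le> norm (norm (k y) * schwartz_seminorm 0 f)"
        by (intro AE_I2 order_trans[OF _ real_le_norm]) (simp add: norm_mult mult_left_mono schwartz_sup_le_seminorm[OF f])
      show "(\<lambda>y. k y * f (x, y)) \<in> borel_measurable lborel"
        using borel_measurable_integrable[OF k] measurable_compose[OF pm schwartz_measurable[OF f]] by simp
    qed
  qed
  have "(\<lambda>x. LINT y|lborel. k y * (c * f (x, y) + g (x, y))) = (\<lambda>x. c * (LINT y|lborel. k y * f (x, y)) + (LINT y|lborel. k y * g (x, y)))"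
  proof
    fix x
    have "(LINT y|lborel. k y * (c * f (x, y) + g (x, y))) = (LINT y|lborel. c * (k y * f (x, y)) + k y * g (x, y))"
      by (simp add: algebra_simps)
    then show "(LINT y|lborel. k y * (c * f (x, y) + g (x, y))) = c * (LINT y|lborel. k y * f (x, y)) + (LINT y|lborel. k y * g (x, y))"
      using int[OF f] int[OF g] by simp
  qed
  then show "dist_tensor (dist_of_fun h) k (\<lambda>x. c * f x + g x) = c * dist_tensor (dist_of_fun h) k f + dist_tensor (dist_of_fun h) k g"
    unfolding dist_tensor_def using f g schwartz_add[OF schwartz_cmult[OF f, of c] g]
      tempered_linear[OF tempered_fun_tempered[OF h(1)] partial_integral_schwartz[OF f k] partial_integral_schwartz[OF g k]]
    by simp
qed (simp add: dist_tensor_def)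

section \<open>Extension kernels and their spectra\<close>

lemma aniso_dilation_real[simp]: "aniso_dilation (b::real) t x = t powr b * x"
  by (simp add: aniso_dilation_def)

lemma weight_sum_real[simp]: "weight_sum (b::real) = b"
  by (simp add: weight_sum_def)

locale ext_setup = trace_setup a \<psi> p s t q
  for a :: "'b::euclidean_space \<times> real" and \<psi> p s t q +
  fixes \<eta>0 \<eta> :: "real \<Rightarrow> complex"
  assumes ker: "extension_kernels \<eta>0 \<eta>"
begin

abbreviation an :: real where "an \<equiv> snd a"
abbreviation en :: "nat \<Rightarrow> real \<Rightarrow> complex" where "en \<equiv> extension_kernel an \<eta>0 \<eta>"

text \<open>The factor of the j-th term of an extension in the variable x_n. The normalisation makes
  it a dilate of a fixed profile with value 1 at 0 (\<open>kap_eq\<close>, \<open>kap_0\<close>), so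
  that restriction to x_n = 0 returns the other factor.\<close>

definition kap :: "nat \<Rightarrow> real \<Rightarrow> complex" where
  "kap j \<tau> = of_real (2 powr (- (real j * an))) * inv_fourier (en j) \<tau>"

lemma \<eta>_test: "\<eta>0 \<in> test_functions" "\<eta> \<in> test_functions"
proof -
  have c: "compact (fun_support f)" if "fun_support f \<subseteq> {l<..<u}" for f :: "real \<Rightarrow> complex" and l u
    using bounded_subset[OF bounded_box[of l u, unfolded box_real] that] by (simp add: fun_support_def compact_eq_bounded_closed)
  show "\<eta>0 \<in> test_functions" "\<eta> \<in> test_functions"
    using ker c unfolding extension_kernels_def test_functions_def by (auto simp: schwartz_smooth)
qed

lemma \<eta>_support: "\<eta>0 \<tau> \<noteq> 0 \<Longrightarrow> \<bar>\<tau>\<bar> < 1" "\<eta> \<tau> \<noteq> 0 \<Longrightarrow> 1 < \<tau> \<and> \<tau> < 2"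
  using ker fun_support_superset[of \<eta>0 \<tau>] fun_support_superset[of \<eta> \<tau>] unfolding extension_kernels_def by fastforce+

lemma en_test: "en j \<in> test_functions"
proof (cases "j = 0")
  case False
  then have "en j = (\<lambda>\<tau>. \<eta> ((2 powr (- (real j * an))) *\<^sub>R (\<tau> - 0)))" by (simp add: extension_kernel_def)
  then show ?thesis using scaled_test_function[OF \<eta>_test(2), of "2 powr (- (real j * an))" 0] by simp
qed (simp add: extension_kernel_def \<eta>_test)

lemma en_schwartz: "en j \<in> schwartz" by (rule test_functions_schwartz[OF en_test])

lemma kap_eq: "kap j \<tau> = inv_fourier (if j = 0 then \<eta>0 else \<eta>) (2 powr (real j * an) * \<tau>)"
proof (cases "j = 0")
  case True then show ?thesis by (simp add: kap_def extension_kernel_def)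
next
  case False
  have e: "en j = (\<lambda>\<xi>. \<eta> (aniso_dilation an (2 powr (- real j)) \<xi>))"
    using False by (simp add: extension_kernel_def powr_powr)
  have "inv_fourier (en j) \<tau> = of_real ((2 powr (- real j)) powr (- weight_sum an)) * inv_fourier \<eta> (aniso_dilation an (1 / 2 powr (- real j)) \<tau>)"
    unfolding e by (rule inv_fourier_dilation) (use schwartz_measurable[OF test_functions_schwartz[OF \<eta>_test(2)]] in auto)
  also have "1 / 2 powr (- real j) = 2 powr real j" by (simp add: powr_minus_divide)
  finally have "inv_fourier (en j) \<tau> = of_real (2 powr (real j * an)) * inv_fourier \<eta> (2 powr (real j * an) * \<tau>)"
    by (simp add: powr_powr)
  moreover have "complex_of_real (2 powr (- (real j * an))) * of_real (2 powr (real j * an)) = 1"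
    by (simp flip: of_real_mult powr_add)
  ultimately show ?thesis using False by (simp add: kap_def flip: mult.assoc)
qed

lemma kap_0: "kap j 0 = 1"
  unfolding kap_eq using ker by (auto simp: extension_kernels_def)

lemma kap_schwartz: "kap j \<in> schwartz"
  unfolding kap_def[abs_def] by (intro schwartz_cmult schwartz_inv_fourier en_schwartz)

lemma kap_integrable: "integrable lborel (kap j)"
  by (rule schwartz_integrable[OF kap_schwartz])

text \<open>By dilation the norms even carry the factor 2^(-j a_n); uniform boundedness is enough
  for summing the tensor products.\<close>

lemma kap_L1:
  obtains C where "C > 0" "\<And>j. (LINT \<tau>|lborel. norm (kap j \<tau>)) \<le> C"
proof
  let ?I = "\<lambda>f. LINT \<tau>|lborel. norm (inv_fourier f \<tau>) :: real"
  show "1 + ?I \<eta>0 + ?I \<eta> > 0" by (simp add: add_pos_nonneg)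
  fix j :: nat
  let ?e = "if j = 0 then \<eta>0 else \<eta>"
  have em: "inv_fourier ?e \<in> schwartz" by (intro schwartz_inv_fourier) (simp add: \<eta>_test test_functions_schwartz)
  have [measurable]: "inv_fourier ?e \<in> borel_measurable borel" by (rule schwartz_measurable[OF em])
  have "?I ?e = \<bar>2 powr (real j * an)\<bar> *\<^sub>R (LINT \<tau>|lborel. norm (inv_fourier ?e (0 + 2 powr (real j * an) * \<tau>)))"
    by (rule lborel_integral_real_affine) simp
  also have "\<dots> = 2 powr (real j * an) * (LINT \<tau>|lborel. norm (kap j \<tau>))" by (simp add: kap_eq)
  finally have e: "2 powr (real j * an) * (LINT \<tau>|lborel. norm (kap j \<tau>)) = ?I ?e" by simp
  have "1 * (LINT \<tau>|lborel. norm (kap j \<tau>)) \<le> 2 powr (real j * an) * (LINT \<tau>|lborel. norm (kap j \<tau>))"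
    using an_ge by (intro mult_right_mono) (auto intro!: ge_one_powr_ge_zero)
  also have "\<dots> \<le> 1 + ?I \<eta>0 + ?I \<eta>" unfolding e by (simp add: add_nonneg_nonneg)
  finally show "(LINT \<tau>|lborel. norm (kap j \<tau>)) \<le> 1 + ?I \<eta>0 + ?I \<eta>" by simp
qed

text \<open>The frequency localisation of the j-th term of an extension: its tangential factor
  reproduces under \<open>cut j\<close>, so phi_k acts on the term through the product of phi_k and
  \<open>tens j\<close>.\<close>

definition tens :: "nat \<Rightarrow> 'b \<times> real \<Rightarrow> complex" where
  "tens j \<xi> = cut j (fst \<xi>) * en j (snd \<xi>)"

lemma cut_test: "cut j \<in> test_functions"
  unfolding cut_def[abs_def] by (intro test_functions_dilation \<rho>_test) simp

lemma tens_test: "tens j \<in> test_functions"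
  unfolding tens_def[abs_def] by (rule test_functions_tensor[OF cut_test en_test])

lemma en_support:
  assumes "en j \<tau> \<noteq> 0"
  shows "\<bar>\<tau>\<bar> \<le> 2 powr (real (Suc j) * an)" "0 < j \<Longrightarrow> 2 powr (real j * an) \<le> \<tau>"
proof -
  have "\<bar>\<tau>\<bar> \<le> 2 powr (real (Suc j) * an) \<and> (0 < j \<longrightarrow> 2 powr (real j * an) \<le> \<tau>)"
  proof (cases "j = 0")
    case True
    then have "\<bar>\<tau>\<bar> < 1" using assms \<eta>_support(1) by (simp add: extension_kernel_def)
    moreover have "1 \<le> 2 powr an" using an_ge by (intro ge_one_powr_ge_zero) auto
    ultimately show ?thesis using True by simp
  next
    case False
    let ?c = "2 powr (real j * an)"
    have c: "?c > 0" by simp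
    have "1 < 2 powr (- (real j * an)) * \<tau> \<and> 2 powr (- (real j * an)) * \<tau> < 2"
      using assms False by (intro \<eta>_support(2)) (simp add: extension_kernel_def)
    then have "1 < \<tau> / ?c \<and> \<tau> / ?c < 2" by (simp add: powr_minus_divide)
    then have 1: "?c < \<tau>" "\<tau> < 2 * ?c" using c by (simp_all add: pos_less_divide_eq pos_divide_less_eq)
    have "2 * ?c \<le> 2 powr an * ?c" using powr_mono[OF an_ge, of 2] by (intro mult_right_mono) auto
    also have "\<dots> = 2 powr (real (Suc j) * an)" by (simp add: powr_add[symmetric] algebra_simps)
    finally show ?thesis using 1 c by simp
  qed
  then show "\<bar>\<tau>\<bar> \<le> 2 powr (real (Suc j) * an)" "0 < j \<Longrightarrow> 2 powr (real j * an) \<le> \<tau>" by auto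
qed

text \<open>The lower bound rests on the support of \<open>\<eta>\<close> in ]1, 2[, which forces
  xi_n >= 2^(j a_n). For the upper one, \<open>cut j\<close> reaches to radius 2^(j+2); one more
  level gains 1/4 because the weights are at least 1, and leaves room for xi_n, which contributes at
  most 1/2.\<close>

lemma tens_support:
  assumes "tens j \<xi> \<noteq> 0"
  shows "aq a (2 ^ (j + 3)) \<xi> \<le> 1" "0 < j \<Longrightarrow> 1 \<le> aq a (2 ^ j) \<xi>"
proof -
  obtain x \<tau> where \<xi>: "\<xi> = (x, \<tau>)" by (cases \<xi>)
  have c: "cut j x \<noteq> 0" and e: "en j \<tau> \<noteq> 0" using assms by (auto simp: tens_def \<xi>)
  have p2: "(2::real) ^ k = 2 powr real k" for k by (simp add: powr_realpow)
  have "aq (fst a) 2 (aniso_dilation (fst a) (2 powr (- real (Suc j))) x) < 1"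
    using c \<rho>_zero unfolding cut_def by force
  then have "aq (fst a) (2 / 2 powr (- real (Suc j))) x < 1" by (simp add: aq_dilation del: of_nat_Suc)
  also have "2 / 2 powr (- real (Suc j)) = (2::real) ^ (j + 2)"
    unfolding p2 by (simp add: powr_minus_divide powr_add powr_diff)
  finally have A: "aq (fst a) (2 ^ (j + 2)) x < 1" .
  have "aq (fst a) (2 ^ (j + 3)) x \<le> aq (fst a) (2 ^ (j + 2)) x / 4"
    unfolding aq_def sum_divide_distrib
  proof (rule sum_mono)
    fix i :: 'b assume i: "i \<in> Basis"
    let ?b = "2 * (fst a \<bullet> i)"
    have "(2::real) powr 2 \<le> 2 powr ?b" using b_ge[OF i] by (intro powr_mono) auto
    then have "4 * (2 ^ (j + 2)) powr ?b \<le> 2 powr ?b * (2 ^ (j + 2)) powr ?b" by (intro mult_right_mono) auto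
    also have "\<dots> = (2 ^ (j + 3)) powr ?b" by (subst powr_mult[symmetric]) (simp add: power_add mult.commute)
    finally have "4 * (2 ^ (j + 2)) powr ?b \<le> (2 ^ (j + 3)) powr ?b" .
    then have "(x \<bullet> i)\<^sup>2 / (2 ^ (j + 3)) powr ?b \<le> (x \<bullet> i)\<^sup>2 / (4 * (2 ^ (j + 2)) powr ?b)"
      by (intro divide_left_mono) auto
    then show "(x \<bullet> i)\<^sup>2 / (2 ^ (j + 3)) powr ?b \<le> (x \<bullet> i)\<^sup>2 / (2 ^ (j + 2)) powr ?b / 4" by (simp add: mult.commute)
  qed
  then have 1: "aq (fst a) (2 ^ (j + 3)) x \<le> 1 / 4" using A by simp
  have sq: "(2 powr c)\<^sup>2 = 2 powr (2 * c)" for c :: real by (simp only: mult_2 powr_add power2_eq_square)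
  have "\<tau>\<^sup>2 \<le> (2 powr (real (Suc j) * an))\<^sup>2"
    using power_mono[OF en_support(1)[OF e] abs_ge_zero, of 2] by simp
  also have "\<dots> \<le> 2 powr (2 * (real (j + 3) * an) - 1)"
    unfolding sq using an_ge by (intro powr_mono) (auto simp: algebra_simps)
  also have "\<dots> = (2 ^ (j + 3)) powr (2 * an) / 2"
    unfolding p2 powr_powr powr_diff by (simp add: algebra_simps)
  finally have 2: "\<tau>\<^sup>2 / (2 ^ (j + 3)) powr (2 * an) \<le> 1 / 2" by (simp add: divide_le_eq mult.commute)
  show "aq a (2 ^ (j + 3)) \<xi> \<le> 1" unfolding \<xi> aq_prod using 1 2 by linarith
  show "1 \<le> aq a (2 ^ j) \<xi>" if j: "0 < j"
  proof -
    have "(2 powr (real j * an))\<^sup>2 \<le> \<tau>\<^sup>2" using en_support(2)[OF e j] by (intro power_mono) auto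
    then have "(2 ^ j) powr (2 * an) \<le> \<tau>\<^sup>2" unfolding sq p2 powr_powr by (simp add: algebra_simps)
    then have "1 \<le> \<tau>\<^sup>2 / (2 ^ j) powr (2 * an)" by (simp add: le_divide_eq)
    moreover have "0 \<le> aq (fst a) (2 ^ j) x" unfolding aq_def by (intro sum_nonneg) auto
    ultimately show ?thesis unfolding \<xi> aq_prod by linarith
  qed
qed

text \<open>Only k = j, ..., j + 3 survive: below j the lower support bound applies, from j + 4 on
  the upper one.\<close>

lemma LP_tens_zero:
  assumes "k < j \<or> j + 4 \<le> k" shows "LP_fun a \<psi> k \<xi> * tens j \<xi> = 0"
proof (cases "tens j \<xi> = 0")
  case False
  from assms show ?thesis
  proof
    assume k: "k < j"
    then have "1 \<le> aq a (2 ^ j) \<xi>" using tens_support(2)[OF False] by simp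
    also have "\<dots> \<le> aq a (2 ^ Suc k) \<xi>" using k by (intro aq_antimono[OF a_pos] power_increasing) auto
    finally show ?thesis by (simp add: LP_fun_zero)
  next
    assume k: "j + 4 \<le> k"
    then obtain k' where k': "k = Suc k'" "j + 3 \<le> k'" by (cases k) auto
    have "aq a (2 ^ k') \<xi> \<le> aq a (2 ^ (j + 3)) \<xi>" using k' by (intro aq_antimono[OF a_pos] power_increasing) auto
    also have "\<dots> \<le> 1" by (rule tens_support(1)[OF False])
    finally show ?thesis unfolding k'(1) by (simp add: LP_fun_zero')
  qed
qed simp

lemma LP_tens_sum: "(\<Sum>k\<le>j + 3. LP_fun a \<psi> k \<xi> * tens j \<xi>) = tens j \<xi>"
  using tens_support(1)[of j \<xi>] by (cases "tens j \<xi> = 0") (simp_all add: LPc_one sum_LP_fun flip: sum_distrib_right)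

end

context ext_setup
begin

text \<open>The convolution kernel, in x' only, that maps the factor h_j to the part of its extended
  term selected by the multiplier phi; see \<open>tensor_kern\<close>.\<close>

definition Lk :: "nat \<Rightarrow> ('b \<times> real \<Rightarrow> complex) \<Rightarrow> 'b \<times> real \<Rightarrow> complex" where
  "Lk j \<phi> z = of_real (2 powr (- (real j * an))) * inv_fourier (\<lambda>\<xi>. \<phi> \<xi> * tens j \<xi>) z"

lemma Lk_schwartz: "\<phi> \<in> schwartz \<Longrightarrow> Lk j \<phi> \<in> schwartz"
  unfolding Lk_def[abs_def]
  by (intro schwartz_cmult schwartz_inv_fourier schwartz_mult test_functions_schwartz[OF tens_test])

lemma tens_kernel: "inv_fourier (cut j) x * kap j \<tau> = of_real (2 powr (- (real j * an))) * inv_fourier (tens j) (x, \<tau>)"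
  unfolding tens_def[abs_def] by (subst inv_fourier_tensor[OF cut_schwartz en_schwartz]) (simp add: kap_def)

text \<open>Replace \<open>h\<close> by its reproduction under \<open>cut j\<close>, move that
  convolution onto the other factor by Fubini, and read the product of the two kernels as the
  inverse transform of \<open>tens j\<close>. The convolution theorem on R^n then merges it with
  phi.\<close>

lemma tensor_kern:
  assumes h: "band j h" and fin: "L1n h < top" and \<phi>: "\<phi> \<in> schwartz"
  shows "dist_tensor (dist_of_fun h) (kap j) (\<lambda>z. kern \<phi> (z - x)) = (LINT y|lborel. h y * Lk j \<phi> (fst x - y, snd x))"
proof -
  let ?ic = "inv_fourier (cut j)" and ?i\<phi> = "inv_fourier \<phi>"
  let ?Q = "\<lambda>u. LINT \<tau>|lborel. kap j \<tau> * kern \<phi> ((u, \<tau>) - x)"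
  have ts: "tens j \<in> schwartz" by (rule test_functions_schwartz[OF tens_test])
  have ks: "(\<lambda>z. kern \<phi> (z - x)) \<in> schwartz" by (intro schwartz_translate schwartz_kern \<phi>)
  have Qs: "?Q \<in> schwartz" by (rule partial_integral_schwartz[OF ks kap_integrable])
  have ics: "?ic \<in> schwartz" by (intro schwartz_inv_fourier cut_schwartz)
  have i\<phi>s: "?i\<phi> \<in> schwartz" by (intro schwartz_inv_fourier \<phi>)
  have [measurable]: "?ic \<in> borel_measurable borel" "?i\<phi> \<in> borel_measurable borel" "?Q \<in> borel_measurable borel"
    "inv_fourier (tens j) \<in> borel_measurable borel" "h \<in> borel_measurable borel"
    by (intro schwartz_measurable ics i\<phi>s Qs schwartz_inv_fourier ts hm[OF h])+
  obtain B where B: "\<And>z. norm (?ic z) \<le> B" using schwartz_bounded[OF ics] by blast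
  obtain B' where B': "\<And>z. norm (?i\<phi> z) \<le> B'" using schwartz_bounded[OF i\<phi>s] by blast
  have hi: "integrable lborel h" by (rule L1n_integrable[OF hm[OF h] fin])
  have inner_eq: "(LINT u|lborel. ?ic (u - y) * ?Q u) = Lk j \<phi> (fst x - y, snd x)" for y
  proof -
    have e0: "(fst x - y, snd x) - w = x - ((y, 0) + w)" for w :: "'b \<times> real" by (simp add: prod_eq_iff)
    have "integrable (lborel \<Otimes>\<^sub>M lborel) (\<lambda>(u, \<tau>). ?i\<phi> (x - (u, \<tau>)) * (?ic (u - y) * kap j \<tau>))"
    proof (rule integrable_kernel[OF _ kap_integrable])
      show "integrable lborel (\<lambda>u. ?ic (u - y))" by (intro schwartz_integrable schwartz_translate ics)
      have "(\<lambda>z::'b \<times> real. ?i\<phi> (x - z)) \<in> borel_measurable borel" by measurable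
      then show "(\<lambda>(u, \<tau>). ?i\<phi> (x - (u, \<tau>))) \<in> borel_measurable (borel \<Otimes>\<^sub>M borel)"
        by (simp add: case_prod_beta' borel_prod)
      show "norm (?i\<phi> (x - (u, \<tau>))) \<le> B'" for u \<tau> by (rule B')
    qed
    from lborel_pair.integral_fst'[OF this]
    have "(LINT u|lborel. LINT \<tau>|lborel. ?i\<phi> (x - (u, \<tau>)) * (?ic (u - y) * kap j \<tau>))
      = (LINT z|lborel. ?i\<phi> (x - z) * (?ic (fst z - y) * kap j (snd z)))"
      by (simp add: lborel_prod case_prod_beta')
    moreover have "?ic (u - y) * ?Q u = (LINT \<tau>|lborel. ?i\<phi> (x - (u, \<tau>)) * (?ic (u - y) * kap j \<tau>))" for u
      by (subst integral_mult_right_zero[symmetric]) (simp add: kern_eq mult_ac)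
    ultimately have "(LINT u|lborel. ?ic (u - y) * ?Q u) = (LINT z|lborel. ?i\<phi> (x - z) * (?ic (fst z - y) * kap j (snd z)))"
      by simp
    also have "\<dots> = (LINT z|lborel. ?i\<phi> (x - ((y, 0) + z)) * (?ic (fst ((y, 0) + z) - y) * kap j (snd ((y, 0) + z))))"
    proof (rule integral_translate[symmetric])
      have [measurable]: "kap j \<in> borel_measurable borel" by (rule schwartz_measurable[OF kap_schwartz])
      show "(\<lambda>z. ?i\<phi> (x - z) * (?ic (fst z - y) * kap j (snd z))) \<in> borel_measurable borel" by measurable
    qed
    also have "\<dots> = (LINT z|lborel. of_real (2 powr (- (real j * an))) * (?i\<phi> ((fst x - y, snd x) - z) * inv_fourier (tens j) z))"
    proof (unfold e0, intro Bochner_Integration.integral_cong refl)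
      fix z :: "'b \<times> real"
      have f: "fst ((y, 0) + z) - y = fst z" "snd ((y, 0) + z) = snd z" by simp_all
      have tk: "?ic (fst z) * kap j (snd z) = of_real (2 powr (- (real j * an))) * inv_fourier (tens j) z"
        unfolding tens_kernel by simp
      show "?i\<phi> (x - ((y, 0) + z)) * (?ic (fst ((y, 0) + z) - y) * kap j (snd ((y, 0) + z))) =
        of_real (2 powr (- (real j * an))) * (?i\<phi> (x - ((y, 0) + z)) * inv_fourier (tens j) z)"
        unfolding f tk by (simp only: mult_ac)
    qed
    also have "\<dots> = of_real (2 powr (- (real j * an))) * (LINT z|lborel. ?i\<phi> ((fst x - y, snd x) - z) * inv_fourier (tens j) z)"
      by (rule integral_mult_right_zero)
    also have "(LINT z|lborel. ?i\<phi> ((fst x - y, snd x) - z) * inv_fourier (tens j) z) = inv_fourier (\<lambda>\<xi>. \<phi> \<xi> * tens j \<xi>) (fst x - y, snd x)"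
      by (rule inv_fourier_mult[OF \<phi> ts, symmetric])
    finally show ?thesis unfolding Lk_def .
  qed
  have "dist_tensor (dist_of_fun h) (kap j) (\<lambda>z. kern \<phi> (z - x)) = (LINT u|lborel. h u * ?Q u)"
    by (rule dist_tensor_apply[OF ks kap_integrable])
  \<comment> \<open>Changing \<open>h\<close> on a null set brings in the convolution with
    \<open>inv_fourier (cut j)\<close>, which an integrable \<open>h\<close> alone does not
    display.\<close>
  also have "\<dots> = (LINT u|lborel. reg j h u * ?Q u)"
  proof (rule integral_cong_AE)
    have [measurable]: "reg j h \<in> borel_measurable borel" by (rule reg_measurable[OF h])
    show "(\<lambda>u. h u * ?Q u) \<in> borel_measurable lborel" "(\<lambda>u. reg j h u * ?Q u) \<in> borel_measurable lborel"
      by measurable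
    show "AE u in lborel. h u * ?Q u = reg j h u * ?Q u" using reg_AE[OF h] by (auto elim: eventually_mono)
  qed
  also have "\<dots> = (LINT u|lborel. ?Q u * (LINT y|lborel. ?ic (u - y) * h y))"
    by (simp only: reg_eq[OF h] mult.commute)
  also have "\<dots> = (LINT y|lborel. h y * (LINT u|lborel. ?ic (u - y) * ?Q u))"
  proof (rule fubini_kernel[OF schwartz_integrable[OF Qs] hi])
    show "(\<lambda>(u, y). ?ic (u - y)) \<in> borel_measurable (borel \<Otimes>\<^sub>M borel)" by measurable
    show "norm (?ic (u - y)) \<le> B" for u y by (rule B)
  qed
  finally show ?thesis unfolding inner_eq .
qed

text \<open>The multiplier of the piece j + i of the j-th term, brought to unit scale.\<close>

definition Mf :: "nat \<Rightarrow> nat \<Rightarrow> 'b \<times> real \<Rightarrow> complex" where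
  "Mf j i \<xi> = LP_fun a \<psi> (j + i) (aniso_dilation a (2 powr real (Suc j)) \<xi>) * tens j (aniso_dilation a (2 powr real (Suc j)) \<xi>)"

lemma Mf_test: "Mf j i \<in> test_functions"
  unfolding Mf_def[abs_def]
  by (intro test_functions_dilation[where f = "\<lambda>\<xi>. LP_fun a \<psi> (j + i) \<xi> * tens j \<xi>"] test_functions_mult LP_fun_test test_functions_smooth tens_test) simp

text \<open>By dilation invariance only finitely many kernels occur up to scaling.\<close>

lemma Mf_min: "Mf j i = Mf (min j 1) i"
proof (cases "j = 0")
  case False
  have m: "min j 1 = 1" using False by simp
  have d: "aniso_dilation b (2 powr r) (aniso_dilation b (2 powr u) x) = aniso_dilation b (2 powr (r + u)) x" for b x :: "'c::euclidean_space" and r u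
    by (simp add: aniso_dilation_dilation powr_add)
  \<comment> \<open>For positive j both factors are dilates of fixed functions, and j cancels. Only
    j = 0 is exceptional, since phi_0 and \<open>\<eta>0\<close> are not dilates of the later
    functions.\<close>
  have L: "LP_fun a \<psi> (j + i) (aniso_dilation a (2 powr real (Suc j)) \<xi>) = \<psi> (aniso_dilation a (2 powr (1 - real i)) \<xi>) - \<psi> (aniso_dilation a (2 powr (2 - real i)) \<xi>)"
    if "j \<noteq> 0" for j \<xi>
    using that unfolding LP_fun_def d by simp
  have T: "tens j (aniso_dilation a (2 powr real (Suc j)) (x, \<tau>)) = \<psi> (x, 0) * \<eta> (2 powr an * \<tau>)" if "j \<noteq> 0" for j x \<tau>
  proof -
    have "cut j (aniso_dilation (fst a) (2 powr real (Suc j)) x) = \<psi> (x, 0)" unfolding cut_def d by simp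
    moreover have "2 powr (- (real j * an)) * ((2 powr real (Suc j)) powr an * \<tau>) = 2 powr an * \<tau>"
      unfolding powr_powr mult.assoc[symmetric] powr_add[symmetric] by (simp add: algebra_simps)
    moreover from this that have "en j ((2 powr real (Suc j)) powr an * \<tau>) = \<eta> (2 powr an * \<tau>)"
      by (simp only: extension_kernel_def if_False)
    ultimately show ?thesis by (simp only: tens_def aniso_dilation_prod fst_conv snd_conv)
  qed
  show ?thesis
  proof
    fix \<xi> :: "'b \<times> real"
    obtain x \<tau> where \<xi>: "\<xi> = (x, \<tau>)" by (cases \<xi>)
    show "Mf j i \<xi> = Mf (min j 1) i \<xi>"
      unfolding m Mf_def L[OF False] L[OF one_neq_zero] unfolding \<xi> T[OF False] T[OF one_neq_zero] ..
  qed
qed simp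

text \<open>By \<open>Mf_min\<close> only the kernels with j in {0, 1} and i <= 3 are different, so
  their constants can be added up.\<close>

lemma kernel_bound:
  obtains A where "A > 0" "\<And>j i z. i \<le> 3 \<Longrightarrow> (1 + norm z) ^ N * norm (inv_fourier (Mf j i) z) \<le> A"
proof -
  have "\<exists>A. \<forall>z. (1 + norm z) ^ N * norm (inv_fourier (Mf j i) z) \<le> A" for j i
    using rapidE[OF schwartz_rapid[OF schwartz_inv_fourier[OF test_functions_schwartz[OF Mf_test]]]] by blast
  then obtain A where A: "\<And>j i z. (1 + norm z) ^ N * norm (inv_fourier (Mf j i) z) \<le> A j i" by metis
  define A' where "A' = 1 + (\<Sum>j\<le>1. \<Sum>i\<le>3. \<bar>A j i\<bar>)"
  have "(1 + norm z) ^ N * norm (inv_fourier (Mf j i) z) \<le> A'" if i: "i \<le> 3" for j i z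
  proof -
    have "(1 + norm z) ^ N * norm (inv_fourier (Mf j i) z) \<le> A (min j 1) i" unfolding Mf_min[of j] by (rule A)
    also have "\<dots> \<le> \<bar>A (min j 1) i\<bar>" by simp
    also have "\<dots> \<le> (\<Sum>i\<le>3. \<bar>A (min j 1) i\<bar>)" using i by (intro member_le_sum) auto
    also have "\<dots> \<le> (\<Sum>j\<le>1. \<Sum>i\<le>3. \<bar>A j i\<bar>)"
      by (rule member_le_sum[where f = "\<lambda>j. \<Sum>i\<le>3. \<bar>A j i\<bar>"]) (auto intro: sum_nonneg)
    finally show ?thesis by (simp add: A'_def)
  qed
  moreover have "A' > 0" unfolding A'_def by (intro add_pos_nonneg sum_nonneg) auto
  ultimately show thesis using that by blast
qed

lemma Lk_scale:
  "Lk j (LP_fun a \<psi> (j + i)) (aniso_dilation a (2 powr (- real (Suc j))) z) =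
    of_real (2 powr (an + real (Suc j) * weight_sum (fst a))) * inv_fourier (Mf j i) z"
proof -
  let ?\<delta> = "2 powr (- real (Suc j)) :: real"
  have inv: "1 / ?\<delta> = 2 powr real (Suc j)" by (simp only: powr_minus_divide) simp
  have id: "aniso_dilation a (1 / ?\<delta>) (aniso_dilation a ?\<delta> z) = z" for z by (subst aniso_dilation_dilation) simp_all
  have e: "(\<lambda>\<xi>. LP_fun a \<psi> (j + i) \<xi> * tens j \<xi>) = (\<lambda>\<xi>. Mf j i (aniso_dilation a ?\<delta> \<xi>))"
    unfolding Mf_def inv[symmetric] id ..
  have "inv_fourier (\<lambda>\<xi>. LP_fun a \<psi> (j + i) \<xi> * tens j \<xi>) (aniso_dilation a ?\<delta> z)
    = of_real (?\<delta> powr (- weight_sum a)) * inv_fourier (Mf j i) (aniso_dilation a (1 / ?\<delta>) (aniso_dilation a ?\<delta> z))"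
    unfolding e by (rule inv_fourier_dilation[OF schwartz_measurable[OF test_functions_schwartz[OF Mf_test]]]) simp
  also note id
  finally have "Lk j (LP_fun a \<psi> (j + i)) (aniso_dilation a ?\<delta> z) = of_real (2 powr (- (real j * an)) * ?\<delta> powr (- weight_sum a)) * inv_fourier (Mf j i) z"
    unfolding Lk_def by simp
  \<comment> \<open>The exponent is - j a_n + (j+1) |a|, and |a| = |a'| + a_n.\<close>
  also have "2 powr (- (real j * an)) * ?\<delta> powr (- weight_sum a) = 2 powr (an + real (Suc j) * weight_sum (fst a))"
    unfolding powr_powr powr_add[symmetric] weight_sum_prod by (simp add: algebra_simps)
  finally show ?thesis .
qed

text \<open>The k-th Littlewood-Paley piece of the j-th term of the extension.\<close>

definition P :: "nat \<Rightarrow> nat \<Rightarrow> ('b \<Rightarrow> complex) \<Rightarrow> 'b \<times> real \<Rightarrow> complex" where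
  "P j k h x = (LINT y|lborel. h y * Lk j (LP_fun a \<psi> k) (fst x - y, snd x))"

lemma P_zero: assumes "k < j \<or> j + 4 \<le> k" shows "P j k h x = 0"
proof -
  have "(\<lambda>\<xi>. LP_fun a \<psi> k \<xi> * tens j \<xi>) = (\<lambda>\<xi>. 0)" by (rule ext) (rule LP_tens_zero[OF assms])
  then have "Lk j (LP_fun a \<psi> k) z = 0" for z by (simp add: Lk_def inv_fourier_def)
  then show ?thesis by (simp add: P_def)
qed

text \<open>On x_n = 0 the height 2^((j+1) |a'|) of the kernel is compensated exactly by its width.
  The added 1 in the constant is for positivity.\<close>

lemma Lk_section_L1:
  obtains C where "C > 0" "\<And>j i. i \<le> 3 \<Longrightarrow> L1n (\<lambda>x. Lk j (LP_fun a \<psi> (j + i)) (x, 0)) \<le> ennreal C"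
proof -
  let ?N = "2 * DIM('b)" and ?W = "W_int TYPE('b)"
  obtain A where A: "A > 0" "\<And>j i z. i \<le> 3 \<Longrightarrow> (1 + norm z) ^ ?N * norm (inv_fourier (Mf j i) z) \<le> A"
    using kernel_bound[of ?N] by blast
  have "L1n (\<lambda>x. Lk j (LP_fun a \<psi> (j + i)) (x, 0)) \<le> ennreal (2 powr an * A * ?W + 1)" if i: "i \<le> 3" for j i
  proof -
    let ?\<delta> = "2 powr (- real (Suc j)) :: real" and ?J = "real (Suc j) * weight_sum (fst a)"
    have [measurable]: "Lk j (LP_fun a \<psi> (j + i)) \<in> borel_measurable borel"
      by (rule schwartz_measurable[OF Lk_schwartz[OF LP_fun_schwartz]])
    have d: "aniso_dilation a ?\<delta> (x, 0) = (aniso_dilation (fst a) ?\<delta> x, 0)" for x by (simp add: aniso_dilation_prod)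
    have pm: "(\<lambda>x::'b. (x, 0::real)) \<in> borel_measurable borel" by (intro borel_measurable_continuous_onI continuous_intros)
    have m: "(\<lambda>x. Lk j (LP_fun a \<psi> (j + i)) (x, 0)) \<in> borel_measurable borel"
      by (rule measurable_compose[OF pm]) measurable
    have "L1n (\<lambda>x. Lk j (LP_fun a \<psi> (j + i)) (x, 0)) = ennreal (?\<delta> powr weight_sum (fst a)) *
      (\<integral>\<^sup>+x. ennreal (norm (Lk j (LP_fun a \<psi> (j + i)) (aniso_dilation (fst a) ?\<delta> x, 0))) \<partial>lborel)"
      unfolding L1n_def by (rule nn_integral_dilation) (use m in simp_all)
    also have "\<dots> \<le> ennreal (?\<delta> powr weight_sum (fst a)) * (\<integral>\<^sup>+x. ennreal (2 powr (an + ?J) * A) * ennreal (1 / (1 + norm (x::'b)) ^ ?N) \<partial>lborel)"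
    proof (intro mult_left_mono nn_integral_mono)
      fix x :: 'b
      have "(1 + norm x) ^ ?N * norm (inv_fourier (Mf j i) (x, 0)) \<le> A" using A(2)[OF i, of "(x, 0)" j] by (simp add: norm_Pair)
      then have "norm (inv_fourier (Mf j i) (x, 0)) \<le> A * (1 / (1 + norm x) ^ ?N)"
        by (simp add: pos_le_divide_eq add_pos_nonneg mult.commute)
      then have "2 powr (an + ?J) * norm (inv_fourier (Mf j i) (x, 0)) \<le> 2 powr (an + ?J) * (A * (1 / (1 + norm x) ^ ?N))"
        by (rule mult_left_mono) simp
      then show "ennreal (norm (Lk j (LP_fun a \<psi> (j + i)) (aniso_dilation (fst a) ?\<delta> x, 0))) \<le> ennreal (2 powr (an + ?J) * A) * ennreal (1 / (1 + norm x) ^ ?N)"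
        unfolding d[symmetric] Lk_scale using A(1) by (simp add: norm_mult mult.assoc ennreal_leI flip: ennreal_mult)
    qed simp
    also have "\<dots> = ennreal (?\<delta> powr weight_sum (fst a)) * (ennreal (2 powr (an + ?J) * A) * ennreal ?W)"
      by (subst nn_integral_cmult) (simp_all add: W_int)
    also have "\<dots> = ennreal ((?\<delta> powr weight_sum (fst a) * 2 powr (an + ?J)) * A * ?W)"
      using A(1) by (simp add: ennreal_mult mult.assoc)
    also have "?\<delta> powr weight_sum (fst a) * 2 powr (an + ?J) = 2 powr an"
      unfolding powr_powr powr_add[symmetric] by (simp add: algebra_simps)
    finally show ?thesis by (rule order_trans) (simp add: ennreal_leI)
  qed
  moreover have "2 powr an * A * ?W + 1 > 0" using A(1) by (intro add_nonneg_pos) auto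
  ultimately show thesis using that by blast
qed

text \<open>Young's inequality for L_1 with kernels of uniformly bounded norm. It provides the
  summable majorant in \<open>Ext_trace\<close>.\<close>

lemma P_section_L1:
  obtains C where "C > 0" "\<And>j k h. band j h \<Longrightarrow> L1n (\<lambda>x. P j k h (x, 0)) \<le> ennreal C * L1n h"
proof -
  obtain C where C: "C > 0" "\<And>j i. i \<le> 3 \<Longrightarrow> L1n (\<lambda>x. Lk j (LP_fun a \<psi> (j + i)) (x, 0)) \<le> ennreal C"
    using Lk_section_L1 by blast
  have "L1n (\<lambda>x. P j k h (x, 0)) \<le> ennreal C * L1n h" if h: "band j h" for j k h
  proof (cases "k < j \<or> j + 4 \<le> k")
    case True then show ?thesis by (simp add: P_zero L1n_def)
  next
    case False
    then obtain i where i: "k = j + i" "i \<le> 3" using le_Suc_ex[of j k] by force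
    let ?L = "\<lambda>x. Lk j (LP_fun a \<psi> k) (x, 0)"
    have pm: "(\<lambda>x::'b. (x, 0::real)) \<in> borel_measurable borel" by (intro borel_measurable_continuous_onI continuous_intros)
    have [measurable]: "?L \<in> borel_measurable borel"
      by (rule measurable_compose[OF pm schwartz_measurable[OF Lk_schwartz[OF LP_fun_schwartz]]])
    have [measurable]: "h \<in> borel_measurable borel" by (rule hm[OF h])
    have "L1n (\<lambda>x. P j k h (x, 0)) \<le> (\<integral>\<^sup>+x. (\<integral>\<^sup>+y. ennreal (norm (h y)) * ennreal (norm (?L (x - y))) \<partial>lborel) \<partial>lborel)"
      unfolding L1n_def P_def
      by (intro nn_integral_mono order_trans[OF ennreal_norm_integral_le]) (simp add: norm_mult ennreal_mult)
    also have "\<dots> = (\<integral>\<^sup>+y. (\<integral>\<^sup>+x. ennreal (norm (h y)) * ennreal (norm (?L (x - y))) \<partial>lborel) \<partial>lborel)"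
      by (rule lborel_pair.Fubini') measurable
    also have "\<dots> = (\<integral>\<^sup>+y. ennreal (norm (h y)) * L1n ?L \<partial>lborel)"
      unfolding L1n_def
      by (intro nn_integral_cong, subst nn_integral_cmult) (simp_all add: nn_integral_translate[where f = "\<lambda>x. ennreal (norm (?L x))"])
    also have "\<dots> = L1n h * L1n ?L" unfolding L1n_def by (rule nn_integral_multc) measurable
    also have "\<dots> \<le> L1n h * ennreal C" unfolding i(1) by (intro mult_left_mono C i) simp
    finally show ?thesis by (simp add: mult.commute)
  qed
  then show thesis using that C(1) by blast
qed

end

section \<open>The weights under changes of scale\<close>

lemma mn_le_1: assumes "\<tau> \<noteq> 0" shows "mn \<tau> \<le> 1"
  unfolding mn_eq[OF assms] using powr_mono[of "- \<bar>log 2 \<bar>\<tau>\<bar>\<bar> / 2" 0 2] by simp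

text \<open>Of three powers of decay one gives \<open>mn\<close> times |tau|^(-1/2), and two are the
  denominator of \<open>om\<close>. As \<open>mn\<close> is at most 1, it may be replaced by its
  p-th power.\<close>

lemma weight_le_mn_om:
  assumes p: "0 < p" "p < 1" and M: "real M * p \<ge> 3" and \<tau>: "\<tau> \<noteq> 0"
  shows "(1 / (1 + \<bar>\<tau>\<bar>) ^ M) powr p \<le> mn \<tau> powr p * om \<tau>"
proof -
  let ?t = "\<bar>\<tau>\<bar>"
  have t: "?t > 0" using \<tau> by simp
  have "(1 / (1 + ?t) ^ M) powr p = (1 + ?t) powr (- (real M * p))"
    by (simp add: powr_divide powr_minus_divide powr_powr flip: powr_realpow)
  also have "\<dots> \<le> (1 + ?t) powr (- 3)" using M by (intro powr_mono) auto
  also have "\<dots> = 1 / (1 + ?t) * (1 / (1 + ?t) ^ 2)"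
    by (simp add: powr_minus_divide powr_numeral power3_eq_cube power2_eq_square)
  also have "\<dots> \<le> (mn \<tau> * ?t powr (- (1/2))) * (1 / (1 + ?t) ^ 2)"
  proof (rule mult_right_mono)
    have "?t powr (1/2) * ?t powr (- (1/2)) = 1" "?t powr (- (1/2)) * ?t powr (- (1/2)) = 1 / ?t"
      using t by (simp_all add: powr_minus_divide flip: powr_add)
    then have "mn \<tau> * ?t powr (- (1/2)) = 1 \<or> mn \<tau> * ?t powr (- (1/2)) = 1 / ?t"
      unfolding mn_def min_def by presburger
    moreover have "1 / (1 + ?t) \<le> 1" "1 / (1 + ?t) \<le> 1 / ?t" using t by (simp_all add: divide_simps)
    ultimately show "1 / (1 + ?t) \<le> mn \<tau> * ?t powr (- (1/2))" by presburger
  qed simp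
  also have "\<dots> = mn \<tau> powr 1 * om \<tau>" by (simp add: om_def)
  also have "\<dots> \<le> mn \<tau> powr p * om \<tau>"
    using p mn_le_1[OF \<tau>] by (intro mult_right_mono powr_mono') auto
  finally show ?thesis .
qed

text \<open>Makes the weights of neighbouring scales comparable: a dilation by c changes each entry
  of the minimum by a factor c^(1/2) at most.\<close>

lemma mn_scale:
  assumes c: "1 \<le> c" shows "mn \<tau> \<le> c powr (1/2) * mn (c * \<tau>)"
proof -
  have 1: "(c * \<bar>\<tau>\<bar>) powr r = c powr r * \<bar>\<tau>\<bar> powr r" for r using c by (simp add: powr_mult)
  have "c powr (1/2) * (c * \<bar>\<tau>\<bar>) powr (1/2) = c * \<bar>\<tau>\<bar> powr (1/2)"
    unfolding 1 using c by (simp flip: mult.assoc powr_add)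
  moreover have "c powr (1/2) * (c * \<bar>\<tau>\<bar>) powr (- (1/2)) = \<bar>\<tau>\<bar> powr (- (1/2))"
    unfolding 1 using c by (simp flip: mult.assoc powr_add)
  moreover have "\<bar>\<tau>\<bar> powr (1/2) \<le> c * \<bar>\<tau>\<bar> powr (1/2)" using mult_right_mono[OF c, of "\<bar>\<tau>\<bar> powr (1/2)"] by simp
  moreover have "mn (c * \<tau>) = (c * \<bar>\<tau>\<bar>) powr (1/2) \<or> mn (c * \<tau>) = (c * \<bar>\<tau>\<bar>) powr (- (1/2))"
    using c unfolding mn_def min_def by (simp add: abs_mult)
  moreover have "mn \<tau> \<le> \<bar>\<tau>\<bar> powr (1/2)" "mn \<tau> \<le> \<bar>\<tau>\<bar> powr (- (1/2))" by (simp_all add: mn_def)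
  ultimately show ?thesis by (smt (verit))
qed

text \<open>For q = infinity the bound \<open>mn\<close> <= 1 suffices; otherwise the q-th powers
  are summed by \<open>sum_mn_le\<close>.\<close>

lemma lq_norm_mn:
  assumes \<alpha>: "\<alpha> > 0" and q: "0 < q"
  obtains C where "C > 0" "\<And>u \<beta> \<tau>. \<tau> \<noteq> 0 \<Longrightarrow> 0 \<le> \<beta> \<Longrightarrow> (\<And>k. \<bar>u k\<bar> \<le> \<beta> * mn (2 powr (real k * \<alpha>) * \<tau>)) \<Longrightarrow>
    lq_norm q u \<le> ennreal (C * \<beta>)"
proof (cases "q = \<infinity>")
  case True
  have "lq_norm q u \<le> ennreal (1 * \<beta>)"
    if \<tau>: "\<tau> \<noteq> 0" and \<beta>: "0 \<le> \<beta>" and u: "\<And>k. \<bar>u k\<bar> \<le> \<beta> * mn (2 powr (real k * \<alpha>) * \<tau>)" for u \<beta> \<tau>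
  proof -
    have "\<bar>u k\<bar> \<le> \<beta>" for k
      using u[of k] mult_left_mono[OF mn_le_1[of "2 powr (real k * \<alpha>) * \<tau>"] \<beta>] \<tau> by simp
    then show ?thesis unfolding lq_norm_def using True by (simp add: SUP_le_iff ennreal_leI)
  qed
  then show thesis using that zero_less_one by blast
next
  case False
  let ?r = "enn2real q"
  have r: "?r > 0" using q False by (simp add: enn2real_positive_iff less_top)
  obtain D where D: "D > 0" "\<And>t. t \<noteq> 0 \<Longrightarrow> (\<Sum>j. ennreal (mn (2 powr (real j * \<alpha>) * t) powr ?r)) \<le> ennreal D"
    using sum_mn_le[OF \<alpha> r] by blast
  have "lq_norm q u \<le> ennreal (D powr (1 / ?r) * \<beta>)"
    if \<tau>: "\<tau> \<noteq> 0" and \<beta>: "0 \<le> \<beta>" and u: "\<And>k. \<bar>u k\<bar> \<le> \<beta> * mn (2 powr (real k * \<alpha>) * \<tau>)" for u \<beta> \<tau>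
  proof -
    have "(\<Sum>k. ennreal (\<bar>u k\<bar> powr ?r)) \<le> (\<Sum>k. ennreal (\<beta> powr ?r) * ennreal (mn (2 powr (real k * \<alpha>) * \<tau>) powr ?r))"
    proof (rule suminf_le)
      fix k
      have "\<bar>u k\<bar> powr ?r \<le> (\<beta> * mn (2 powr (real k * \<alpha>) * \<tau>)) powr ?r"
        by (rule powr_mono2) (use r u in auto)
      then show "ennreal (\<bar>u k\<bar> powr ?r) \<le> ennreal (\<beta> powr ?r) * ennreal (mn (2 powr (real k * \<alpha>) * \<tau>) powr ?r)"
        using \<beta> by (simp add: powr_mult ennreal_leI flip: ennreal_mult)
    qed auto
    also have "\<dots> \<le> ennreal (\<beta> powr ?r) * ennreal D"
      unfolding ennreal_suminf_cmult by (intro mult_left_mono D(2)[OF \<tau>]) simp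
    finally have "lq_norm q u \<le> ennpowr (ennreal (\<beta> powr ?r) * ennreal D) (1 / ?r)"
      unfolding lq_norm_def using False r by (simp add: ennpowr_mono)
    also have "\<dots> = ennreal (D powr (1 / ?r) * \<beta>)"
      using r \<beta> D(1) by (simp add: powr_mult powr_powr mult.commute flip: ennreal_mult)
    finally show ?thesis .
  qed
  moreover have "D powr (1 / ?r) > 0" using D(1) by simp
  ultimately show thesis using that by blast
qed

context ext_setup
begin

text \<open>At unit scale N powers of the kernel's decay go to the tangential variable, for
  \<open>band_limited_conv\<close>, and M powers to tau, for \<open>weight_le_mn_om\<close>. The
  bound thus separates the variables: \<open>Hconv\<close> sees y alone, the weight sees tau
  alone.\<close>

lemma P_bound:
  obtains C where "C > 0" "\<And>j k h y \<tau>. band j h \<Longrightarrow> Lp_pow p h < top \<Longrightarrow> \<tau> \<noteq> 0 \<Longrightarrow>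
    ennreal (norm (P j k h (aniso_dilation a (2 powr (- real (Suc j))) (y, \<tau>))) powr p) \<le>
    ennreal C * Hconv p (unit_reg j h) y * ennreal (mn \<tau> powr p * om \<tau>)"
proof -
  have K: "rapid (inv_fourier (\<lambda>\<xi>. \<psi> (\<xi>, 0)))" by (intro schwartz_rapid schwartz_inv_fourier \<rho>_schwartz)
  show thesis
  proof (rule band_limited_conv[OF K p01])
    fix N :: nat and C :: real
    assume C: "C > 0" "\<And>v x. band_limited (inv_fourier (\<lambda>\<xi>. \<psi> (\<xi>, 0))) v \<Longrightarrow> Lp_pow p v < top \<Longrightarrow>
      ennpowr (\<integral>\<^sup>+y. ennreal (norm (v y) / (1 + norm (x - y)) ^ N) \<partial>lborel) p \<le> ennreal C * Hconv p v x"
    \<comment> \<open>The smallest natural number with M p >= 3, as \<open>weight_le_mn_om\<close>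
      demands.\<close>
    define M where "M = nat \<lceil>3 / p\<rceil>"
    have "3 / p \<le> real M" unfolding M_def by linarith
    then have M: "real M * p \<ge> 3" using p01 by (simp add: divide_le_eq)
    obtain A where A: "A > 0" "\<And>j i z. i \<le> 3 \<Longrightarrow> (1 + norm z) ^ (N + M) * norm (inv_fourier (Mf j i) z) \<le> A"
      using kernel_bound[of "N + M"] by blast
    let ?C = "(2 powr an * A) powr p * C"
    have bound: "ennreal (norm (P j k h (aniso_dilation a (2 powr (- real (Suc j))) (y, \<tau>))) powr p) \<le>
      ennreal ?C * Hconv p (unit_reg j h) y * ennreal (mn \<tau> powr p * om \<tau>)"
      if h: "band j h" and fin: "Lp_pow p h < top" and \<tau>: "\<tau> \<noteq> 0" for j k h y \<tau>
    proof (cases "k < j \<or> j + 4 \<le> k")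
      case True then show ?thesis by (simp add: P_zero)
    next
      case False
      then obtain i where i: "k = j + i" "i \<le> 3" using le_Suc_ex[of j k] by force
      let ?\<delta> = "2 powr (- real (Suc j)) :: real" and ?J = "real (Suc j) * weight_sum (fst a)"
      let ?v = "unit_reg j h" and ?L = "Lk j (LP_fun a \<psi> k)"
      let ?d = "aniso_dilation (fst a) ?\<delta>"
      let ?X = "aniso_dilation a ?\<delta> (y, \<tau>)"
      have [measurable]: "?L \<in> borel_measurable borel" by (rule schwartz_measurable[OF Lk_schwartz[OF LP_fun_schwartz]])
      have [measurable]: "h \<in> borel_measurable borel" "reg j h \<in> borel_measurable borel" by (rule hm[OF h] reg_measurable[OF h])+
      have pm: "(\<lambda>u::'b. (fst ?X - u, snd ?X)) \<in> borel_measurable borel" by (intro borel_measurable_continuous_onI continuous_intros)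
      have Lm[measurable]: "(\<lambda>u. ?L (fst ?X - u, snd ?X)) \<in> borel_measurable borel"
        by (rule measurable_compose[OF pm]) measurable
      have vfin: "Lp_pow p ?v < top" using fin by (simp add: Lp_pow_unit[OF h] ennreal_mult_less_top)
      have vm[measurable]: "?v \<in> borel_measurable borel" using unit_band[OF h] by (simp add: band_limited_def)
      have "P j k h ?X = (LINT u|lborel. reg j h u * ?L (fst ?X - u, snd ?X))"
        unfolding P_def by (rule integral_cong_AE) (use reg_AE[OF h] in \<open>auto elim: eventually_mono\<close>)
      also have "\<dots> = of_real (?\<delta> powr weight_sum (fst a)) * (LINT z|lborel. reg j h (?d z) * ?L (fst ?X - ?d z, snd ?X))"
        by (rule integral_dilation) simp_all
      finally have P: "P j k h ?X = of_real (?\<delta> powr weight_sum (fst a)) * (LINT z|lborel. reg j h (?d z) * ?L (fst ?X - ?d z, snd ?X))" .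
      have nb: "norm (reg j h (?d z) * ?L (fst ?X - ?d z, snd ?X)) \<le>
        2 powr (an + ?J) * A * (1 / (1 + \<bar>\<tau>\<bar>) ^ M) * (norm (?v z) / (1 + norm (y - z)) ^ N)" for z
      proof -
        have "(fst ?X - ?d z, snd ?X) = aniso_dilation a ?\<delta> (y - z, \<tau>)"
          by (simp add: aniso_dilation_prod aniso_dilation_diff del: of_nat_Suc)
        then have "norm (?L (fst ?X - ?d z, snd ?X)) = 2 powr (an + ?J) * norm (inv_fourier (Mf j i) (y - z, \<tau>))"
          unfolding i(1) by (simp add: Lk_scale norm_mult del: of_nat_Suc)
        also have "\<dots> \<le> 2 powr (an + ?J) * (A * (1 / (1 + norm (y - z)) ^ N * (1 / (1 + \<bar>\<tau>\<bar>) ^ M)))"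
        proof (intro mult_left_mono)
          let ?w = "(1 + norm (y - z, \<tau>)) ^ (N + M)"
          have w: "?w > 0" by (intro zero_less_power add_pos_nonneg) auto
          have "norm (inv_fourier (Mf j i) (y - z, \<tau>)) \<le> A * (1 / ?w)"
            using A(2)[OF i(2), of "(y - z, \<tau>)" j] w by (simp add: pos_le_divide_eq mult.commute)
          also have "\<dots> \<le> A * (1 / (1 + norm (y - z)) ^ N * (1 / (1 + \<bar>\<tau>\<bar>) ^ M))"
            using A(1) by (intro mult_left_mono weight_prod_le) auto
          finally show "norm (inv_fourier (Mf j i) (y - z, \<tau>)) \<le> \<dots>" .
        qed simp
        finally have "norm (?v z) * norm (?L (fst ?X - ?d z, snd ?X)) \<le> norm (?v z) * \<dots>" by (rule mult_left_mono) simp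
        then show ?thesis by (simp add: norm_mult unit_reg_def[OF h] mult_ac del: of_nat_Suc)
      qed
      let ?c = "2 powr (an + ?J) * A * (1 / (1 + \<bar>\<tau>\<bar>) ^ M)"
      let ?I = "\<integral>\<^sup>+z. ennreal (norm (?v z) / (1 + norm (y - z)) ^ N) \<partial>lborel"
      have c0: "0 \<le> ?c" using A(1) by simp
      have "ennreal (norm (P j k h ?X)) = ennreal (?\<delta> powr weight_sum (fst a)) * ennreal (norm (LINT z|lborel. reg j h (?d z) * ?L (fst ?X - ?d z, snd ?X)))"
        unfolding P by (simp only: norm_mult norm_of_real) (simp add: ennreal_mult)
      also have "\<dots> \<le> ennreal (?\<delta> powr weight_sum (fst a)) * (\<integral>\<^sup>+z. ennreal ?c * ennreal (norm (?v z) / (1 + norm (y - z)) ^ N) \<partial>lborel)"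
      proof (intro mult_left_mono order_trans[OF ennreal_norm_integral_le] nn_integral_mono)
        fix z
        show "ennreal (norm (reg j h (?d z) * ?L (fst ?X - ?d z, snd ?X))) \<le> ennreal ?c * ennreal (norm (?v z) / (1 + norm (y - z)) ^ N)"
          using ennreal_leI[OF nb[of z]] by (subst ennreal_mult[symmetric]) (use c0 in simp_all)
      qed simp
      also have "\<dots> = ennreal (?\<delta> powr weight_sum (fst a)) * (ennreal ?c * ?I)"
        by (subst nn_integral_cmult) simp_all
      also have "\<dots> = ennreal (?\<delta> powr weight_sum (fst a) * ?c) * ?I"
        using c0 by (subst ennreal_mult) (simp_all add: mult.assoc)
      also have "?\<delta> powr weight_sum (fst a) * ?c = (?\<delta> powr weight_sum (fst a) * 2 powr (an + ?J)) * A * (1 / (1 + \<bar>\<tau>\<bar>) ^ M)"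
        by (simp only: mult_ac)
      \<comment> \<open>The height of the kernel cancels against the volume factor of the tangential
        substitution, so the bound is uniform in j.\<close>
      also have "?\<delta> powr weight_sum (fst a) * 2 powr (an + ?J) = 2 powr an"
        unfolding powr_powr powr_add[symmetric] by (simp add: algebra_simps)
      finally have "ennpowr (ennreal (norm (P j k h ?X))) p \<le> ennpowr (ennreal (2 powr an * A * (1 / (1 + \<bar>\<tau>\<bar>) ^ M)) * ?I) p"
        by (rule ennpowr_mono) (use p01 in simp)
      also have "\<dots> = ennreal ((2 powr an * A * (1 / (1 + \<bar>\<tau>\<bar>) ^ M)) powr p) * ennpowr ?I p"
        using p01 A(1) by (simp add: ennpowr_mult)
      also have "\<dots> \<le> ennreal ((2 powr an * A) powr p * (mn \<tau> powr p * om \<tau>)) * (ennreal C * Hconv p ?v y)"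
      proof (intro mult_mono C(2) unit_band h vfin ennreal_leI)
        have "(2 powr an * A * (1 / (1 + \<bar>\<tau>\<bar>) ^ M)) powr p = (2 powr an * A) powr p * (1 / (1 + \<bar>\<tau>\<bar>) ^ M) powr p"
          by (rule powr_mult)
        also have "\<dots> \<le> (2 powr an * A) powr p * (mn \<tau> powr p * om \<tau>)"
          by (intro mult_left_mono weight_le_mn_om p01 M \<tau>) simp
        finally show "(2 powr an * A * (1 / (1 + \<bar>\<tau>\<bar>) ^ M)) powr p \<le> \<dots>" .
      qed simp_all
      also have "\<dots> = ennreal ?C * Hconv p ?v y * ennreal (mn \<tau> powr p * om \<tau>)"
        using C(1) by (subst (1 2) ennreal_mult) (simp_all add: mult_ac)
      finally show ?thesis by simp
    qed
    have "?C > 0" using A(1) C(1) by simp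
    then show thesis by (rule that[OF _ bound])
  qed
qed

text \<open>The common majorant for the p-th powers of all pieces at a point, with the factors
  \<open>mn\<close> left aside: these serve the summation over k, while \<open>om\<close> and
  \<open>Hconv\<close> serve integration in x_n and x'.\<close>

definition Bs :: "(nat \<Rightarrow> 'b \<Rightarrow> complex) \<Rightarrow> 'b \<times> real \<Rightarrow> ennreal" where
  "Bs h x = (\<Sum>j. ennreal (2 powr (real j * s * p)) * (Hconv p (unit_reg j (h j)) (aniso_dilation (fst a) (2 powr real (Suc j)) (fst x)) *
      ennreal (om ((2 powr real (Suc j)) powr an * snd x))))"

lemma unit_reg_measurable: "band j h \<Longrightarrow> unit_reg j h \<in> borel_measurable borel"
  using unit_band by (simp add: band_limited_def)

lemma Bs_measurable: assumes h: "\<And>j. band j (h j)" shows "Bs h \<in> borel_measurable borel"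
proof -
  have [measurable]: "Hconv p (unit_reg j (h j)) \<in> borel_measurable borel" for j by (intro Hconv_measurable unit_reg_measurable h)
  show ?thesis unfolding Bs_def[abs_def] by measurable
qed

text \<open>After rescaling, each summand is a product of functions of x' and of x_n. Integration
  produces 2^(-(j+1) a_n), which by s p - a_n = t p turns the weights of the pieces into those of
  the cost.\<close>

lemma integral_Bs:
  obtains C where "C > 0" "\<And>h. (\<And>j. band j (h j)) \<Longrightarrow> (\<integral>\<^sup>+x. Bs h x \<partial>lborel) \<le> ennreal C * cost_pow h"
proof -
  let ?W = "W_int TYPE('b)"
  define O' where "O' = enn2real (\<integral>\<^sup>+t. ennreal (om t) \<partial>lborel)"
  have O': "(\<integral>\<^sup>+t. ennreal (om t) \<partial>lborel) = ennreal O'" "0 \<le> O'"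
    unfolding O'_def using nn_integral_om by simp_all
  let ?C = "2 powr (- an) * ?W * O'"
  have "(\<integral>\<^sup>+x. Bs h x \<partial>lborel) \<le> ennreal (?C + 1) * cost_pow h" if h: "\<And>j. band j (h j)" for h
  proof -
    let ?t = "\<lambda>j x. Hconv p (unit_reg j (h j)) (aniso_dilation (fst a) (2 powr real (Suc j)) (fst x)) *
      ennreal (om ((2 powr real (Suc j)) powr an * snd (x :: 'b \<times> real)))"
    have Hm[measurable]: "Hconv p (unit_reg j (h j)) \<in> borel_measurable borel" for j by (intro Hconv_measurable unit_reg_measurable h)
    have tm[measurable]: "?t j \<in> borel_measurable borel" for j by measurable
    have I: "(\<integral>\<^sup>+x. ?t j x \<partial>lborel) = ennreal (2 powr (- (real (Suc j) * an))) * (ennreal ?W * Lp_pow p (h j)) * ennreal O'" for j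
    proof -
      let ?\<delta> = "2 powr (- real (Suc j)) :: real" and ?J = "real (Suc j) * weight_sum (fst a)"
      have d: "?t j (aniso_dilation a ?\<delta> (x, \<tau>)) = Hconv p (unit_reg j (h j)) x * ennreal (om \<tau>)" for x \<tau>
      proof -
        have 1: "aniso_dilation (fst a) (2 powr real (Suc j)) (aniso_dilation (fst a) ?\<delta> x) = x"
          by (subst aniso_dilation_dilation) (simp_all flip: powr_add)
        have 2: "(2 powr real (Suc j)) powr an * (?\<delta> powr an * \<tau>) = \<tau>"
          unfolding powr_powr mult.assoc[symmetric] powr_add[symmetric] by (simp add: algebra_simps)
        show ?thesis unfolding aniso_dilation_prod fst_conv snd_conv 1 2 ..
      qed
      have m: "(\<lambda>z. ?t j (aniso_dilation a ?\<delta> z)) \<in> borel_measurable borel"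
        by (rule measurable_compose[OF measurable_aniso_dilation tm])
      have "(\<integral>\<^sup>+x. ?t j x \<partial>lborel) = ennreal (?\<delta> powr weight_sum a) * (\<integral>\<^sup>+z. ?t j (aniso_dilation a ?\<delta> z) \<partial>lborel)"
        by (rule nn_integral_dilation[OF tm]) simp
      also have "(\<integral>\<^sup>+z. ?t j (aniso_dilation a ?\<delta> z) \<partial>lborel) = (\<integral>\<^sup>+x. (\<integral>\<^sup>+\<tau>. Hconv p (unit_reg j (h j)) x * ennreal (om \<tau>) \<partial>lborel) \<partial>lborel)"
        unfolding nn_integral_prod_lborel(1)[OF m] d ..
      also have "\<dots> = (\<integral>\<^sup>+x. Hconv p (unit_reg j (h j)) x * ennreal O' \<partial>lborel)"
        by (subst nn_integral_cmult) (simp_all add: O')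
      also have "\<dots> = ennreal ?W * (ennreal (2 powr ?J) * Lp_pow p (h j)) * ennreal O'"
        by (subst nn_integral_multc) (simp_all add: integral_Hconv[OF unit_reg_measurable[OF h]] Lp_pow_unit[OF h] del: of_nat_Suc)
      finally have "(\<integral>\<^sup>+x. ?t j x \<partial>lborel) = (ennreal (?\<delta> powr weight_sum a) * ennreal (2 powr ?J)) * (ennreal ?W * Lp_pow p (h j)) * ennreal O'"
        by (simp only: mult_ac)
      also have "ennreal (?\<delta> powr weight_sum a) * ennreal (2 powr ?J) = ennreal (2 powr (- (real (Suc j) * an)))"
        unfolding weight_sum_prod by (simp add: powr_powr algebra_simps flip: ennreal_mult powr_add)
      finally show ?thesis .
    qed
    have "(\<integral>\<^sup>+x. Bs h x \<partial>lborel) = (\<Sum>j. \<integral>\<^sup>+x. ennreal (2 powr (real j * s * p)) * ?t j x \<partial>lborel)"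
      unfolding Bs_def by (rule nn_integral_suminf) measurable
    also have "\<dots> = (\<Sum>j. ennreal ?C * (ennreal (2 powr (real j * t * p)) * Lp_pow p (h j)))"
    proof (rule suminf_cong)
      fix j
      have "(\<integral>\<^sup>+x. ennreal (2 powr (real j * s * p)) * ?t j x \<partial>lborel) = ennreal (2 powr (real j * s * p)) * (\<integral>\<^sup>+x. ?t j x \<partial>lborel)"
        by (rule nn_integral_cmult) (simp only: measurable_lborel2 tm)
      also have "\<dots> = (ennreal (2 powr (real j * s * p)) * ennreal (2 powr (- (real (Suc j) * an)))) * ennreal ?W * ennreal O' * Lp_pow p (h j)"
        unfolding I by (simp only: mult_ac)
      also have "ennreal (2 powr (real j * s * p)) * ennreal (2 powr (- (real (Suc j) * an))) = ennreal (2 powr (- an)) * ennreal (2 powr (real j * t * p))"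
      proof -
        have "real j * s * p = real j * t * p + real j * an" by (simp only: mult.assoc exponents) (simp add: algebra_simps)
        then have "real j * s * p + - (real (Suc j) * an) = - an + real j * t * p" by (simp add: algebra_simps)
        then show ?thesis by (simp only: ennreal_mult[symmetric] powr_ge_zero powr_add[symmetric])
      qed
      also have "ennreal (2 powr (- an)) * ennreal (2 powr (real j * t * p)) * ennreal ?W * ennreal O' * Lp_pow p (h j) = ennreal ?C * (ennreal (2 powr (real j * t * p)) * Lp_pow p (h j))"
        using O'(2) by (simp only: ennreal_mult powr_ge_zero W_int_nonneg mult_nonneg_nonneg mult_ac)
      finally show "(\<integral>\<^sup>+x. ennreal (2 powr (real j * s * p)) * ?t j x \<partial>lborel) = ennreal ?C * (ennreal (2 powr (real j * t * p)) * Lp_pow p (h j))" .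
    qed
    also have "\<dots> = ennreal ?C * cost_pow h" unfolding cost_pow_def by (rule ennreal_suminf_cmult)
    also have "\<dots> \<le> ennreal (?C + 1) * cost_pow h" by (intro mult_right_mono ennreal_leI) auto
    finally show ?thesis .
  qed
  moreover have "?C + 1 > 0" using O'(2) by (intro add_nonneg_pos) auto
  ultimately show thesis using that by blast
qed

end

section \<open>The extension, its quasi-norm and its trace\<close>

lemma inv_fourier_sum:
  fixes f :: "'i \<Rightarrow> 'a::euclidean_space \<Rightarrow> complex"
  assumes "\<And>k. k \<in> A \<Longrightarrow> f k \<in> schwartz"
  shows "inv_fourier (\<lambda>\<xi>. \<Sum>k\<in>A. f k \<xi>) x = (\<Sum>k\<in>A. inv_fourier (f k) x)"
proof -
  have "integrable lborel (\<lambda>\<xi>. exp (\<i> * of_real (x \<bullet> \<xi>)) * f k \<xi>)" if "k \<in> A" for k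
    using schwartz_integrable[OF schwartz_modulate[OF assms[OF that], of "- x"]] by (simp add: inner_commute)
  then show ?thesis
    unfolding inv_fourier_def sum_distrib_left by (simp add: sum_divide_distrib)
qed

lemma trace_op_eq: "has_trace \<psi> a f g \<Longrightarrow> trace_op \<psi> a f = g"
  unfolding trace_op_def has_trace_def by (rule the_equality, assumption) (rule dist_tendsto_unique)

context ext_setup
begin

definition Ext :: "(nat \<Rightarrow> 'b \<Rightarrow> complex) \<Rightarrow> ('b \<times> real) dist" where
  "Ext h \<phi> = (\<Sum>j. dist_tensor (dist_of_fun (h j)) (kap j) \<phi>)"

context
  fixes h assumes h: "\<And>j. band j (h j)" and hL: "\<And>j. Lp_pow p (h j) < top" and fin: "(\<Sum>j. L1n (h j)) < top"
begin

lemma Ext_sums: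
  shows "Ext h \<in> tempered" "dist_sums (\<lambda>j. dist_tensor (dist_of_fun (h j)) (kap j)) (Ext h)"
    "\<And>\<phi>. \<phi> \<in> schwartz \<Longrightarrow> (\<lambda>j. dist_tensor (dist_of_fun (h j)) (kap j) \<phi>) sums Ext h \<phi>"
proof -
  obtain C where C: "C > 0" "\<And>j. (LINT \<tau>|lborel. norm (kap j \<tau>)) \<le> C" using kap_L1 by blast
  note s = suminf_L1_summable[OF fin]
  let ?c = "\<lambda>j. C * enn2real (L1n (h j))" and ?T = "\<lambda>j. dist_tensor (dist_of_fun (h j)) (kap j)"
  have T: "?T j \<in> tempered" for j by (rule dist_tensor_tempered[OF tf[OF h] s(1) kap_integrable])
  have c: "summable ?c" "\<And>j. 0 \<le> ?c j" using s(2) C(1) by (auto intro: summable_mult)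
  have b: "norm (?T j f) \<le> ?c j * schwartz_seminorm 0 f" if f: "f \<in> schwartz" for j f
  proof (rule order_trans[OF dist_tensor_bound[OF hm[OF h] s(1) f kap_integrable]])
    show "(LINT y|lborel. norm (kap j y)) * enn2real (L1n (h j)) * schwartz_seminorm 0 f \<le> ?c j * schwartz_seminorm 0 f"
      by (intro mult_right_mono C(2) schwartz_seminorm_nonneg f) simp
  qed
  note d = dist_sums_absolute[where T = ?T and c = ?c, OF T c b]
  show "Ext h \<in> tempered" unfolding Ext_def[abs_def] by (rule d(1))
  show "dist_sums ?T (Ext h)" unfolding Ext_def[abs_def] by (rule d(2))
  show "(\<lambda>j. ?T j \<phi>) sums Ext h \<phi>" if "\<phi> \<in> schwartz" for \<phi> unfolding Ext_def[abs_def] by (rule d(3), assumption, rule that)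
qed

text \<open>The series defining the extension is tested with a translated kernel. The terms with j >
  k vanish by \<open>P_zero\<close>, so the sum is finite.\<close>

lemma Ext_piece: "LP_piece a \<psi> k (Ext h) x = (\<Sum>j\<le>k. P j k (h j) x)"
proof -
  have ks: "(\<lambda>z. kern (LP_fun a \<psi> k) (z - x)) \<in> schwartz" by (intro schwartz_translate schwartz_kern LP_fun_schwartz)
  have "dist_tensor (dist_of_fun (h j)) (kap j) (\<lambda>z. kern (LP_fun a \<psi> k) (z - x)) = P j k (h j) x" for j
    unfolding P_def by (rule tensor_kern[OF h suminf_L1_summable(1)[OF fin] LP_fun_schwartz])
  then have "(\<lambda>j. P j k (h j) x) sums LP_piece a \<psi> k (Ext h) x"
    using Ext_sums(3)[OF ks] unfolding LP_piece_eq[OF Ext_sums(1)] tconv_def by simp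
  moreover have "(\<lambda>j. P j k (h j) x) sums (\<Sum>j\<le>k. P j k (h j) x)"
    by (rule sums_finite) (auto intro: P_zero)
  ultimately show ?thesis by (rule sums_unique2)
qed

end

text \<open>One summand is at most the whole series \<open>Bs\<close>, so a p-th root bounds 2^(j s)
  |P j k| by beta \<open>mn\<close>(tau_j) with beta independent of j and k. The terms relevant to
  piece k have scales within 3 of k, where tau_j may be replaced by tau_k, and
  \<open>lq_norm_mn\<close> takes care of q.\<close>

lemma Ext_pointwise:
  obtains C where "C > 0" "\<And>h x. (\<And>j. band j (h j)) \<Longrightarrow> (\<And>j. Lp_pow p (h j) < top) \<Longrightarrow> (\<Sum>j. L1n (h j)) < top \<Longrightarrow>
    snd x \<noteq> 0 \<Longrightarrow> ennpowr (FG (Ext h) x) p \<le> ennreal C * Bs h x"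
proof -
  obtain C1 where C1: "C1 > 0" "\<And>j k h y \<tau>. band j h \<Longrightarrow> Lp_pow p h < top \<Longrightarrow> \<tau> \<noteq> 0 \<Longrightarrow>
    ennreal (norm (P j k h (aniso_dilation a (2 powr (- real (Suc j))) (y, \<tau>))) powr p) \<le>
    ennreal C1 * Hconv p (unit_reg j h) y * ennreal (mn \<tau> powr p * om \<tau>)"
    using P_bound by metis
  have an0: "an > 0" using an_ge by simp
  obtain C2 where C2: "C2 > 0" "\<And>u \<beta> \<tau>. \<tau> \<noteq> 0 \<Longrightarrow> 0 \<le> \<beta> \<Longrightarrow> (\<And>k. \<bar>u k\<bar> \<le> \<beta> * mn (2 powr (real k * an) * \<tau>)) \<Longrightarrow>
    lq_norm q u \<le> ennreal (C2 * \<beta>)"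
    using lq_norm_mn[OF an0 q] by metis
  \<comment> \<open>At most 4 terms per piece; 2^(3 |s|) changes 2^(j s) into 2^(k s), and 2^(3 a_n)
    generously covers the loss in \<open>mn_scale\<close>.\<close>
  define c where "c = 4 * (2 powr (3 * \<bar>s\<bar>) * 2 powr (3 * an))"
  have c0: "c > 0" by (simp add: c_def)
  let ?C = "(C2 * c) powr p * C1"
  have bound: "ennpowr (FG (Ext h) x) p \<le> ennreal ?C * Bs h x"
    if h: "\<And>j. band j (h j)" and hL: "\<And>j. Lp_pow p (h j) < top" and fin: "(\<Sum>j. L1n (h j)) < top" and x: "snd x \<noteq> 0" for h x
  proof (cases "Bs h x = top")
    case True
    then show ?thesis using C1(1) C2(1) c0 by (simp add: ennreal_mult_eq_top_iff)
  next
    case False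
    then obtain b where b: "Bs h x = ennreal b" "0 \<le> b" by (cases "Bs h x") auto
    define \<tau> where "\<tau> j = (2 powr real (Suc j)) powr an * snd x" for j
    have \<tau>0: "\<tau> j \<noteq> 0" for j using x by (simp add: \<tau>_def)
    define \<beta> where "\<beta> = (C1 * b) powr (1 / p)"
    have key: "2 powr (real j * s) * norm (P j k (h j) x) \<le> \<beta> * mn (\<tau> j)" for j k
    proof -
      let ?y = "aniso_dilation (fst a) (2 powr real (Suc j)) (fst x)" and ?n = "norm (P j k (h j) x)"
      have "aniso_dilation a (2 powr (- real (Suc j))) (?y, \<tau> j) = aniso_dilation a (2 powr (- real (Suc j))) (aniso_dilation a (2 powr real (Suc j)) x)"
        using aniso_dilation_prod[of a "2 powr real (Suc j)" "fst x" "snd x"] by (simp add: \<tau>_def del: of_nat_Suc)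
      also have "\<dots> = x" by (subst aniso_dilation_dilation) (simp_all flip: powr_add)
      finally have X: "aniso_dilation a (2 powr (- real (Suc j))) (?y, \<tau> j) = x" .
      let ?H = "Hconv p (unit_reg j (h j)) ?y" and ?e = "ennreal (2 powr (real j * s * p))"
      have "?e * ennreal (?n powr p) \<le> ?e * (ennreal C1 * ?H * ennreal (mn (\<tau> j) powr p * om (\<tau> j)))"
        using C1(2)[OF h hL \<tau>0, of j k ?y j] unfolding X by (intro mult_left_mono) auto
      also have "\<dots> = ennreal C1 * (?e * (?H * ennreal (om (\<tau> j)))) * ennreal (mn (\<tau> j) powr p)"
        unfolding ennreal_mult[OF powr_ge_zero om_nonneg] by (simp only: mult_ac)
      also have "\<dots> \<le> ennreal C1 * Bs h x * ennreal (mn (\<tau> j) powr p)"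
        unfolding Bs_def \<tau>_def
        by (intro mult_right_mono mult_left_mono ennreal_le_suminf[of "\<lambda>j. ennreal (2 powr (real j * s * p)) * (Hconv p (unit_reg j (h j)) (aniso_dilation (fst a) (2 powr real (Suc j)) (fst x)) *
      ennreal (om ((2 powr real (Suc j)) powr an * snd x)))"]) simp_all
      finally have "ennreal (2 powr (real j * s * p) * ?n powr p) \<le> ennreal (C1 * b * mn (\<tau> j) powr p)"
        unfolding b(1) using C1(1) b(2) by (simp add: ennreal_mult)
      then have "2 powr (real j * s * p) * ?n powr p \<le> C1 * b * mn (\<tau> j) powr p"
        using C1(1) b(2) by (subst (asm) ennreal_le_iff) auto
      then have "(2 powr (real j * s * p) * ?n powr p) powr (1 / p) \<le> (C1 * b * mn (\<tau> j) powr p) powr (1 / p)"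
        using p01 by (intro powr_mono2) auto
      then show ?thesis using p01 by (simp add: powr_mult powr_powr \<beta>_def)
    qed
    have \<beta>0: "0 \<le> \<beta>" by (simp add: \<beta>_def)
    have summand: "2 powr (real k * s) * norm (P j k (h j) x) \<le> 2 powr (3 * \<bar>s\<bar>) * 2 powr (3 * an) * \<beta> * mn (\<tau> k)"
      if jk: "j \<in> {k - 3..k}" for j k
    proof -
      have jk': "j \<le> k" "real k - real j \<le> 3" using jk by auto
      have "real k * s = real j * s + (real k - real j) * s" by (simp add: algebra_simps)
      also have "\<dots> \<le> real j * s + 3 * \<bar>s\<bar>"
        using jk' by (intro add_left_mono mult_mono' order_trans[OF mult_left_mono[OF abs_ge_self] mult_right_mono]) auto
      finally have "2 powr (real k * s) \<le> 2 powr (real j * s + 3 * \<bar>s\<bar>)" by (intro powr_mono) auto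
      from mult_right_mono[OF this[unfolded powr_add] norm_ge_zero[of "P j k (h j) x"]]
      have "2 powr (real k * s) * norm (P j k (h j) x) \<le> 2 powr (3 * \<bar>s\<bar>) * (2 powr (real j * s) * norm (P j k (h j) x))"
        by (simp only: mult_ac)
      also have "\<dots> \<le> 2 powr (3 * \<bar>s\<bar>) * (\<beta> * mn (\<tau> j))" by (intro mult_left_mono key) simp
      also have "\<dots> \<le> 2 powr (3 * \<bar>s\<bar>) * (\<beta> * (2 powr (3 * an) * mn (\<tau> k)))"
      proof (intro mult_left_mono \<beta>0)
        let ?c = "2 powr ((real k - real j) * an)"
        have "1 \<le> ?c" using jk' an0 by (intro ge_one_powr_ge_zero) auto
        then have "mn (\<tau> j) \<le> ?c powr (1/2) * mn (?c * \<tau> j)" by (rule mn_scale)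
        also have "?c * \<tau> j = \<tau> k"
          unfolding \<tau>_def powr_powr mult.assoc[symmetric] powr_add[symmetric] by (simp add: algebra_simps)
        also have "?c powr (1/2) \<le> 2 powr (3 * an)"
        proof -
          have "(real k - real j) * an \<le> 3 * an" using jk' an0 by (intro mult_right_mono) auto
          then show ?thesis unfolding powr_powr using an0 by (intro powr_mono) auto
        qed
        finally show "mn (\<tau> j) \<le> 2 powr (3 * an) * mn (\<tau> k)" by (simp add: mult_right_mono)
      qed simp
      finally show ?thesis by (simp only: mult_ac)
    qed
    have "FG (Ext h) x \<le> ennreal (C2 * (c * \<beta>))"
      unfolding FG_def
    proof (rule C2(2)[where \<tau> = "2 powr an * snd x"])
      fix k
      let ?K = "2 powr (3 * \<bar>s\<bar>) * 2 powr (3 * an) * \<beta> * mn (\<tau> k)"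
      have "norm (LP_piece a \<psi> k (Ext h) x) \<le> (\<Sum>j\<le>k. norm (P j k (h j) x))"
        unfolding Ext_piece[OF h hL fin] by (rule norm_sum)
      \<comment> \<open>Subtraction of naturals truncates for k < 3; the interval never has more
        than four elements.\<close>
      also have "\<dots> = (\<Sum>j\<in>{k - 3..k}. norm (P j k (h j) x))"
        by (rule sum.mono_neutral_right) (auto intro!: P_zero)
      finally have "2 powr (real k * s) * norm (LP_piece a \<psi> k (Ext h) x) \<le> 2 powr (real k * s) * \<dots>"
        by (rule mult_left_mono) simp
      also have "\<dots> = (\<Sum>j\<in>{k - 3..k}. 2 powr (real k * s) * norm (P j k (h j) x))" by (rule sum_distrib_left)
      also have "\<dots> \<le> of_nat (card {k - 3..k}) * ?K" by (rule sum_bounded_above) (rule summand)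
      also have "\<dots> \<le> 4 * ?K" using \<beta>0 by (intro mult_right_mono) auto
      also have "\<tau> k = 2 powr (real k * an) * (2 powr an * snd x)"
        unfolding \<tau>_def powr_powr mult.assoc[symmetric] powr_add[symmetric] by (simp add: algebra_simps)
      finally show "\<bar>2 powr (real k * s) * norm (LP_piece a \<psi> k (Ext h) x)\<bar> \<le> c * \<beta> * mn (2 powr (real k * an) * (2 powr an * snd x))"
        unfolding c_def by (simp add: abs_mult mult_ac)
    qed (use x c0 \<beta>0 in auto)
    then have "ennpowr (FG (Ext h) x) p \<le> ennpowr (ennreal (C2 * (c * \<beta>))) p"
      by (rule ennpowr_mono) (use p01 in simp)
    also have "\<dots> = ennreal (?C * b)"
      using C1(1) C2(1) c0 \<beta>0 b(2) p01 by (simp add: powr_mult \<beta>_def powr_powr mult_ac)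
    also have "\<dots> = ennreal ?C * Bs h x" unfolding b(1) using C1(1) b(2) by (simp add: ennreal_mult)
    finally show ?thesis .
  qed
  have "?C > 0" using C1(1) C2(1) c0 by simp
  then show thesis by (rule that[OF _ bound])
qed

lemma Ext_norm:
  obtains C where "C > 0" "\<And>h. (\<And>j. band j (h j)) \<Longrightarrow> (\<And>j. Lp_pow p (h j) < top) \<Longrightarrow> (\<Sum>j. L1n (h j)) < top \<Longrightarrow>
    F_norm \<psi> a s p q (Ext h) \<le> ennreal C * A_cost t p h"
proof -
  obtain C where C: "C > 0" "\<And>h x. (\<And>j. band j (h j)) \<Longrightarrow> (\<And>j. Lp_pow p (h j) < top) \<Longrightarrow> (\<Sum>j. L1n (h j)) < top \<Longrightarrow>
    snd x \<noteq> 0 \<Longrightarrow> ennpowr (FG (Ext h) x) p \<le> ennreal C * Bs h x"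
    using Ext_pointwise by metis
  obtain D where D: "D > 0" "\<And>h. (\<And>j. band j (h j)) \<Longrightarrow> (\<integral>\<^sup>+x. Bs h x \<partial>lborel) \<le> ennreal D * cost_pow h"
    using integral_Bs by metis
  let ?C = "(C * D) powr (1 / p)"
  have bound: "F_norm \<psi> a s p q (Ext h) \<le> ennreal ?C * A_cost t p h"
    if h: "\<And>j. band j (h j)" "\<And>j. Lp_pow p (h j) < top" "(\<Sum>j. L1n (h j)) < top" for h
  proof -
    have m: "Bs h \<in> borel_measurable lborel" using Bs_measurable[OF h(1)] by simp
    have "ennpowr (F_norm \<psi> a s p q (Ext h)) p \<le> (\<integral>\<^sup>+x. ennreal C * Bs h x \<partial>lborel)"
      unfolding F_norm_pow
      by (rule nn_integral_mono_AE) (use AE_snd_nonzero C(2)[OF h] in \<open>auto elim: eventually_mono\<close>)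
    also have "\<dots> = ennreal C * (\<integral>\<^sup>+x. Bs h x \<partial>lborel)" by (rule nn_integral_cmult[OF m])
    also have "\<dots> \<le> ennreal C * (ennreal D * cost_pow h)" by (intro mult_left_mono D(2) h) simp
    also have "\<dots> = ennreal (C * D) * cost_pow h" using C(1) D(1) by (simp add: ennreal_mult mult.assoc)
    finally have "ennpowr (ennpowr (F_norm \<psi> a s p q (Ext h)) p) (1 / p) \<le> ennpowr (ennreal (C * D) * cost_pow h) (1 / p)"
      by (rule ennpowr_mono) (use p01 in simp)
    then show ?thesis using p01 C(1) D(1) by (simp add: ennpowr_inverse ennpowr_mult A_cost_eq)
  qed
  have "?C > 0" using C D by simp
  then show thesis by (rule that[OF _ bound])
qed

lemma P_section_measurable: assumes h: "band j h" shows "(\<lambda>x. P j k h (x, 0)) \<in> borel_measurable borel"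
proof -
  have pm: "(\<lambda>x::'b. (x, 0::real)) \<in> borel_measurable borel" by (intro borel_measurable_continuous_onI continuous_intros)
  have [measurable]: "(\<lambda>x. Lk j (LP_fun a \<psi> k) (x, 0)) \<in> borel_measurable borel"
    by (rule measurable_compose[OF pm schwartz_measurable[OF Lk_schwartz[OF LP_fun_schwartz]]])
  have [measurable]: "h \<in> borel_measurable borel" by (rule hm[OF h])
  show ?thesis unfolding P_def fst_conv snd_conv by measurable
qed

text \<open>The phi_k with k <= j + 3 add up to 1 on the support of \<open>tens j\<close>, and at
  x_n = 0 the factor \<open>kap j\<close> is 1; only the tangential cutoff remains.\<close>

lemma sum_Lk: "(\<Sum>k\<le>j + 3. Lk j (LP_fun a \<psi> k) (x, 0)) = inv_fourier (cut j) x"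
proof -
  have "(\<Sum>k\<le>j + 3. inv_fourier (\<lambda>\<xi>. LP_fun a \<psi> k \<xi> * tens j \<xi>) (x, 0)) = inv_fourier (tens j) (x, 0)"
    by (subst inv_fourier_sum[symmetric])
      (simp_all add: LP_tens_sum schwartz_mult LP_fun_schwartz test_functions_schwartz[OF tens_test])
  then show ?thesis
    using tens_kernel[of j x 0] unfolding Lk_def sum_distrib_left[symmetric] by (simp add: kap_0)
qed

text \<open>So the restricted pieces of the j-th term recover the continuous representative of
  \<open>h\<close> exactly, after finitely many steps.\<close>

lemma sum_P_section:
  assumes h: "band j h" and fin: "L1n h < top" shows "(\<Sum>k\<le>j + 3. P j k h (x, 0)) = reg j h x"
proof -
  have pm: "(\<lambda>y::'b. (x - y, 0::real)) \<in> borel_measurable borel" by (intro borel_measurable_continuous_onI continuous_intros)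
  have int: "integrable lborel (\<lambda>y. h y * Lk j (LP_fun a \<psi> k) (x - y, 0))" for k
  proof -
    have L: "Lk j (LP_fun a \<psi> k) \<in> schwartz" by (rule Lk_schwartz[OF LP_fun_schwartz])
    obtain B where B: "\<And>z. norm (Lk j (LP_fun a \<psi> k) z) \<le> B" using schwartz_bounded[OF L] by blast
    have [measurable]: "(\<lambda>y. Lk j (LP_fun a \<psi> k) (x - y, 0)) \<in> borel_measurable borel" "h \<in> borel_measurable borel"
      by (rule measurable_compose[OF pm schwartz_measurable[OF L]] hm[OF h])+
    show ?thesis
    proof (rule Bochner_Integration.integrable_bound)
      show "integrable lborel (\<lambda>y. norm (h y) * B)" using L1n_integrable[OF hm[OF h] fin] by simp
      show "AE y in lborel. norm (h y * Lk j (LP_fun a \<psi> k) (x - y, 0)) \<le> norm (norm (h y) * B)"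
        by (intro AE_I2 order_trans[OF _ real_le_norm]) (simp add: norm_mult mult_left_mono B)
    qed measurable
  qed
  have "(\<Sum>k\<le>j + 3. P j k h (x, 0)) = (LINT y|lborel. (\<Sum>k\<le>j + 3. h y * Lk j (LP_fun a \<psi> k) (x - y, 0)))"
    unfolding P_def fst_conv snd_conv by (rule Bochner_Integration.integral_sum[symmetric]) (rule int)
  also have "\<dots> = reg j h x"
    unfolding sum_distrib_left[symmetric] sum_Lk reg_eq[OF h] by (simp only: mult.commute)
  finally show ?thesis .
qed

text \<open>A double series in j and k. For fixed j the sum over k <= N is h_j as soon as N >= j +
  3, and Tannery's theorem carries this limit through the sum over j, the majorant being a multiple
  of the L_1 norms of the h_j.\<close>

lemma Ext_trace:
  assumes h: "\<And>j. band j (h j)" and hL: "\<And>j. Lp_pow p (h j) < top" and fin: "(\<Sum>j. L1n (h j)) < top"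
    and ds: "dist_sums (\<lambda>j. dist_of_fun (h j)) f"
  shows "has_trace \<psi> a (Ext h) f"
  unfolding has_trace_def dist_tendsto_def
proof (intro conjI ballI)
  show "f \<in> tempered" using ds by (simp add: dist_sums_def dist_tendsto_def)
  fix \<phi> :: "'b \<Rightarrow> complex" assume \<phi>: "\<phi> \<in> schwartz"
  have [measurable]: "\<phi> \<in> borel_measurable borel" by (rule schwartz_measurable[OF \<phi>])
  obtain C where C: "C > 0" "\<And>j k h. band j h \<Longrightarrow> L1n (\<lambda>x. P j k h (x, 0)) \<le> ennreal C * L1n h"
    using P_section_L1 by metis
  note s = suminf_L1_summable[OF fin]
  let ?B = "schwartz_seminorm 0 \<phi>"
  note B = schwartz_sup_le_seminorm[OF \<phi>] schwartz_seminorm_nonneg[OF \<phi>, of 0]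
  let ?l = "\<lambda>j. enn2real (L1n (h j))"
  define e where "e j k = (LINT x|lborel. P j k (h j) (x, 0) * \<phi> x)" for j k
  have Pm[measurable]: "(\<lambda>x. P j k (h j) (x, 0)) \<in> borel_measurable borel" for j k by (rule P_section_measurable[OF h])
  have Pfin: "L1n (\<lambda>x. P j k (h j) (x, 0)) < top" for j k
    by (rule le_less_trans[OF C(2)[OF h]]) (simp add: ennreal_mult_less_top s(1))
  have int: "integrable lborel (\<lambda>x. P j k (h j) (x, 0) * \<phi> x)" for j k
  proof (rule Bochner_Integration.integrable_bound)
    show "integrable lborel (\<lambda>x. norm (P j k (h j) (x, 0)) * ?B)" using L1n_integrable[OF Pm Pfin] by simp
    show "AE x in lborel. norm (P j k (h j) (x, 0) * \<phi> x) \<le> norm (norm (P j k (h j) (x, 0)) * ?B)"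
      by (intro AE_I2 order_trans[OF _ real_le_norm]) (simp add: norm_mult mult_left_mono B)
  qed measurable
  have e_bound: "norm (e j k) \<le> ?B * (C * ?l j)" for j k
  proof -
    have "norm (e j k) \<le> ?B * enn2real (L1n (\<lambda>x. P j k (h j) (x, 0)))"
      unfolding e_def by (rule L1n_pairing[OF Pm Pfin B])
    also have "\<dots> \<le> ?B * enn2real (ennreal C * L1n (h j))"
      by (intro mult_left_mono enn2real_mono C(2) h B) (simp add: ennreal_mult_less_top s(1))
    also have "enn2real (ennreal C * L1n (h j)) = C * ?l j" using C(1) by (simp add: enn2real_mult)
    finally show ?thesis .
  qed
  have e_zero: "e j k = 0" if "k < j \<or> j + 4 \<le> k" for j k unfolding e_def P_zero[OF that] by simp
  define d where "d j N = (\<Sum>k\<le>N. e j k)" for j N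
  \<comment> \<open>At most four values of k contribute for each j, which makes the bound
    independent of N.\<close>
  have d_bound: "norm (d j N) \<le> 4 * (?B * C) * ?l j" for j N
  proof -
    have "d j N = (\<Sum>k\<in>{..N} \<inter> {j..j+3}. e j k)"
      unfolding d_def by (rule sum.mono_neutral_right) (auto intro!: e_zero)
    then have "norm (d j N) \<le> (\<Sum>k\<in>{..N} \<inter> {j..j+3}. ?B * (C * ?l j))"
      by (simp only:) (rule sum_norm_le, rule e_bound)
    also have "\<dots> \<le> (\<Sum>k\<in>{j..j+3}. ?B * (C * ?l j))"
      using B(2) C(1) by (intro sum_mono2) auto
    finally show ?thesis by (simp add: mult_ac)
  qed
  have d_lim: "(\<lambda>N. d j N) \<longlonglongrightarrow> dist_of_fun (h j) \<phi>" for j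
  proof (rule tendsto_eventually)
    have "d j N = dist_of_fun (h j) \<phi>" if N: "N \<ge> j + 3" for N
    proof -
      have "d j N = (\<Sum>k\<le>j+3. e j k)"
        unfolding d_def by (rule sum.mono_neutral_right) (use N in \<open>auto intro!: e_zero\<close>)
      also have "\<dots> = (LINT x|lborel. (\<Sum>k\<le>j+3. P j k (h j) (x, 0) * \<phi> x))"
        unfolding e_def by (rule Bochner_Integration.integral_sum[symmetric]) (rule int)
      also have "\<dots> = (LINT x|lborel. reg j (h j) x * \<phi> x)"
        unfolding sum_distrib_right[symmetric] sum_P_section[OF h s(1)] ..
      also have "\<dots> = (LINT x|lborel. h j x * \<phi> x)"
      proof (rule integral_cong_AE)
        have [measurable]: "reg j (h j) \<in> borel_measurable borel" "h j \<in> borel_measurable borel"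
          by (rule reg_measurable[OF h] hm[OF h])+
        show "(\<lambda>x. reg j (h j) x * \<phi> x) \<in> borel_measurable lborel" "(\<lambda>x. h j x * \<phi> x) \<in> borel_measurable lborel"
          by measurable
        show "AE x in lborel. reg j (h j) x * \<phi> x = h j x * \<phi> x" using reg_AE[OF h, of j] by (auto elim: eventually_mono)
      qed
      finally show ?thesis by (simp add: dist_of_fun_apply[OF \<phi>])
    qed
    then show "\<forall>\<^sub>F N in sequentially. d j N = dist_of_fun (h j) \<phi>"
      unfolding eventually_sequentially by blast
  qed
  have "(\<lambda>N. \<Sum>j. d j N) \<longlonglongrightarrow> (\<Sum>j. dist_of_fun (h j) \<phi>)"
    using tannerys_theorem[where a = d and F = sequentially and M = "\<lambda>j. 4 * (?B * C) * ?l j", OF d_lim]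
      d_bound summable_mult[OF s(2), of "4 * (?B * C)"] by (simp add: eventually_prod_sequentially case_prod_beta')
  moreover have "(\<Sum>j. d j N) = dist_of_fun (\<lambda>x'. \<Sum>k\<le>N. LP_piece a \<psi> k (Ext h) (x', 0)) \<phi>" for N
  proof -
    have "(\<Sum>j. d j N) = (\<Sum>j\<le>N. d j N)"
      by (rule suminf_finite) (auto simp: d_def intro!: sum.neutral e_zero)
    also have "\<dots> = (\<Sum>k\<le>N. \<Sum>j\<le>N. e j k)" unfolding d_def by (rule sum.swap)
    \<comment> \<open>The terms with j > k vanish, which produces the triangular form of
      \<open>Ext_piece\<close>.\<close>
    also have "\<dots> = (\<Sum>k\<le>N. \<Sum>j\<le>k. e j k)"
      by (intro sum.cong refl sum.mono_neutral_right) (auto intro!: e_zero)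
    also have "\<dots> = (LINT x|lborel. (\<Sum>k\<le>N. \<Sum>j\<le>k. P j k (h j) (x, 0) * \<phi> x))"
      unfolding e_def by (simp add: int)
    finally show ?thesis
      by (simp add: dist_of_fun_apply[OF \<phi>] Ext_piece[OF h hL fin] sum_distrib_right)
  qed
  moreover have "(\<Sum>j. dist_of_fun (h j) \<phi>) = f \<phi>"
  proof (rule sums_unique[symmetric])
    show "(\<lambda>j. dist_of_fun (h j) \<phi>) sums f \<phi>"
      using ds \<phi> unfolding dist_sums_def dist_tendsto_def sums_def_le by blast
  qed
  ultimately show "(\<lambda>N. dist_of_fun (\<lambda>x'. \<Sum>j\<le>N. LP_piece a \<psi> j (Ext h) (x', 0)) \<phi>) \<longlonglongrightarrow> f \<phi>" by simp
qed

end

section \<open>Near-optimal representations, and differences of traces\<close>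

lemma schwartz_seminorm_mono:
  fixes f :: "'a::euclidean_space \<Rightarrow> complex"
  assumes f: "f \<in> schwartz" and "N \<le> M" shows "schwartz_seminorm N f \<le> schwartz_seminorm M f"
  unfolding schwartz_seminorm_def[of N]
proof (rule cSUP_least)
  have "[] \<in> {vs::'a list. set vs \<subseteq> Basis \<and> length vs \<le> N}" by simp
  then show "{vs::'a list. set vs \<subseteq> Basis \<and> length vs \<le> N} \<times> (UNIV :: 'a set) \<noteq> {}" by blast
  fix z assume "z \<in> {vs::'a list. set vs \<subseteq> Basis \<and> length vs \<le> N} \<times> (UNIV :: 'a set)"
  then obtain vs x where z: "z = (vs, x)" "set vs \<subseteq> Basis" "length vs \<le> N" by auto
  have "(1 + norm x) ^ N * norm (iter_pderiv vs f x) \<le> (1 + norm x) ^ M * norm (iter_pderiv vs f x)"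
    using assms(2) by (intro mult_right_mono power_increasing) auto
  also have "\<dots> \<le> schwartz_seminorm M f" using z assms(2) by (intro le_schwartz_seminorm f) auto
  finally show "(case z of (vs, x) \<Rightarrow> (1 + norm x) ^ N * norm (iter_pderiv vs f x)) \<le> schwartz_seminorm M f"
    by (simp add: z)
qed

lemma dist_diff_tempered:
  assumes S: "S \<in> tempered" and T: "T \<in> tempered" shows "dist_diff S T \<in> tempered"
  unfolding tempered_def mem_Collect_eq
proof (intro conjI allI impI ballI)
  show "dist_diff S T f = 0" if "f \<notin> schwartz" for f
    using tempered_outside[OF S that] tempered_outside[OF T that] by (simp add: dist_diff_def)
  show "dist_diff S T (\<lambda>x. c * f x + g x) = c * dist_diff S T f + dist_diff S T g"
    if "f \<in> schwartz" "g \<in> schwartz" for f g c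
    using tempered_linear[OF S that, of c] tempered_linear[OF T that, of c] by (simp add: dist_diff_def algebra_simps)
  obtain N C where C: "\<And>f. f \<in> schwartz \<Longrightarrow> norm (S f) \<le> C * schwartz_seminorm N f"
    using S unfolding tempered_def by blast
  obtain M D where D: "\<And>f. f \<in> schwartz \<Longrightarrow> norm (T f) \<le> D * schwartz_seminorm M f"
    using T unfolding tempered_def by blast
  have "norm (dist_diff S T f) \<le> (\<bar>C\<bar> + \<bar>D\<bar>) * schwartz_seminorm (max N M) f" if f: "f \<in> schwartz" for f
  proof -
    have le: "K * schwartz_seminorm n f \<le> \<bar>K\<bar> * schwartz_seminorm (max N M) f" if "n \<le> max N M" for K n
      by (intro mult_mono schwartz_seminorm_mono schwartz_seminorm_nonneg f that) auto
    have "norm (dist_diff S T f) \<le> norm (S f) + norm (T f)" unfolding dist_diff_def by (rule norm_triangle_ineq4)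
    also have "\<dots> \<le> \<bar>C\<bar> * schwartz_seminorm (max N M) f + \<bar>D\<bar> * schwartz_seminorm (max N M) f"
      using order_trans[OF C[OF f] le[of N C]] order_trans[OF D[OF f] le[of M D]] by (intro add_mono) auto
    finally show ?thesis by (simp add: distrib_right)
  qed
  then show "\<exists>N C. \<forall>f\<in>schwartz. norm (dist_diff S T f) \<le> C * schwartz_seminorm N f" by blast
qed

context ext_setup
begin

text \<open>The infimum need not be attained; the factor 2 leaves room for a near-minimiser when it
  is positive. When it is 0 no room is left, and f has to be shown to vanish: the L_1 estimate makes
  every pairing arbitrarily small, and the zero sequence represents f at no cost.\<close>

lemma A_space_representation:
  assumes f: "f \<in> A_space (fst a) t p"
  obtains h where "\<And>j. band j (h j)" "\<And>j. Lp_pow p (h j) < top" "(\<Sum>j. L1n (h j)) < top"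
    "dist_sums (\<lambda>j. dist_of_fun (h j)) f" "A_cost t p h \<le> 2 * A_norm (fst a) t p f"
proof -
  obtain D where D: "D > 0" "\<And>h. (\<And>j. band j (h j)) \<Longrightarrow> (\<And>j. Lp_pow p (h j) < top) \<Longrightarrow>
    (\<Sum>j. L1n (h j)) \<le> ennreal D * A_cost t p h"
    using rep_L1 by metis
  have ft: "f \<in> tempered" using f by (simp add: A_space_def)
  let ?A = "A_norm (fst a) t p f"
  have Afin: "?A < top"
  proof -
    obtain h where "Lp_representation (fst a) p h f" "A_cost t p h < top" using f by (auto simp: A_space_def)
    moreover from this have "?A \<le> A_cost t p h" unfolding A_norm_def by (intro INF_lower) simp
    ultimately show ?thesis by simp
  qed
  have near: "\<exists>h. Lp_representation (fst a) p h f \<and> A_cost t p h < c" if "?A < c" for c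
    using that unfolding A_norm_def INF_less_iff by blast
  have L1: "(\<Sum>j. L1n (h j)) \<le> ennreal D * A_cost t p h" if "Lp_representation (fst a) p h f" for h
    using that by (intro D(2)) (simp_all add: Lp_representation_iff)
  show thesis
  proof (cases "?A = 0")
    case False
    then have "?A < 2 * ?A" using Afin by (cases ?A) (simp_all flip: ennreal_numeral ennreal_mult add: ennreal_less_iff)
    then obtain h where h: "Lp_representation (fst a) p h f" "A_cost t p h < 2 * ?A" using near by blast
    have "ennreal D * A_cost t p h < top"
      using h(2) Afin by (simp add: ennreal_mult_less_top order_less_le_trans[OF h(2)])
    then have "(\<Sum>j. L1n (h j)) < top" using L1[OF h(1)] by (rule le_less_trans[rotated])
    then show thesis using h by (intro that[of h]) (simp_all add: Lp_representation_iff)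
  next
    case True
    have "f \<phi> = 0" for \<phi>
    proof (cases "\<phi> \<in> schwartz")
      case \<phi>: True
      let ?S = "schwartz_seminorm 0 \<phi>"
      have S: "0 \<le> ?S" by (rule schwartz_seminorm_nonneg[OF \<phi>])
      have "norm (f \<phi>) \<le> 0"
      proof (rule field_le_epsilon)
        fix e :: real assume e: "e > 0"
        \<comment> \<open>Chosen so that D epsilon (S + 1) = e; the added 1 avoids division by zero
          when the seminorm vanishes.\<close>
        define \<epsilon> where "\<epsilon> = e / (D * (?S + 1))"
        have \<epsilon>: "\<epsilon> > 0" unfolding \<epsilon>_def using e D(1) S by simp
        obtain h where h: "Lp_representation (fst a) p h f" "A_cost t p h < ennreal \<epsilon>"
          using near[of "ennreal \<epsilon>"] \<epsilon> True by auto
        have le: "(\<Sum>j. L1n (h j)) \<le> ennreal (D * \<epsilon>)"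
          using order_trans[OF L1[OF h(1)] mult_left_mono[OF less_imp_le[OF h(2)]]] D(1) \<epsilon> by (simp add: ennreal_mult)
        have fin: "(\<Sum>j. L1n (h j)) < top" using le by (rule le_less_trans) simp
        have th: "tempered_fun (h j)" for j using h(1) by (simp add: Lp_representation_def)
        have "dist_sums (\<lambda>j. dist_of_fun (h j)) f" using h(1) by (simp add: Lp_representation_iff)
        then have "f = (\<lambda>\<phi>. \<Sum>j. dist_of_fun (h j) \<phi>)"
          using L1_sum(1)[OF th fin] unfolding dist_sums_def by (rule dist_tendsto_unique)
        then have "norm (f \<phi>) \<le> enn2real (\<Sum>j. L1n (h j)) * ?S" using L1_sum(2)[OF th fin \<phi>] by simp
        also have "enn2real (\<Sum>j. L1n (h j)) \<le> D * \<epsilon>" using le D(1) \<epsilon> by (intro enn2real_leI) auto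
        also have "D * \<epsilon> * ?S \<le> D * \<epsilon> * (?S + 1)" using D(1) \<epsilon> by (intro mult_left_mono) auto
        also have "\<dots> = e" unfolding \<epsilon>_def using D(1) S by simp
        finally show "norm (f \<phi>) \<le> 0 + e" using S by (simp add: mult_right_mono)
      qed
      then show ?thesis by simp
    qed (rule tempered_outside[OF ft])
    then have f0: "f = (\<lambda>\<phi>. 0)" by (rule ext)
    have "dist_sums (\<lambda>j. dist_of_fun (\<lambda>x. 0)) f"
      unfolding dist_sums_def dist_tendsto_def dist_of_fun_zero using ft by (simp add: f0)
    then show thesis
      using band_zero by (intro that[of "\<lambda>j x. 0"]) (simp_all add: A_cost_eq cost_pow_def L1n_def)
  qed
qed

text \<open>Reduces continuity at f to the bound for the single distribution g - f; each
  Littlewood-Paley piece is additive because it is an evaluation of the distribution.\<close>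

lemma trace_dist_diff:
  assumes f: "f \<in> tempered" "has_trace \<psi> a f F" and g: "g \<in> tempered" "has_trace \<psi> a g G"
  shows "has_trace \<psi> a (dist_diff g f) (dist_diff G F)"
proof -
  have d: "dist_diff g f \<in> tempered" by (rule dist_diff_tempered[OF g(1) f(1)])
  have FG: "F \<in> tempered" "G \<in> tempered" using f g by (simp_all add: has_trace_def dist_tendsto_def)
  have piece: "LP_piece a \<psi> k (dist_diff g f) x = LP_piece a \<psi> k g x - LP_piece a \<psi> k f x" for k x
    unfolding LP_piece_eq[OF d] LP_piece_eq[OF f(1)] LP_piece_eq[OF g(1)] by (simp add: tconv_def dist_diff_def)
  show ?thesis
    unfolding has_trace_def dist_tendsto_def
  proof (intro conjI ballI dist_diff_tempered FG)
    fix \<phi> :: "'b \<Rightarrow> complex" assume \<phi>: "\<phi> \<in> schwartz"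
    have int: "integrable lborel (\<lambda>x. (\<Sum>k\<le>N. tr u k x) * \<phi> x)" if "u \<in> tempered" for u N
      unfolding sum_distrib_right
      by (intro Bochner_Integration.integrable_sum tempered_fun_integrable[OF tf[OF tr_band[OF that]] \<phi>])
    have "dist_of_fun (\<lambda>x. \<Sum>k\<le>N. tr (dist_diff g f) k x) \<phi> = dist_of_fun (\<lambda>x. \<Sum>k\<le>N. tr g k x) \<phi> - dist_of_fun (\<lambda>x. \<Sum>k\<le>N. tr f k x) \<phi>" for N
      unfolding dist_of_fun_apply[OF \<phi>] piece sum_subtractf left_diff_distrib
      by (rule Bochner_Integration.integral_diff) (rule int g(1) f(1))+
    moreover have "(\<lambda>N. dist_of_fun (\<lambda>x. \<Sum>k\<le>N. tr g k x) \<phi> - dist_of_fun (\<lambda>x. \<Sum>k\<le>N. tr f k x) \<phi>) \<longlonglongrightarrow> G \<phi> - F \<phi>"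
      by (rule tendsto_diff) (use f(2) g(2) \<phi> in \<open>simp_all add: has_trace_def dist_tendsto_def\<close>)
    ultimately show "(\<lambda>N. dist_of_fun (\<lambda>x. \<Sum>k\<le>N. tr (dist_diff g f) k x) \<phi>) \<longlonglongrightarrow> dist_diff G F \<phi>"
      by (simp add: dist_diff_def)
  qed
qed

end

section \<open>Existence, surjectivity and continuity of the trace, with bounded extension\<close>

theorem corollary7:
  fixes a :: "(real ^ 'm) \<times> real"
    and \<psi> :: "(real ^ 'm) \<times> real \<Rightarrow> complex"
    and \<eta>0 \<eta> :: "real \<Rightarrow> complex"
    and p s t :: real and q :: ennreal
  assumes "anisotropy a"
    and "LP_generator a \<psi>"
    and "extension_kernels \<eta>0 \<eta>"
    and "0 < p" and "p < 1" and "0 < q"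
    and "s = weight_sum a / p - weight_sum (fst a)"
    and "t = weight_sum (fst a) * (1 / p - 1)"
  shows "(\<forall>f \<in> F_space \<psi> a s p q. \<exists>g. has_trace \<psi> a f g)
    \<and> trace_op \<psi> a ` F_space \<psi> a s p q = A_space (fst a) t p
    \<and> quasi_continuous_on (F_space \<psi> a s p q) (F_norm \<psi> a s p q) (A_norm (fst a) t p) (trace_op \<psi> a)
    \<and> (\<exists>c::real. c \<ge> 0 \<and>
        (\<forall>f \<in> A_space (fst a) t p. \<exists>Ef \<in> F_space \<psi> a s p q.
           is_extension a \<eta>0 \<eta> f Ef \<and> trace_op \<psi> a Ef = f \<and>
           F_norm \<psi> a s p q Ef \<le> ennreal c * A_norm (fst a) t p f))"
proof -
  interpret ext_setup a \<psi> p s t q \<eta>0 \<eta> by unfold_locales (use assms in auto)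
  let ?X = "F_space \<psi> a s p q" and ?Y = "A_space (fst a) t p" and ?N = "F_norm \<psi> a s p q" and ?M = "A_norm (fst a) t p"
  obtain C where C: "C > 0" "\<And>f. f \<in> ?X \<Longrightarrow> \<exists>g. has_trace \<psi> a f g \<and> g \<in> ?Y \<and> ?M g \<le> ennreal C * ?N f"
    using trace_main by metis
  have tro: "has_trace \<psi> a f (trace_op \<psi> a f)" "trace_op \<psi> a f \<in> ?Y" "?M (trace_op \<psi> a f) \<le> ennreal C * ?N f" if f: "f \<in> ?X" for f
  proof -
    obtain g where g: "has_trace \<psi> a f g" "g \<in> ?Y" "?M g \<le> ennreal C * ?N f" using C(2)[OF f] by blast
    show "has_trace \<psi> a f (trace_op \<psi> a f)" "trace_op \<psi> a f \<in> ?Y" "?M (trace_op \<psi> a f) \<le> ennreal C * ?N f"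
      unfolding trace_op_eq[OF g(1)] by (rule g)+
  qed
  obtain D where D: "D > 0" "\<And>h. (\<And>j. band j (h j)) \<Longrightarrow> (\<And>j. Lp_pow p (h j) < top) \<Longrightarrow> (\<Sum>j. L1n (h j)) < top \<Longrightarrow>
    ?N (Ext h) \<le> ennreal D * A_cost t p h"
    using Ext_norm by metis
  have extension: "\<exists>Ef \<in> ?X. is_extension a \<eta>0 \<eta> f Ef \<and> trace_op \<psi> a Ef = f \<and> ?N Ef \<le> ennreal (2 * D) * ?M f"
    if f: "f \<in> ?Y" for f
  proof -
    obtain h where h: "\<And>j. band j (h j)" "\<And>j. Lp_pow p (h j) < top" "(\<Sum>j. L1n (h j)) < top"
      "dist_sums (\<lambda>j. dist_of_fun (h j)) f" "A_cost t p h \<le> 2 * ?M f"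
      using A_space_representation[OF f] by metis
    have "?N (Ext h) \<le> ennreal D * A_cost t p h" by (rule D(2)[OF h(1-3)])
    also have "\<dots> \<le> ennreal D * (2 * ?M f)" by (intro mult_left_mono h(5)) simp
    also have "\<dots> = ennreal (2 * D) * ?M f" using D(1) by (simp add: ennreal_mult mult_ac)
    finally have N: "?N (Ext h) \<le> ennreal (2 * D) * ?M f" .
    \<comment> \<open>Finiteness of the quasi-norm of f is what places the extension in the F-space,
      beyond the bare inequality.\<close>
    obtain h' where h': "Lp_representation (fst a) p h' f" "A_cost t p h' < top" using f by (auto simp: A_space_def)
    have "?M f \<le> A_cost t p h'" unfolding A_norm_def by (rule INF_lower) (use h' in simp)
    then have "?M f < top" using h'(2) by (rule le_less_trans)
    then have "?N (Ext h) < top" using N by (simp add: le_less_trans[OF N] ennreal_mult_less_top)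
    then have X: "Ext h \<in> ?X" using Ext_sums(1)[OF h(1-3)] by (simp add: F_space_def)
    have "band_representation (fst a) (\<lambda>j. dist_of_fun (h j)) f"
      unfolding band_representation_def using h(1,4) tempered_fun_tempered by (auto simp: band_def)
    then have "is_extension a \<eta>0 \<eta> f (Ext h)"
      unfolding is_extension_def using Ext_sums(2)[OF h(1-3)] unfolding kap_def[abs_def] by blast
    then show ?thesis using X N trace_op_eq[OF Ext_trace[OF h(1-4)]] by blast
  qed
  have image: "trace_op \<psi> a ` ?X = ?Y"
  proof
    show "trace_op \<psi> a ` ?X \<subseteq> ?Y" using tro(2) by blast
    show "?Y \<subseteq> trace_op \<psi> a ` ?X" using extension by blast
  qed
  have cont: "quasi_continuous_on ?X ?N ?M (trace_op \<psi> a)"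
    unfolding quasi_continuous_on_def
  proof (intro ballI allI impI)
    fix f and \<epsilon> :: real assume f: "f \<in> ?X" and \<epsilon>: "\<epsilon> > 0"
    \<comment> \<open>The linear bound with constant C makes delta = epsilon / C suitable at every
      point.\<close>
    have "?M (dist_diff (trace_op \<psi> a g) (trace_op \<psi> a f)) < ennreal \<epsilon>"
      if g: "g \<in> ?X" and lt: "?N (dist_diff g f) < ennreal (\<epsilon> / C)" for g
    proof -
      have t: "f \<in> tempered" "g \<in> tempered" using f g by (simp_all add: F_space_def)
      have d: "dist_diff g f \<in> ?X"
        using dist_diff_tempered[OF t(2,1)] less_trans[OF lt ennreal_less_top] by (simp add: F_space_def)
      have "trace_op \<psi> a (dist_diff g f) = dist_diff (trace_op \<psi> a g) (trace_op \<psi> a f)"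
        by (intro trace_op_eq trace_dist_diff t tro(1) f g)
      then have "?M (dist_diff (trace_op \<psi> a g) (trace_op \<psi> a f)) \<le> ennreal C * ?N (dist_diff g f)"
        using tro(3)[OF d] by simp
      also have "\<dots> < ennreal C * ennreal (\<epsilon> / C)"
        using lt C(1) by (intro ennreal_mult_strict_left_mono) auto
      also have "\<dots> = ennreal \<epsilon>" using C(1) \<epsilon> by (simp flip: ennreal_mult)
      finally show ?thesis .
    qed
    moreover have "\<epsilon> / C > 0" using \<epsilon> C(1) by simp
    ultimately show "\<exists>\<delta>::real. \<delta> > 0 \<and> (\<forall>g\<in>?X. ?N (dist_diff g f) < ennreal \<delta> \<longrightarrow>
      ?M (dist_diff (trace_op \<psi> a g) (trace_op \<psi> a f)) < ennreal \<epsilon>)" by blast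
  qed
  show ?thesis
  proof (intro conjI image cont)
    show "\<forall>f\<in>?X. \<exists>g. has_trace \<psi> a f g" using tro(1) by blast
    show "\<exists>c::real. c \<ge> 0 \<and> (\<forall>f \<in> ?Y. \<exists>Ef \<in> ?X. is_extension a \<eta>0 \<eta> f Ef \<and> trace_op \<psi> a Ef = f \<and> ?N Ef \<le> ennreal c * ?M f)"
      by (intro exI[of _ "2 * D"] conjI ballI extension) (use D(1) in simp)
  qed
qed

end
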